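(* Let $r\ge 2$ and $n\ge 1$ be integers. Then the polynomial $$F_{r,n}(q)=\prod_{k=1}^{n}\frac{1-q^{rk}}{1-q^k}=\prod_{k=1}^{n}\left(1+q^k+q^{2k}+\cdots+q^{(r-1)k}\right)$$ is unimodal whenever $r$ is even or $n\ge 11$.
   Context: A finite real sequence $a_0,a_1,\ldots,a_m$ is unimodal if there is an index $j$ such that $a_0\le a_1\le\cdots\le a_{j-1}\le a_j\ge a_{j+1}\ge\cdots\ge a_m$. A polynomial is unimodal when its coefficient sequence (from degree $0$ to its degree) is unimodal. *)

theory Defs
  imports Complex_Main "HOL-Computational_Algebra.Polynomial"
begin

definition unimodal_seq :: "nat \<Rightarrow> (nat \<Rightarrow> real) \<Rightarrow> bool" where
  "unimodal_seq m a \<longleftrightarrow>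
     (\<exists>j\<le>m. (\<forall>i<j. a i \<le> a (Suc i)) \<and> (\<forall>i. j \<le> i \<and> i < m \<longrightarrow> a i \<ge> a (Suc i)))"
  \<comment> \<open>Only the entries \<open>a 0, \<dots>, a m\<close> of the function \<open>a\<close> matter.\<close>

definition unimodal_poly :: "real poly \<Rightarrow> bool" where
  "unimodal_poly p \<longleftrightarrow> unimodal_seq (degree p) (coeff p)"

text \<open>
  The polynomial is defined by the product of the truncated geometric sums;
  the lemmas below show that it agrees with the quotient form, factor by factor and as a whole.
  Here \<open>monom 1 i\<close> is \<open>q ^ i\<close>.
\<close>

definition F :: "nat \<Rightarrow> nat \<Rightarrow> real poly" where
  "F r n = (\<Prod>k=1..n. \<Sum>i<r. monom 1 (i * k))"

lemma one_minus_monom_nonzero: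
  assumes "k \<ge> 1"
  shows "1 - monom 1 k \<noteq> (0 :: real poly)"
proof
  assume "1 - monom 1 k = (0 :: real poly)"
  then have "coeff (1 - monom 1 k :: real poly) 0 = 0" by simp
  then show False using assms by simp
qed

lemma geometric_factor:
  "(1 - monom 1 k) * (\<Sum>i<r. monom 1 (i * k)) = (1 - monom 1 (r * k) :: real poly)"
proof (induction r)
  case (Suc r)
  have "(1 - monom 1 k) * (\<Sum>i<Suc r. monom 1 (i * k)) =
        (1 - monom 1 k) * (\<Sum>i<r. monom 1 (i * k)) + (1 - monom 1 k) * (monom 1 (r * k) :: real poly)"
    by (simp add: distrib_left)
  also have "\<dots> = (1 - monom 1 (Suc r * k) :: real poly)"
    unfolding Suc by (simp add: left_diff_distrib mult_monom)
  finally show ?case .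
qed simp

lemma F_eq_prod_quotients:
  "F r n = (\<Prod>k=1..n. (1 - monom 1 (r * k)) div (1 - monom 1 k))"
  unfolding F_def
proof (rule prod.cong)
  fix k assume "k \<in> {1..n}"
  then have "1 - monom 1 k \<noteq> (0 :: real poly)"
    by (intro one_minus_monom_nonzero) simp
  then show "(\<Sum>i<r. monom 1 (i * k)) = (1 - monom 1 (r * k) :: real poly) div (1 - monom 1 k)"
    by (metis geometric_factor nonzero_mult_div_cancel_left)
qed simp

lemma F_mult_denominator:
  "(\<Prod>k=1..n. 1 - monom 1 k) * F r n = (\<Prod>k=1..n. 1 - monom 1 (r * k))"
  by (simp add: F_def prod.distrib [symmetric] geometric_factor)

end

theory Submission
  imports Defs "HOL-Analysis.Analysis"
begin

text \<open>
Write \<open>d\<^sub>n(m)\<close> for the difference of the coefficients of \<open>q ^ m\<close> and \<open>q ^ (m - 1)\<close> in \<open>F r n\<close>.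
The polynomial is palindromic, so it is unimodal as soon as \<open>d\<^sub>n(m) \<ge> 0\<close> up to the middle degree; this is the
predicate \<open>rising\<close>, and \<open>rising_imp_unimodal\<close> is the reduction. Since \<open>F r (n + 1)\<close> arises from \<open>F r n\<close>
by a window sum of length \<open>r\<close> and step \<open>n + 1\<close>, \<open>rising_Suc\<close> shows that an induction on \<open>n\<close> only has to
look at the central range of \<open>m\<close>, within \<open>(r - 1)(n + 1) / 2\<close> of the middle.

For large \<open>n\<close> the central differences are given by an integral over \<open>[0, pi/2]\<close> of
\<open>\<Prod>k\<le>n. sin (r k a) / sin (k a)\<close> against \<open>sin (X a) sin a\<close>, where \<open>X \<ge> 1\<close> is twice the distance from the middle.
Near \<open>0\<close> the integrand is positive and of Gaussian shape (\<open>main_lobe\<close>), elsewhere the product is tiny: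
every kernel is controlled by \<open>sin (k a)\<^sup>2\<close>, and the average of these squares over \<open>k\<close> is about one half
(\<open>SS_ge\<close>, \<open>PP_large\<close>, \<open>PP_small\<close>). This gives \<open>fourier_step_2\<close>, \<open>fourier_step_3_to_8\<close> and
\<open>fourier_step_9_up\<close>: for \<open>r \<ge> 18\<close> the induction step is valid from \<open>n = 12\<close> on, and for each smaller \<open>r\<close> from an explicit \<open>n\<close> on.

It remains to start the induction. For \<open>r < 18\<close> only finitely many polynomials are left, and the recurrence
for \<open>d\<^sub>n\<close> is evaluated (\<open>chk_sound\<close>). For \<open>r \<ge> 18\<close> and \<open>n \<le> 12\<close> one expands
\<open>(1 - q) F = \<Prod>k\<le>n. (1 - q ^ (r k)) / \<Prod>k=2..n. (1 - q ^ k)\<close>: the numerator has few terms and the denominator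
generates partitions into parts \<open>2, ..., n\<close>, so \<open>d\<^sub>n(m)\<close> is a short signed sum of restricted partition numbers
\<open>pp n (m - j r)\<close> (\<open>dif_eq_sum_pp\<close>). Those are quasi-polynomials; on each range \<open>j r \<le> m < (j + 1) r\<close>, roughly, the sum is a
polynomial in two nonnegative variables up to a bounded oscillation, and it is positive because its coefficients are
nonnegative after a translation (\<open>chamber_gen\<close>). For \<open>n \<le> 4\<close> and even \<open>r\<close> the same expansion is short enough to be treated by hand.
The hypothesis that \<open>r\<close> is even enters only in the cases \<open>n \<le> 10\<close>.
\<close>

section \<open>Coefficient differences, symmetry and their Fourier integral\<close>

text \<open>The factor that \<open>F\<close> acquires with each new \<open>k\<close>.\<close>

definition win :: "nat \<Rightarrow> nat \<Rightarrow> real poly" where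
  "win r k = (\<Sum>i<r. monom 1 (i * k))"

definition top_deg :: "nat \<Rightarrow> nat \<Rightarrow> nat" where
  "top_deg r n = (r - 1) * (\<Sum>{1..n})"

lemma top_deg_Suc: "top_deg r (Suc n) = top_deg r n + (r - 1) * Suc n"
  by (simp add: top_deg_def distrib_left)

lemma F_0: "F r 0 = 1" by (simp add: F_def)

lemma F_Suc: "F r (Suc n) = F r n * win r (Suc n)"
  by (simp add: F_def win_def)

lemma coeff_win: "k > 0 \<Longrightarrow> coeff (win r k) j = (if k dvd j \<and> j div k < r then 1 else 0)"
proof -
  assume k: "k > 0"
  have "coeff (win r k) j = (\<Sum>i<r. if i * k = j then 1 else 0)"
    by (simp add: win_def coeff_sum)
  also have "\<dots> = (\<Sum>i<r. if i = j div k \<and> k dvd j then 1 else (0::real))"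
    by (rule sum.cong) (use k in auto)
  finally show ?thesis using k by (auto simp: sum.If_cases)
qed

lemma degree_win: assumes "k > 0" "r > 0" shows "degree (win r k) = (r - 1) * k"
proof (rule antisym)
  show "degree (win r k) \<le> (r - 1) * k"
    unfolding win_def
    by (rule degree_sum_le) (auto intro!: order.trans[OF degree_monom_le] mult_right_mono)
  have "coeff (win r k) ((r - 1) * k) \<noteq> 0" using assms by (simp add: coeff_win)
  then show "(r - 1) * k \<le> degree (win r k)" by (rule le_degree)
qed

lemma win_nonzero: "k > 0 \<Longrightarrow> r > 0 \<Longrightarrow> win r k \<noteq> 0"
  using coeff_win[of k r 0] by (metis coeff_0 div_0 dvd_0_right zero_neq_one)

lemma F_nonzero: "r > 0 \<Longrightarrow> F r n \<noteq> 0"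
  by (induction n) (auto simp: F_0 F_Suc win_nonzero)

lemma degree_F: "r > 0 \<Longrightarrow> degree (F r n) = top_deg r n"
proof (induction n)
  case (Suc n)
  then show ?case
    using degree_mult_eq[OF F_nonzero[of r n] win_nonzero[of "Suc n" r]]
    by (simp add: F_Suc degree_win top_deg_Suc)
qed (simp add: F_0 top_deg_def)

text \<open>Every factor is palindromic, and reflection is multiplicative; this is where the symmetry of \<open>F\<close> comes from.\<close>

lemma reflect_win: assumes "k > 0" "r > 0" shows "reflect_poly (win r k) = win r k"
proof (rule poly_eqI)
  fix j
  have *: "k dvd (r - 1) * k - j \<longleftrightarrow> k dvd j" if "j \<le> (r - 1) * k"
    using that by (metis dvd_diff_nat dvd_triv_right diff_diff_cancel)
  have **: "((r - 1) * k - j) div k < r" using assms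
    by (metis diff_le_self div_le_mono div_mult_self_is_m le_less_trans diff_less zero_less_one)
  have ***: "j div k < r \<longleftrightarrow> j \<le> (r - 1) * k" if "k dvd j"
    using that assms by (auto elim!: dvdE)
  show "coeff (reflect_poly (win r k)) j = coeff (win r k) j"
    using assms * ** *** by (auto simp: coeff_reflect_poly degree_win coeff_win)
qed

lemma reflect_F: "r > 0 \<Longrightarrow> reflect_poly (F r n) = F r n"
  by (induction n) (simp_all add: F_0 F_Suc reflect_poly_mult reflect_win)

text \<open>Coefficients are indexed by integers so that shifts below degree \<open>0\<close> need no case distinction.\<close>

definition co :: "nat \<Rightarrow> nat \<Rightarrow> int \<Rightarrow> real" where
  "co r n k = (if k < 0 then 0 else coeff (F r n) (nat k))"

lemma co_sym: assumes "r > 0" shows "co r n (int (top_deg r n) - k) = co r n k"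
proof -
  have *: "coeff (F r n) j = (if j > top_deg r n then 0 else coeff (F r n) (top_deg r n - j))" for j
    using coeff_reflect_poly[of "F r n" j] reflect_F[OF assms, of n] degree_F[OF assms, of n] by simp
  show ?thesis
    using *[of "nat k"] *[of "nat (int (top_deg r n) - k)"]
    by (auto simp: co_def nat_diff_distrib)
qed

lemma co_Suc: "co r (Suc n) k = (\<Sum>i<r. co r n (k - int (i * Suc n)))"
proof (cases "k < 0")
  case True
  then have "k - int (i * Suc n) < 0" for i
    using of_nat_0_le_iff[of "i * Suc n"] by linarith
  then have "co r n (k - int (i * Suc n)) = 0" for i by (simp only: co_def if_True)
  with True show ?thesis by (simp only: sum.neutral_const) (simp add: co_def)
next
  case False
  have "coeff (F r (Suc n)) (nat k) = (\<Sum>i<r. coeff (monom 1 (i * Suc n) * F r n) (nat k))"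
    unfolding F_Suc win_def mult.commute[of "F r n"] sum_distrib_right coeff_sum ..
  also have "\<dots> = (\<Sum>i<r. co r n (k - int (i * Suc n)))"
  proof (rule sum.cong[OF refl])
    fix i
    have "coeff (monom 1 j * F r n) (nat k) = co r n (k - int j)" for j
      using False by (auto simp: co_def coeff_monom_mult nat_diff_distrib)
    then show "coeff (monom 1 (i * Suc n) * F r n) (nat k) = co r n (k - int (i * Suc n))" .
  qed
  finally show ?thesis using False by (simp add: co_def)
qed

definition dif :: "nat \<Rightarrow> nat \<Rightarrow> int \<Rightarrow> real" where
  "dif r n k = co r n k - co r n (k - 1)"

lemma dif_Suc: "dif r (Suc n) k = (\<Sum>i<r. dif r n (k - int (i * Suc n)))"
  by (simp add: dif_def co_Suc sum_subtractf algebra_simps)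

text \<open>The coefficients increase up to the middle degree. Together with the symmetry this is unimodality, but unlike unimodality it is stated on a half-line of degrees and passes through inductions well.\<close>

definition rising :: "nat \<Rightarrow> nat \<Rightarrow> bool" where
  "rising r n \<longleftrightarrow> (\<forall>k. 2 * k \<le> int (top_deg r n) \<longrightarrow> 0 \<le> dif r n k)"

lemma rising_imp_unimodal:
  assumes r: "r > 0" and R: "rising r n" shows "unimodal_poly (F r n)"
proof -
  let ?N = "top_deg r n" and ?a = "coeff (F r n)"
  have up: "?a i \<le> ?a (Suc i)" if "i < ?N div 2" for i
    using R[unfolded rising_def, rule_format, of "int (Suc i)"] that by (auto simp: dif_def co_def nat_add_distrib)
  have "unimodal_seq ?N ?a"
    unfolding unimodal_seq_def
  proof (intro exI[of _ "?N div 2"] conjI allI impI)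
    fix i assume i: "?N div 2 \<le> i \<and> i < ?N"
    have s: "?a j = ?a (?N - j)" if "j \<le> ?N" for j
      using co_sym[OF r, of n "int j"] that by (simp add: co_def of_nat_diff[symmetric] del: of_nat_diff)
    have 1: "?a (Suc i) = ?a (?N - Suc i)" "?a i = ?a (Suc (?N - Suc i))"
      using s[of "Suc i"] s[of i] i by (simp_all add: Suc_diff_Suc)
    have "2 * (?N - Suc i) + 1 \<le> ?N" using i by linarith
    show "?a (Suc i) \<le> ?a i"
    proof (cases "?N - Suc i < ?N div 2")
      case True
      then show ?thesis using up 1 by metis
    next
      case False
      then have "Suc (?N - Suc i) = ?N - (?N - Suc i)"  using i by linarith
      then show ?thesis using 1 s[of "?N - Suc i"] by simp
    qed
  qed (use up in auto)
  then show ?thesis using r by (simp add: unimodal_poly_def degree_F)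
qed

text \<open>Below the middle of \<open>F r n\<close> all terms of the window sum for the new difference lie in the rising range of \<open>F r n\<close>. Hence only the degrees between the old and the new middle have to be examined.\<close>

lemma rising_Suc:
  assumes "rising r n"
    and "\<And>k. int (top_deg r n) < 2 * k \<Longrightarrow> 2 * k \<le> int (top_deg r (Suc n)) \<Longrightarrow> 0 \<le> dif r (Suc n) k"
  shows "rising r (Suc n)"
  unfolding rising_def
proof (intro allI impI)
  fix k assume k: "2 * k \<le> int (top_deg r (Suc n))"
  show "0 \<le> dif r (Suc n) k"
  proof (cases "2 * k \<le> int (top_deg r n)")
    case True
    then have "2 * (k - int (i * Suc n)) \<le> int (top_deg r n)" for i
      by (smt (verit) of_nat_0_le_iff)
    then show ?thesis using assms(1) by (auto simp: dif_Suc rising_def intro!: sum_nonneg)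
  qed (use assms(2) k in auto)
qed

text \<open>The Dirichlet kernel \<open>sin (r b) / sin b\<close>, written as a cosine sum so that it is total and continuous.\<close>

definition dk :: "nat \<Rightarrow> real \<Rightarrow> real" where
  "dk r b = (\<Sum>i<r. cos ((2 * real i + 1 - real r) * b))"

lemma dk_sin_zero: "(\<Sum>i<r. sin ((2 * real i + 1 - real r) * b)) = 0"
proof -
  have "(\<Sum>i<r. sin ((2 * real i + 1 - real r) * b)) = (\<Sum>i<r. sin ((2 * real (r - Suc i) + 1 - real r) * b))"
    by (rule sum.nat_diff_reindex[symmetric])
  also have "\<dots> = (\<Sum>i<r. - sin ((2 * real i + 1 - real r) * b))"
  proof (rule sum.cong[OF refl])
    fix i assume "i \<in> {..<r}"
    then have "(2 * real (r - Suc i) + 1 - real r) * b = - ((2 * real i + 1 - real r) * b)"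
      by (simp add: of_nat_diff algebra_simps)
    then show "sin ((2 * real (r - Suc i) + 1 - real r) * b) = - sin ((2 * real i + 1 - real r) * b)"
      by (simp only: sin_minus)
  qed
  finally show ?thesis by (simp add: sum_negf)
qed

lemma dk_mult_cos: "dk r b * cos c = (\<Sum>i<r. cos (c - (2 * real i + 1 - real r) * b))"
proof -
  have "(\<Sum>i<r. cos (c - (2 * real i + 1 - real r) * b)) = dk r b * cos c + (\<Sum>i<r. sin ((2 * real i + 1 - real r) * b)) * sin c"
    by (simp add: dk_def cos_diff sum.distrib sum_distrib_right sum_distrib_left mult_ac)
  then show ?thesis by (simp add: dk_sin_zero)
qed

lemma dk_sin: "dk r b * sin b = sin (real r * b)"
proof -
  have "2 * (dk r b * sin b) = (\<Sum>i<r. sin ((2 * real (Suc i) - real r) * b) - sin ((2 * real i - real r) * b))"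
    unfolding dk_def sum_distrib_left sum_distrib_right
  proof (rule sum.cong[OF refl])
    fix i
    have e: "(2 * real (Suc i) - real r) * b = (2 * real i + 1 - real r) * b + b"
      "(2 * real i - real r) * b = (2 * real i + 1 - real r) * b - b" by (simp_all add: algebra_simps)
    show "2 * (cos ((2 * real i + 1 - real r) * b) * sin b) =
        sin ((2 * real (Suc i) - real r) * b) - sin ((2 * real i - real r) * b)"
      unfolding e sin_add sin_diff by simp
  qed
  also have "\<dots> = sin (real r * b) - sin (- (real r * b))"
    by (subst sum_lessThan_telescope[of "\<lambda>i. sin ((2 * real i - real r) * b)"]) (simp add: algebra_simps)
  finally show ?thesis by simp
qed

definition PP :: "nat \<Rightarrow> nat \<Rightarrow> real \<Rightarrow> real" where
  "PP r n a = (\<Prod>k=1..n. dk r (real k * a))"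

lemma continuous_PP [continuous_intros]: "continuous_on S (PP r n)"
  unfolding PP_def dk_def by (intro continuous_intros)

lemma has_integral_cos_multiple:
  "((\<lambda>a. cos (2 * of_int z * a)) has_integral (if z = 0 then pi else 0)) {0..pi}"
proof (cases "z = 0")
  case True
  then show ?thesis using has_integral_const_real[of "1::real" 0 pi] by simp
next
  case False
  have "((\<lambda>a. cos (2 * of_int z * a)) has_integral
      (sin (2 * of_int z * pi) / (2 * of_int z) - sin (2 * of_int z * 0) / (2 * of_int z))) {0..pi}"
    by (rule fundamental_theorem_of_calculus)
       (use False in \<open>auto intro!: derivative_eq_intros simp: has_real_derivative_iff_has_vector_derivative[symmetric]\<close>)
  moreover have "sin (2 * of_int z * pi) = 0"
    by (metis mult.commute mult.left_commute sin_times_pi_eq_0 Ints_mult Ints_numeral Ints_of_int)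
  ultimately show ?thesis using False by simp
qed

text \<open>The product of kernels is \<open>F r n\<close> on the unit circle, centred so that it becomes real; orthogonality of the cosines extracts a coefficient.\<close>

lemma coefficient_integral:
  assumes "r > 0"
  shows "((\<lambda>a. PP r n a * cos (of_int (int (top_deg r n) - 2 * z) * a)) has_integral (pi * co r n z)) {0..pi}"
proof (induction n arbitrary: z)
  case 0
  have "co r 0 z = (if z = 0 then 1 else 0)" by (simp add: co_def F_0)
  then show ?case using has_integral_cos_multiple[of "-z"] by (simp add: PP_def top_deg_def algebra_simps split: if_splits)
next
  case (Suc n)
  let ?f = "\<lambda>i a. PP r n a * cos (of_int (int (top_deg r n) - 2 * (z - int ((r - Suc i) * Suc n))) * a)"
  have "((\<lambda>a. \<Sum>i<r. ?f i a) has_integral (\<Sum>i<r. pi * co r n (z - int ((r - Suc i) * Suc n)))) {0..pi}"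
    by (intro has_integral_sum finite_lessThan Suc)
  also have "(\<Sum>i<r. pi * co r n (z - int ((r - Suc i) * Suc n))) = pi * co r (Suc n) z"
    unfolding co_Suc sum_distrib_left
    by (rule sum.nat_diff_reindex[of "\<lambda>i. pi * co r n (z - int (i * Suc n))"])
  also have "(\<lambda>a. \<Sum>i<r. ?f i a) = (\<lambda>a. PP r (Suc n) a * cos (of_int (int (top_deg r (Suc n)) - 2 * z) * a))"
  proof
    fix a
    have "PP r (Suc n) a * cos (of_int (int (top_deg r (Suc n)) - 2 * z) * a)
        = PP r n a * (dk r (real (Suc n) * a) * cos (of_int (int (top_deg r (Suc n)) - 2 * z) * a))"
      by (simp add: PP_def)
    also have "\<dots> = (\<Sum>i<r. PP r n a * cos (of_int (int (top_deg r (Suc n)) - 2 * z) * a - (2 * real i + 1 - real r) * (real (Suc n) * a)))"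
      by (simp add: dk_mult_cos sum_distrib_left)
    also have "\<dots> = (\<Sum>i<r. ?f i a)"
    proof (rule sum.cong[OF refl])
      fix i assume i: "i \<in> {..<r}"
      have "of_int (int (top_deg r (Suc n)) - 2 * z) * a - (2 * real i + 1 - real r) * (real (Suc n) * a)
        = of_int (int (top_deg r n) - 2 * (z - int ((r - Suc i) * Suc n))) * a"
      proof -
        have h: "int (r - Suc i) = int r - 1 - int i" "int (r - 1) = int r - 1" using i assms by auto
        show ?thesis unfolding top_deg_Suc of_nat_add of_nat_mult h by (simp add: algebra_simps)
      qed
      then show "PP r n a * cos (of_int (int (top_deg r (Suc n)) - 2 * z) * a - (2 * real i + 1 - real r) * (real (Suc n) * a)) = ?f i a"
        by simp
    qed
    finally show "(\<Sum>i<r. ?f i a) = PP r (Suc n) a * cos (of_int (int (top_deg r (Suc n)) - 2 * z) * a)" by simp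
  qed
  finally show ?case .
qed

lemma dif_integral:
  assumes "r > 0" and X: "X = int (top_deg r n) + 1 - 2 * z"
  shows "((\<lambda>a. PP r n a * sin (of_int X * a) * sin a) has_integral (pi / 2 * dif r n z)) {0..pi}"
proof -
  have "((\<lambda>a. (PP r n a * cos (of_int (int (top_deg r n) - 2 * z) * a) - PP r n a * cos (of_int (int (top_deg r n) - 2 * (z - 1)) * a)) / 2)
     has_integral (pi * co r n z - pi * co r n (z - 1)) / 2) {0..pi}"
    by (intro has_integral_divide has_integral_diff coefficient_integral assms)
  moreover have "(PP r n a * cos (of_int (int (top_deg r n) - 2 * z) * a) - PP r n a * cos (of_int (int (top_deg r n) - 2 * (z - 1)) * a)) / 2
      = PP r n a * sin (of_int X * a) * sin a" for a
  proof -
    have e: "of_int (int (top_deg r n) - 2 * z) * a = of_int X * a - a" "of_int (int (top_deg r n) - 2 * (z - 1)) * a = of_int X * a + a"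
      by (simp_all add: X algebra_simps)
    show ?thesis unfolding e cos_add cos_diff by (simp add: algebra_simps)
  qed
  moreover have "(pi * co r n z - pi * co r n (z - 1)) / 2 = pi / 2 * dif r n z"
    by (simp add: dif_def field_simps)
  ultimately show ?thesis by simp
qed

lemma cos_int_pi_mult: "cos (of_int k * (pi - a)) = (if even k then 1 else -1) * cos (of_int k * a)"
  and sin_int_pi_mult: "sin (of_int k * (pi - a)) = (if even k then -1 else 1) * sin (of_int k * a)"
proof -
  have s: "sin (of_int k * pi) = 0" by (metis sin_int_times_real Ints_of_int sin_times_pi_eq_0)
  have c: "cos (of_int k * pi) = (if even k then 1 else -1)"
    by (metis cos_int_times_real cos_npi_int  mult.commute)
  show "cos (of_int k * (pi - a)) = (if even k then 1 else -1) * cos (of_int k * a)"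
    "sin (of_int k * (pi - a)) = (if even k then -1 else 1) * sin (of_int k * a)"
    by (simp_all add: right_diff_distrib cos_diff sin_diff s c)
qed

lemma dk_reflect: "dk r (real k * (pi - a)) = (if even ((r - 1) * k) then 1 else -1) * dk r (real k * a)"
proof (cases "r = 0")
  case False
  have "cos ((2 * real i + 1 - real r) * (real k * (pi - a))) =
     (if even ((r - 1) * k) then 1 else -1) * cos ((2 * real i + 1 - real r) * (real k * a))" for i
  proof -
    have "(2 * real i + 1 - real r) * (real k * (pi - a)) = of_int ((2 * int i + 1 - int r) * int k) * (pi - a)"
      "(2 * real i + 1 - real r) * (real k * a) = of_int ((2 * int i + 1 - int r) * int k) * a"
      by (simp_all add: algebra_simps)
    moreover have "even ((2 * int i + 1 - int r) * int k) \<longleftrightarrow> even ((r - 1) * k)"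
      using False by auto
    ultimately show ?thesis by (simp only: cos_int_pi_mult)
  qed
  then show ?thesis by (simp add: dk_def sum_distrib_left)
qed (simp add: dk_def)

lemma PP_reflect: "PP r n (pi - a) = (if even (top_deg r n) then 1 else -1) * PP r n a"
proof (induction n)
  case (Suc n)
  have "PP r (Suc n) b = PP r n b * dk r (real (Suc n) * b)" for b by (simp add: PP_def)
  then show ?case using Suc dk_reflect[of r "Suc n" a] by (auto simp: top_deg_Suc)
qed (simp add: PP_def top_deg_def)

text \<open>The difference of two neighbouring cosines is a product of two sines, and \<open>a \<mapsto> pi - a\<close> preserves the integrand because \<open>X\<close> and the degree have opposite parity.\<close>

lemma dif_half_integral:
  assumes "r > 0" and X: "X = int (top_deg r n) + 1 - 2 * z"
  shows "integral {0..pi/2} (\<lambda>a. PP r n a * sin (of_int X * a) * sin a) = pi / 4 * dif r n z"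
proof -
  let ?f = "\<lambda>a. PP r n a * sin (of_int X * a) * sin a"
  have sym: "?f (pi - a) = ?f a" for a
  proof -
    have "even X \<longleftrightarrow> odd (top_deg r n)" using X by auto
    then show ?thesis by (simp add: PP_reflect sin_int_pi_mult)
  qed
  have int: "?f integrable_on {a..b}" for a b
    by (intro integrable_continuous_real continuous_intros)
  have "integral {pi/2..pi} ?f = integral {0..pi/2} ?f"
  proof -
    have "(?f has_integral integral {pi/2..pi} ?f) (cbox (pi/2) pi)"
      using int by (simp add: integrable_integral)
    from has_integral_affinity[OF this, of "-1" pi]
    have "((\<lambda>x. ?f (pi - x)) has_integral integral {pi/2..pi} ?f) ((\<lambda>x. pi - x) ` {pi/2..pi})"
      by (simp add: image_affinity_atLeastAtMost_diff)
    moreover have "(\<lambda>x. pi - x) ` {pi/2..pi} = {0..pi/2}" by (simp add: image_diff_atLeastAtMost)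
    ultimately have "((\<lambda>x. ?f (pi - x)) has_integral integral {pi/2..pi} ?f) {0..pi/2}" by simp
    then show ?thesis unfolding sym by (simp add: integral_unique)
  qed
  moreover have "integral {0..pi/2} ?f + integral {pi/2..pi} ?f = integral {0..pi} ?f"
    by (rule Henstock_Kurzweil_Integration.integral_combine) (use int pi_ge_zero in auto)
  moreover have "integral {0..pi} ?f = pi / 2 * dif r n z"
    using dif_integral[OF assms] by (rule integral_unique)
  ultimately show ?thesis by simp
qed

section \<open>Pointwise bounds for the Dirichlet kernel\<close>

lemma abs_dk_le: "\<bar>dk r b\<bar> \<le> real r"
proof -
  have "\<bar>dk r b\<bar> \<le> (\<Sum>i<r. \<bar>cos ((2 * real i + 1 - real r) * b)\<bar>)" unfolding dk_def by (rule sum_abs)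
  also have "\<dots> \<le> (\<Sum>i<r. 1)" by (intro sum_mono) simp
  finally show ?thesis by simp
qed

lemma abs_dk_sin_le: "\<bar>dk r b\<bar> * \<bar>sin b\<bar> \<le> 1"
  by (metis abs_mult abs_sin_le_one dk_sin)

lemma sin_sq_bound: "(sin x)\<^sup>2 * (3 + x\<^sup>2) \<le> 3 * (x::real)\<^sup>2"
proof (cases "x\<^sup>2 \<ge> 3/2")
  case True
  have "(sin x)\<^sup>2 \<le> 1" using abs_sin_le_one[of x] by (simp only: abs_square_le_1)
  then have "(sin x)\<^sup>2 * (3 + x\<^sup>2) \<le> 1 * (3 + x\<^sup>2)" by (rule mult_right_mono) simp
  also have "\<dots> \<le> 3 * x\<^sup>2" using True by simp
  finally show ?thesis .
next
  case False
  obtain t where t: "cos (2*x) = (\<Sum>m<6. cos_coeff m * (2*x) ^ m) + (cos (t + 1 / 2 * real 6 * pi) / fact 6) * (2*x) ^ 6"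
    using Maclaurin_cos_expansion[of "2*x" 6] by blast
  have "cos (2*x) = 1 - 2*x^2 + 2/3*x^4 - cos t / 720 * (2*x)^6"
  proof -
    have "cos (t + 1 / 2 * real 6 * pi) = - cos t" by (simp add: cos_add)
    moreover have "(\<Sum>m<6. f m) = f 0 + f 1 + f 2 + f 3 + f 4 + f 5" for f :: "nat \<Rightarrow> real"
      by (simp add: eval_nat_numeral)
    ultimately show ?thesis unfolding t
      by (simp add: cos_coeff_def fact_numeral power_mult_distrib)
  qed
  moreover have "cos t / 720 * (2*x)^6 \<le> 1/720 * (2*x)^6" by (intro mult_right_mono) auto
  moreover have "(2*x)^6 = 64 * x^6" by (simp add: power_mult_distrib)
  ultimately have c: "cos (2*x) \<ge> 1 - 2*x^2 + 2/3*x^4 - 4/45 * x^6" by simp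
  have "(sin x)\<^sup>2 = (1 - cos (2*x))/2" by (simp add: cos_double_sin)
  then have s: "(sin x)\<^sup>2 \<le> x^2 - x^4/3 + 2/45*x^6" using c by (simp add: field_simps)
  define y where "y = x^2"
  have y: "0 \<le> y" "y \<le> 3/2" using False by (auto simp: y_def)
  have s': "(sin x)\<^sup>2 \<le> y - y^2/3 + 2/45*y^3" using s by (simp add: y_def flip: power_mult)
  have "(sin x)\<^sup>2 * (3 + y) \<le> (y - y^2/3 + 2/45*y^3) * (3 + y)"
    using s' y by (intro mult_right_mono) auto
  also have "\<dots> = 3*y - y^3 * (1/5 - 2/45*y)" by (simp add: field_simps power2_eq_square power3_eq_cube)
  also have "\<dots> \<le> 3*y" using y by (simp add: zero_le_mult_iff)
  finally show ?thesis by (simp add: y_def)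
qed

lemma tan_sq_bound: fixes b :: real assumes "\<bar>b\<bar> \<le> pi/2" shows "b\<^sup>2 * (1 - (sin b)\<^sup>2) \<le> (sin b)\<^sup>2"
proof -
  have *: "c * cos c \<le> sin c" if "0 \<le> c" "c \<le> pi/2" for c :: real
  proof (cases "c = pi/2")
    case False
    then have c: "c < pi/2" using that by simp
    have "cos c > 0" using that c by (intro cos_gt_zero_pi) auto
    have "c \<le> tan c" using abs_tan_ge[of c] that c tan_gt_zero[of c] by (cases "c = 0") auto
    then show ?thesis using \<open>cos c > 0\<close> by (simp add: tan_def field_simps)
  next
    case True
    show ?thesis unfolding True by simp
  qed
  have cs: "cos (\<bar>b\<bar>) = cos b" "(sin \<bar>b\<bar>)\<^sup>2 = (sin b)\<^sup>2" by (auto simp: abs_if)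
  have "(\<bar>b\<bar> * cos b)\<^sup>2 \<le> (sin \<bar>b\<bar>)\<^sup>2"
    using *[of "\<bar>b\<bar>"] assms cs by (intro power_mono) (auto intro!: mult_nonneg_nonneg cos_ge_zero)
  then show ?thesis using cs by (simp add: power_mult_distrib cos_squared_eq)
qed

text \<open>Up to sign the kernel and the sine have period \<open>pi\<close>, so an estimate in terms of \<open>(sin b)\<^sup>2\<close> needs to be shown for \<open>\<bar>b\<bar> \<le> pi/2\<close> only.\<close>

lemma reduce_mod_pi:
  fixes b :: real
  obtains b' where "\<bar>b'\<bar> \<le> pi/2" "(sin b')\<^sup>2 = (sin b)\<^sup>2" "(sin (real r * b'))\<^sup>2 = (sin (real r * b))\<^sup>2"
proof -
  define m where "m = round (b / pi)"
  define b' where "b' = b - of_int m * pi"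
  have "\<bar>of_int m - b/pi\<bar> \<le> 1/2" unfolding m_def by (rule of_int_round_abs_le)
  then have *: "\<bar>b/pi - of_int m\<bar> * pi \<le> 1/2 * pi" by (intro mult_right_mono) (simp_all only: abs_minus_commute pi_ge_zero)
  then have "\<bar>b'\<bar> \<le> pi/2" 
  proof -
    have "b' = (b/pi - of_int m) * pi" by (simp add: b'_def left_diff_distrib)
    then have "\<bar>b'\<bar> = \<bar>b/pi - of_int m\<bar> * pi" by (simp add: abs_mult)
    then show ?thesis using * by simp
  qed
  moreover have *: "(sin (x - of_int j * pi))\<^sup>2 = (sin x)\<^sup>2" for x :: real and j :: int
  proof -
    have "sin (of_int j * pi) = 0" by (metis Ints_of_int sin_times_pi_eq_0)
    moreover have "(cos (of_int j * pi))\<^sup>2 = 1" using calculation by (simp add: cos_squared_eq)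
    ultimately show ?thesis by (simp add: sin_diff power_mult_distrib)
  qed
  moreover have "real r * b' = real r * b - of_int (int r * m) * pi" by (simp add: b'_def algebra_simps)
  then have "(sin (real r * b'))\<^sup>2 = (sin (real r * b))\<^sup>2" by (simp only: *)
  ultimately show ?thesis using that[of b'] by (simp add: b'_def)
qed

text \<open>A rational bound for the squared normalised kernel in \<open>s = (sin b)\<^sup>2\<close>: it has the right order both at \<open>s = 0\<close> and for \<open>s\<close> near \<open>1\<close>.\<close>

lemma dk_sq_bound:
  assumes "r > 0"
  shows "(dk r b)\<^sup>2 * (3 + ((real r)\<^sup>2 - 3) * (sin b)\<^sup>2) \<le> 3 * (real r)\<^sup>2"
proof (cases "sin b = 0")
  case True
  have "(dk r b)\<^sup>2 \<le> (real r)\<^sup>2" using abs_dk_le[of r b] by (metis abs_le_square_iff abs_of_nat)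
  then show ?thesis using True by simp
next
  case False
  obtain b' where b': "\<bar>b'\<bar> \<le> pi/2" "(sin b')\<^sup>2 = (sin b)\<^sup>2" "(sin (real r * b'))\<^sup>2 = (sin (real r * b))\<^sup>2"
    by (rule reduce_mod_pi)
  define s where "s = (sin b)\<^sup>2"
  define R where "R = (real r)\<^sup>2"
  define B where "B = b'\<^sup>2"
  define Y where "Y = (sin (real r * b))\<^sup>2"
  have s: "0 < s" "s \<le> 1" using False by (auto simp: s_def abs_square_le_1)
  have R: "R \<ge> 1" using assms by (simp add: R_def)
  have B: "B \<ge> 0" by (simp add: B_def)
  have 1: "Y * (3 + R * B) \<le> 3 * (R * B)" using sin_sq_bound[of "real r * b'"] b'(3)
    by (simp add: Y_def R_def B_def power_mult_distrib)
  have 2: "B * (1 - s) \<le> s" using tan_sq_bound[OF b'(1)] by (simp add: B_def s_def b'(2))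
  have "Y \<ge> 0" by (simp add: Y_def)
  have "Y * (B * (3 + (R - 3) * s)) \<le> Y * (s * (3 + R * B))"
    using 2 \<open>Y \<ge> 0\<close> by (intro mult_left_mono) (auto simp: algebra_simps)
  also have "\<dots> \<le> s * (3 * (R * B))" using 1 s by (simp add: mult.left_commute)
  finally have "B * (Y * (3 + (R - 3) * s)) \<le> B * (3 * R * s)" by (simp add: algebra_simps)
  moreover have "B > 0" using b'(2) False B by (cases "B = 0") (auto simp: B_def)
  ultimately have "Y * (3 + (R - 3) * s) \<le> 3 * R * s" by simp
  moreover have "Y = (dk r b)\<^sup>2 * s" by (simp add: Y_def s_def dk_sin[symmetric] power_mult_distrib)
  ultimately have "s * ((dk r b)\<^sup>2 * (3 + (R - 3) * s)) \<le> s * (3 * R)" by (simp add: algebra_simps)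
  then show ?thesis using s by (simp add: s_def R_def)
qed

lemma ln_le_diff_sqrt:
  fixes s :: real assumes "0 < s" "s \<le> 1" shows "- ln s \<le> (1 - s) / sqrt s"
proof -
  define u where "u = sqrt s"
  have u: "0 < u" "u \<le> 1" "s = u\<^sup>2" using assms by (auto simp: u_def)
  have "(\<lambda>x::real. (1 - x\<^sup>2)/x + 2 * ln x) u \<ge> (\<lambda>x::real. (1 - x\<^sup>2)/x + 2 * ln x) 1"
  proof (rule DERIV_nonpos_imp_nonincreasing[OF u(2)])
    fix x assume x: "u \<le> x" "x \<le> 1"
    then have "x > 0" using u by simp
    have "((\<lambda>x::real. (1 - x\<^sup>2)/x + 2 * ln x) has_real_derivative (- ((1 - x)\<^sup>2 / x\<^sup>2))) (at x)"
      using \<open>x > 0\<close> by (auto intro!: derivative_eq_intros simp: field_simps power2_eq_square)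
    then show "\<exists>y. ((\<lambda>x::real. (1 - x\<^sup>2)/x + 2 * ln x) has_real_derivative y) (at x) \<and> y \<le> 0"
      by (meson divide_nonneg_nonneg neg_le_0_iff_le zero_le_power2)
  qed
  then have "0 \<le> (1 - u\<^sup>2)/u + 2 * ln u" by simp
  then show ?thesis using u assms by (simp add: ln_realpow u_def[symmetric])
qed

text \<open>The maximum is the reciprocal of the two available bounds for the squared normalised kernel. Replacing its logarithm by a polynomial in \<open>s\<close> makes the product over \<open>k\<close> the exponential of a sum of squared sines; the term \<open>s (1 - s)\<close> becomes a squared sine of the doubled angle.\<close>

lemma large_r_exponent:
  fixes r s :: real
  assumes r: "r \<ge> 8" and s: "0 \<le> s" "s \<le> 1"
  shows "2 * ln r * (s + 3/4 * s * (1 - s)) \<le> ln (max (1 + (r\<^sup>2/3 - 1) * s) (r\<^sup>2 * s))"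
proof -
  define L where "L = ln r"
  have l8: "ln (8::real) = 3 * ln 2" using ln_realpow[of 2 3] by simp
  have "L \<ge> ln 8" unfolding L_def using r by (subst ln_le_cancel_iff) auto
  then have L: "L \<ge> 2" using l8 ln2_ge_two_thirds by simp
  define C where "C = r\<^sup>2/3 - 1"
  have r2: "r\<^sup>2 \<ge> 64" using power_mono[OF r, of 2] by simp
  then have C: "C > 0" by (simp add: C_def)
  have Cs: "1 + C * s > 0" using C s by (meson add_pos_nonneg less_imp_le mult_nonneg_nonneg zero_less_one)
  consider "s * sqrt r * r \<le> 1" | "s * sqrt r * r \<ge> 1" "s \<le> 3/20" | "s \<ge> 3/20" by linarith
  then show ?thesis
  proof cases
    case 1
    have "ln (r/8) \<le> r/8 - 1" using r by (intro ln_le_minus_one) auto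
    then have L1: "L \<le> 13/12 + r/8" using r l8 ln2_le_25_over_36 by (simp add: L_def ln_div)
    have sq: "sqrt r \<ge> 2.8" using r by (intro real_le_rsqrt) (simp add: power2_eq_square)
    have sr: "sqrt r * sqrt r = r" using r by simp
    have "2.8 * sqrt r \<le> sqrt r * sqrt r" using sq r by (intro mult_right_mono) auto
    then have sq2: "sqrt r \<le> r / 2.8" using sr by simp
    have "s * r\<^sup>2 = (s * sqrt r * r) * sqrt r" using sr by (simp add: power2_eq_square algebra_simps)
    also have "\<dots> \<le> 1 * sqrt r" using 1 r by (intro mult_right_mono) auto
    finally have sr2: "s * r\<^sup>2 \<le> r / 2.8" using sq2 by simp
    have Cs1: "1 + C * s \<le> 1 + r / 8.4" using sr2 s by (simp add: C_def algebra_simps)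
    have "3.5 * L * (1 + C * s) \<le> 3.5 * (13/12 + r/8) * (1 + r/8.4)"
      using L1 Cs1 L Cs r by (intro mult_mono) auto
    also have "\<dots> \<le> C"
    proof -
      have "8 * r \<le> r\<^sup>2" using r by (simp add: power2_eq_square)
      then show ?thesis using r2 by (simp add: C_def field_simps power2_eq_square)
    qed
    finally have "3.5 * L \<le> C / (1 + C * s)" using Cs by (simp add: pos_le_divide_eq)
    then have "3.5 * L * s \<le> C / (1 + C * s) * s" using s by (intro mult_right_mono) auto
    also have "C / (1 + C * s) * s = 1 - 1 / (1 + C * s)" using Cs by (simp add: field_simps)
    also have "\<dots> \<le> ln (1 + C * s)" 
      using ln_le_minus_one[of "1 / (1 + C * s)"] Cs by (simp add: ln_div)
    also have "\<dots> \<le> ln (max (1 + C * s) (r\<^sup>2 * s))" using Cs by simp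
    finally have "3.5 * L * s \<le> ln (max (1 + C * s) (r\<^sup>2 * s))" .
    moreover have "2 * L * (s + 3/4 * s * (1 - s)) \<le> 3.5 * L * s"
      using L s mult_nonneg_nonneg[of L "s\<^sup>2"] by (simp add: algebra_simps power2_eq_square)
    ultimately show ?thesis unfolding L_def C_def by linarith
  next
    case 2
    have s0: "s > 0" using 2 s r by (cases "s = 0") auto
    have "0 \<le> ln (s * sqrt r * r)" using 2 by simp
    then have "- ln s \<le> 3/2 * L" using s0 r by (simp add: L_def ln_mult ln_sqrt)
    then have "L / 2 \<le> ln (r\<^sup>2 * s)" using s0 r by (simp add: L_def ln_mult ln_realpow)
    also have "\<dots> \<le> ln (max (1 + C * s) (r\<^sup>2 * s))"
    proof -
      have "0 < r\<^sup>2 * s" using s0 r by simp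
      then show ?thesis by (subst ln_le_cancel_iff) auto
    qed
    finally have *: "L / 2 \<le> ln (max (1 + C * s) (r\<^sup>2 * s))" .
    have "(3/20 - s) * (7/4 - 3/4 * (3/20 + s)) \<ge> 0" using 2 s by (intro mult_nonneg_nonneg) auto
    moreover have "(3/20 - s) * (7/4 - 3/4 * (3/20 + s)) = 393/1600 - (s + 3/4 * s * (1 - s))"
      by (simp add: field_simps)
    ultimately have "s + 3/4 * s * (1 - s) \<le> 1/4" by linarith
    then have "2 * L * (s + 3/4 * s * (1 - s)) \<le> 2 * L * (1/4)" using L by (intro mult_left_mono) auto
    then show ?thesis using * unfolding L_def C_def by simp
  next
    case 3
    have s0: "s > 0" using 3 by simp
    define u where "u = sqrt s"
    have u: "u > 0" "u \<le> 1" "s = u\<^sup>2" using s0 s by (auto simp: u_def)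
    have "u \<ge> 0.38" unfolding u_def using 3 by (intro real_le_rsqrt) (simp add: power2_eq_square)
    then have "0 \<le> (1 - u) * (3 * u\<^sup>2 + 3 * u - 1)" using u 3 by (intro mult_nonneg_nonneg) auto
    then have "1 \<le> (4 - 3 * s) * u" by (simp add: u(3) algebra_simps power2_eq_square)
    then have a: "1 / u \<le> 4 - 3 * s" using u by (simp add: pos_divide_le_eq)
    have "- ln s \<le> (1 - s) / u" using ln_le_diff_sqrt[OF s0 s(2)] by (simp add: u_def)
    also have "\<dots> = (1 - s) * (1 / u)" by simp
    also have "\<dots> \<le> (1 - s) * (4 - 3 * s)" using a s by (intro mult_left_mono) auto
    also have "\<dots> = 4 * ((1 - s) * (1 - 3/4 * s))" by (simp add: field_simps)
    also have "\<dots> \<le> 2 * L * ((1 - s) * (1 - 3/4 * s))" using L s by (intro mult_right_mono) auto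
    finally have "2 * L * (s + 3/4 * s * (1 - s)) \<le> 2 * L + ln s" by (simp add: algebra_simps)
    also have "\<dots> = ln (r\<^sup>2 * s)" using s0 r by (simp add: L_def ln_mult ln_realpow)
    also have "\<dots> \<le> ln (max (1 + C * s) (r\<^sup>2 * s))"
    proof -
      have "0 < r\<^sup>2 * s" using s0 r by simp
      then show ?thesis by (subst ln_le_cancel_iff) auto
    qed
    finally show ?thesis unfolding L_def C_def .
  qed
qed

lemma small_r_exponent:
  fixes r s :: real
  assumes r: "r \<ge> 4" and s: "0 \<le> s" "s \<le> 1"
  shows "2 * ln r * s \<le> ln (max (1 + (r\<^sup>2/3 - 1) * s) (r\<^sup>2 * s))"
proof (cases "r \<ge> 8")
  case True
  have "2 * ln r * s \<le> 2 * ln r * (s + 3/4 * s * (1 - s))" using True s by (intro mult_left_mono) auto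
  then show ?thesis using large_r_exponent[OF True s] by linarith
next
  case False
  define L where "L = ln r"
  have l4: "ln (4::real) = 2 * ln 2" using ln_realpow[of 2 2] by simp
  have "L \<ge> ln 4" unfolding L_def using r by (subst ln_le_cancel_iff) auto
  then have L: "L \<ge> 4/3" using l4 ln2_ge_two_thirds by simp
  define C where "C = r\<^sup>2/3 - 1"
  have r2: "r\<^sup>2 \<ge> 16" using power_mono[OF r, of 2] by simp
  then have C: "C > 0" by (simp add: C_def)
  have Cs: "1 + C * s > 0" using C s by (meson add_pos_nonneg less_imp_le mult_nonneg_nonneg zero_less_one)
  show ?thesis
  proof (cases "s \<ge> 0.2")
    case True
    then have s0: "s > 0" by simp
    define u where "u = sqrt s"
    have u: "u > 0" "u \<le> 1" "s = u\<^sup>2" using s0 s by (auto simp: u_def)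
    have "u \<ge> 3/8" unfolding u_def using True by (intro real_le_rsqrt) (simp add: power2_eq_square)
    then have "1 / u \<le> 8/3" using u by (simp add: pos_divide_le_eq)
    have "- ln s \<le> (1 - s) / u" using ln_le_diff_sqrt[OF s0 s(2)] by (simp add: u_def)
    also have "\<dots> = (1 - s) * (1 / u)" by simp
    also have "\<dots> \<le> (1 - s) * (2 * L)" using \<open>1 / u \<le> 8/3\<close> L s by (intro mult_left_mono) auto
    finally have "2 * L * s \<le> 2 * L + ln s" by (simp add: algebra_simps)
    also have "\<dots> = ln (r\<^sup>2 * s)" using s0 r by (simp add: L_def ln_mult ln_realpow)
    also have "\<dots> \<le> ln (max (1 + C * s) (r\<^sup>2 * s))"
    proof -
      have "0 < r\<^sup>2 * s" using s0 r by simp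
      then show ?thesis by (subst ln_le_cancel_iff) auto
    qed
    finally show ?thesis unfolding L_def C_def .
  next
    case s2: False
    have conc: "5 * s * ln (1 + C/5) \<le> ln (1 + C * s)"
    proof -
      have "concave_on {0<..} (ln :: real \<Rightarrow> real)" by (rule ln_concave)
      from concave_onD[OF this, of "5 * s" 1 "1 + C/5"]
      show ?thesis using s s2 C by (simp add: algebra_simps)
    qed
    have "L * (2/5) \<le> ln (1 + C/5)"
    proof -
      have "concave_on {0<..} (ln :: real \<Rightarrow> real)" by (rule ln_concave)
      from concave_onD[OF this, of "4/7" 1 "r\<^sup>2/16"] r
      have "4/7 * ln (r\<^sup>2/16) \<le> ln (3/7 + r\<^sup>2/28)" by (simp add: algebra_simps)
      moreover have "ln (r\<^sup>2/16) = 2 * (L - ln 4)"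
      proof -
        have "r\<^sup>2/16 = (r/4)^2" by (simp add: power_divide)
        then show ?thesis using r by (simp add: ln_realpow ln_div L_def)
      qed
      moreover have "ln (1 + C/5) = ln (28/15) + ln (3/7 + r\<^sup>2/28)"
      proof -
        have "1 + C/5 = 28/15 * (3/7 + r\<^sup>2/28)" by (simp add: C_def field_simps)
        moreover have "3/7 + r\<^sup>2/28 > 0" by (intro add_pos_nonneg) auto
        ultimately show ?thesis by (simp only: ln_mult_pos zero_less_divide_iff zero_less_numeral simp_thms)
      qed
      moreover have "4 * ln 2 \<le> 5 * ln (28/15::real)"
      proof -
        have "ln ((2::real)^4) \<le> ln ((28/15)^5)" by (subst ln_le_cancel_iff) (auto simp: power_divide)
        then show ?thesis by (simp only: ln_realpow)
      qed
      moreover have "L * (2/5) \<le> D" if "4/7 * A \<le> B" "A = 2 * (L - 2 * l)" "D = E + B" "4 * l \<le> 5 * E" "2 * l \<le> L"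
        for A B D E l :: real using that by (simp add: field_simps)
      ultimately show ?thesis using \<open>L \<ge> ln 4\<close> unfolding l4 by blast
    qed
    then have "2 * L * s \<le> 5 * s * ln (1 + C/5)" using s mult_right_mono[of "L * (2/5)" "ln (1 + C/5)" "5 * s"] by (simp add: algebra_simps)
    also note conc
    also have "ln (1 + C * s) \<le> ln (max (1 + C * s) (r\<^sup>2 * s))" using Cs by simp
    finally show ?thesis unfolding L_def C_def .
  qed
qed

section \<open>Bounds for products of Dirichlet kernels\<close>

lemma sin_ge_cubic: fixes x :: real assumes "0 \<le> x" shows "x - x^3/6 \<le> sin x"
proof -
  have "\<bar>sin x - (\<Sum>m<3. sin_coeff m * x ^ m)\<bar> \<le> inverse (fact 3) * \<bar>x\<bar> ^ 3"
    by (rule Maclaurin_sin_bound)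
  moreover have "(\<Sum>m<3. sin_coeff m * x ^ m) = x"
    by (simp add: eval_nat_numeral sin_coeff_def)
  ultimately have "\<bar>sin x - x\<bar> \<le> x^3/6" using assms by (simp add: fact_numeral)
  then show ?thesis by linarith
qed

lemma sqrt_power_square: "x \<ge> 0 \<Longrightarrow> (sqrt x ^ n)\<^sup>2 = x ^ n"
  by (metis mult.commute power_mult real_sqrt_pow2)

lemma dk_max_bound:
  assumes "r > 0" and s: "s = (sin b)\<^sup>2"
  shows "(dk r b / real r)\<^sup>2 * max (1 + ((real r)\<^sup>2/3 - 1) * s) ((real r)\<^sup>2 * s) \<le> 1"
proof -
  have 1: "(dk r b / real r)\<^sup>2 * (1 + ((real r)\<^sup>2/3 - 1) * s) \<le> 1"
    using dk_sq_bound[OF assms(1), of b] assms by (simp add: power_divide field_simps)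
  have "(\<bar>dk r b\<bar> * \<bar>sin b\<bar>)\<^sup>2 \<le> 1\<^sup>2" using abs_dk_sin_le[of r b] by (intro power_mono) auto
  then have 2: "(dk r b / real r)\<^sup>2 * ((real r)\<^sup>2 * s) \<le> 1"
    using assms by (simp add: power_divide power_mult_distrib)
  show ?thesis using 1 2 by (simp add: max_def)
qed

lemma abs_le_of_ln_bound:
  fixes g m e :: real assumes "g\<^sup>2 * m \<le> 1" "2 * e \<le> ln m" "m > 0" shows "\<bar>g\<bar> \<le> exp (- e)"
proof (cases "g = 0")
  case False
  have "g\<^sup>2 \<le> 1 / m" using assms by (simp add: pos_le_divide_eq)
  also have "\<dots> = exp (- ln m)" using assms by (simp add: exp_minus inverse_eq_divide)
  also have "\<dots> \<le> exp (- e) ^ 2" using assms by (simp flip: exp_of_nat_mult)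
  finally show ?thesis by (metis abs_exp_cancel abs_le_square_iff)
qed simp

lemma dk_large:
  assumes "r \<ge> 8" and s: "s = (sin b)\<^sup>2"
  shows "\<bar>dk r b\<bar> \<le> real r * exp (- (ln (real r) * (s + 3/4 * s * (1 - s))))"
proof -
  have s01: "0 \<le> s" "s \<le> 1" by (auto simp: s abs_square_le_1)
  have C: "(real r)\<^sup>2/3 - 1 \<ge> 0" using power_mono[of 8 "real r" 2] assms by simp
  have "\<bar>dk r b / real r\<bar> \<le> exp (- (ln (real r) * (s + 3/4 * s * (1 - s))))"
    using large_r_exponent[of "real r" s] s01 C assms
    by (intro abs_le_of_ln_bound[OF dk_max_bound[OF _ s]])
       (auto simp: less_max_iff_disj intro!: disjI1 add_pos_nonneg mult_nonneg_nonneg)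
  then show ?thesis using assms by (simp add: abs_divide field_simps)
qed

lemma dk_3: "dk 3 b = 3 - 4 * (sin b)\<^sup>2"
proof -
  have "dk 3 b = cos (2*b) + 1 + cos (2*b)" by (simp add: dk_def eval_nat_numeral)
  then show ?thesis by (simp add: cos_double_sin)
qed

lemma dk_2: "dk 2 b = 2 * cos b"
  by (simp add: dk_def eval_nat_numeral)

lemma dk_small:
  assumes "r \<ge> 3" and s: "s = (sin b)\<^sup>2"
  shows "\<bar>dk r b\<bar> \<le> real r * exp (- (ln (real r) * s))"
proof -
  have s01: "0 \<le> s" "s \<le> 1" by (auto simp: s abs_square_le_1)
  show ?thesis
  proof (cases "r \<ge> 4")
    case True
    have C: "(real r)\<^sup>2/3 - 1 \<ge> 0" using power_mono[of 4 "real r" 2] True by simp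
    have "\<bar>dk r b / real r\<bar> \<le> exp (- (ln (real r) * s))"
      using small_r_exponent[of "real r" s] s01 C True
      by (intro abs_le_of_ln_bound[OF dk_max_bound[OF _ s]])
         (auto simp: less_max_iff_disj mult.assoc intro!: disjI1 add_pos_nonneg mult_nonneg_nonneg)
    then show ?thesis using True by (simp add: abs_divide field_simps)
  next
    case False
    then have r: "r = 3" using assms by simp
    have l3: "0 \<le> ln (3::real)" "ln (3::real) \<le> 4/3"
    proof -
      have "ln (27::real) \<le> ln 32" by (subst ln_le_cancel_iff) auto
      moreover have "ln (27::real) = 3 * ln 3" "ln (32::real) = 5 * ln 2" using ln_realpow[of 3 3] ln_realpow[of 2 5] by simp_all
      ultimately have "3 * ln (3::real) \<le> 5 * ln 2" by linarith
      then show "ln (3::real) \<le> 4/3" using ln2_le_25_over_36 by linarith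
    qed simp
    show ?thesis
    proof (cases "s \<le> 3/4")
      case True
      have "\<bar>dk r b\<bar> = 3 * (1 + - (4/3 * s))" using True by (simp add: r dk_3 s)
      also have "\<dots> \<le> 3 * exp (- ((4/3) * s))" by (intro mult_left_mono exp_ge_add_one_self) auto
      also have "\<dots> \<le> 3 * exp (- (ln 3 * s))" using mult_right_mono[OF l3(2) s01(1)] by simp
      finally show ?thesis by (simp add: r)
    next
      case False
      have "\<bar>dk r b\<bar> = 4 * s - 3" using False by (simp add: r dk_3 s)
      also have "\<dots> \<le> 1" using s01 by simp
      also have "1 \<le> 3 * exp (- (ln (3::real) * s))"
      proof -
        have "ln 3 * s \<le> ln (3::real) * 1" using s01 l3 by (intro mult_left_mono) auto
        then have "exp (- ln (3::real)) \<le> exp (- (ln 3 * s))" by simp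
        then show ?thesis by (simp add: exp_minus)
      qed
      finally show ?thesis by (simp add: r)
    qed
  qed
qed

text \<open>The exponent that governs the size of the product of kernels at \<open>a\<close>.\<close>

definition SS :: "nat \<Rightarrow> real \<Rightarrow> real" where "SS n a = (\<Sum>k=1..n. (sin (real k * a))\<^sup>2)"

lemma SS_nonneg: "SS n a \<ge> 0" by (auto simp: SS_def intro: sum_nonneg)

text \<open>Telescoping of \<open>2 (sin x)\<^sup>2 = 1 - cos (2 x)\<close> after multiplication by \<open>sin a\<close>.\<close>

lemma SS_closed: "4 * (sin a * SS n a) = (2 * real n + 1) * sin a - sin ((2 * real n + 1) * a)"
proof (induction n)
  case (Suc n)
  have "4 * (sin a * (sin (real (Suc n) * a))\<^sup>2) = 2 * sin a - (sin ((2 * real (Suc n) + 1) * a) - sin ((2 * real n + 1) * a))"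
  proof -
    define c where "c = real (Suc n) * a"
    have e: "(2 * real (Suc n) + 1) * a = 2 * c + a" "(2 * real n + 1) * a = 2 * c - a" by (simp_all add: c_def algebra_simps)
    have "sin (2*c + a) - sin (2*c - a) = 2 * (1 - 2 * (sin c)\<^sup>2) * sin a"
      unfolding cos_double_sin[symmetric] by (simp add: sin_add sin_diff)
    then show ?thesis unfolding e c_def[symmetric] by (simp add: algebra_simps)
  qed
  then show ?case using Suc by (simp add: SS_def algebra_simps)
qed (simp add: SS_def)

lemma PP_bound_by_exp:
  assumes "\<And>k. \<bar>dk r (real k * a)\<bar> \<le> real r * exp (- e k)"
  shows "\<bar>PP r n a\<bar> \<le> real r ^ n * exp (- (\<Sum>k=1..n. e k))"
proof -
  have "\<bar>PP r n a\<bar> = (\<Prod>k=1..n. \<bar>dk r (real k * a)\<bar>)" by (simp add: PP_def abs_prod)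
  also have "\<dots> \<le> (\<Prod>k=1..n. real r * exp (- e k))" using assms by (intro prod_mono) auto
  also have "\<dots> = real r ^ n * exp (- (\<Sum>k=1..n. e k))" by (simp add: prod.distrib exp_sum flip: sum_negf)
  finally show ?thesis .
qed

lemma PP_large:
  assumes "r \<ge> 8"
  shows "\<bar>PP r n a\<bar> \<le> real r ^ n * exp (- (ln (real r) * (SS n a + 3/16 * SS n (2 * a))))"
proof -
  have q: "s + 3/4 * s * (1 - s) = (sin b)\<^sup>2 + 3/16 * (sin (2*b))\<^sup>2" if "s = (sin b)\<^sup>2" for s b :: real
    by (simp add: that sin_double power_mult_distrib cos_squared_eq)
  have "(\<Sum>k=1..n. ln (real r) * ((sin (real k * a))\<^sup>2 + 3/16 * (sin (2 * (real k * a)))\<^sup>2))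
     = ln (real r) * (SS n a + 3/16 * SS n (2 * a))"
    by (simp add: SS_def sum_distrib_left sum.distrib algebra_simps)
  moreover have "\<bar>PP r n a\<bar> \<le> real r ^ n * exp (- (\<Sum>k=1..n. ln (real r) * ((sin (real k * a))\<^sup>2 + 3/16 * (sin (2 * (real k * a)))\<^sup>2)))"
    using dk_large[OF assms refl] by (intro PP_bound_by_exp) (simp only: q[OF refl])
  ultimately show ?thesis by simp
qed

lemma PP_small:
  assumes "r \<ge> 3"
  shows "\<bar>PP r n a\<bar> \<le> real r ^ n * exp (- (ln (real r) * SS n a))"
  using PP_bound_by_exp[of r a "\<lambda>k. ln (real r) * (sin (real k * a))\<^sup>2" n] dk_small[OF assms refl]
  by (simp add: SS_def sum_distrib_left)

lemma PP_2:
  assumes "SS n a \<ge> 5/12 * real n"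
  shows "\<bar>PP 2 n a\<bar> \<le> 2 ^ n * sqrt (7/12) ^ n"
proof -
  have c: "(cos b)\<^sup>2 \<le> (7/12 * exp ((5/12 - (sin b)\<^sup>2) / (7/12)))" for b :: real
  proof -
    have "(cos b)\<^sup>2 = 7/12 * (1 + (5/12 - (sin b)\<^sup>2) / (7/12))" by (simp add: cos_squared_eq field_simps)
    also have "\<dots> \<le> 7/12 * exp ((5/12 - (sin b)\<^sup>2) / (7/12))" by (intro mult_left_mono exp_ge_add_one_self) auto
    finally show ?thesis .
  qed
  have "(PP 2 n a / 2 ^ n)\<^sup>2 = (\<Prod>k=1..n. (cos (real k * a))\<^sup>2)"
    by (simp add: PP_def dk_2 prod.distrib prod_power_distrib)
  also have "\<dots> \<le> (\<Prod>k=1..n. 7/12 * exp ((5/12 - (sin (real k * a))\<^sup>2) / (7/12)))"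
    using c by (intro prod_mono) auto
  also have "\<dots> = (7/12) ^ n * exp (\<Sum>k=1..n. (5/12 - (sin (real k * a))\<^sup>2) / (7/12))"
    by (simp only: prod.distrib exp_sum[OF finite_atLeastAtMost] prod_constant card_atLeastAtMost) simp
  also have "(\<Sum>k=1..n. (5/12 - (sin (real k * a))\<^sup>2) / (7/12)) = (5/12 * real n - SS n a) / (7/12)"
    by (simp only: SS_def sum_divide_distrib[symmetric] sum_subtractf) simp
  also have "(7/12) ^ n * exp ((5/12 * real n - SS n a) / (7/12)) \<le> (7/12)^n * 1"
    using assms by (intro mult_left_mono) auto
  also have "(7/12::real)^n * 1 = (sqrt (7/12) ^ n)\<^sup>2" by (simp add: sqrt_power_square)
  finally have "\<bar>PP 2 n a / 2 ^ n\<bar> \<le> \<bar>sqrt (7/12) ^ n\<bar>" by (simp only: abs_le_square_iff)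
  then show ?thesis by (simp add: abs_divide field_simps)
qed

lemma SS_lower:
  assumes "sin a > 0" "sin ((2 * real n + 1) * a) \<le> c * sin a"
  shows "(2 * real n + 1 - c) / 4 \<le> SS n a"
proof -
  have "sin a * (2 * real n + 1 - c) \<le> sin a * (4 * SS n a)"
    using SS_closed[of a n] assms by (simp add: algebra_simps)
  then show ?thesis using assms by simp
qed

lemma sin_small_ge: fixes c :: real assumes "0 \<le> c" "c \<le> 1/22" shows "6.15 * c \<le> sin (2 * pi * c)"
proof -
  define x where "x = 2 * pi * c"
  have "x \<le> 2 * 3.1416 * (1/22)" unfolding x_def using assms pi_approx by (intro mult_mono) auto
  then have x: "0 \<le> x" "x \<le> 0.286" using assms by (auto simp: x_def)
  have "x\<^sup>2 \<le> 0.286\<^sup>2" using x by (intro power_mono) auto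
  then have x2: "x\<^sup>2 \<le> 0.0818" by (simp add: power2_eq_square)
  have "6.15 * c \<le> x * 0.986" unfolding x_def using assms pi_approx mult_right_mono[of "6.15" "2 * pi * 0.986" c] by (simp add: mult_ac)
  also have "\<dots> \<le> x * (1 - x\<^sup>2/6)" using x x2 by (intro mult_left_mono) auto
  also have "\<dots> = x - x^3/6" by (simp add: algebra_simps power3_eq_cube power2_eq_square)
  also have "\<dots> \<le> sin x" using x by (intro sin_ge_cubic)
  finally show ?thesis by (simp add: x_def)
qed

context
  fixes n :: nat and a :: real
  assumes n: "n \<ge> 11" and a: "pi / (2 * real n) \<le> a" "a \<le> pi / 2"
begin

private definition "M = 2 * real n + 1"

private lemma M: "M \<ge> 23" using n by (simp add: M_def)

private lemma a0: "0 < a"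
proof -
  have "0 < pi / (2 * real n)" using n by simp
  then show ?thesis using a(1) by linarith
qed

private lemma sin_a: "0 < sin a" using a0 a(2) by (intro sin_gt_zero) (auto simp: field_simps)

text \<open>By the closed form, the sum is \<open>(2 n + 1) / 4\<close> minus a quarter of a Dirichlet kernel, and that kernel is at most a sixth of its maximum beyond \<open>pi / (2 n)\<close>.\<close>

lemma SS_ge: "5/24 * (2 * real n + 1) \<le> SS n a"
proof -
  have "sin (M * a) \<le> M/6 * sin a"
  proof (cases "M * a \<le> 2 * pi")
    case True
    have "pi \<le> M * (pi / (2 * real n))" using n by (simp add: M_def field_simps)
    also have "\<dots> \<le> M * a" using a M by (intro mult_left_mono) auto
    finally have "sin (M * a) \<le> 0" using True sin_le_zero[of "M * a"] by (cases "M * a = 2 * pi") auto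
    also have "0 \<le> M/6 * sin a" using sin_a M by simp
    finally show ?thesis .
  next
    case False
    have "6.15 * (1/M) \<le> sin (2 * pi * (1/M))" using M by (intro sin_small_ge) (auto simp: field_simps)
    also have "\<dots> \<le> sin a"
    proof (rule sin_monotone_2pi_le)
      have "0 \<le> 2 * pi * (1/M)" using M by simp
      then show "- (pi/2) \<le> 2 * pi * (1/M)" using pi_ge_zero by linarith
    qed (use a False M in \<open>auto simp: field_simps\<close>)
    finally have "M * (6.15 * (1/M)) \<le> M * sin a" using M by (intro mult_left_mono) auto
    then have "1 \<le> M/6 * sin a" using M by simp
    then show ?thesis using sin_le_one[of "M * a"] by linarith
  qed
  then have "(M - M/6)/4 \<le> SS n a" using SS_lower[OF sin_a, of n "M/6"] by (simp add: M_def)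
  then show ?thesis by (simp add: M_def field_simps)
qed

text \<open>The same idea applied to the exponent with the quadratic correction, whose second term is a sum of squared sines at the doubled angle.\<close>

lemma SS_ge2: "19/80 * (2 * real n + 1) \<le> SS n a + 3/16 * SS n (2 * a)"
proof (cases "a \<le> pi/2 - pi / (2 * real n)")
  case True
  have c: "6.15 * (1 / (2 * real n)) \<le> sin (2 * pi * (1 / (2 * real n)))" using n by (intro sin_small_ge) (auto simp: field_simps)
  have n0: "- (pi/2) \<le> 2 * pi * (1 / (2 * real n))"
  proof -
    have "0 \<le> 2 * pi * (1 / (2 * real n))" by simp
    then show ?thesis using pi_ge_zero by linarith
  qed
  have s: "sin (2 * pi * (1 / (2 * real n))) \<le> sin (2 * a)"
  proof (cases "2 * a \<le> pi/2")
    case True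
    then show ?thesis using a a0 n n0 by (intro sin_monotone_2pi_le) (auto simp: field_simps)
  next
    case F: False
    have "sin (2 * pi * (1 / (2 * real n))) \<le> sin (pi - 2 * a)"
      using F True n n0 by (intro sin_monotone_2pi_le) (auto simp: field_simps)
    then show ?thesis by simp
  qed
  have "1 \<le> M/6 * (6.15 * (1 / (2 * real n)))" using n by (simp add: M_def field_simps)
  also have "\<dots> \<le> M/6 * sin (2 * a)" using c s M by (intro mult_left_mono) auto
  finally have "sin (M * (2 * a)) \<le> M/6 * sin (2 * a)" using sin_le_one[of "M * (2 * a)"] by linarith
  moreover have "sin (2 * a) > 0" 
  proof -
    have "0 < 6.15 * (1 / (2 * real n))" using n by simp
    then show ?thesis using c s by linarith
  qed
  ultimately have "(M - M/6)/4 \<le> SS n (2 * a)" using SS_lower[of "2 * a" n "M/6"] by (simp add: M_def)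
  then have "5/24 * (2 * real n + 1) \<le> SS n (2 * a)" by (simp add: M_def field_simps)
  then show ?thesis using SS_ge of_nat_0_le_iff[of n] by (simp add: field_simps)
next
  case False
  define t where "t = pi/2 - a"
  have t: "0 \<le> t" "t \<le> pi / (2 * real n)" using False a by (auto simp: t_def)
  have "pi / (2 * real n) \<le> 3.1416 / (2 * 11)" using n pi_approx by (intro frac_le) auto
  then have "t\<^sup>2 \<le> 0.143\<^sup>2" using t by (intro power_mono) auto
  have "1 - t\<^sup>2/2 \<le> cos t"
  proof -
    have "(sin (t/2))\<^sup>2 \<le> (t/2)\<^sup>2" using abs_sin_x_le_abs_x[of "t/2"] by (simp only: abs_le_square_iff)
    moreover have "cos t = 1 - 2 * (sin (t/2))\<^sup>2" using cos_double_sin[of "t/2"] by simp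
    ultimately show ?thesis by (simp add: power_divide)
  qed
  moreover have "cos t = sin a" by (simp add: t_def cos_sin_eq[symmetric] sin_cos_eq)
  moreover have "(0.143::real)\<^sup>2 \<le> 0.03" by (simp add: power2_eq_square)
  ultimately have ct: "sin a \<ge> 49/50" using \<open>t\<^sup>2 \<le> 0.143\<^sup>2\<close> by simp
  then have "sin (M * a) \<le> 103/100 * sin a" using sin_le_one[of "M * a"] by linarith
  then have "(2 * real n + 1 - 103/100) / 4 \<le> SS n a" using SS_lower[OF sin_a, of n "103/100"] by (simp add: M_def)
  then show ?thesis using SS_nonneg[of n "2*a"] n by simp
qed

end

lemma sin_concave_ratio:
  fixes x t :: real assumes "0 \<le> x" "x \<le> pi/2" "0 \<le> t" "t \<le> 1" shows "t * sin x \<le> sin (t * x)"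
proof -
  have "concave_on {0..pi} sin"
    unfolding concave_on_def
    by (rule f''_ge0_imp_convex[where f' = "\<lambda>x. - cos x" and f'' = sin])
       (auto intro!: derivative_eq_intros sin_ge_zero)
  from concave_onD[OF this, of t 0 x] show ?thesis using assms by (simp add: mult.commute)
qed

text \<open>The last \<open>j\<close> kernels are bounded by reciprocal sines, which concavity compares with \<open>sin (n a)\<close> at the cost of \<open>k / n\<close>; the others are at most \<open>r\<close>. Pairing \<open>k\<close> with its reflection inside this upper half shows that the product of the ratios \<open>k / n\<close> is at least \<open>2 powr (- j / 2)\<close>.\<close>

lemma PP_near_zero:
  assumes "r > 0" and j: "n \<le> 2 * j" "2 * j \<le> n + 1" "n > 0" and a: "0 < real n * a" "real n * a \<le> pi / 2"
  shows "\<bar>PP r n a\<bar> \<le> real r ^ n * (sqrt 2 / (real r * sin (real n * a))) ^ j"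
proof -
  define S where "S = sin (real n * a)"
  have S: "S > 0" unfolding S_def using a by (intro sin_gt_zero) (auto simp: field_simps)
  define T where "T = {n + 1 - j..n}"
  have jn: "j \<le> n" using j by linarith
  have cardT: "card T = j" using jn by (simp add: T_def)
  have T1: "T \<subseteq> {1..n}" using jn by (auto simp: T_def)
  define q where "q = (\<Prod>k\<in>T. real k / real n)"
  have q0: "q > 0" unfolding q_def using T1 j(3) by (intro prod_pos) (auto intro!: divide_pos_pos dest!: subsetD)
  have "q = (\<Prod>k\<in>T. real (2 * n + 1 - j - k) / real n)"
    unfolding q_def
    by (rule prod.reindex_bij_witness[of _ "\<lambda>k. 2 * n + 1 - j - k" "\<lambda>k. 2 * n + 1 - j - k"])
       (use jn in \<open>auto simp: T_def\<close>)
  then have "q\<^sup>2 = (\<Prod>k\<in>T. real k / real n) * (\<Prod>k\<in>T. real (2 * n + 1 - j - k) / real n)"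
    by (simp add: power2_eq_square q_def)
  also have "\<dots> = (\<Prod>k\<in>T. (real k * real (2 * n + 1 - j - k)) / (real n)\<^sup>2)"
    by (simp add: prod.distrib[symmetric] power2_eq_square)
  also have "\<dots> \<ge> (\<Prod>k\<in>T. 1/2)"
  proof (intro prod_mono conjI)
    fix k assume k: "k \<in> T"
    then have "real (2 * n + 1 - j - k) = 2 * real n + 1 - real j - real k" using jn by (auto simp: T_def of_nat_diff)
    moreover have "0 \<le> (real n - real k) * (real k - (real n + 1 - real j))"
      using k jn by (intro mult_nonneg_nonneg) (auto simp: T_def of_nat_diff)
    moreover have "(real n)\<^sup>2 / 2 \<le> real n * (real n + 1 - real j)"
    proof -
      have "real n / 2 \<le> real n + 1 - real j" using j by linarith
      from mult_left_mono[OF this, of "real n"] show ?thesis by (simp add: power2_eq_square)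
    qed
    ultimately have "(real n)\<^sup>2 / 2 \<le> real k * real (2 * n + 1 - j - k)" by (simp add: algebra_simps power2_eq_square)
    then show "1/2 \<le> (real k * real (2 * n + 1 - j - k)) / (real n)\<^sup>2" using j(3) by (simp add: pos_le_divide_eq)
  qed simp
  finally have "(1/2)^j \<le> q\<^sup>2" by (simp add: cardT)
  then have "(sqrt (1/2) ^ j)\<^sup>2 \<le> q\<^sup>2" by (subst sqrt_power_square) auto
  then have q: "sqrt (1/2) ^ j \<le> q" by (rule power2_le_imp_le) (use q0 in auto)
  have k: "\<bar>dk r (real k * a)\<bar> \<le> 1 / (S * (real k / real n))" if "k \<in> T" for k
  proof -
    have k: "0 < k" "k \<le> n" using that T1 by auto
    have "real k / real n * S \<le> sin (real k / real n * (real n * a))"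
      unfolding S_def using a k by (intro sin_concave_ratio) auto
    also have "\<dots> = sin (real k * a)" using j by simp
    finally have le: "S * (real k / real n) \<le> sin (real k * a)" by (simp add: mult.commute)
    have pos: "0 < S * (real k / real n)" using S k j by simp
    have "\<bar>dk r (real k * a)\<bar> * (S * (real k / real n)) \<le> \<bar>dk r (real k * a)\<bar> * \<bar>sin (real k * a)\<bar>"
      using le pos by (intro mult_left_mono) auto
    also have "\<dots> \<le> 1" by (rule abs_dk_sin_le)
    finally show ?thesis using pos by (subst pos_le_divide_eq)
  qed
  have "\<bar>PP r n a\<bar> = (\<Prod>k\<in>{1..n} - T. \<bar>dk r (real k * a)\<bar>) * (\<Prod>k\<in>T. \<bar>dk r (real k * a)\<bar>)"
    unfolding PP_def abs_prod by (rule prod.subset_diff) (use T1 in auto)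
  also have "\<dots> \<le> (\<Prod>k\<in>{1..n} - T. real r) * (\<Prod>k\<in>T. 1 / (S * (real k / real n)))"
    using k abs_dk_le by (intro mult_mono prod_mono prod_nonneg) auto
  also have "(\<Prod>k\<in>{1..n} - T. real r) = real r ^ (n - j)"
    using T1 by (simp add: card_Diff_subset cardT finite_subset)
  also have "(\<Prod>k\<in>T. 1 / (S * (real k / real n))) = 1 / (S ^ j * q)"
    by (simp only: prod_dividef prod.distrib q_def) (simp add: cardT)
  also have "1 / (S ^ j * q) \<le> 1 / (S ^ j * sqrt (1/2) ^ j)"
    using S q q0 by (intro divide_left_mono mult_left_mono) auto
  also have "real r ^ (n - j) * (1 / (S ^ j * sqrt (1/2) ^ j)) = real r ^ n * (sqrt 2 / (real r * S)) ^ j"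
  proof -
    have "real r ^ n = real r ^ (n - j) * real r ^ j" using jn by (simp flip: power_add)
    moreover have "sqrt 2 * sqrt (1/2) = (1::real)" by (simp flip: real_sqrt_mult)
    then have "sqrt 2 ^ j * sqrt (1/2) ^ j = (1::real)" by (simp flip: power_mult_distrib)
    ultimately show ?thesis using assms(1) S by (simp add: power_divide power_mult_distrib field_simps)
  qed
  finally show ?thesis using S by (simp add: S_def mult_left_mono)
qed

section \<open>Main lobe against the remaining arc\<close>

text \<open>A Gaussian minorant of the sine. Applied to every factor it bounds the product over \<open>k\<close> below by a single Gaussian.\<close>

lemma sin_ge_gauss:
  fixes x :: real assumes x: "0 \<le> x" "x \<le> 2" shows "x * exp (- (x\<^sup>2 / 5)) \<le> sin x"
proof -
  define y where "y = x\<^sup>2"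
  have "x\<^sup>2 \<le> 2\<^sup>2" using x by (intro power_mono) auto
  then have y: "0 \<le> y" "y \<le> 4" by (auto simp: y_def)
  define e where "e = 1 + y/5 + (y/5)^2/2 + (y/5)^3/6 + (y/5)^4/24"
  define s where "s = 1 - y/6 + y^2/120 - y^3/5040"
  have e1: "e \<le> exp (y/5)"
  proof -
    obtain t where "exp (y/5) = (\<Sum>m<5. (y/5) ^ m / fact m) + (exp t / fact 5) * (y/5) ^ 5"
      using Maclaurin_exp_le[of "y/5" 5] by blast
    moreover have "0 \<le> (exp t / fact 5) * (y/5) ^ 5" using y by simp
    moreover have "(\<Sum>m<5. f m) = f 0 + f 1 + f 2 + f 3 + f 4" for f :: "nat \<Rightarrow> real"
      by (simp add: eval_nat_numeral)
    ultimately show ?thesis by (simp add: e_def fact_numeral)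
  qed
  have e0: "e > 0" unfolding e_def using y by (intro add_pos_nonneg) auto
  have "1 \<le> s * e"
  proof -
    define z where "z = 1 - y/4"
    define u where "u = y/4"
    have uz: "u \<ge> 0" "z \<ge> 0" "y = 4 * u" "z = 1 - u" using y by (auto simp: u_def z_def)
    have "s * e - 1 = y * (1/30 * u^0 * z^6 + 9/50 * u^1 * z^5 + 3083/7875 * u^2 * z^4 + 16963/39375 * u^3 * z^3 + 19093/78750 * u^4 * z^2 + 69397/1181250 * u^5 * z^1 + 146/65625 * u^6 * z^0)"
      unfolding s_def e_def uz(4) uz(3) by (simp add: field_simps eval_nat_numeral)
    also have "\<dots> \<ge> 0" using uz(1,2) y(1) by (intro mult_nonneg_nonneg add_nonneg_nonneg) auto
    finally show ?thesis by simp
  qed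
  have "exp (- (y/5)) \<le> s"
  proof -
    have "exp (- (y/5)) = 1 / exp (y/5)" by (simp add: exp_minus inverse_eq_divide)
    also have "\<dots> \<le> 1 / e" using e1 e0 by (intro divide_left_mono) auto
    also have "\<dots> \<le> s" using \<open>1 \<le> s * e\<close> e0 by (simp add: pos_divide_le_eq)
    finally show ?thesis .
  qed
  then have "x * exp (- (y/5)) \<le> x * s" using x by (intro mult_left_mono) auto
  also have "\<dots> = x - x^3/6 + x^5/120 - x^7/5040"
    by (simp add: s_def y_def field_simps eval_nat_numeral)
  also have "\<dots> \<le> sin x"
  proof -
    have "\<bar>sin x - (\<Sum>m<7. sin_coeff m * x ^ m)\<bar> \<le> inverse (fact 7) * \<bar>x\<bar> ^ 7"
      by (rule Maclaurin_sin_bound)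
    moreover have "(\<Sum>m<7. f m) = f 0 + f 1 + f 2 + f 3 + f 4 + f 5 + f 6" for f :: "nat \<Rightarrow> real"
      by (simp add: eval_nat_numeral)
    ultimately have "\<bar>sin x - (x - x^3/6 + x^5/120)\<bar> \<le> x^7/5040" using x by (simp add: fact_numeral sin_coeff_def)
    then show ?thesis by linarith
  qed
  finally show ?thesis by (simp add: y_def)
qed

text \<open>A primitive of \<open>t\<^sup>2 (1 - t\<^sup>2/8) ^ 8\<close>, a polynomial minorant of \<open>t\<^sup>2 exp (- t\<^sup>2)\<close> for \<open>t \<le> 2\<close>; it makes the Gaussian moment rational.\<close>

definition gprim :: "real \<Rightarrow> real" where
  "gprim t = t^3/3 - t^5/5 + t^7/16 - t^9/(9*64/7) + 35/(11*2048)*t^11 - 7/(13*4096)*t^13 + 7/(15*65536)*t^15 - t^17/(17*262144) + t^19/(19*16777216)"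

lemma gprim_deriv: "(gprim has_real_derivative (t\<^sup>2 * (1 - t\<^sup>2/8)^8)) (at t)"
  unfolding gprim_def
  by (rule derivative_eq_intros refl | simp)+ (simp add: field_simps eval_nat_numeral)

lemma gprim_2: "gprim 2 \<ge> 0.354" by (simp add: gprim_def power_divide)
lemma gprim_0: "gprim 0 = 0" by (simp add: gprim_def)

lemma gauss_moment:
  fixes c :: real assumes c: "c > 0"
  shows "((\<lambda>a. a\<^sup>2 * (1 - (c * a)\<^sup>2/8)^8) has_integral (gprim 2 / c^3)) {0..2/c}"
proof -
  have "((\<lambda>a. a\<^sup>2 * (1 - (c * a)\<^sup>2/8)^8) has_integral (gprim (c * (2/c)) / c^3 - gprim (c * 0) / c^3)) {0..2/c}"
  proof (rule fundamental_theorem_of_calculus)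
    fix a assume "a \<in> {0..2/c}"
    have "((\<lambda>a. gprim (c * a) / c^3) has_real_derivative ((c * a)\<^sup>2 * (1 - (c * a)\<^sup>2/8)^8 * c / c^3)) (at a)"
      by (intro DERIV_cdivide DERIV_chain2[OF gprim_deriv]) (auto intro!: derivative_eq_intros)
    then show "((\<lambda>a. gprim (c * a) / c^3) has_vector_derivative a\<^sup>2 * (1 - (c * a)\<^sup>2/8)^8) (at a within {0..2/c})"
      using c by (simp add: has_real_derivative_iff_has_vector_derivative[symmetric] has_field_derivative_at_within power_mult_distrib power2_eq_square power3_eq_cube field_simps)
  qed (use c in auto)
  then show ?thesis using c by (simp add: gprim_0)
qed

lemma sum_squares: "6 * (\<Sum>k=1..n. (real k)\<^sup>2) = real n * (real n + 1) * (2 * real n + 1)"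
  by (induction n) (auto simp: algebra_simps power2_eq_square)

lemma dk_gauss:
  assumes "r > 0" "0 \<le> b" "real r * b \<le> 2"
  shows "real r * exp (- ((real r * b)\<^sup>2 / 5)) \<le> dk r b"
proof (cases "b = 0")
  case False
  have "b \<le> real r * b" using assms by (cases r) (auto simp: algebra_simps)
  then have b: "0 < b" "b \<le> 2" using False assms by linarith+
  have sb: "0 < sin b" using b pi_gt3 by (intro sin_gt_zero) auto
  have "real r * exp (- ((real r * b)\<^sup>2 / 5)) * sin b \<le> real r * exp (- ((real r * b)\<^sup>2 / 5)) * b"
    using b by (intro mult_left_mono sin_x_le_x) auto
  also have "\<dots> = real r * b * exp (- ((real r * b)\<^sup>2 / 5))" by simp
  also have "\<dots> \<le> sin (real r * b)" using assms by (intro sin_ge_gauss) auto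
  also have "\<dots> = dk r b * sin b" by (simp add: dk_sin)
  finally show ?thesis using sb by simp
qed (simp add: dk_def)

text \<open>All sines are positive here and have Gaussian minorants, so the integral is at least \<open>X\<close> times a second Gaussian moment.\<close>

lemma main_lobe:
  fixes X :: real
  assumes n: "n \<ge> 11" and r: "r \<ge> 2" and X: "0 \<le> X" "X \<le> real r * real n"
  shows "real r ^ n * X * (75 / ((real n + 5)\<^sup>2 * (real r * real n)^3))
    \<le> integral {0..pi/(real r * real n)} (\<lambda>a. PP r n a * sin (X * a) * sin a)"
proof -
  let ?f = "\<lambda>a. PP r n a * sin (X * a) * sin a"
  define Q where "Q = (\<Sum>k=1..n. (real k)\<^sup>2) + (real n)\<^sup>2"
  define A where "A = (real r)\<^sup>2 / 5 * Q"
  define c where "c = sqrt A"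
  define rn where "rn = real r * real n"
  define w where "w = (real n + 5) / 15"
  have rn: "rn \<ge> 22" unfolding rn_def using mult_mono[of 2 "real r" 11 "real n"] n r by simp
  have w: "w \<ge> 1" using n by (simp add: w_def)
  have Q6: "6 * Q = real n * (2 * (real n)\<^sup>2 + 9 * real n + 1)"
    using sum_squares[of n] by (simp add: Q_def algebra_simps power2_eq_square)
  have Qlo: "5 * (real n)\<^sup>2 \<le> Q"
  proof -
    have "30 * real n \<le> 2 * (real n)\<^sup>2 + 9 * real n + 1" 
    proof -
      have "11 * real n \<le> real n * real n" using n by (intro mult_right_mono) auto
      then show ?thesis unfolding power2_eq_square by linarith
    qed
    from mult_left_mono[OF this, of "real n"] show ?thesis using Q6 by (simp add: power2_eq_square)
  qed
  have Qhi: "Q \<le> 5 * (real n)\<^sup>2 * w"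
  proof -
    have "2 * (real n)\<^sup>2 + 9 * real n + 1 \<le> 2 * real n * (real n + 5)" using n by (simp add: power2_eq_square algebra_simps)
    from mult_left_mono[OF this, of "real n"] show ?thesis using Q6 by (simp add: power2_eq_square w_def)
  qed
  have A_lo: "rn\<^sup>2 \<le> A" using mult_left_mono[OF Qlo, of "(real r)\<^sup>2/5"] by (simp add: A_def rn_def power_mult_distrib)
  have A_hi: "A \<le> rn\<^sup>2 * w" using mult_left_mono[OF Qhi, of "(real r)\<^sup>2/5"] by (simp add: A_def rn_def power_mult_distrib mult_ac)
  have A0: "A > 0" using A_lo rn by (smt (verit) zero_less_power)
  have c0: "c > 0" "c\<^sup>2 = A" using A0 by (auto simp: c_def)
  have c_lo: "rn \<le> c" unfolding c_def using A_lo rn by (intro real_le_rsqrt)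
  have c_hi: "c \<le> rn * w"
  proof -
    have "rn\<^sup>2 * w \<le> rn\<^sup>2 * (w * w)" using w by (intro mult_left_mono) auto
    then have "A \<le> (rn * w)\<^sup>2" using A_hi by (simp add: power2_eq_square mult_ac)
    then show ?thesis unfolding c_def using rn w by (intro real_le_lsqrt) auto
  qed
  have c3: "c^3 \<le> rn^3 * w\<^sup>2"
  proof -
    have "c^3 = c\<^sup>2 * c" by (simp add: power3_eq_cube power2_eq_square)
    also have "\<dots> \<le> (rn\<^sup>2 * w) * (rn * w)" using A_hi c_hi c0 rn w by (intro mult_mono) auto
    finally show ?thesis by (simp add: power3_eq_cube power2_eq_square mult_ac)
  qed
  have int: "?f integrable_on {x..y}" for x y
    by (intro integrable_continuous_real continuous_intros)
  have cut: "2/c \<le> pi/rn"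
    using c_lo rn c0 pi_ge_two by (intro frac_le) auto
  have low: "0.99 * real r ^ n * X * (a\<^sup>2 * (1 - (c * a)\<^sup>2/8)^8) \<le> ?f a" if a: "a \<in> {0..2/c}" for a
  proof -
    have ca: "c * a \<le> 2" "0 \<le> a" using a c0 by (auto simp: field_simps)
    have rna: "rn * a \<le> 2" using c_lo ca by (meson mult_right_mono order_trans)
    have "22 * a \<le> rn * a" using rn ca by (intro mult_right_mono) auto
    then have a2: "a \<le> 1/11" using rna by simp
    have P: "real r ^ n * exp (- (\<Sum>k=1..n. (real r * (real k * a))\<^sup>2 / 5)) \<le> PP r n a"
    proof -
      have "real r ^ n * exp (- (\<Sum>k=1..n. (real r * (real k * a))\<^sup>2 / 5)) = (\<Prod>k=1..n. real r * exp (- ((real r * (real k * a))\<^sup>2 / 5)))"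
        by (simp add: prod.distrib exp_sum flip: sum_negf)
      also have "\<dots> \<le> PP r n a" unfolding PP_def
      proof (intro prod_mono conjI dk_gauss)
        fix k assume k: "k \<in> {1..n}"
        have "real r * (real k * a) \<le> rn * a" unfolding rn_def using k ca by (auto intro!: mult_mono simp: mult.assoc)
        then show "real r * (real k * a) \<le> 2" using rna by simp
      qed (use r ca in auto)
      finally show ?thesis .
    qed
    have Xa: "X * a \<le> rn * a" using X ca by (intro mult_right_mono) (auto simp: rn_def)
    have S: "X * a * exp (- ((rn * a)\<^sup>2 / 5)) \<le> sin (X * a)"
    proof -
      have "(X * a)\<^sup>2 \<le> (rn * a)\<^sup>2" using Xa X ca by (intro power_mono) auto
      then have "X * a * exp (- ((rn * a)\<^sup>2 / 5)) \<le> X * a * exp (- ((X * a)\<^sup>2 / 5))"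
        using X ca by (intro mult_left_mono) auto
      also have "\<dots> \<le> sin (X * a)" using X ca Xa rna by (intro sin_ge_gauss) auto
      finally show ?thesis .
    qed
    have s: "0.99 * a \<le> sin a"
    proof -
      have "a\<^sup>2 \<le> (1/11)\<^sup>2" using a2 ca by (intro power_mono) auto
      then have "a * 0.99 \<le> a * (1 - a\<^sup>2/6)" using ca by (intro mult_left_mono) (auto simp: power2_eq_square)
      also have "\<dots> = a - a^3/6" by (simp add: algebra_simps power3_eq_cube power2_eq_square)
      also have "\<dots> \<le> sin a" using ca by (intro sin_ge_cubic)
      finally show ?thesis by simp
    qed
    have E: "(\<Sum>k=1..n. (real r * (real k * a))\<^sup>2 / 5) + (rn * a)\<^sup>2 / 5 = (c * a)\<^sup>2"
      by (simp add: power_mult_distrib c0 A_def Q_def rn_def sum_divide_distrib[symmetric] sum_distrib_left[symmetric] sum_distrib_right[symmetric] algebra_simps)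
    have e: "(1 - (c * a)\<^sup>2/8)^8 \<le> exp (- (c * a)\<^sup>2)"
    proof -
      have "(c * a)\<^sup>2 \<le> 2\<^sup>2" using ca c0 by (intro power_mono) auto
      then show ?thesis using exp_ge_one_minus_x_over_n_power_n[of "(c * a)\<^sup>2" 8] by simp
    qed
    have "0.99 * real r ^ n * X * (a\<^sup>2 * (1 - (c * a)\<^sup>2/8)^8) \<le> 0.99 * real r ^ n * X * (a\<^sup>2 * exp (- (c * a)\<^sup>2))"
      using e X by (intro mult_left_mono) auto
    also have "\<dots> = (real r ^ n * exp (- (\<Sum>k=1..n. (real r * (real k * a))\<^sup>2 / 5))) * (X * a * exp (- ((rn * a)\<^sup>2 / 5))) * (0.99 * a)"
      unfolding E[symmetric] by (simp add: exp_add[symmetric] power2_eq_square mult_ac flip: exp_minus)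
    also have "\<dots> \<le> ?f a"
      using P S s ca X by (intro mult_mono mult_nonneg_nonneg) (auto intro: order_trans[rotated])
    finally show ?thesis .
  qed
  have nonneg: "0 \<le> ?f a" if a: "a \<in> {2/c..pi/rn}" for a
  proof -
    have a0: "0 < a" "rn * a \<le> pi" using a c0 rn by (auto simp: field_simps intro: less_le_trans[of 0 "2/c"])
    have "22 * a \<le> rn * a" using a0 rn by (intro mult_right_mono) auto
    then have "22 * a \<le> pi" using a0(2) by linarith
    then have api: "a \<le> pi/22" by simp
    have "0 \<le> PP r n a" unfolding PP_def
    proof (intro prod_nonneg)
      fix k assume k: "k \<in> {1..n}"
      have 1: "real k * a \<le> real n * a" using k a0 by (intro mult_right_mono) auto
      have "2 * (real n * a) \<le> real r * (real n * a)" using r a0 by (intro mult_right_mono) auto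
      then have 2: "2 * (real n * a) \<le> rn * a" by (simp add: rn_def mult.assoc)
      have 3: "real r * (real k * a) \<le> rn * a" unfolding rn_def using k a0 by (auto intro!: mult_mono simp: mult.assoc)
      have "real k * a < pi" using 1 2 a0(2) pi_gt_zero by linarith
      then have "0 < sin (real k * a)" using a0 k by (intro sin_gt_zero) auto
      moreover have "0 \<le> dk r (real k * a) * sin (real k * a)" unfolding dk_sin
        using order_trans[OF 3 a0(2)] a0(1) by (intro sin_ge_zero) auto
      ultimately show "0 \<le> dk r (real k * a)" by (simp add: zero_le_mult_iff)
    qed
    moreover have "X * a \<le> rn * a" using X a0 by (intro mult_right_mono) (auto simp: rn_def)
    then have "X * a \<le> pi" using a0(2) by linarith
    then have "0 \<le> sin (X * a)" using X a0 by (intro sin_ge_zero) auto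
    moreover have "0 \<le> sin a" using a0 api by (intro sin_ge_zero) auto
    ultimately show ?thesis by simp
  qed
  have "real r ^ n * X * (75 / ((real n + 5)\<^sup>2 * rn^3)) \<le> 0.99 * real r ^ n * X * (gprim 2 / c^3)"
  proof -
    have "75 / ((real n + 5)\<^sup>2 * rn^3) = (1/3) / (rn^3 * w\<^sup>2)" by (simp add: w_def power_divide)
    also have "\<dots> \<le> (0.99 * gprim 2) / c^3"
      using c3 c0 gprim_2 by (intro frac_le) auto
    finally have "real r ^ n * X * (75 / ((real n + 5)\<^sup>2 * rn^3)) \<le> real r ^ n * X * ((0.99 * gprim 2) / c^3)"
      using X by (intro mult_left_mono) auto
    then show ?thesis by (simp add: mult_ac)
  qed
  also have "\<dots> \<le> integral {0..2/c} ?f"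
  proof (rule has_integral_le[OF has_integral_mult_right[OF gauss_moment[OF c0(1)]] integrable_integral[OF int]])
  qed (use low in auto)
  also have "\<dots> \<le> integral {0..2/c} ?f + integral {2/c..pi/rn} ?f"
    using nonneg int by (auto intro!: integral_nonneg)
  also have "\<dots> = integral {0..pi/rn} ?f"
    by (rule Henstock_Kurzweil_Integration.integral_combine) (use cut c0 int in auto)
  finally show ?thesis by (simp add: rn_def)
qed


text \<open>The estimates \<open>\<bar>sin (X a)\<bar> \<le> X a\<close> near \<open>0\<close> and \<open>\<bar>sin (X a)\<bar> \<le> 1 \<le> X\<close> further out make both error terms proportional to \<open>X\<close>, like the lower bound for the main lobe. Hence one inequality without \<open>X\<close> suffices.\<close>

lemma half_integral_nonneg:
  fixes X :: real
  assumes n: "n \<ge> 11" and r: "r \<ge> 2" and X: "1 \<le> X" "X \<le> real r * real n"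
    and A: "integral {pi/(real r * real n)..pi/(2 * real n)} (\<lambda>a. \<bar>PP r n a\<bar> * a\<^sup>2) \<le> real r ^ n * EA"
    and B: "\<And>a. a \<in> {pi/(2 * real n)..pi/2} \<Longrightarrow> \<bar>PP r n a\<bar> \<le> real r ^ n * EB"
    and AB: "EA + EB \<le> 75 / ((real n + 5)\<^sup>2 * (real r * real n)^3)"
  shows "0 \<le> integral {0..pi/2} (\<lambda>a. PP r n a * sin (X * a) * sin a)"
proof -
  let ?f = "\<lambda>a. PP r n a * sin (X * a) * sin a"
  let ?x = "pi/(real r * real n)" and ?y = "pi/(2 * real n)"
  have int: "?f integrable_on {x..y}" for x y
    by (intro integrable_continuous_real continuous_intros)
  have ord: "0 \<le> ?x" "?x \<le> ?y" "0 < ?y" using n r by (auto intro!: frac_le)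
  have ord2: "?y \<le> pi/2" using n by (intro divide_left_mono) auto
  note ord = ord ord2
  have 1: "\<bar>integral {?x..?y} ?f\<bar> \<le> real r ^ n * X * EA"
  proof -
    have "norm (integral {?x..?y} ?f) \<le> integral {?x..?y} (\<lambda>a. X * (\<bar>PP r n a\<bar> * a\<^sup>2))"
    proof (rule integral_norm_bound_integral[OF int])
      show "(\<lambda>a. X * (\<bar>PP r n a\<bar> * a\<^sup>2)) integrable_on {?x..?y}"
        by (intro integrable_continuous_real continuous_intros)
      fix a assume "a \<in> {?x..?y}"
      then have a: "0 \<le> a" using order_trans[OF ord(1), of a] by auto
      have "\<bar>sin (X * a)\<bar> * \<bar>sin a\<bar> \<le> \<bar>X * a\<bar> * \<bar>a\<bar>" by (intro mult_mono abs_sin_x_le_abs_x) auto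
      then have "\<bar>sin (X * a)\<bar> * \<bar>sin a\<bar> \<le> X * a\<^sup>2" using X a by (simp add: power2_eq_square mult_ac)
      from mult_left_mono[OF this, of "\<bar>PP r n a\<bar>"]
      show "norm (?f a) \<le> X * (\<bar>PP r n a\<bar> * a\<^sup>2)" by (simp add: abs_mult mult_ac)
    qed
    also have "\<dots> = X * integral {?x..?y} (\<lambda>a. \<bar>PP r n a\<bar> * a\<^sup>2)" by simp
    also have "\<dots> \<le> X * (real r ^ n * EA)" using A X by (intro mult_left_mono) auto
    finally show ?thesis by (simp add: mult_ac)
  qed
  have 2: "\<bar>integral {?y..pi/2} ?f\<bar> \<le> real r ^ n * X * EB"
  proof -
    have sn: "(sin has_integral (- cos (pi/2) - (- cos ?y))) {?y..pi/2}"
      using ord by (intro fundamental_theorem_of_calculus)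
         (auto intro!: derivative_eq_intros simp: has_real_derivative_iff_has_vector_derivative[symmetric])
    have EB: "0 \<le> real r ^ n * EB" using order_trans[OF abs_ge_zero B[of "?y"]] ord by auto
    have "norm (integral {?y..pi/2} ?f) \<le> integral {?y..pi/2} (\<lambda>a. real r ^ n * X * EB * sin a)"
    proof (rule integral_norm_bound_integral[OF int])
      show "(\<lambda>a. real r ^ n * X * EB * sin a) integrable_on {?y..pi/2}"
        by (intro integrable_continuous_real continuous_intros)
      fix a assume a: "a \<in> {?y..pi/2}"
      then have s: "0 \<le> sin a" using ord by (intro sin_ge_zero) auto
      have "\<bar>PP r n a\<bar> * \<bar>sin (X * a)\<bar> \<le> (real r ^ n * EB) * X"
        using B[OF a] EB X by (intro mult_mono) (auto intro: order_trans[OF abs_sin_le_one])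
      from mult_right_mono[OF this s]
      show "norm (?f a) \<le> real r ^ n * X * EB * sin a" using s by (simp add: abs_mult mult_ac)
    qed
    also have "\<dots> = real r ^ n * X * EB * cos ?y" using integral_unique[OF sn] by simp
    also have "\<dots> = X * (real r ^ n * EB) * cos ?y" by (simp add: mult_ac)
    also have "\<dots> \<le> X * (real r ^ n * EB) * 1" using EB X by (intro mult_left_mono) auto
    finally show ?thesis by (simp add: mult_ac)
  qed
  have 3: "real r ^ n * X * (75 / ((real n + 5)\<^sup>2 * (real r * real n)^3)) \<le> integral {0..?x} ?f"
    using main_lobe[OF n r _ X(2)] X(1) by simp
  have "real r ^ n * X * (EA + EB) \<le> real r ^ n * X * (75 / ((real n + 5)\<^sup>2 * (real r * real n)^3))"
    using AB X by (intro mult_left_mono) auto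
  then have 4: "real r ^ n * X * EA + real r ^ n * X * EB \<le> integral {0..?x} ?f" using 3 by (simp add: distrib_left)
  have "integral {0..?x} ?f + integral {?x..?y} ?f = integral {0..?y} ?f"
    by (rule Henstock_Kurzweil_Integration.integral_combine) (use ord int in auto)
  moreover have "integral {0..?y} ?f + integral {?y..pi/2} ?f = integral {0..pi/2} ?f"
    by (rule Henstock_Kurzweil_Integration.integral_combine) (use ord int in auto)
  ultimately show ?thesis using 1 2 4 by linarith
qed

lemma integral_square: "a \<le> b \<Longrightarrow> ((\<lambda>x::real. x\<^sup>2) has_integral (b^3/3 - a^3/3)) {a..b}"
  by (rule fundamental_theorem_of_calculus)
     (auto intro!: derivative_eq_intros simp: has_real_derivative_iff_has_vector_derivative[symmetric])

text \<open>A pointwise bound leaves the integral of \<open>a\<^sup>2\<close>; the constant 1.3 exceeds \<open>pi ^ 3 / 24\<close>.\<close>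

lemma zone_constant:
  assumes n: "n > 0" and xy: "0 \<le> x" "x \<le> y" "y \<le> pi/(2 * real n)" and q: "q \<ge> 0"
    and b: "\<And>a. a \<in> {x..y} \<Longrightarrow> \<bar>PP r n a\<bar> \<le> real r ^ n * q"
  shows "integral {x..y} (\<lambda>a. \<bar>PP r n a\<bar> * a\<^sup>2) \<le> real r ^ n * (q * (1.3 / (real n)^3))"
proof -
  have "integral {x..y} (\<lambda>a. \<bar>PP r n a\<bar> * a\<^sup>2) \<le> real r ^ n * q * (y^3/3 - x^3/3)"
  proof (rule has_integral_le[OF integrable_integral has_integral_mult_right[OF integral_square]])
    show "(\<lambda>a. \<bar>PP r n a\<bar> * a\<^sup>2) integrable_on {x..y}"
      by (intro integrable_continuous_real continuous_intros)
  qed (use b xy in \<open>auto intro!: mult_right_mono\<close>)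
  also have "\<dots> \<le> real r ^ n * q * (1.3 / (real n)^3)"
  proof (rule mult_left_mono)
    have "y^3 \<le> (pi/(2 * real n))^3" using xy by (intro power_mono) auto
    also have "\<dots> = pi^3/8 / (real n)^3" by (simp add: power_divide power_mult_distrib)
    also have "\<dots> \<le> 3.9 / (real n)^3"
    proof (rule divide_right_mono)
      have "pi^3 \<le> 3.1416^3" using pi_approx by (intro power_mono) auto
      then show "pi^3/8 \<le> 3.9" by (simp add: power_divide)
    qed simp
    finally have "y^3 \<le> 3.9 / (real n)^3" .
    moreover have "0 \<le> x^3" using xy by simp
    moreover have "3.9 / (real n)^3 = 3 * (1.3 / (real n)^3)" by simp
    ultimately show "y^3/3 - x^3/3 \<le> 1.3 / (real n)^3" by linarith
  qed (use q in auto)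
  finally show ?thesis by (simp add: mult_ac)
qed

lemma zoneA_small:
  assumes n: "n > 0" and r: "r \<ge> 2" and j: "n \<le> 2 * j" "2 * j \<le> n + 1"
  shows "integral {pi/(real r * real n)..pi/(2 * real n)} (\<lambda>a. \<bar>PP r n a\<bar> * a\<^sup>2)
    \<le> real r ^ n * ((sqrt 2 / (real r * sin (pi / real r))) ^ j * (1.3 / (real n)^3))"
proof (rule zone_constant[OF n])
  have sr: "0 < sin (pi / real r)" using r by (intro sin_gt_zero) (auto simp: field_simps)
  then show "0 \<le> (sqrt 2 / (real r * sin (pi / real r))) ^ j" by simp
  fix a assume a: "a \<in> {pi/(real r * real n)..pi/(2 * real n)}"
  have a1: "pi / real r \<le> real n * a" "real n * a \<le> pi/2" using a n r by (auto simp: field_simps)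
  have "sin (pi / real r) \<le> sin (real n * a)" 
    using a1 by (intro sin_monotone_2pi_le) (auto intro: order_trans[of _ 0])
  then have "(sqrt 2 / (real r * sin (real n * a))) ^ j \<le> (sqrt 2 / (real r * sin (pi / real r))) ^ j"
    using sr r by (intro power_mono divide_left_mono mult_left_mono) (auto intro!: divide_nonneg_nonneg)
  moreover have "0 < real n * a" using a1 r by (meson divide_pos_pos less_le_trans of_nat_0_less_iff pi_gt_zero zero_less_numeral order.strict_trans2)
  ultimately show "\<bar>PP r n a\<bar> \<le> real r ^ n * (sqrt 2 / (real r * sin (pi / real r))) ^ j"
    using PP_near_zero[of r n j a] r j n a1 by (meson mult_left_mono order_trans zero_le_power of_nat_0_le_iff less_le_trans zero_less_numeral)
qed (use n r in \<open>auto intro!: frac_le\<close>)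

text \<open>For large \<open>r\<close> the interval is split where \<open>n a = pi / 6\<close>: below, \<open>sin (n a) \<ge> 3 n a / pi\<close> leaves an elementary power integral; above, the sine is at least one half.\<close>

lemma zoneA_large:
  assumes n: "n > 0" and r: "r \<ge> 6" and j: "n \<le> 2 * j" "2 * j \<le> n + 1" "j \<ge> 4"
  shows "integral {pi/(real r * real n)..pi/(2 * real n)} (\<lambda>a. \<bar>PP r n a\<bar> * a\<^sup>2)
    \<le> real r ^ n * ((sqrt 2 / 3) ^ j * (31.1 / (real j - 3)) / (real r * real n)^3
          + (2 * sqrt 2 / real r) ^ j * (1.3 / (real n)^3))"
proof -
  let ?g = "\<lambda>a. \<bar>PP r n a\<bar> * a\<^sup>2"
  let ?x = "pi/(real r * real n)" and ?m = "pi/(6 * real n)" and ?y = "pi/(2 * real n)"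
  have ord: "0 < ?x" "?x \<le> ?m" "?m \<le> ?y" "0 < ?m" using n r by (auto intro!: frac_le)
  have near: "\<bar>PP r n a\<bar> \<le> real r ^ n * (sqrt 2 / (real r * s)) ^ j"
    if "0 < a" "a \<le> ?y" "0 < s" "s \<le> sin (real n * a)" for a s
  proof -
    have a1: "0 < real n * a" "real n * a \<le> pi/2" using that n by (auto simp: field_simps)
    have "(sqrt 2 / (real r * sin (real n * a))) ^ j \<le> (sqrt 2 / (real r * s)) ^ j"
      using that r by (intro power_mono divide_left_mono mult_left_mono) (auto intro!: divide_nonneg_nonneg)
    then show ?thesis
      using PP_near_zero[of r n j a] r j n a1 by (meson mult_left_mono order_trans zero_le_power of_nat_0_le_iff less_le_trans zero_less_numeral)
  qed
  have int: "?g integrable_on {x..y}" for x y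
    by (intro integrable_continuous_real continuous_intros)
  have 1: "integral {?m..?y} ?g \<le> real r ^ n * ((2 * sqrt 2 / real r) ^ j * (1.3 / (real n)^3))"
  proof (rule zone_constant[OF n])
    fix a assume a: "a \<in> {?m..?y}"
    have "sin (pi/6) \<le> sin (real n * a)" using a n
      by (intro sin_monotone_2pi_le) (auto simp: field_simps)
    then have "\<bar>PP r n a\<bar> \<le> real r ^ n * (sqrt 2 / (real r * (1/2))) ^ j"
      using a ord by (intro near) (auto simp: sin_30)
    then show "\<bar>PP r n a\<bar> \<le> real r ^ n * (2 * sqrt 2 / real r) ^ j" by (simp add: mult.commute)
  qed (use ord in auto)
  define C where "C = (sqrt 2 * pi / (3 * (real r * real n))) ^ j"
  have C0: "C \<ge> 0" by (simp add: C_def)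
  have 2: "integral {?x..?m} ?g \<le> real r ^ n * ((sqrt 2 / 3) ^ j * (31.1 / (real j - 3)) / (real r * real n)^3)"
  proof -
    obtain i where i: "j = i + 4" using j(3) by (metis add.commute le_Suc_ex)
    let ?h = "\<lambda>a::real. real r ^ n * C * (1 / a ^ (i + 2))"
    have "((\<lambda>a. 1 / a ^ (i + 2)) has_integral (- 1 / (real (i + 1) * ?m ^ (i + 1)) - (- 1 / (real (i + 1) * ?x ^ (i + 1))))) {?x..?m}"
    proof (rule fundamental_theorem_of_calculus)
      fix a assume "a \<in> {?x..?m}"
      then have a: "a > 0" using ord by auto
      have "((\<lambda>a. - (1 / real (i + 1)) * inverse a ^ (i + 1)) has_real_derivative (inverse a ^ (i + 2))) (at a)"
      proof -
        have "(inverse has_real_derivative (- (inverse a)\<^sup>2)) (at a)"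
          using a by (auto intro!: derivative_eq_intros simp: power2_eq_square)
        from DERIV_cmult[OF DERIV_power_Suc[OF this, of i], of "- (1 / real (i + 1))"]
        show ?thesis by (simp add: mult.assoc power2_eq_square add.commute)
      qed
      moreover have "- (1 / real (i + 1)) * inverse x ^ (i + 1) = - 1 / (real (i + 1) * x ^ (i + 1))" for x :: real
        by (simp add: divide_inverse power_inverse mult_ac)
      moreover have "inverse a ^ (i + 2) = 1 / a ^ (i + 2)" by (simp add: power_inverse divide_inverse)
      ultimately have "((\<lambda>a. - 1 / (real (i + 1) * a ^ (i + 1))) has_real_derivative (1 / a ^ (i + 2))) (at a)"
        by simp
      then show "((\<lambda>a. - 1 / (real (i + 1) * a ^ (i + 1))) has_vector_derivative 1 / a ^ (i + 2)) (at a within {?x..?m})"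
        by (simp add: has_real_derivative_iff_has_vector_derivative[symmetric] has_field_derivative_at_within)
    qed (use ord in auto)
    then have hi: "(?h has_integral (real r ^ n * C * (- 1 / (real (i + 1) * ?m ^ (i + 1)) - (- 1 / (real (i + 1) * ?x ^ (i + 1)))))) {?x..?m}"
      by (rule has_integral_mult_right)
    have "integral {?x..?m} ?g \<le> real r ^ n * C * (- 1 / (real (i + 1) * ?m ^ (i + 1)) - (- 1 / (real (i + 1) * ?x ^ (i + 1))))"
    proof (rule has_integral_le[OF integrable_integral[OF int] hi])
      fix a assume a: "a \<in> {?x..?m}"
      then have a0: "a > 0" using ord by auto
      define t where "t = real n * a / (pi/6)"
      have t: "0 \<le> t" "t \<le> 1" "t * (pi/6) = real n * a" using a a0 n by (auto simp: t_def field_simps)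
      have "3 / pi * (real n * a) = t * sin (pi/6)" by (simp add: t_def sin_30)
      also have "\<dots> \<le> sin (real n * a)" unfolding t(3)[symmetric] using t by (intro sin_concave_ratio) auto
      finally have "\<bar>PP r n a\<bar> \<le> real r ^ n * (sqrt 2 / (real r * (3 / pi * (real n * a)))) ^ j"
        using a a0 ord n by (intro near) auto
      also have "sqrt 2 / (real r * (3 / pi * (real n * a))) = sqrt 2 * pi / (3 * (real r * real n)) / a"
        using a0 by (simp add: field_simps)
      also have "\<dots> ^ j = C / a ^ j" by (simp add: C_def power_divide power_mult_distrib)
      finally have "\<bar>PP r n a\<bar> * a\<^sup>2 \<le> real r ^ n * (C / a ^ j) * a\<^sup>2" by (intro mult_right_mono) auto
      also have "\<dots> = ?h a" using a0 by (simp add: i field_simps power_add eval_nat_numeral)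
      finally show "?g a \<le> ?h a" .
    qed
    also have "\<dots> \<le> real r ^ n * C * (1 / (real (i + 1) * ?x ^ (i + 1)))"
      using C0 ord by (intro mult_left_mono) (auto intro!: mult_nonneg_nonneg)
    finally have I: "integral {?x..?m} ?g \<le> real r ^ n * (C * (1 / (real (i + 1) * ?x ^ (i + 1))))"
      by (simp only: mult.assoc)
    have "C * (1 / (real (i + 1) * ?x ^ (i + 1))) = (sqrt 2 / 3) ^ j * (pi ^ 3 / real (i + 1)) / (real r * real n)^3"
    proof -
      have "C = (sqrt 2 / 3) ^ j * ?x ^ j" by (simp add: C_def flip: power_mult_distrib)
      moreover have "?x ^ j = ?x ^ (i + 1) * ?x ^ 3" unfolding i by (simp add: eval_nat_numeral)
      moreover have "?x ^ 3 = pi ^ 3 / (real r * real n)^3" by (rule power_divide)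
      ultimately show ?thesis using ord(1) by simp
    qed
    also have "(sqrt 2 / 3) ^ j * (pi ^ 3 / real (i + 1)) / (real r * real n)^3 \<le> (sqrt 2 / 3) ^ j * (31.1 / real (i + 1)) / (real r * real n)^3"
    proof -
      have "pi^3 \<le> 3.1416^3" using pi_approx by (intro power_mono) auto
      then have "pi^3 \<le> 31.1" by (simp add: power_divide)
      then show ?thesis by (intro divide_right_mono mult_left_mono) auto
    qed
    finally have "real r ^ n * (C * (1 / (real (i + 1) * ?x ^ (i + 1))))
        \<le> real r ^ n * ((sqrt 2 / 3) ^ j * (31.1 / real (i + 1)) / (real r * real n)^3)"
      by (intro mult_left_mono) auto
    moreover have "real (i + 1) = real j - 3" by (simp add: i)
    ultimately show ?thesis using I by (simp only: order_trans)
  qed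
  have "integral {?x..?m} ?g + integral {?m..?y} ?g = integral {?x..?y} ?g"
    by (rule Henstock_Kurzweil_Integration.integral_combine) (use ord int in auto)
  then show ?thesis using 1 2 by (simp add: distrib_left)
qed

section \<open>The analytic induction step\<close>

lemma sqrt2_le: "sqrt 2 \<le> 99/70"
  by (rule real_le_lsqrt) (auto simp: power_divide)

text \<open>The analytic form of one induction step: \<open>EA\<close> bounds the arc up to \<open>pi / (2 (n + 1))\<close> in the mean, \<open>EB\<close> bounds the rest pointwise.\<close>

lemma fourier_step:
  assumes n: "n \<ge> 10" and r: "r \<ge> 2" and R: "rising r n"
    and A: "integral {pi/(real r * real (Suc n))..pi/(2 * real (Suc n))} (\<lambda>a. \<bar>PP r (Suc n) a\<bar> * a\<^sup>2) \<le> real r ^ Suc n * EA"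
    and B: "\<And>a. a \<in> {pi/(2 * real (Suc n))..pi/2} \<Longrightarrow> \<bar>PP r (Suc n) a\<bar> \<le> real r ^ Suc n * EB"
    and AB: "(real (Suc n) + 5)\<^sup>2 * ((real r * real (Suc n))^3 * (EA + EB)) \<le> 75"
  shows "rising r (Suc n)"
proof (rule rising_Suc[OF R])
  fix k assume k: "int (top_deg r n) < 2 * k" "2 * k \<le> int (top_deg r (Suc n))"
  define X where "X = int (top_deg r (Suc n)) + 1 - 2 * k"
  have "int (top_deg r (Suc n)) = int (top_deg r n) + int ((r - 1) * Suc n)" by (simp only: top_deg_Suc of_nat_add)
  then have X: "1 \<le> X" "X \<le> int ((r - 1) * Suc n)" using k unfolding X_def by linarith+
  have "(r - 1) * Suc n \<le> r * Suc n" by (intro mult_right_mono) auto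
  then have X2: "X \<le> int (r * Suc n)" using X(2) by linarith
  have Xr: "1 \<le> real_of_int X" "real_of_int X \<le> real r * real (Suc n)"
  proof -
    show "1 \<le> real_of_int X" using X(1) by simp
    have "real_of_int X \<le> real_of_int (int (r * Suc n))" using X2 by (simp only: of_int_le_iff)
    then show "real_of_int X \<le> real r * real (Suc n)" by (simp only: of_int_of_nat_eq of_nat_mult of_int_mult)
  qed
  have "EA + EB \<le> 75 / ((real (Suc n) + 5)\<^sup>2 * (real r * real (Suc n))^3)"
  proof (subst pos_le_divide_eq)
    show "0 < (real (Suc n) + 5)\<^sup>2 * (real r * real (Suc n))^3" using r by (intro mult_pos_pos zero_less_power) auto
    show "(EA + EB) * ((real (Suc n) + 5)\<^sup>2 * (real r * real (Suc n))^3) \<le> 75" using AB by (simp only: mult_ac)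
  qed
  then have "0 \<le> integral {0..pi/2} (\<lambda>a. PP r (Suc n) a * sin (of_int X * a) * sin a)"
    using n r Xr A B by (intro half_integral_nonneg[where EA = EA and EB = EB]) auto
  moreover have "integral {0..pi/2} (\<lambda>a. PP r (Suc n) a * sin (of_int X * a) * sin a) = pi/4 * dif r (Suc n) k"
    by (rule dif_half_integral) (use r X_def in simp_all)
  ultimately have "0 \<le> pi/4 * dif r (Suc n) k" by (simp only:)
  then show "0 \<le> dif r (Suc n) k"
    using mult_pos_neg[of "pi/4" "dif r (Suc n) k"] pi_gt_zero by linarith
qed

text \<open>A polynomial times a geometric sequence decreases once its ratio does, so the numerical conditions below have to be checked at a single index.\<close>

lemma poly_geometric_decreasing:
  fixes f :: "nat \<Rightarrow> real"
  assumes "m \<le> n" "\<And>k. m \<le> k \<Longrightarrow> f (Suc k) * q \<le> f k" "q \<ge> 0"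
  shows "f n * q ^ n \<le> f m * q ^ m"
  using assms(1)
proof (induction n rule: dec_induct)
  case (step k)
  have "f (Suc k) * q ^ Suc k = (f (Suc k) * q) * q ^ k" by simp
  also have "\<dots> \<le> f k * q ^ k" using assms(2)[OF step(1)] assms(3) by (intro mult_right_mono) auto
  finally show ?case using step by simp
qed simp

lemma square_ratio:
  fixes q :: real assumes "j \<ge> 6" "0 \<le> q" "q \<le> 3/5"
  shows "(2 * real (Suc j) + 5)\<^sup>2 * q \<le> (2 * real j + 5)\<^sup>2"
proof -
  have "(2 * real (Suc j) + 5)\<^sup>2 * q \<le> (2 * real (Suc j) + 5)\<^sup>2 * (3/5)" using assms by (intro mult_left_mono) auto
  also have "\<dots> \<le> (2 * real j + 5)\<^sup>2"
  proof -
    have "6 * real j \<le> real j * real j" using assms by (intro mult_right_mono) auto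
    moreover have "6 \<le> real j" using assms by simp
    ultimately have "22 \<le> 16 * real j + 8 * (real j * real j)" by linarith
    then show ?thesis by (simp add: power2_eq_square algebra_simps)
  qed
  finally show ?thesis .
qed

lemma quintic_ratio:
  fixes q :: real assumes "n \<ge> 11" "0 \<le> q" "q \<le> 13/20"
  shows "(real (Suc n) + 5)\<^sup>2 * (real (Suc n))^3 * q \<le> (real n + 5)\<^sup>2 * (real n)^3"
proof -
  have a: "real (Suc n) + 5 \<le> 17/16 * (real n + 5)" "real (Suc n) \<le> 12/11 * real n" using assms by auto
  have "(real (Suc n) + 5)\<^sup>2 * (real (Suc n))^3 * q \<le> (17/16 * (real n + 5))\<^sup>2 * (12/11 * real n)^3 * (13/20)"
    using a assms by (intro mult_mono power_mono) auto
  also have "\<dots> = ((17/16)\<^sup>2 * (12/11)^3 * (13/20)) * ((real n + 5)\<^sup>2 * (real n)^3)" by (simp only: power_mult_distrib mult_ac)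
  also have "\<dots> \<le> 1 * ((real n + 5)\<^sup>2 * (real n)^3)"
    by (intro mult_right_mono) (auto simp: power_divide)
  finally show ?thesis by simp
qed

text \<open>The exponential gain in \<open>n\<close> beats the polynomial factors, and the negative power of \<open>r\<close> makes the smallest \<open>r\<close> the worst one.\<close>

lemma minor_arc_decay:
  fixes r0 w b c :: real
  assumes n: "n0 \<le> n" "11 \<le> n0" and r: "r0 \<le> real r" "1 < r0"
    and w: "0 < w" "w \<le> r0 powr (b * (2 * real n0 + 1) - 3)" and b: "0 \<le> b" "20/13 \<le> r0 powr (2 * b)"
    and e: "3 \<le> b * (2 * real n0 + 1)"
  shows "(real n + 5)\<^sup>2 * (real r * real n)^3 * exp (- (ln (real r) * (b * (2 * real n + 1))))
    \<le> (real n0 + 5)\<^sup>2 * (real n0)^3 / w"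
proof -
  have r0: "real r > 0" "real r > 1" using r by auto
  have mono: "b * (2 * real n0 + 1) \<le> b * (2 * real n + 1)" using n b by (intro mult_left_mono) auto
  define q where "q = r0 powr (- (2 * b))"
  have q: "0 \<le> q" "q \<le> 13/20" using b r unfolding q_def powr_minus by (auto simp: field_simps)
  have "(real r)^3 * exp (- (ln (real r) * (b * (2 * real n + 1)))) = real r powr (3 - b * (2 * real n + 1))"
  proof -
    have "(real r)^3 = real r powr 3" using r0 by (simp flip: powr_numeral)
    moreover have "exp (- (ln (real r) * (b * (2 * real n + 1)))) = real r powr (- (b * (2 * real n + 1)))"
      using r0 by (simp add: powr_def mult.commute)
    ultimately show ?thesis by (simp only: flip: powr_add) simp
  qed
  also have "\<dots> \<le> r0 powr (3 - b * (2 * real n + 1))"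
    using r r0 e mono by (intro powr_mono2') auto
  also have "\<dots> = r0 powr (- (b * (2 * real n0 + 1) - 3)) * q ^ (n - n0)"
  proof -
    have "q ^ (n - n0) = r0 powr (- (2 * b) * real (n - n0))" using r by (simp add: q_def powr_powr flip: powr_realpow)
    moreover have "3 - b * (2 * real n + 1) = - (b * (2 * real n0 + 1) - 3) + - (2 * b) * real (n - n0)"
      using n by (simp add: of_nat_diff algebra_simps)
    ultimately show ?thesis by (simp only: powr_add)
  qed
  also have "\<dots> \<le> (1 / w) * q ^ (n - n0)"
    unfolding powr_minus using w q by (intro mult_right_mono) (auto simp: inverse_eq_divide intro!: divide_left_mono mult_pos_pos)
  finally have 1: "(real r)^3 * exp (- (ln (real r) * (b * (2 * real n + 1)))) \<le> (1 / w) * q ^ (n - n0)" .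
  have 2: "(real (n0 + (n - n0)) + 5)\<^sup>2 * (real (n0 + (n - n0)))^3 * q ^ (n - n0) \<le> (real (n0 + 0) + 5)\<^sup>2 * (real (n0 + 0))^3 * q ^ 0"
  proof (rule poly_geometric_decreasing[where f = "\<lambda>k. (real (n0 + k) + 5)\<^sup>2 * (real (n0 + k))^3"])
    show "(real (n0 + Suc k) + 5)\<^sup>2 * (real (n0 + Suc k))^3 * q \<le> (real (n0 + k) + 5)\<^sup>2 * (real (n0 + k))^3" for k
      unfolding add_Suc_right by (rule quintic_ratio) (use n q in auto)
  qed (use q in auto)
  have "(real n + 5)\<^sup>2 * (real r * real n)^3 * exp (- (ln (real r) * (b * (2 * real n + 1))))
    = (real n + 5)\<^sup>2 * (real n)^3 * ((real r)^3 * exp (- (ln (real r) * (b * (2 * real n + 1)))))"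
    by (simp add: power_mult_distrib)
  also have "\<dots> \<le> (real n + 5)\<^sup>2 * (real n)^3 * ((1 / w) * q ^ (n - n0))"
    using 1 by (intro mult_left_mono) auto
  also have "\<dots> = ((real n + 5)\<^sup>2 * (real n)^3 * q ^ (n - n0)) / w" by simp
  also have "\<dots> \<le> ((real n0 + 5)\<^sup>2 * (real n0)^3) / w"
    using 2 n w by (intro divide_right_mono) auto
  finally show ?thesis .
qed

text \<open>Reduces the step for all \<open>r \<ge> r0\<close> and all \<open>n \<ge> n0\<close> to one numerical inequality at \<open>(r0, n0)\<close>, by monotonicity in both parameters.\<close>

lemma fourier_step_large:
  fixes r0 n0 j0 :: nat
  assumes R: "rising r n" and r: "r0 \<le> r" "9 \<le> r0" and n: "n0 \<le> Suc n" "11 \<le> n0" and j0: "2 * j0 \<le> n0 + 1" "j0 \<ge> 6"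
    and w: "0 < w" "w \<le> real r0 powr (19/80 * (2 * real n0 + 1) - 3)"
    and num: "(2 * real j0 + 5)\<^sup>2 * (33/70) ^ j0 * (31.1 / (real j0 - 3))
      + (2 * real j0 + 5)\<^sup>2 * ((99/35) ^ 3 * 1.3 * ((99/35) / real r0) ^ (j0 - 3))
      + (real n0 + 5)\<^sup>2 * (real n0)^3 / w \<le> 75"
  shows "rising r (Suc n)"
proof -
  define N where "N = Suc n"
  define j where "j = (N + 1) div 2"
  have j: "N \<le> 2 * j" "2 * j \<le> N + 1" unfolding j_def by linarith+
  have jj: "j0 \<le> j" using j0 n unfolding j_def N_def by linarith
  let ?EA = "(sqrt 2 / 3) ^ j * (31.1 / (real j - 3)) / (real r * real N)^3 + (2 * sqrt 2 / real r) ^ j * (1.3 / (real N)^3)"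
  let ?EB = "exp (- (ln (real r) * (19/80 * (2 * real N + 1))))"
  have rN: "real r > 0" "real N > 0" using r n by (auto simp: N_def)
  have N5: "(real N + 5)\<^sup>2 \<le> (2 * real j + 5)\<^sup>2" using j by (intro power_mono) auto
  have T1: "(2 * real j + 5)\<^sup>2 * ((sqrt 2 / 3) ^ j * (31.1 / (real j - 3))) \<le> (2 * real j0 + 5)\<^sup>2 * (33/70) ^ j0 * (31.1 / (real j0 - 3))"
  proof -
    have "(2 * real j + 5)\<^sup>2 * (sqrt 2 / 3) ^ j * (31.1 / (real j - 3)) \<le> (2 * real j + 5)\<^sup>2 * (33/70) ^ j * (31.1 / (real j0 - 3))"
      using jj j0 sqrt2_le by (intro mult_mono power_mono divide_left_mono) auto
    also have "\<dots> \<le> (2 * real j0 + 5)\<^sup>2 * (33/70) ^ j0 * (31.1 / (real j0 - 3))"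
    proof (rule mult_right_mono)
      show "(2 * real j + 5)\<^sup>2 * (33/70) ^ j \<le> (2 * real j0 + 5)\<^sup>2 * (33/70) ^ j0"
      proof (rule poly_geometric_decreasing[where f = "\<lambda>j. (2 * real j + 5)\<^sup>2"])
        show "(2 * real (Suc k) + 5)\<^sup>2 * (33/70) \<le> (2 * real k + 5)\<^sup>2" if "j0 \<le> k" for k
          by (rule square_ratio) (use that j0 in auto)
      qed (use jj in auto)
    qed (use j0 in auto)
    finally show ?thesis by (simp add: mult.assoc)
  qed
  have T2: "(2 * real j + 5)\<^sup>2 * ((real r)^3 * ((2 * sqrt 2 / real r) ^ j * 1.3)) \<le> (2 * real j0 + 5)\<^sup>2 * ((99/35) ^ 3 * 1.3 * ((99/35) / real r0) ^ (j0 - 3))"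
  proof -
    define q where "q = (99/35) / real r0"
    have q: "0 \<le> q" "q \<le> 3/5" using r by (auto simp: q_def field_simps)
    have "(real r)^3 * (2 * sqrt 2 / real r) ^ j = (2 * sqrt 2)^3 * (2 * sqrt 2 / real r) ^ (j - 3)"
    proof -
      have "(2 * sqrt 2 / real r) ^ j = (2 * sqrt 2 / real r) ^ 3 * (2 * sqrt 2 / real r) ^ (j - 3)"
        using jj j0 by (simp flip: power_add)
      then show ?thesis using rN by (simp add: power_divide)
    qed
    also have "\<dots> \<le> (99/35)^3 * q ^ (j - 3)"
      unfolding q_def using sqrt2_le r rN by (intro mult_mono power_mono frac_le) auto
    finally have a: "(real r)^3 * (2 * sqrt 2 / real r) ^ j \<le> (99/35)^3 * q ^ (j - 3)" .
    have b: "(2 * real (j - 3 + 3) + 5)\<^sup>2 * q ^ (j - 3) \<le> (2 * real (j0 - 3 + 3) + 5)\<^sup>2 * q ^ (j0 - 3)"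
    proof (rule poly_geometric_decreasing[where f = "\<lambda>j. (2 * real (j + 3) + 5)\<^sup>2"])
      fix k assume "j0 - 3 \<le> k"
      then show "(2 * real (Suc k + 3) + 5)\<^sup>2 * q \<le> (2 * real (k + 3) + 5)\<^sup>2"
        using square_ratio[of "k + 3" q] q j0 by simp
    qed (use jj q in auto)
    have "(2 * real j + 5)\<^sup>2 * ((real r)^3 * ((2 * sqrt 2 / real r) ^ j * 1.3)) \<le> (2 * real j + 5)\<^sup>2 * ((99/35)^3 * q ^ (j - 3) * 1.3)"
      using a by (intro mult_left_mono) (auto simp: mult.assoc[symmetric])
    also have "\<dots> = ((2 * real (j - 3 + 3) + 5)\<^sup>2 * q ^ (j - 3)) * ((99/35)^3 * 1.3)" using jj j0 by simp
    also have "\<dots> \<le> ((2 * real (j0 - 3 + 3) + 5)\<^sup>2 * q ^ (j0 - 3)) * ((99/35)^3 * 1.3)" using b by (intro mult_right_mono) auto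
    also have "\<dots> = (2 * real j0 + 5)\<^sup>2 * ((99/35) ^ 3 * 1.3 * q ^ (j0 - 3))" using j0 by simp
    finally show ?thesis by (simp add: q_def)
  qed
  have T3: "(real N + 5)\<^sup>2 * (real r * real N)^3 * ?EB \<le> (real n0 + 5)\<^sup>2 * (real n0)^3 / w"
  proof (rule minor_arc_decay[where ?r0.0 = "real r0"])
    have "20/13 \<le> (9::real) powr (2 * (19/80))"
    proof -
      have "(20/13::real) \<le> 9 powr (1/4)"
      proof (rule power_le_imp_le_base[of _ 3])
        have "(9 powr (1/4::real)) ^ Suc 3 = (9::real)" by (simp add: powr_powr flip: powr_realpow)
        then show "(20/13::real) ^ Suc 3 \<le> (9 powr (1/4)) ^ Suc 3" by (simp add: power_divide)
      qed simp
      also have "\<dots> \<le> (9::real) powr (2 * (19/80))" by (intro powr_mono) auto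
      finally show ?thesis .
    qed
    also have "(9::real) powr (2 * (19/80)) \<le> real r0 powr (2 * (19/80))" using r by (intro powr_mono2) auto
    finally show "20/13 \<le> real r0 powr (2 * (19/80))" .
  qed (use n r w in \<open>auto simp: N_def\<close>)
  have expand: "(real N + 5)\<^sup>2 * ((real r * real N)^3 * (?EA + ?EB)) =
     (real N + 5)\<^sup>2 * ((sqrt 2 / 3) ^ j * (31.1 / (real j - 3))) + (real N + 5)\<^sup>2 * ((real r)^3 * ((2 * sqrt 2 / real r) ^ j * 1.3))
     + (real N + 5)\<^sup>2 * (real r * real N)^3 * ?EB"
    using rN by (simp add: power_mult_distrib distrib_left mult.assoc)
  have "(real N + 5)\<^sup>2 * ((sqrt 2 / 3) ^ j * (31.1 / (real j - 3))) \<le> (2 * real j + 5)\<^sup>2 * ((sqrt 2 / 3) ^ j * (31.1 / (real j - 3)))"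
     "(real N + 5)\<^sup>2 * ((real r)^3 * ((2 * sqrt 2 / real r) ^ j * 1.3)) \<le> (2 * real j + 5)\<^sup>2 * ((real r)^3 * ((2 * sqrt 2 / real r) ^ j * 1.3))"
    using jj j0 by (intro mult_right_mono[OF N5] mult_nonneg_nonneg divide_nonneg_nonneg; simp)+
  then have fin: "(real N + 5)\<^sup>2 * ((real r * real N)^3 * (?EA + ?EB)) \<le> 75"
    unfolding expand using T1 T2 T3 num by linarith
  show ?thesis
  proof (rule fourier_step[OF _ _ R])
    show "integral {pi/(real r * real (Suc n))..pi/(2 * real (Suc n))} (\<lambda>a. \<bar>PP r (Suc n) a\<bar> * a\<^sup>2) \<le> real r ^ Suc n * ?EA"
      using zoneA_large[of N r j] r j jj j0 unfolding N_def by simp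
    show "\<bar>PP r (Suc n) a\<bar> \<le> real r ^ Suc n * ?EB" if "a \<in> {pi/(2 * real (Suc n))..pi/2}" for a
    proof -
      have "19/80 * (2 * real N + 1) \<le> SS N a + 3/16 * SS N (2 * a)"
        using that n unfolding N_def by (intro SS_ge2) auto
      then have "ln (real r) * (19/80 * (2 * real N + 1)) \<le> ln (real r) * (SS N a + 3/16 * SS N (2 * a))"
        using r by (intro mult_left_mono) auto
      then have "real r ^ N * exp (- (ln (real r) * (SS N a + 3/16 * SS N (2 * a)))) \<le> real r ^ N * ?EB"
        by (intro mult_left_mono) auto
      then show ?thesis using PP_large[of r N a] r unfolding N_def by linarith
    qed
    show "(real (Suc n) + 5)\<^sup>2 * ((real r * real (Suc n))^3 * (?EA + ?EB)) \<le> 75" using fin unfolding N_def .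
  qed (use n r in auto)
qed

text \<open>Compares with a power with exponent a multiple of one tenth, which makes the claim an inequality between integers.\<close>

lemma powr_lower:
  fixes x w :: real assumes "x > 1" "w > 0" "w ^ 10 \<le> x ^ k" "real k / 10 \<le> e"
  shows "w \<le> x powr e"
proof -
  have "w \<le> x powr (real k / 10)"
  proof (rule power_le_imp_le_base[of _ 9])
    have "(x powr (real k / 10)) ^ Suc 9 = (x powr (real k / 10)) powr real (Suc 9)"
      using assms by (subst powr_realpow) auto
    also have "\<dots> = x powr real k" by (simp only: powr_powr) simp
    also have "\<dots> = x ^ k" using assms by (simp add: powr_realpow)
    finally have "(x powr (real k / 10)) ^ Suc 9 = x ^ k" .
    then show "w ^ Suc 9 \<le> (x powr (real k / 10)) ^ Suc 9" using assms by simp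
  qed simp
  also have "\<dots> \<le> x powr e" using assms by (intro powr_mono) auto
  finally show ?thesis .
qed

lemma fourier_step_small:
  fixes r0 n0 j0 :: nat and q :: real
  assumes R: "rising r n" and r: "r0 \<le> r" "r \<le> r1" "3 \<le> r0" and n: "n0 \<le> Suc n" "11 \<le> n0" and j0: "2 * j0 \<le> n0 + 1" "j0 \<ge> 6"
    and q: "sqrt 2 \<le> q * (real r * sin (pi / real r))" "q \<le> 3/5"
    and w: "0 < w" "w \<le> real r0 powr (5/24 * (2 * real n0 + 1) - 3)"
    and num: "(2 * real j0 + 5)\<^sup>2 * q ^ j0 * (1.3 * (real r1)^3)
      + (real n0 + 5)\<^sup>2 * (real n0)^3 / w \<le> 75"
  shows "rising r (Suc n)"
proof -
  define N where "N = Suc n"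
  define j where "j = (N + 1) div 2"
  have j: "N \<le> 2 * j" "2 * j \<le> N + 1" unfolding j_def by linarith+
  have jj: "j0 \<le> j" using j0 n unfolding j_def N_def by linarith
  have sr: "0 < real r * sin (pi / real r)" using r by (auto intro!: mult_pos_pos sin_gt_zero simp: field_simps)
  define p where "p = sqrt 2 / (real r * sin (pi / real r))"
  have p: "0 \<le> p" "p \<le> q" using sr q by (auto simp: p_def pos_divide_le_eq)
  let ?EA = "p ^ j * (1.3 / (real N)^3)"
  let ?EB = "exp (- (ln (real r) * (5/24 * (2 * real N + 1))))"
  have rN: "real r > 0" "real N > 0" using r n by (auto simp: N_def)
  have N5: "(real N + 5)\<^sup>2 \<le> (2 * real j + 5)\<^sup>2" using j by (intro power_mono) auto
  have T1: "(real N + 5)\<^sup>2 * p ^ j * (1.3 * (real r)^3) \<le> (2 * real j0 + 5)\<^sup>2 * q ^ j0 * (1.3 * (real r1)^3)"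
  proof -
    have "(real N + 5)\<^sup>2 * p ^ j \<le> (2 * real j + 5)\<^sup>2 * q ^ j" using N5 p by (intro mult_mono power_mono) auto
    also have "\<dots> \<le> (2 * real j0 + 5)\<^sup>2 * q ^ j0"
    proof (rule poly_geometric_decreasing[where f = "\<lambda>j. (2 * real j + 5)\<^sup>2"])
      show "(2 * real (Suc k) + 5)\<^sup>2 * q \<le> (2 * real k + 5)\<^sup>2" if "j0 \<le> k" for k
        by (rule square_ratio) (use that j0 p q in auto)
    qed (use jj p q in auto)
    finally show ?thesis by (rule mult_mono) (use r p in \<open>auto intro!: power_mono\<close>)
  qed
  have T3: "(real N + 5)\<^sup>2 * (real r * real N)^3 * ?EB \<le> (real n0 + 5)\<^sup>2 * (real n0)^3 / w"
  proof (rule minor_arc_decay[where ?r0.0 = "real r0"])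
    have "20/13 \<le> (3::real) powr (2 * (5/24))"
      by (rule powr_lower[of _ _ 4]) (auto simp: power_divide)
    also have "(3::real) powr (2 * (5/24)) \<le> real r0 powr (2 * (5/24))" using r by (intro powr_mono2) auto
    finally show "20/13 \<le> real r0 powr (2 * (5/24))" .
  qed (use n r w in \<open>auto simp: N_def\<close>)
  have expand: "(real N + 5)\<^sup>2 * ((real r * real N)^3 * (?EA + ?EB)) =
     (real N + 5)\<^sup>2 * p ^ j * (1.3 * (real r)^3) + (real N + 5)\<^sup>2 * (real r * real N)^3 * ?EB"
    using rN by (simp add: power_mult_distrib distrib_left mult.assoc)
  have fin: "(real N + 5)\<^sup>2 * ((real r * real N)^3 * (?EA + ?EB)) \<le> 75"
    unfolding expand using T1 T3 num by linarith
  show ?thesis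
  proof (rule fourier_step[OF _ _ R])
    show "integral {pi/(real r * real (Suc n))..pi/(2 * real (Suc n))} (\<lambda>a. \<bar>PP r (Suc n) a\<bar> * a\<^sup>2) \<le> real r ^ Suc n * ?EA"
      using zoneA_small[of N r j] r j unfolding N_def p_def by simp
    show "\<bar>PP r (Suc n) a\<bar> \<le> real r ^ Suc n * ?EB" if "a \<in> {pi/(2 * real (Suc n))..pi/2}" for a
    proof -
      have "5/24 * (2 * real N + 1) \<le> SS N a"
        using that n unfolding N_def by (intro SS_ge) auto
      then have "ln (real r) * (5/24 * (2 * real N + 1)) \<le> ln (real r) * SS N a"
        using r by (intro mult_left_mono) auto
      then have "real r ^ N * exp (- (ln (real r) * SS N a)) \<le> real r ^ N * ?EB"
        by (intro mult_left_mono) auto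
      then show ?thesis using PP_small[of r N a] r unfolding N_def by linarith
    qed
    show "(real (Suc n) + 5)\<^sup>2 * ((real r * real (Suc n))^3 * (?EA + ?EB)) \<le> 75" using fin unfolding N_def .
  qed (use n r in auto)
qed

lemma fourier_step_9_up:
  assumes "rising r n" and "r \<ge> 18 \<and> n \<ge> 12 \<or> r \<ge> 12 \<and> n \<ge> 14 \<or> r \<ge> 9 \<and> n \<ge> 16"
  shows "rising r (Suc n)"
  using assms(2)
proof (elim disjE conjE)
  assume "r \<ge> 18" "n \<ge> 12"
  then show ?thesis by (intro fourier_step_large[OF assms(1), of 18 13 7 18500] powr_lower[of _ _ 34]) (auto simp: power_divide)
next
  assume "r \<ge> 12" "n \<ge> 14"
  then show ?thesis by (intro fourier_step_large[OF assms(1), of 12 15 8 43000] powr_lower[of _ _ 43]) (auto simp: power_divide)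
next
  assume "r \<ge> 9" "n \<ge> 16"
  then show ?thesis by (intro fourier_step_large[OF assms(1), of 9 17 9 110000] powr_lower[of _ _ 53]) (auto simp: power_divide)
qed

lemma fourier_step_3_to_8:
  assumes "rising r n" and "r = 3 \<and> n \<ge> 39 \<or> r = 4 \<and> n \<ge> 29 \<or> 5 \<le> r \<and> r \<le> 8 \<and> n \<ge> 27"
  shows "rising r (Suc n)"
proof -
  have s4: "sqrt 2 \<le> 1/2 * (real r * sin (pi / real r))" if "r \<ge> 4"
  proof -
    have "4 / real r * sin (pi/4) \<le> sin (4 / real r * (pi/4))" using that by (intro sin_concave_ratio) auto
    then have "real r * (4 / real r * sin (pi/4)) \<le> real r * sin (pi / real r)" using that by (intro mult_left_mono) auto
    then show ?thesis using that by (simp add: sin_45)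
  qed
  have s3: "sqrt 2 \<le> 11/20 * (real 3 * sin (pi / real 3))"
  proof -
    have "sqrt 2 \<le> sqrt (((11/20) * 3 / 2)\<^sup>2 * 3)" by (subst real_sqrt_le_iff) (simp add: power_divide)
    then show ?thesis by (simp add: sin_60 real_sqrt_mult)
  qed
  show ?thesis using assms(2)
  proof (elim disjE conjE)
    assume "r = 3" "n \<ge> 39"
    then show ?thesis using s3
      by (intro fourier_step_small[OF assms(1), of 3 3 40 20 "11/20" 3800000] powr_lower[of _ _ 138]) (auto simp: power_divide)
  next
    assume "r = 4" "n \<ge> 29"
    then show ?thesis using s4
      by (intro fourier_step_small[OF assms(1), of 4 4 30 15 "1/2" 690000] powr_lower[of _ _ 97]) (auto simp: power_divide)
  next
    assume "5 \<le> r" "r \<le> 8" "n \<ge> 27"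
    then show ?thesis using s4
      by (intro fourier_step_small[OF assms(1), of 5 8 28 14 "1/2" 1400000] powr_lower[of _ _ 88]) (auto simp: power_divide)
  qed
qed

text \<open>For \<open>r = 2\<close> the first zero of the product is already \<open>pi / (2 n)\<close>, so the intermediate arc is empty, and the kernel is \<open>2 cos\<close>.\<close>

lemma fourier_step_2:
  assumes R: "rising 2 n" and n: "n \<ge> 74"
  shows "rising 2 (Suc n)"
proof -
  define N where "N = Suc n"
  define q where "q = sqrt (7/12::real)"
  have q: "0 \<le> q" "q \<le> 13/17"
    unfolding q_def by (simp, rule real_le_lsqrt) (simp_all add: power_divide)
  have "(real N + 5)\<^sup>2 * (real N)^3 * q ^ N \<le> (real 75 + 5)\<^sup>2 * (real 75)^3 * q ^ 75"
  proof (rule poly_geometric_decreasing[where f = "\<lambda>n. (real n + 5)\<^sup>2 * (real n)^3"])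
    fix k :: nat assume k: "75 \<le> k"
    have a: "real (Suc k) + 5 \<le> 81/80 * (real k + 5)" "real (Suc k) \<le> 76/75 * real k" using k by auto
    have "(real (Suc k) + 5)\<^sup>2 * (real (Suc k))^3 * q \<le> (81/80 * (real k + 5))\<^sup>2 * (76/75 * real k)^3 * (13/17)"
      using a q by (intro mult_mono power_mono) auto
    also have "\<dots> = ((81/80)\<^sup>2 * (76/75)^3 * (13/17)) * ((real k + 5)\<^sup>2 * (real k)^3)" by (simp only: power_mult_distrib mult_ac)
    also have "\<dots> \<le> 1 * ((real k + 5)\<^sup>2 * (real k)^3)" by (intro mult_right_mono) (auto simp: power_divide)
    finally show "(real (Suc k) + 5)\<^sup>2 * (real (Suc k))^3 * q \<le> (real k + 5)\<^sup>2 * (real k)^3" by simp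
  qed (use n q in \<open>auto simp: N_def\<close>)
  also have "\<dots> \<le> (real 75 + 5)\<^sup>2 * (real 75)^3 * (13/17) ^ 75" using q by (intro mult_left_mono power_mono) auto
  also have "\<dots> \<le> 75 / 8" by (simp add: power_divide)
  finally have fin: "(real N + 5)\<^sup>2 * ((real 2 * real N)^3 * (0 + q ^ N)) \<le> 75" by (simp add: power_mult_distrib)
  show ?thesis
  proof (rule fourier_step[OF _ _ R])
    show "integral {pi/(real 2 * real (Suc n))..pi/(2 * real (Suc n))} (\<lambda>a. \<bar>PP 2 (Suc n) a\<bar> * a\<^sup>2) \<le> real 2 ^ Suc n * 0"
      by simp
    show "\<bar>PP 2 (Suc n) a\<bar> \<le> real 2 ^ Suc n * q ^ N" if "a \<in> {pi/(2 * real (Suc n))..pi/2}" for a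
    proof -
      have "5/24 * (2 * real N + 1) \<le> SS N a"
        using that n unfolding N_def by (intro SS_ge) auto
      then have "5/12 * real N \<le> SS N a" by (simp add: field_simps)
      from PP_2[OF this] show ?thesis by (simp add: q_def N_def)
    qed
    show "(real (Suc n) + 5)\<^sup>2 * ((real 2 * real (Suc n))^3 * (0 + q ^ N)) \<le> 75" using fin unfolding N_def .
  qed (use n in auto)
qed

section \<open>A recurrence for lists of coefficient differences\<close>

lemma dif_neg: "k < 0 \<Longrightarrow> dif r n k = 0"
  by (simp add: dif_def co_def)

lemma dif_antisym: "r > 0 \<Longrightarrow> dif r n (int (top_deg r n) + 1 - k) = - dif r n k"
  using co_sym[of r n k] co_sym[of r n "k - 1"] by (simp add: dif_def algebra_simps)

text \<open>The window sum telescopes, which replaces \<open>r\<close> additions by two.\<close>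

lemma dif_recurrence:
  "dif r (Suc n) m = dif r (Suc n) (m - int (Suc n)) + dif r n m - dif r n (m - int (r * Suc n))"
proof -
  let ?f = "\<lambda>i. dif r n (m - int (i * Suc n))"
  have "dif r (Suc n) (m - int (Suc n)) = (\<Sum>i<r. ?f (Suc i))"
    unfolding dif_Suc by (intro sum.cong) (auto simp: algebra_simps)
  moreover have "(\<Sum>i<r. ?f i) - (\<Sum>i<r. ?f (Suc i)) = ?f 0 - ?f r"
    using sum_lessThan_telescope'[of ?f r] by (simp add: sum_subtractf)
  ultimately show ?thesis unfolding dif_Suc[of r n m] by simp
qed

text \<open>Solves \<open>g m = g (m - k) + D m - H m\<close> on lists; the third argument is a queue holding the last \<open>k\<close> values.\<close>

primrec outs :: "real list \<Rightarrow> real list \<Rightarrow> real list \<Rightarrow> real list" where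
  "outs [] S q = []"
| "outs (a # A) S q = (let x = a - hd S + hd q in x # outs A (tl S) (tl q @ [x]))"

lemma length_outs [simp]: "length (outs A S q) = length A"
  by (induction A arbitrary: S q) (auto simp: Let_def)

lemma nth_outs:
  assumes g: "\<And>m. g m = g (m - int k) + D m - H m" and "k > 0"
    and "\<And>t. t < length A \<Longrightarrow> A ! t = D (i + int t)"
    and "\<And>t. t < length A \<Longrightarrow> t < length S \<and> S ! t = H (i + int t)"
    and "length q = k" "\<And>t. t < k \<Longrightarrow> q ! t = g (i + int t - int k)"
    and "t < length A"
  shows "outs A S q ! t = g (i + int t)"
  using assms(3-)
proof (induction A arbitrary: S q t i)
  case (Cons a A)
  obtain s S' where S: "S = s # S'" using Cons.prems(2)[of 0] by (cases S) auto
  obtain f q' where q: "q = f # q'" using Cons.prems(3) \<open>k > 0\<close> by (cases q) auto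
  define x where "x = a - s + f"
  have x: "x = g i"
    using Cons.prems(1)[of 0] Cons.prems(2)[of 0] Cons.prems(4)[of 0] g[of i] \<open>k > 0\<close> by (simp add: x_def S q)
  have o: "outs (a # A) S q = x # outs A S' (q' @ [x])" by (simp add: S q x_def Let_def)
  show ?case
  proof (cases t)
    case 0
    then show ?thesis using x by (simp add: o del: outs.simps)
  next
    case (Suc u)
    have "outs A S' (q' @ [x]) ! u = g ((i + 1) + int u)"
    proof (rule Cons.IH)
      show "A ! t = D (i + 1 + int t)" if "t < length A" for t
        using Cons.prems(1)[of "Suc t"] that by (simp add: add.assoc)
      show "t < length S' \<and> S' ! t = H (i + 1 + int t)" if "t < length A" for t
        using Cons.prems(2)[of "Suc t"] that by (simp add: S add.assoc)
      show "length (q' @ [x]) = k" using Cons.prems(3) q by simp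
      show "(q' @ [x]) ! t = g (i + 1 + int t - int k)" if "t < k" for t
      proof (cases "Suc t < k")
        case True
        then have "t < length q'" using Cons.prems(3) q by simp
        then show ?thesis using Cons.prems(4)[of "Suc t"] True by (simp add: nth_append q algebra_simps)
      next
        case False
        then have "t = length q'" "int k = int t + 1" using Cons.prems(3) q that by auto
        then show ?thesis by (simp add: nth_append x)
      qed
      show "u < length A" using Suc Cons.prems(5) by simp
    qed
    then show ?thesis by (simp add: o Suc add.assoc del: outs.simps)
  qed
qed simp

text \<open>The continuation of the list beyond the middle, by antisymmetry; past the end of the polynomial it is \<open>0\<close>.\<close>

primrec nt :: "nat \<Rightarrow> real list \<Rightarrow> real list" where
  "nt 0 R = []"
| "nt (Suc e) R = (case R of [] \<Rightarrow> 0 # nt e [] | x # R' \<Rightarrow> - x # nt e R')"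

lemma length_nt [simp]: "length (nt e R) = e"
  by (induction e arbitrary: R) (auto split: list.splits)

lemma nth_nt: "t < e \<Longrightarrow> nt e R ! t = (if t < length R then - R ! t else 0)"
proof (induction e arbitrary: R t)
  case (Suc e)
  then show ?case by (cases R; cases t) auto
qed simp

definition rvapp :: "real list \<Rightarrow> real list \<Rightarrow> real list" where "rvapp R E = rev R @ E"
definition zs :: "nat \<Rightarrow> real list \<Rightarrow> real list" where "zs n S = replicate n 0 @ S"
definition go :: "real list \<Rightarrow> real list \<Rightarrow> real list \<Rightarrow> real list \<Rightarrow> real list \<Rightarrow> real list" where
  "go A S Q B O' = rev (outs A S (Q @ rev B)) @ O'"
text \<open>When the degree is odd the difference just above the middle is \<open>0\<close> and is inserted explicitly.\<close>

definition ext :: "nat \<Rightarrow> nat \<Rightarrow> real list \<Rightarrow> real list" where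
  "ext N u R = rvapp R (if even N then nt (u div 2) R else 0 # nt ((u - 1) div 2) R)"
definition new :: "nat \<Rightarrow> nat \<Rightarrow> nat \<Rightarrow> real list \<Rightarrow> real list" where
  "new p k N R = go (ext N (p * k) R) (zs (k + p * k) (ext N (p * k) R)) (zs k []) [] []"

text \<open>The list contains the differences from the middle down to degree \<open>0\<close>. Storing it reversed makes the antisymmetric continuation a prefix operation.\<close>

definition good :: "nat \<Rightarrow> nat \<Rightarrow> real list \<Rightarrow> bool" where
  "good r n R \<longleftrightarrow> length R = top_deg r n div 2 + 1 \<and>
     (\<forall>i<length R. R ! i = dif r n (int (top_deg r n div 2) - int i))"

lemma nth_ext:
  assumes R: "good r n R" and r: "r > 0" and N: "N = top_deg r n" and t: "t < length (ext N u R)"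
  shows "ext N u R ! t = dif r n (int t)"
proof -
  have lR: "length R = N div 2 + 1" and nR: "\<And>i. i < length R \<Longrightarrow> R ! i = dif r n (int (N div 2) - int i)"
    using R by (auto simp: good_def N)
  have anti: "dif r n (int N + 1 - k) = - dif r n k" for k using dif_antisym[OF r, of n k] by (simp add: N)
  have refl: "(if i < length R then - R ! i else 0) = dif r n (int N + 1 - (int (N div 2) - int i))" for i
    using lR by (auto simp: nR anti dif_neg)
  show ?thesis
  proof (cases "t < length R")
    case True
    then have "ext N u R ! t = R ! (length R - Suc t)"
      by (simp add: ext_def rvapp_def nth_append rev_nth)
    also have "\<dots> = dif r n (int (N div 2) - int (length R - Suc t))" using True by (intro nR) auto
    also have "int (N div 2) - int (length R - Suc t) = int t" using True lR by auto
    finally show ?thesis .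
  next
    case False
    define s where "s = t - length R"
    have ts: "t = N div 2 + 1 + s" using False lR by (simp add: s_def)
    show ?thesis
    proof (cases "even N")
      case True
      then have "ext N u R ! t = nt (u div 2) R ! s" using False by (simp add: ext_def rvapp_def nth_append s_def)
      also have "\<dots> = (if s < length R then - R ! s else 0)"
        using t False True by (intro nth_nt) (auto simp: ext_def rvapp_def s_def)
      also have "\<dots> = dif r n (int t)" unfolding refl using True ts by (auto elim!: evenE simp: ac_simps)
      finally show ?thesis .
    next
      case odd: False
      show ?thesis
      proof (cases s)
        case 0
        have "int N + 1 - int t = int t" using odd ts 0 by (auto elim!: oddE)
        then have "dif r n (int t) = 0" using anti[of "int t"] by simp
        moreover have "ext N u R ! t = 0" using False odd 0 by (simp add: ext_def rvapp_def nth_append s_def)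
        ultimately show ?thesis by simp
      next
        case (Suc v)
        have "ext N u R ! t = nt ((u - 1) div 2) R ! v" using False odd Suc by (simp add: ext_def rvapp_def nth_append s_def)
        also have "\<dots> = (if v < length R then - R ! v else 0)"
          using t False odd Suc by (intro nth_nt) (auto simp: ext_def rvapp_def s_def)
        also have "\<dots> = dif r n (int t)" unfolding refl using odd ts Suc by (auto elim!: oddE simp: ac_simps)
        finally show ?thesis .
      qed
    qed
  qed
qed

lemma good_new:
  assumes R: "good (Suc p) n R" and p: "p > 0" and N: "N = top_deg (Suc p) n"
  shows "good (Suc p) (Suc n) (new p (Suc n) N R)"
proof -
  define A where "A = ext N (p * Suc n) R"
  define N' where "N' = top_deg (Suc p) (Suc n)"
  have N': "N' = N + p * Suc n" by (simp add: N'_def N top_deg_Suc)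
  have A: "A ! t = dif (Suc p) n (int t)" if "t < length A" for t
    using nth_ext[OF R _ N] that by (simp add: A_def)
  have lR: "length R = N div 2 + 1" using R by (simp add: good_def N)
  have pos: "p * Suc n > 0" using p by simp
  have lA: "length A = N' div 2 + 1"
  proof -
    define u where "u = p * Suc n"
    have "length A = length R + (if even N then u div 2 else Suc ((u - 1) div 2))"
      by (simp add: A_def ext_def rvapp_def u_def)
    moreover have "u > 0" using pos by (simp add: u_def)
    moreover from this have "Suc ((u - 1) div 2) = (u + 1) div 2" by (cases u) auto
    ultimately have "length A = N div 2 + 1 + (if even N then u div 2 else (u + 1) div 2)" by (simp only: lR)
    then show ?thesis unfolding N' u_def[symmetric] by (cases "even N"; cases "even u") (auto elim!: evenE oddE)
  qed
  have nth: "outs A (zs (Suc n + p * Suc n) A) (zs (Suc n) []) ! t = dif (Suc p) (Suc n) (0 + int t)" if "t < length A" for t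
  proof (rule nth_outs[where k = "Suc n" and D = "dif (Suc p) n" and H = "\<lambda>m. dif (Suc p) n (m - int (Suc p * Suc n))"])
    show "dif (Suc p) (Suc n) m = dif (Suc p) (Suc n) (m - int (Suc n)) + dif (Suc p) n m - dif (Suc p) n (m - int (Suc p * Suc n))" for m
      by (rule dif_recurrence)
    show "t < length (zs (Suc n + p * Suc n) A) \<and> zs (Suc n + p * Suc n) A ! t = dif (Suc p) n (0 + int t - int (Suc p * Suc n))"
      if "t < length A" for t
    proof (cases "t < Suc n + p * Suc n")
      case True
      then have "0 + int t - int (Suc p * Suc n) < 0" by (simp only: mult_Suc)
      moreover have "zs (Suc n + p * Suc n) A ! t = 0" using True by (simp only: zs_def nth_append length_replicate nth_replicate if_True)
      ultimately show ?thesis using that by (simp add: dif_neg zs_def)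
    next
      case False
      then have "int t - int (Suc p * Suc n) = int (t - (Suc n + p * Suc n))" by (simp only: mult_Suc)
      moreover have "zs (Suc n + p * Suc n) A ! t = A ! (t - (Suc n + p * Suc n))"
        using False by (simp only: zs_def nth_append length_replicate if_False)
      ultimately show ?thesis using that A by (simp add: zs_def less_imp_diff_less)
    qed
  qed (use A that in \<open>auto simp: zs_def dif_neg simp del: replicate.simps\<close>)
  define B where "B = outs A (zs (Suc n + p * Suc n) A) (zs (Suc n) [])"
  have new: "new p (Suc n) N R = rev B"
    by (simp only: new_def go_def A_def B_def rev.simps append_Nil2)
  have B: "length B = N' div 2 + 1" "\<And>t. t < length B \<Longrightarrow> B ! t = dif (Suc p) (Suc n) (int t)"
    unfolding B_def using nth lA by (simp_all only: length_outs add_0)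
  show ?thesis
    unfolding good_def new by (auto simp: B rev_nth of_nat_diff N'_def[symmetric])
qed

definition nn :: "real list \<Rightarrow> bool" where "nn R \<longleftrightarrow> (\<forall>x\<in>set R. 0 \<le> x)"

lemma good_nn_rising:
  assumes "good r n R" "nn R" shows "rising r n"
  unfolding rising_def
proof (intro allI impI)
  fix k assume k: "2 * k \<le> int (top_deg r n)"
  show "0 \<le> dif r n k"
  proof (cases "k < 0")
    case False
    define i where "i = nat (int (top_deg r n div 2) - k)"
    have i: "int i = int (top_deg r n div 2) - k" "i < length R"
      using k False assms(1) by (auto simp: i_def good_def)
    then have "R ! i = dif r n k" using assms(1) by (simp add: good_def)
    then show ?thesis using i(2) assms(2) nth_mem unfolding nn_def by metis
  qed (simp add: dif_neg)
qed

text \<open>Runs the recurrence from \<open>n\<close> on and tests signs from \<open>lo\<close> on, since for odd \<open>r\<close> the early polynomials need not be unimodal.\<close>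

primrec chk :: "nat \<Rightarrow> nat \<Rightarrow> nat \<Rightarrow> nat \<Rightarrow> real list \<Rightarrow> nat \<Rightarrow> bool" where
  "chk lo p n N R 0 = True"
| "chk lo p n N R (Suc t) = (let R' = new p (n + 1) N R in
     (lo \<le> n + 1 \<longrightarrow> nn R') \<and> chk lo p (n + 1) (N + p * (n + 1)) R' t)"

lemma chk_sound_aux:
  assumes "p > 0" "chk lo p n N R t" "good (Suc p) n R" "N = top_deg (Suc p) n" "n < m" "m \<le> n + t" "lo \<le> m"
  shows "rising (Suc p) m"
  using assms(2-)
proof (induction t arbitrary: n N R)
  case (Suc t)
  let ?R = "new p (n + 1) N R"
  have g: "good (Suc p) (Suc n) ?R" using good_new[OF Suc.prems(2) assms(1) Suc.prems(3)] by simp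
  show ?case
  proof (cases "m = Suc n")
    case True
    then show ?thesis using Suc.prems(1,6) good_nn_rising[OF g] by (simp add: Let_def)
  next
    case False
    show ?thesis
      by (rule Suc.IH[of "Suc n" "N + p * (n + 1)" ?R]) (use g Suc.prems False in \<open>auto simp: Let_def top_deg_Suc\<close>)
  qed
qed simp

lemma chk_sound:
  assumes "chk lo p 0 0 [1] t" "p > 0" "lo \<le> m" "1 \<le> m" "m \<le> t"
  shows "rising (Suc p) m"
proof -
  have "dif (Suc p) 0 0 = 1" by (simp add: dif_def co_def F_0)
  then have "good (Suc p) 0 [1]" by (simp add: good_def top_deg_def)
  then show ?thesis using assms by (intro chk_sound_aux[of p lo 0 0 "[1]"]) (auto simp: top_deg_def)
qed

section \<open>Coefficient differences and restricted partitions\<close>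

text \<open>Partitions of \<open>y\<close> into parts \<open>2, ..., n\<close>. The part \<open>1\<close> is absent because it is cancelled by the factor \<open>1 - q\<close> that produces differences.\<close>

primrec pp :: "nat \<Rightarrow> int \<Rightarrow> real" where
  "pp 0 y = (if y = 0 then 1 else 0)"
| "pp (Suc n) y = (if n = 0 then (if y = 0 then 1 else 0) else (\<Sum>t\<le>nat y. pp n (y - int (t * Suc n))))"

lemma pp_neg: "y < 0 \<Longrightarrow> pp n y = 0"
  by (induction n arbitrary: y) auto

lemma pp_0: "pp n 0 = 1"
  by (induction n) auto

lemma pp_nonneg: "0 \<le> pp n y"
  by (induction n arbitrary: y) (auto intro!: sum_nonneg)

lemma pp_Suc_long:
  assumes "n \<ge> 1" "nat y \<le> M"
  shows "pp (Suc n) y = (\<Sum>t\<le>M. pp n (y - int (t * Suc n)))"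
proof -
  have "(\<Sum>t\<le>M. pp n (y - int (t * Suc n))) = (\<Sum>t\<le>nat y. pp n (y - int (t * Suc n)))"
  proof (rule sum.mono_neutral_right)
    show "\<forall>t\<in>{..M} - {..nat y}. pp n (y - int (t * Suc n)) = 0"
    proof
      fix t assume "t \<in> {..M} - {..nat y}"
      then have "y < int t" by auto
      also have "int t \<le> int (t * Suc n)" unfolding of_nat_le_iff by simp
      finally show "pp n (y - int (t * Suc n)) = 0" by (intro pp_neg) linarith
    qed
  qed (use assms in auto)
  then show ?thesis using assms(1) by simp
qed

lemma pp_rec:
  assumes "n \<ge> 1"
  shows "pp (Suc n) y = pp (Suc n) (y - int (Suc n)) + pp n y"
proof -
  let ?f = "\<lambda>t. pp n (y - int (t * Suc n))"
  have "pp (Suc n) y = (\<Sum>t\<le>Suc (nat y). ?f t)" using assms by (intro pp_Suc_long) auto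
  also have "\<dots> = ?f 0 + (\<Sum>t\<le>nat y. ?f (Suc t))" by (rule sum.atMost_Suc_shift)
  also have "(\<Sum>t\<le>nat y. ?f (Suc t)) = (\<Sum>t\<le>nat y. pp n (y - int (Suc n) - int (t * Suc n)))"
    by (intro sum.cong) (auto simp: algebra_simps)
  also have "\<dots> = pp (Suc n) (y - int (Suc n))" using assms by (intro pp_Suc_long[symmetric]) auto
  finally show ?thesis by simp
qed

text \<open>Adding one part \<open>k\<close> is an injection on partitions.\<close>

lemma pp_part_mono:
  assumes "2 \<le> k" "k \<le> n"
  shows "pp n (y - int k) \<le> pp n y"
  using assms
proof (induction n arbitrary: y)
  case (Suc n)
  show ?case
  proof (cases "k = Suc n")
    case True
    then show ?thesis using pp_rec[of n y] Suc.prems pp_nonneg[of n y] by simp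
  next
    case False
    have n: "n \<ge> 1" using Suc.prems False by auto
    have "pp (Suc n) (y - int k) = (\<Sum>t\<le>nat y. pp n (y - int (t * Suc n) - int k))"
      using pp_Suc_long[OF n, of "y - int k" "nat y"] by (simp add: algebra_simps)
    also have "\<dots> \<le> (\<Sum>t\<le>nat y. pp n (y - int (t * Suc n)))"
      using Suc False by (intro sum_mono) auto
    also have "\<dots> = pp (Suc n) y" using n by simp
    finally show ?thesis .
  qed
qed auto

text \<open>Every \<open>r \<ge> 2\<close> is a sum of twos and threes.\<close>

lemma pp_mono:
  assumes "r \<ge> 2" "n \<ge> 3 \<or> n = 2 \<and> even r"
  shows "pp n (y - int r) \<le> pp n y"
proof -
  have two: "pp n (y - int (2 * s)) \<le> pp n y" for s y
  proof (induction s)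
    case (Suc s)
    have "pp n (y - int (2 * s) - int 2) \<le> pp n (y - int (2 * s))" using assms by (intro pp_part_mono) auto
    then show ?case using Suc by (simp add: algebra_simps)
  qed simp
  show ?thesis
  proof (cases "even r")
    case True
    then show ?thesis using two[of y "r div 2"] by simp
  next
    case False
    then obtain s where s: "r = 2 * s + 1" by (elim oddE)
    then obtain u where u: "s = Suc u" using assms by (cases s) auto
    have "pp n (y - int (2 * u) - int 3) \<le> pp n (y - int (2 * u))" using assms False by (intro pp_part_mono) auto
    then show ?thesis using two[of y u] by (simp add: s u algebra_simps)
  qed
qed

primrec padd :: "real list \<Rightarrow> real list \<Rightarrow> real list" where
  "padd [] q = q"
| "padd (a # p) q = (case q of [] \<Rightarrow> a # p | b # q' \<Rightarrow> (a + b) # padd p q')"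

primrec smul :: "real \<Rightarrow> real list \<Rightarrow> real list" where
  "smul c [] = []"
| "smul c (a # p) = c * a # smul c p"

definition cf :: "real list \<Rightarrow> nat \<Rightarrow> real" where "cf p i = (if i < length p then p ! i else 0)"

lemma cf_Cons: "cf (a # p) i = (case i of 0 \<Rightarrow> a | Suc j \<Rightarrow> cf p j)"
  by (auto simp: cf_def split: nat.splits)

lemma cf_padd: "cf (padd p q) i = cf p i + cf q i"
proof (induction p arbitrary: q i)
  case (Cons a p)
  then show ?case by (cases q) (auto simp: cf_Cons cf_def[of "[]"] split: nat.splits)
qed (simp add: cf_def)

lemma cf_smul: "cf (smul c p) i = c * cf p i"
  by (induction p arbitrary: i) (auto simp: cf_Cons cf_def[of "[]"] split: nat.splits)

lemma cf_replicate_append: "cf (replicate k 0 @ p) i = (if i < k then 0 else cf p (i - k))"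
  by (auto simp: cf_def nth_append)

text \<open>Coefficients of \<open>\<Prod>k\<le>n. (1 - z ^ k)\<close>.\<close>

primrec ec :: "nat \<Rightarrow> real list" where
  "ec 0 = [1]"
| "ec (Suc n) = padd (ec n) (replicate (Suc n) 0 @ smul (- 1) (ec n))"

lemma cf_ec_Suc: "cf (ec (Suc n)) j = cf (ec n) j - (if j < Suc n then 0 else cf (ec n) (j - Suc n))"
  by (simp only: ec.simps cf_padd cf_replicate_append cf_smul) simp

lemma cf_ec_01: "n \<ge> 1 \<Longrightarrow> cf (ec n) 0 = 1 \<and> cf (ec n) 1 = - 1"
proof (induction n rule: dec_induct)
  case base
  show ?case by (simp add: cf_def)
next
  case (step n)
  then show ?case unfolding cf_ec_Suc by auto
qed

lemma sum_shift_cf: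
  fixes f :: "nat \<Rightarrow> real"
  assumes "\<And>j. J < j \<Longrightarrow> f j = 0"
  shows "(\<Sum>j\<le>J. (if j < k then 0 else g (j - k)) * f j) = (\<Sum>j\<le>J. g j * f (j + k))"
proof -
  let ?h = "\<lambda>j. (if j < k then 0 else g (j - k)) * f j"
  have "(\<Sum>j\<le>J. g j * f (j + k)) = (\<Sum>j=0..J. ?h (j + k))" by (intro sum.cong) auto
  also have "\<dots> = sum ?h {0 + k..J + k}" by (rule sum.shift_bounds_cl_nat_ivl[symmetric])
  also have "\<dots> = sum ?h {..J + k}" by (intro sum.mono_neutral_left) auto
  also have "\<dots> = sum ?h {..J}" using assms by (intro sum.mono_neutral_right) auto
  finally show ?thesis by simp
qed

text \<open>Both sides satisfy the recurrence in \<open>n\<close> and vanish for negative \<open>m\<close>.\<close>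

lemma dif_eq_sum_pp_aux:
  assumes "r \<ge> 1" "n \<ge> 1" "m \<le> int J"
  shows "dif r n m = (\<Sum>j\<le>J. cf (ec n) j * pp n (m - int (j * r)))"
  using assms(2,3)
proof (induction n arbitrary: m rule: dec_induct)
  case base
  have co1: "co r (Suc 0) k = (if 0 \<le> k \<and> k < int r then 1 else 0)" for k
  proof -
    have c0: "co r 0 k = (if k = 0 then 1 else 0)" for k by (auto simp: co_def F_0)
    have "co r (Suc 0) k = (\<Sum>i<r. if k = int i then 1 else 0)" unfolding co_Suc c0 by (intro sum.cong) auto
    also have "\<dots> = (\<Sum>i<r. if i = nat k \<and> 0 \<le> k then 1 else 0)" by (intro sum.cong) auto
    also have "\<dots> = (if 0 \<le> k \<and> k < int r then 1 else 0)" by (cases "0 \<le> k") auto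
    finally show ?thesis by simp
  qed
  have e1: "cf (ec (Suc 0)) j = (if j = 0 then 1 else if j = 1 then - 1 else 0)" for j
    by (cases j; cases "j - 1") (auto simp: cf_def)
  have "(\<Sum>j\<le>J. cf (ec 1) j * pp 1 (m - int (j * r))) = (\<Sum>j\<in>{0,1}. cf (ec 1) j * pp 1 (m - int (j * r)))"
  proof (cases "J = 0")
    case True
    then show ?thesis using base assms(1) by (simp add: e1)
  next
    case False
    then show ?thesis by (intro sum.mono_neutral_right) (auto simp: e1 simp del: ec.simps)
  qed
  then show ?case using assms(1) by (auto simp: dif_def co1 e1 simp del: ec.simps)
next
  case (step n)
  let ?k = "Suc n"
  let ?G = "\<lambda>n m. \<Sum>j\<le>J. cf (ec n) j * pp n (m - int (j * r))"
  have rec: "?G (Suc n) m = ?G (Suc n) (m - int ?k) + ?G n m - ?G n (m - int (r * ?k))" if "m \<le> int J" for m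
  proof -
    have "?G (Suc n) m - ?G (Suc n) (m - int ?k) = (\<Sum>j\<le>J. cf (ec (Suc n)) j * pp n (m - int (j * r)))"
    proof -
      have "pp (Suc n) (m - int (j * r)) - pp (Suc n) (m - int ?k - int (j * r)) = pp n (m - int (j * r))" for j
        using pp_rec[of n "m - int (j * r)"] step(1) by (simp add: algebra_simps)
      then show ?thesis by (simp only: sum_subtractf[symmetric] right_diff_distrib[symmetric])
    qed
    also have "\<dots> = ?G n m - (\<Sum>j\<le>J. (if j < ?k then 0 else cf (ec n) (j - ?k)) * pp n (m - int (j * r)))"
      by (simp only: cf_ec_Suc left_diff_distrib sum_subtractf)
    also have "(\<Sum>j\<le>J. (if j < ?k then 0 else cf (ec n) (j - ?k)) * pp n (m - int (j * r)))
       = (\<Sum>j\<le>J. cf (ec n) j * pp n (m - int ((j + ?k) * r)))"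
    proof (rule sum_shift_cf)
      fix j assume "J < j"
      also have "j \<le> j * r" using assms(1) by simp
      finally have "int J < int (j * r)" by (simp only: of_nat_less_iff)
      then show "pp n (m - int (j * r)) = 0" using that by (intro pp_neg) linarith
    qed
    also have "\<dots> = ?G n (m - int (r * ?k))" by (intro sum.cong) (auto simp: algebra_simps)
    finally show ?thesis by simp
  qed
  show ?case using step.prems
  proof (induction "nat (m + 1)" arbitrary: m rule: less_induct)
    case less
    show ?case
    proof (cases "m < 0")
      case True
      have "m - int (j * r) < 0" for j using True by (simp add: less_le_trans)
      then show ?thesis using True by (simp only: pp_neg dif_neg) simp
    next
      case False
      have "dif r (Suc n) (m - int ?k) = ?G (Suc n) (m - int ?k)" using False less.prems by (intro less.hyps) auto
      moreover have "dif r n m = ?G n m" "dif r n (m - int (r * ?k)) = ?G n (m - int (r * ?k))"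
      proof -
        show "dif r n m = ?G n m" using less.prems by (rule step.IH)
        have "0 \<le> int (r * ?k)" by (rule of_nat_0_le_iff)
        then have "m - int (r * ?k) \<le> int J" using less.prems by linarith
        then show "dif r n (m - int (r * ?k)) = ?G n (m - int (r * ?k))" by (rule step.IH)
      qed
      ultimately show ?thesis using dif_recurrence[of r n m] rec[OF less.prems] by simp
    qed
  qed
qed

lemma dif_eq_sum_pp:
  assumes "r \<ge> 1" "n \<ge> 1" "m < int ((j + 1) * r)"
  shows "dif r n m = (\<Sum>i\<le>j. cf (ec n) i * pp n (m - int (i * r)))"
proof -
  define J where "J = max j (nat m)"
  have "dif r n m = (\<Sum>i\<le>J. cf (ec n) i * pp n (m - int (i * r)))"
    using assms by (intro dif_eq_sum_pp_aux) (auto simp: J_def)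
  also have "\<dots> = (\<Sum>i\<le>j. cf (ec n) i * pp n (m - int (i * r)))"
  proof (rule sum.mono_neutral_right)
    show "\<forall>i\<in>{..J} - {..j}. cf (ec n) i * pp n (m - int (i * r)) = 0"
    proof
      fix i assume "i \<in> {..J} - {..j}"
      then have "(j + 1) * r \<le> i * r" by (intro mult_right_mono) auto
      then have "int ((j + 1) * r) \<le> int (i * r)" unfolding of_nat_le_iff .
      then show "cf (ec n) i * pp n (m - int (i * r)) = 0" using assms(3) by (simp add: pp_neg)
    qed
  qed (auto simp: J_def)
  finally show ?thesis .
qed

lemma dif_nonneg_below_2r:
  assumes "r \<ge> 2" "n \<ge> 3 \<or> n = 2 \<and> even r" "m < 2 * int r"
  shows "0 \<le> dif r n m"
proof -
  have "dif r n m = pp n m - pp n (m - int r)"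
    using dif_eq_sum_pp[of r n m 1] cf_ec_01[of n] assms by (auto simp: numeral_2_eq_2)
  then show ?thesis using pp_mono[OF assms(1,2), of m] by simp
qed

section \<open>Quasi-polynomials for restricted partitions\<close>

primrec pev :: "real list \<Rightarrow> real \<Rightarrow> real" where
  "pev [] z = 0"
| "pev (a # p) z = a + z * pev p z"

lemma pev_padd [simp]: "pev (padd p q) z = pev p z + pev q z"
  by (induction p arbitrary: q) (auto simp: algebra_simps split: list.splits)

lemma pev_smul [simp]: "pev (smul c p) z = c * pev p z"
  by (induction p) (auto simp: algebra_simps)

text \<open>Taylor shift.\<close>

primrec tsh :: "real \<Rightarrow> real list \<Rightarrow> real list" where
  "tsh h [] = []"
| "tsh h (a # p) = padd (a # tsh h p) (smul h (tsh h p))"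

lemma pev_tsh [simp]: "pev (tsh h p) w = pev p (w + h)"
  by (induction p) (auto simp: algebra_simps simp del: padd.simps)

definition qrow :: "real list list \<Rightarrow> int \<Rightarrow> real list" where
  "qrow T y = T ! nat (y mod int (length T))"

text \<open>A quasi-polynomial is a list of components; the component of period \<open>d\<close> is a list of \<open>d\<close> polynomials, one for each residue.\<close>

definition qev :: "real list list list \<Rightarrow> int \<Rightarrow> real \<Rightarrow> real" where
  "qev ts y z = (\<Sum>T\<leftarrow>ts. pev (qrow T y) z)"

lemma qev_Cons: "qev (T # ts) y z = pev (qrow T y) z + qev ts y z" by (simp add: qev_def)

primrec allz :: "real list \<Rightarrow> bool" where "allz [] = True" | "allz (a # p) = (a = 0 \<and> allz p)"

lemma pev_allz: "allz p \<Longrightarrow> pev p z = 0" by (induction p) auto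

text \<open>The defining difference equation, residue by residue. The argument is centred halfway between the two shifts, which keeps the polynomials even or odd.\<close>

fun rc :: "real \<Rightarrow> real \<Rightarrow> real list list \<Rightarrow> real list list \<Rightarrow> real list list \<Rightarrow> bool" where
  "rc h m [] [] [] = True"
| "rc h m (a # A) (b # B) (c # C) = (allz (padd (tsh h a) (padd (smul (- 1) (tsh (- h) b)) (smul (- m) c))) \<and> rc h m A B C)"
| "rc h m _ _ _ = False"

lemma rc_length: "rc h m A B C \<Longrightarrow> length A = length B \<and> length C = length B"
  by (induction h m A B C rule: rc.induct) auto

lemma rc_nth:
  assumes "rc h m A B C" "i < length B"
  shows "length A = length B \<and> length C = length B \<and> pev (A ! i) (w + h) - pev (B ! i) (w - h) = m * pev (C ! i) w"
  using assms
proof (induction h m A B C arbitrary: i rule: rc.induct)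
  case (2 h m a A b B c C)
  have "pev a (w + h) - pev b (w - h) = m * pev c w"
    using 2(2) pev_allz[of "padd (tsh h a) (padd (smul (- 1) (tsh (- h) b)) (smul (- m) c))" w] by simp
  moreover have "pev (A ! j) (w + h) - pev (B ! j) (w - h) = m * pev (C ! j) w" if "j < length B" for j
    using 2 that by auto
  ultimately show ?case using 2(3) rc_length[OF 2(2)] by (cases i) auto
qed auto

fun rcs :: "nat \<Rightarrow> real \<Rightarrow> real list list list \<Rightarrow> real list list list \<Rightarrow> bool" where
  "rcs n m [] [] = True"
| "rcs n m (T # ts) (U # us) = (T \<noteq> [] \<and> rc (real n) m (rotate n T) T (rotate n U) \<and> rcs n m ts us)"
| "rcs n m _ _ = False"

lemma rcs_qev: "rcs n m ts us \<Longrightarrow> qev ts (y + int n) (w + real n) - qev ts y (w - real n) = m * qev us (y + int n) w"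
proof (induction n m ts us rule: rcs.induct)
  case (2 n m T ts U us)
  define d where "d = length T"
  define b where "b = nat (y mod int d)"
  have d: "d > 0" using 2(2) by (auto simp: d_def)
  then have b: "b < d" "int b = y mod int d" by (auto simp: b_def nat_less_iff)
  have r: "rc (real n) m (rotate n T) T (rotate n U)" using 2(2) by simp
  note R = rc_nth[OF this b(1)[unfolded d_def], of w]
  have lU: "length U = d" using R by (simp add: d_def)
  have "nat ((y + int n) mod int d) = (n + b) mod d"
  proof -
    have "(y + int n) mod int d = int ((n + b) mod d)"
      using b by (simp add: zmod_int mod_simps add.commute)
    then show ?thesis by simp
  qed
  then have "rotate n T ! b = qrow T (y + int n)" "rotate n U ! b = qrow U (y + int n)" "T ! b = qrow T y"
    using b lU by (simp_all add: qrow_def nth_rotate d_def[symmetric] b_def[symmetric])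
  then show ?case using R 2 by (simp add: qev_Cons algebra_simps)
qed (auto simp: qev_def)

text \<open>The sum \<open>2 + ... + n\<close>. In the variable \<open>2 y + sg n\<close> the partition quasi-polynomial is even or odd, and it vanishes for \<open>- sg n < y < 0\<close>.\<close>

primrec sg :: "nat \<Rightarrow> int" where
  "sg 0 = 0" | "sg (Suc n) = (if n = 0 then 0 else sg n + int (Suc n))"

definition quasi :: "nat \<Rightarrow> real \<Rightarrow> real list list list \<Rightarrow> bool" where
  "quasi n D ts \<longleftrightarrow> (\<forall>y. - sg n < y \<longrightarrow> D * pp n y = qev ts y (of_int (2 * y + sg n)))"

text \<open>The error between both sides is periodic with period \<open>n + 1\<close> on the whole range of validity, so it vanishes once it vanishes on one period.\<close>

lemma quasi_Suc:
  assumes Q: "quasi n D us" and n: "n \<ge> 1"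
    and rcs: "rcs (Suc n) m ts (us @ [replicate (Suc n) []])"
    and win: "list_all (\<lambda>i. qev ts (- i) (of_int (sg (Suc n) - 2 * i)) = (if i = 0 then m * D else 0)) [0..int n]"
  shows "quasi (Suc n) (m * D) ts"
proof -
  let ?k = "int (Suc n)" and ?s = "sg (Suc n)"
  define e where "e y = m * D * pp (Suc n) y - qev ts y (of_int (2 * y + ?s))" for y
  have s: "?s = sg n + ?k" using n by simp
  have us: "qev (us @ [replicate (Suc n) []]) y z = qev us y z" for y z
  proof -
    have "nat (y mod ?k) < Suc n" by (simp add: nat_less_iff)
    then have "qrow (replicate (Suc n) []) y = []" unfolding qrow_def length_replicate by (rule nth_replicate)
    then show ?thesis by (simp only: qev_def) simp
  qed
  have step: "e (y + ?k) = e y" if y: "- ?s < y" for y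
  proof -
    have "pp (Suc n) (y + ?k) = pp (Suc n) y + pp n (y + ?k)" using pp_rec[OF n, of "y + ?k"] by simp
    moreover have "D * pp n (y + ?k) = qev us (y + ?k) (of_int (2 * (y + ?k) + sg n))"
    proof -
      have "- sg n < y + ?k" using y s by linarith
      then show ?thesis using Q unfolding quasi_def by blast
    qed
    moreover have "qev ts (y + ?k) (of_int (2 * (y + ?k) + ?s)) - qev ts y (of_int (2 * y + ?s)) = m * qev us (y + ?k) (of_int (2 * (y + ?k) + sg n))"
    proof -
      have w: "(of_int (2 * (y + ?k) + sg n) :: real) + real (Suc n) = of_int (2 * (y + ?k) + ?s)"
        "(of_int (2 * (y + ?k) + sg n) :: real) - real (Suc n) = of_int (2 * y + ?s)" using s by simp_all
      show ?thesis using rcs_qev[OF rcs, of y "of_int (2 * (y + ?k) + sg n)"] unfolding us w .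
    qed
    ultimately show ?thesis by (simp add: e_def algebra_simps)
  qed
  have steps: "e (y + int t * ?k) = e y" if y: "- ?s < y" for y t
  proof (induction t)
    case (Suc t)
    have "y \<le> y + int t * ?k" by (simp only: le_add_same_cancel1) simp
    then have "e (y + int t * ?k + ?k) = e (y + int t * ?k)" using y by (intro step) linarith
    then show ?case using Suc by (simp add: algebra_simps)
  qed simp
  have sg0: "sg n \<ge> 0" by (induction n) auto
  have window: "e b = 0" if b: "- int n \<le> b" "b \<le> 0" for b
  proof -
    have "- b \<in> set [0..int n]" using b by simp
    with win have "qev ts (- (- b)) (of_int (?s - 2 * (- b))) = (if - b = 0 then m * D else 0)"
      unfolding list_all_iff by (rule bspec)
    moreover have "?s - 2 * (- b) = 2 * b + ?s" by simp
    ultimately have "qev ts b (of_int (2 * b + ?s)) = (if b = 0 then m * D else 0)"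
      by (simp only: minus_minus neg_equal_0_iff_equal)
    moreover have "pp (Suc n) b = (if b = 0 then 1 else 0)" using b pp_0[of "Suc n"] pp_neg[of b "Suc n"] by auto
    ultimately show ?thesis unfolding e_def by (simp only:) simp
  qed
  have "e y = 0" if y: "- ?s < y" for y
  proof -
    define b where "b = - ((- y) mod ?k)"
    have b: "- int n \<le> b" "b \<le> 0"
      using pos_mod_bound[of ?k "- y"] pos_mod_sign[of ?k "- y"] unfolding b_def by linarith+
    have yb: "y = b - ?k * ((- y) div ?k)" using mult_div_mod_eq[of ?k "- y"] unfolding b_def by linarith
    show ?thesis
    proof (cases "(- y) div ?k \<le> 0")
      case True
      define t where "t = nat (- ((- y) div ?k))"
      have "y = b + int t * ?k" using yb True by (simp add: t_def algebra_simps)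
      moreover have "- ?s < b" using b sg0 s by linarith
      ultimately show ?thesis using steps[of b t] window[OF b] by simp
    next
      case False
      define t where "t = nat ((- y) div ?k)"
      have "b = y + int t * ?k" using yb False by (simp add: t_def algebra_simps)
      then show ?thesis using steps[OF y, of t] window[OF b] by simp
    qed
  qed
  then show ?thesis by (simp add: quasi_def e_def)
qed

definition sgn_par :: "int \<Rightarrow> real" where "sgn_par y = (if even y then 1 else - 1)"

text \<open>An approximation by a polynomial \<open>Q\<close> and an alternating polynomial \<open>R\<close> with error \<open>E\<close>. The components of period at least \<open>3\<close> are absorbed into \<open>E\<close>.\<close>

definition est :: "nat \<Rightarrow> real \<Rightarrow> real list \<Rightarrow> real list \<Rightarrow> real list \<Rightarrow> bool" where
  "est n D Q R E \<longleftrightarrow> (\<forall>y. 0 \<le> 2 * y + sg n \<longrightarrow>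
     \<bar>D * pp n y - pev Q (of_int (2 * y + sg n)) - sgn_par y * pev R (of_int (2 * y + sg n))\<bar> \<le> pev E (of_int (2 * y + sg n)))"

fun domi :: "real list \<Rightarrow> real list \<Rightarrow> bool" where
  "domi [] [] = True"
| "domi [] (e # E) = (0 \<le> e \<and> domi [] E)"
| "domi (a # p) [] = False"
| "domi (a # p) (e # E) = (a \<le> e \<and> - a \<le> e \<and> domi p E)"

lemma dom_pev: "domi p E \<Longrightarrow> 0 \<le> z \<Longrightarrow> \<bar>pev p z\<bar> \<le> pev E z"
proof (induction p E rule: domi.induct)
  case (4 a p e E)
  have "\<bar>a + z * pev p z\<bar> \<le> \<bar>a\<bar> + z * \<bar>pev p z\<bar>" using 4(3) abs_triangle_ineq[of a "z * pev p z"] by (simp add: abs_mult)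
  also have "\<dots> \<le> e + z * pev E z" using 4 by (intro add_mono mult_left_mono) auto
  finally show ?case by simp
qed auto

fun doms :: "real list list list \<Rightarrow> real list list \<Rightarrow> bool" where
  "doms [] [] = True"
| "doms (T # ts) (E # Es) = (T \<noteq> [] \<and> list_all (\<lambda>p. domi p E) T \<and> doms ts Es)"
| "doms _ _ = False"

lemma doms_qev: "doms ts Es \<Longrightarrow> 0 \<le> z \<Longrightarrow> \<bar>qev ts y z\<bar> \<le> pev (foldr padd Es []) z"
proof (induction ts Es rule: doms.induct)
  case (2 T ts E Es)
  have "nat (y mod int (length T)) < length T" using 2(2) by (auto simp: nat_less_iff)
  then have "qrow T y \<in> set T" unfolding qrow_def by (rule nth_mem)
  then have "domi (qrow T y) E" using 2(2) by (auto simp: list_all_iff)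
  then have "\<bar>pev (qrow T y) z\<bar> \<le> pev E z" using 2(3) by (rule dom_pev)
  then show ?case using 2 abs_triangle_ineq[of "pev (qrow T y) z" "qev ts y z"] by (auto simp: qev_Cons)
qed (auto simp: qev_def)

lemma est_of_quasi:
  assumes "quasi n D ([Q] # [R, smul (- 1) R] # ts)" "doms ts Es" "n \<ge> 2"
  shows "est n D Q R (foldr padd Es [])"
  unfolding est_def
proof (intro allI impI)
  fix y assume y: "0 \<le> 2 * y + sg n"
  have s0: "sg n > 0"
  proof -
    define k where "k = n - 2"
    have n: "n = Suc (Suc k)" using assms(3) by (simp add: k_def)
    have "sg (Suc k) \<ge> 0" by (induction k) auto
    then show ?thesis using sg.simps(2)[of "Suc k"] unfolding n by simp
  qed
  let ?z = "of_int (2 * y + sg n) :: real"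
  have "D * pp n y = qev ([Q] # [R, smul (- 1) R] # ts) y ?z"
  proof -
    have "- sg n < y" using y s0 by linarith
    then show ?thesis using assms(1) unfolding quasi_def by blast
  qed
  also have "\<dots> = pev Q ?z + sgn_par y * pev R ?z + qev ts y ?z"
  proof -
    have "pev (qrow [R, smul (- 1) R] y) ?z = sgn_par y * pev R ?z"
      by (cases "even y") (simp_all add: qrow_def sgn_par_def numeral_2_eq_2[symmetric] even_iff_mod_2_eq_zero odd_iff_mod_2_eq_one)
    then show ?thesis by (simp add: qev_Cons qrow_def)
  qed
  finally have "D * pp n y - pev Q ?z - sgn_par y * pev R ?z = qev ts y ?z" by simp
  then show "\<bar>D * pp n y - pev Q ?z - sgn_par y * pev R ?z\<bar> \<le> pev (foldr padd Es []) ?z"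
    using doms_qev[OF assms(2), of ?z y] y by (simp only: of_int_0_le_iff)
qed

lemma dom_abs: "domi p (map abs p)" by (induction p) auto

text \<open>Where there is room to spare the alternating part is treated as an error as well.\<close>

lemma est_lump:
  assumes "est n D Q R E"
  shows "est n D Q [] (padd E (map abs R))"
  unfolding est_def
proof (intro allI impI)
  fix y assume y: "0 \<le> 2 * y + sg n"
  let ?z = "of_int (2 * y + sg n) :: real"
  have "\<bar>pev R ?z\<bar> \<le> pev (map abs R) ?z" using y by (intro dom_pev dom_abs) (simp only: of_int_0_le_iff)
  moreover have "\<bar>sgn_par y * pev R ?z\<bar> = \<bar>pev R ?z\<bar>" by (simp add: sgn_par_def)
  ultimately show "\<bar>D * pp n y - pev Q ?z - sgn_par y * pev [] ?z\<bar> \<le> pev (padd E (map abs R)) ?z"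
    using assms y unfolding est_def by (simp only: pev_padd pev.simps) (smt (verit, best) mult_zero_right)
qed

section \<open>Positivity of the pieces\<close>

text \<open>Power sums with weights \<open>ws\<close> at the nodes \<open>bs\<close>, for exponents \<open>0, 1, ...\<close>; the first list only fixes how many.\<close>

primrec mom :: "real list \<Rightarrow> real list \<Rightarrow> real list \<Rightarrow> real list" where
  "mom [] ws bs = []"
| "mom (a # q) ws bs = sum_list ws # mom q (map2 (*) ws bs) bs"

primrec psums :: "real \<Rightarrow> real list \<Rightarrow> real list" where
  "psums c [] = []"
| "psums c (b # B) = (c + b) # psums (c + b) B"

text \<open>Coefficient matrix of \<open>\<Sum>i. w i * q ((b i + 1) v + b i w)\<close>. The mixed moments \<open>\<Sum>i. w i (b i + 1) ^ x (b i) ^ y\<close> obey a Pascal-like rule, so the rows follow from the power sums by additions.\<close>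

primrec tri :: "real list \<Rightarrow> real list \<Rightarrow> real list \<Rightarrow> real list list" where
  "tri [] S B = []"
| "tri (a # q) S B = map2 (*) (a # q) (map2 (*) S B) # tri q (map2 (+) S (tl S)) (psums 0 B)"

primrec ev2 :: "real list list \<Rightarrow> real \<Rightarrow> real \<Rightarrow> real" where
  "ev2 [] v w = 0"
| "ev2 (r # rs) v w = pev r w + v * ev2 rs v w"

primrec madd :: "real list list \<Rightarrow> real list list \<Rightarrow> real list list" where
  "madd [] B = B"
| "madd (a # A) B = (case B of [] \<Rightarrow> a # A | b # B' \<Rightarrow> padd a b # madd A B')"

lemma ev2_madd [simp]: "ev2 (madd A B) v w = ev2 A v w + ev2 B v w"
  by (induction A arbitrary: B) (auto simp: algebra_simps split: list.splits)

lemma pev_sum: "pev p z = (\<Sum>k<length p. p ! k * z ^ k)"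
  by (induction p) (simp_all add: sum.lessThan_Suc_shift sum_distrib_left mult_ac del: sum.lessThan_Suc)

lemma length_mom [simp]: "length (mom q ws bs) = length q"
  by (induction q arbitrary: ws) auto

lemma nth_mom:
  assumes "k < length q" "length ws = length bs"
  shows "mom q ws bs ! k = (\<Sum>i<length ws. ws ! i * (bs ! i) ^ k)"
  using assms
proof (induction q arbitrary: ws k)
  case (Cons a q)
  show ?case
  proof (cases k)
    case 0
    then show ?thesis by (simp add: sum_list_sum_nth atLeast0LessThan)
  next
    case (Suc l)
    then have "mom (a # q) ws bs ! k = (\<Sum>i<length (map2 (*) ws bs). map2 (*) ws bs ! i * (bs ! i) ^ l)"
      using Cons.prems by (simp del: length_map length_zip, subst Cons.IH) auto
    also have "\<dots> = (\<Sum>i<length ws. ws ! i * (bs ! i) ^ k)"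
      using Cons.prems Suc by (intro sum.cong) auto
    finally show ?thesis .
  qed
qed simp

lemma length_psums [simp]: "length (psums c B) = length B"
  by (induction B arbitrary: c) auto

lemma nth_psums: "y < length B \<Longrightarrow> psums c B ! y = c + (\<Sum>t\<le>y. B ! t)"
proof (induction B arbitrary: c y)
  case (Cons b B)
  then show ?case by (cases y) (auto simp: sum.atMost_Suc_shift simp del: sum.atMost_Suc)
qed simp

lemma ev2_tri:
  assumes M: "\<And>x y. M (Suc x) y = M x (Suc y) + M x y"
    and "length S = length q" "length B \<ge> length q"
    and "\<And>y. y < length q \<Longrightarrow> S ! y = M x y"
    and "\<And>y. y < length q \<Longrightarrow> B ! y = real ((x + y) choose y)"
  shows "ev2 (tri q S B) v w = (\<Sum>i<length q. \<Sum>y<length q - i. q ! (i + y) * (M (x + i) y * real ((x + i + y) choose y)) * v ^ i * w ^ y)"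
  using assms(2-)
proof (induction q arbitrary: S B x)
  case (Cons a q)
  let ?S = "map2 (+) S (tl S)" and ?B = "psums 0 B"
  have lS: "length S = Suc (length q)" using Cons.prems by simp
  have S': "?S ! y = M (Suc x) y" if "y < length q" for y
    using that lS Cons.prems(3)[of y] Cons.prems(3)[of "Suc y"] M[of x y] by (simp add: nth_tl)
  have B': "?B ! y = real ((Suc x + y) choose y)" if "y < length q" for y
  proof -
    have "?B ! y = (\<Sum>t\<le>y. B ! t)" using that Cons.prems(2) by (subst nth_psums) auto
    also have "\<dots> = (\<Sum>t\<le>y. real ((x + t) choose t))" using that by (intro sum.cong Cons.prems(4)) auto
    also have "\<dots> = real (\<Sum>t\<le>y. (x + t) choose t)" by simp
    also have "(\<Sum>t\<le>y. (x + t) choose t) = (Suc (x + y) choose y)" by (rule sum_choose_lower)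
    finally show ?thesis by simp
  qed
  have "pev (map2 (*) (a # q) (map2 (*) S B)) w = (\<Sum>y<Suc (length q). (a # q) ! y * (M x y * real ((x + y) choose y)) * w ^ y)"
  proof -
    have "length (map2 (*) (a # q) (map2 (*) S B)) = Suc (length q)" using lS Cons.prems(2) by simp
    then show ?thesis unfolding pev_sum using lS Cons.prems by (intro sum.cong) auto
  qed
  moreover have "ev2 (tri q ?S ?B) v w = (\<Sum>i<length q. \<Sum>y<length q - i. q ! (i + y) * (M (Suc x + i) y * real ((Suc x + i + y) choose y)) * v ^ i * w ^ y)"
    by (rule Cons.IH) (use lS Cons.prems(2) S' B' in auto)
  ultimately show ?case
    by (simp add: sum.lessThan_Suc_shift sum_distrib_left mult_ac del: sum.lessThan_Suc)
qed simp

lemma ev2_tri_moments: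
  assumes "length ws = length bs" "length B \<ge> length q" "\<And>y. y < length q \<Longrightarrow> B ! y = 1"
  shows "ev2 (tri q (mom q ws bs) B) v w = (\<Sum>i<length ws. ws ! i * pev q ((bs ! i + 1) * v + bs ! i * w))"
proof -
  define M where "M x y = (\<Sum>i<length ws. ws ! i * ((bs ! i + 1) ^ x * (bs ! i) ^ y))" for x y
  have "ev2 (tri q (mom q ws bs) B) v w
    = (\<Sum>i<length q. \<Sum>y<length q - i. q ! (i + y) * (M (0 + i) y * real ((0 + i + y) choose y)) * v ^ i * w ^ y)"
  proof (rule ev2_tri)
    show "M (Suc x) y = M x (Suc y) + M x y" for x y
      by (simp add: M_def sum.distrib[symmetric] algebra_simps)
    show "mom q ws bs ! y = M 0 y" if "y < length q" for y using that assms by (simp add: nth_mom M_def)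
  qed (use assms in auto)
  also have "\<dots> = (\<Sum>(i, y)\<in>{(i, y). i + y < length q}. q ! (i + y) * (M i y * real ((i + y) choose y)) * v ^ i * w ^ y)"
    by (subst sum.Sigma) (auto intro!: sum.cong)
  also have "\<dots> = (\<Sum>k<length q. \<Sum>i\<le>k. q ! k * (M i (k - i) * real (k choose (k - i))) * v ^ i * w ^ (k - i))"
    by (subst sum.triangle_reindex) (auto intro!: sum.cong)
  also have "\<dots> = (\<Sum>k<length q. \<Sum>l<length ws. ws ! l * (q ! k * ((bs ! l + 1) * v + bs ! l * w) ^ k))"
  proof (rule sum.cong)
    fix k
    have "(\<Sum>l<length ws. ws ! l * (q ! k * ((bs ! l + 1) * v + bs ! l * w) ^ k))
       = (\<Sum>l<length ws. \<Sum>i\<le>k. q ! k * (ws ! l * ((bs ! l + 1) ^ i * (bs ! l) ^ (k - i)) * real (k choose (k - i))) * v ^ i * w ^ (k - i))"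
    proof (rule sum.cong)
      fix l
      have "((bs ! l + 1) * v + bs ! l * w) ^ k
          = (\<Sum>i\<le>k. real (k choose i) * ((bs ! l + 1) * v) ^ i * (bs ! l * w) ^ (k - i))" by (rule binomial_ring)
      also have "\<dots> = (\<Sum>i\<le>k. real (k choose (k - i)) * ((bs ! l + 1) ^ i * v ^ i) * ((bs ! l) ^ (k - i) * w ^ (k - i)))"
      proof (rule sum.cong[OF refl])
        fix i assume "i \<in> {..k}"
        then have "k choose i = k choose (k - i)" by (intro binomial_symmetric) auto
        then show "real (k choose i) * ((bs ! l + 1) * v) ^ i * (bs ! l * w) ^ (k - i)
           = real (k choose (k - i)) * ((bs ! l + 1) ^ i * v ^ i) * ((bs ! l) ^ (k - i) * w ^ (k - i))"
          by (simp only: power_mult_distrib)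
      qed
      finally show "ws ! l * (q ! k * ((bs ! l + 1) * v + bs ! l * w) ^ k)
         = (\<Sum>i\<le>k. q ! k * (ws ! l * ((bs ! l + 1) ^ i * (bs ! l) ^ (k - i)) * real (k choose (k - i))) * v ^ i * w ^ (k - i))"
        by (simp only: sum_distrib_left mult_ac)
    qed simp
    also have "\<dots> = (\<Sum>i\<le>k. q ! k * (M i (k - i) * real (k choose (k - i))) * v ^ i * w ^ (k - i))"
      unfolding M_def by (subst sum.swap) (simp add: sum_distrib_left sum_distrib_right mult_ac)
    finally show "(\<Sum>i\<le>k. q ! k * (M i (k - i) * real (k choose (k - i))) * v ^ i * w ^ (k - i))
       = (\<Sum>l<length ws. ws ! l * (q ! k * ((bs ! l + 1) * v + bs ! l * w) ^ k))" by simp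
  qed simp
  also have "\<dots> = (\<Sum>l<length ws. ws ! l * pev q ((bs ! l + 1) * v + bs ! l * w))"
    by (subst sum.swap) (simp add: pev_sum sum_distrib_left)
  finally show ?thesis .
qed

primrec nonneg :: "real list \<Rightarrow> bool" where "nonneg [] = True" | "nonneg (a # p) = (0 \<le> a \<and> nonneg p)"

lemma pev_nonneg: "nonneg p \<Longrightarrow> 0 \<le> z \<Longrightarrow> 0 \<le> pev p z" by (induction p) auto

text \<open>Horner evaluation at \<open>h\<close> from the leading row down, with all intermediate results nonnegative. For \<open>v \<ge> h\<close> the true values can then only be larger.\<close>

primrec hchk :: "real \<Rightarrow> real list \<Rightarrow> real list list \<Rightarrow> bool" where
  "hchk h acc [] = True"
| "hchk h acc (r # rs) = (let b = padd r (smul h acc) in nonneg b \<and> hchk h b rs)"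

lemma hchk_sound:
  assumes "hchk h acc rs" "0 \<le> h" "h \<le> v" "0 \<le> w" "0 \<le> pev acc w" "pev acc w \<le> x"
  shows "0 \<le> foldl (\<lambda>x r. pev r w + v * x) x rs"
  using assms
proof (induction rs arbitrary: acc x)
  case (Cons r rs)
  let ?b = "padd r (smul h acc)"
  have "h * pev acc w \<le> v * x" using Cons.prems by (intro mult_mono) auto
  moreover have "0 \<le> pev ?b w" using Cons.prems by (intro pev_nonneg) (auto simp: Let_def)
  ultimately have "0 \<le> foldl (\<lambda>x r. pev r w + v * x) (pev r w + v * x) rs"
    using Cons.prems by (intro Cons.IH[of ?b]) (auto simp: Let_def)
  then show ?case by simp
qed simp

lemma ev2_foldl: "ev2 rw v w = foldl (\<lambda>x r. pev r w + v * x) 0 (rev rw)"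
  by (simp add: foldl_conv_foldr) (induction rw, auto)

lemma hchk_ev2: "hchk h [] (rev rw) \<Longrightarrow> 0 \<le> h \<Longrightarrow> h \<le> v \<Longrightarrow> 0 \<le> w \<Longrightarrow> 0 \<le> ev2 rw v w"
  unfolding ev2_foldl by (rule hchk_sound) auto

definition rowchk :: "real \<Rightarrow> real list list \<Rightarrow> bool" where
  "rowchk h rw \<longleftrightarrow> list_all (\<lambda>r. hchk h [] (rev (map (\<lambda>a. [a]) r))) rw"

lemma rowchk_ev2:
  assumes "rowchk h rw" "0 \<le> h" "h \<le> w" "0 \<le> v"
  shows "0 \<le> ev2 rw v w"
proof -
  have single: "ev2 (map (\<lambda>a. [a]) r) w 0 = pev r w" for r by (induction r) auto
  have "0 \<le> pev r w" if "r \<in> set rw" for r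
    using hchk_ev2[of h "map (\<lambda>a. [a]) r" w 0] single[of r] assms that by (simp add: rowchk_def list_all_iff)
  then show ?thesis using assms(4) by (induction rw) auto
qed

lemma ev2_shift: "ev2 (map (tsh h) rw) v w = ev2 rw v (w + h)"
  by (induction rw) auto

text \<open>One of the two variables is large, because a positive combination of them is a multiple of \<open>r\<close>; the first conjunct treats large \<open>v\<close>, the second large \<open>w\<close>.\<close>

definition poschk :: "real \<Rightarrow> real \<Rightarrow> real \<Rightarrow> real list list \<Rightarrow> bool" where
  "poschk h x h' rw \<longleftrightarrow> hchk h [] (rev (map (tsh x) rw)) \<and> rowchk h' rw"

lemma poschk_ev2:
  assumes "poschk h x h' rw" "0 \<le> h" "0 \<le> h'" "0 \<le> v" "x \<le> w" "h \<le> v \<or> h' \<le> w"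
  shows "0 \<le> ev2 rw v w"
  using assms(6)
proof
  assume "h \<le> v"
  then show ?thesis using hchk_ev2[of h "map (tsh x) rw" v "w - x"] assms by (simp add: poschk_def ev2_shift)
next
  assume "h' \<le> w"
  then show ?thesis using rowchk_ev2[of h' rw w v] assms by (simp add: poschk_def)
qed

primrec alt :: "real \<Rightarrow> real \<Rightarrow> real list \<Rightarrow> real list" where
  "alt e \<rho> [] = []"
| "alt e \<rho> (c # cs) = e * c # alt (e * \<rho>) \<rho> cs"

lemma length_alt [simp]: "length (alt e \<rho> cs) = length cs" by (induction cs arbitrary: e) auto

lemma nth_alt: "i < length cs \<Longrightarrow> alt e \<rho> cs ! i = e * \<rho> ^ i * cs ! i"
proof (induction cs arbitrary: e i)
  case (Cons c cs)
  then show ?case by (cases i) auto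
qed simp

definition chamber_rows :: "real list \<Rightarrow> real list \<Rightarrow> real list \<Rightarrow> real list \<Rightarrow> real list \<Rightarrow> real \<Rightarrow> real \<Rightarrow> real list \<Rightarrow> real list list" where
  "chamber_rows Q R E cs bs s \<rho> B =
     madd (tri Q (mom Q cs bs) B) (madd (tri R (mom R (alt s \<rho> cs) bs) B) (tri E (mom E (map (\<lambda>c. - \<bar>c\<bar>) cs) bs) B))"

lemma ev2_chamber_rows:
  assumes l: "length cs = length bs" and B: "length Q \<le> length B" "length R \<le> length B" "length E \<le> length B" "\<And>y. y < length B \<Longrightarrow> B ! y = 1"
  shows "ev2 (chamber_rows Q R E cs bs s \<rho> B) v w =
    (\<Sum>i<length cs. cs ! i * pev Q ((bs ! i + 1) * v + bs ! i * w) + s * \<rho> ^ i * cs ! i * pev R ((bs ! i + 1) * v + bs ! i * w)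
       - \<bar>cs ! i\<bar> * pev E ((bs ! i + 1) * v + bs ! i * w))"
proof -
  have e: "ev2 (tri q (mom q ws bs) B) v w = (\<Sum>i<length ws. ws ! i * pev q ((bs ! i + 1) * v + bs ! i * w))"
    if "length q \<le> length B" "length ws = length bs" for q ws
    using that B by (intro ev2_tri_moments) auto
  show ?thesis
    unfolding chamber_rows_def ev2_madd
    using l B by (simp add: e nth_alt sum.distrib sum_subtractf sum_negf)
qed

text \<open>The arguments of the partition quasi-polynomials in the sum are nonnegative combinations of the two distances to the ends of the range, with coefficients \<open>b i + 1\<close> and \<open>b i\<close>.\<close>

lemma chamber_nonneg:
  fixes v w :: real
  assumes est: "est n D Q R E" and D: "D > 0" and r: "r \<ge> 1" "n \<ge> 1"
    and m: "2 * m + sg n < 2 * int ((j + 1) * r)"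
    and cs: "cs = take (j + 1) (ec n)" "j < length (ec n)" and l: "length bs = j + 1"
    and Z: "\<And>i. i \<le> j \<Longrightarrow> of_int (2 * m + sg n) - 2 * real i * real r = (bs ! i + 1) * v + bs ! i * w"
      "\<And>i. i \<le> j \<Longrightarrow> 0 \<le> (bs ! i + 1) * v + bs ! i * w"
    and B: "B = replicate L 1" "length Q \<le> L" "length R \<le> L" "length E \<le> L"
    and chk: "0 \<le> ev2 (chamber_rows Q R E cs bs (sgn_par m) (sgn_par (int r)) B) v w"
  shows "0 \<le> dif r n m"
proof -
  have sg0: "sg n \<ge> 0" by (induction n) auto
  have "m < int ((j + 1) * r)" using m sg0 by linarith
  then have d: "dif r n m = (\<Sum>i\<le>j. cf (ec n) i * pp n (m - int (i * r)))" using r by (intro dif_eq_sum_pp) auto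
  let ?z = "\<lambda>i. (bs ! i + 1) * v + bs ! i * w"
  have par: "sgn_par (m - int (i * r)) = sgn_par m * sgn_par (int r) ^ i" for i
    by (induction i) (auto simp: sgn_par_def)
  have bound: "cs ! i * pev Q (?z i) + sgn_par m * sgn_par (int r) ^ i * cs ! i * pev R (?z i) - \<bar>cs ! i\<bar> * pev E (?z i)
     \<le> D * (cf (ec n) i * pp n (m - int (i * r)))" if i: "i \<le> j" for i
  proof -
    define y where "y = m - int (i * r)"
    have zi: "of_int (2 * y + sg n) = ?z i" using Z(1)[OF i] by (simp add: y_def algebra_simps)
    then have "0 \<le> 2 * y + sg n" using Z(2)[OF i] by (metis of_int_0_le_iff)
    then have "\<bar>D * pp n y - pev Q (?z i) - sgn_par y * pev R (?z i)\<bar> \<le> pev E (?z i)"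
      using est unfolding est_def zi[symmetric] by blast
    then have "\<bar>cs ! i\<bar> * \<bar>D * pp n y - pev Q (?z i) - sgn_par y * pev R (?z i)\<bar> \<le> \<bar>cs ! i\<bar> * pev E (?z i)"
      by (intro mult_left_mono) auto
    then have "\<bar>cs ! i * (D * pp n y - pev Q (?z i) - sgn_par y * pev R (?z i))\<bar> \<le> \<bar>cs ! i\<bar> * pev E (?z i)"
      by (simp only: abs_mult)
    moreover have "cf (ec n) i = cs ! i" using i cs by (auto simp: cf_def)
    ultimately show ?thesis unfolding y_def par by (simp add: abs_le_iff algebra_simps)
  qed
  have lc: "length cs = j + 1" using cs by simp
  have "ev2 (chamber_rows Q R E cs bs (sgn_par m) (sgn_par (int r)) B) v w =
    (\<Sum>i<length cs. cs ! i * pev Q (?z i) + sgn_par m * sgn_par (int r) ^ i * cs ! i * pev R (?z i) - \<bar>cs ! i\<bar> * pev E (?z i))"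
    using B l lc by (intro ev2_chamber_rows) auto
  also have "\<dots> \<le> (\<Sum>i<length cs. D * (cf (ec n) i * pp n (m - int (i * r))))"
    using lc by (intro sum_mono bound) auto
  also have "\<dots> = D * dif r n m" unfolding d lc by (simp add: sum_distrib_left lessThan_Suc_atMost del: sum.lessThan_Suc)
  finally have "0 \<le> D * dif r n m" using chk by linarith
  then show ?thesis using D by (simp add: zero_le_mult_iff)
qed

section \<open>Tables of quasi-polynomials up to twelve parts\<close>

lemma quasi_base: "quasi 1 1 [[[]]]"
  by (simp add: quasi_def qev_def qrow_def)

lemma quasi_step:
  assumes "quasi n D us" "n \<ge> 1" "N = Suc n" "zr = replicate N []" "rcs N m ts (us @ [zr])" "sg N = S" "ks = [0..int n]" "M = m * D"
    and "list_all (\<lambda>i. qev ts (- i) (of_int (S - 2 * i)) = (if i = 0 then M else 0)) ks"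
  shows "quasi N M ts"
  using quasi_Suc[OF assms(1,2), of m ts] assms(3-9) by (simp only:)

text \<open>Component \<open>d\<close> of table \<open>n\<close> lists, for each residue modulo \<open>d\<close>, the coefficients of a polynomial in \<open>2 y + sg n\<close>. All entries are scaled by a common denominator, so that they are integers. Their correctness rests only on the difference equation and one period of values, as checked below.\<close>

definition tb2 :: "real list list list" where
  "tb2 = [[[1]],
    [[1], [- 1]]]"

definition tb3 :: "real list list list" where
  "tb3 = [[[0, 1]],
    [[3], [- 3]],
    [[4], [- 4], [0]]]"

definition tb4 :: "real list list list" where
  "tb4 = [[[- 29, 0, 3]],
    [[0, 18], [0, - 18]],
    [[128], [- 64], [- 64]],
    [[72], [- 72], [- 72], [72]]]"

definition tb5 :: "real list list list" where
  "tb5 = [[[0, - 54, 0, 1]],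
    [[0, 90], [0, - 90]],
    [[640], [- 640], [0]],
    [[720], [0], [- 720], [0]],
    [[1152], [- 1152], [0], [0], [0]]]"

definition tb6 :: "real list list list" where
  "tb6 = [[[15016, 0, - 900, 0, 5]],
    [[- 47400, 0, 900], [47400, 0, - 900]],
    [[12800, 12800], [12800, - 12800], [- 25600, 0]],
    [[86400], [0], [- 86400], [0]],
    [[221184], [- 55296], [- 55296], [- 55296], [- 55296]],
    [[38400], [- 38400], [- 76800], [- 38400], [38400], [76800]]]"

definition tb7 :: "real list list list" where
  "tb7 = [[[0, 105955, 0, - 1390, 0, 3]],
    [[- 1921500, 0, 18900], [1921500, 0, - 18900]],
    [[0, 358400], [- 716800, - 179200], [716800, - 179200]],
    [[1814400], [- 1814400], [- 1814400], [1814400]],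
    [[4644864], [- 2322432], [2322432], [- 4644864], [0]],
    [[3225600], [1612800], [- 1612800], [- 3225600], [- 1612800], [1612800]],
    [[8294400], [- 8294400], [0], [0], [0], [0], [0]]]"

definition tb8 :: "real list list list" where
  "tb8 = [[[- 124907633, 0, 4695327, 0, - 21315, 0, 21]],
    [[0, - 97637400, 0, 264600], [0, 97637400, 0, - 264600]],
    [[160563200, 120422400], [160563200, - 120422400], [- 321126400, 0]],
    [[381024000, 76204800], [381024000, - 76204800], [- 381024000, - 76204800], [- 381024000, 76204800]],
    [[3121348608], [- 1560674304], [0], [0], [- 1560674304]],
    [[1083801600], [1083801600], [0], [- 1083801600], [- 1083801600], [0]],
    [[4777574400], [- 796262400], [- 796262400], [- 796262400], [- 796262400], [- 796262400], [- 796262400]],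
    [[2438553600], [- 2438553600], [0], [0], [- 2438553600], [2438553600], [0], [0]]]"

definition tb9 :: "real list list list" where
  "tb9 = [[[0, - 333418400, 0, 3037608, 0, - 5964, 0, 3]],
    [[0, - 1457416800, 0, 2381400], [0, 1457416800, 0, - 2381400]],
    [[- 15534489600, 160563200, 60211200], [15534489600, 160563200, - 60211200], [0, - 321126400, 0]],
    [[0, 1371686400], [- 5486745600, 0], [0, - 1371686400], [5486745600, 0]],
    [[28092137472], [- 28092137472], [0], [0], [0]],
    [[9754214400], [9754214400], [0], [- 9754214400], [- 9754214400], [0]],
    [[42998169600], [- 14332723200], [28665446400], [- 28665446400], [14332723200], [- 42998169600], [0]],
    [[43893964800], [0], [0], [0], [- 43893964800], [0], [0], [0]],
    [[52022476800], [- 52022476800], [0], [- 26011238400], [26011238400], [0], [- 26011238400], [26011238400], [0]]]"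

definition tb10 :: "real list list list" where
  "tb10 = [[[632787234176, 0, - 16146784000, 0, 55156080, 0, - 53760, 0, 15]],
    [[4534325308800, 0, - 33911136000, 0, 23814000], [- 4534325308800, 0, 33911136000, 0, - 23814000]],
    [[- 12780830720000, 0, 32112640000], [6390415360000, - 192675840000, - 16056320000], [6390415360000, 192675840000, - 16056320000]],
    [[0, 548674560000], [- 2194698240000, 0], [0, - 548674560000], [2194698240000, 0]],
    [[4270004895744, 1123685498880], [4270004895744, - 1123685498880], [- 1348422598656, 0], [- 5843164594176, 0], [- 1348422598656, 0]],
    [[5202247680000], [2601123840000], [- 2601123840000], [- 5202247680000], [- 2601123840000], [2601123840000]],
    [[22932357120000], [- 22932357120000], [22932357120000], [0], [- 11466178560000], [- 11466178560000], [0]],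
    [[17557585920000], [0], [17557585920000], [0], [- 17557585920000], [0], [- 17557585920000], [0]],
    [[41617981440000], [0], [0], [- 20808990720000], [0], [0], [- 20808990720000], [0], [0]],
    [[16855282483200], [- 16855282483200], [- 11236854988800], [11236854988800], [- 11236854988800], [- 16855282483200], [16855282483200], [11236854988800], [- 11236854988800], [11236854988800]]]"

definition tb11 :: "real list list list" where
  "tb11 = [[[0, 5486122777261, 0, - 36102624300, 0, 56912982, 0, - 30300, 0, 5]],
    [[342568928948400, 0, - 1689603300000, 0, 785862000], [- 342568928948400, 0, 1689603300000, 0, - 785862000]],
    [[- 588849479680000, 3532390400000, 1059717120000], [588849479680000, 3532390400000, - 1059717120000], [0, - 7064780800000, 0]],
    [[126743823360000, 18106260480000], [126743823360000, - 18106260480000], [- 126743823360000, - 18106260480000], [- 126743823360000, 18106260480000]],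
    [[0, 59330594340864], [- 207657080193024, - 14832648585216], [29665297170432, - 14832648585216], [- 29665297170432, - 14832648585216], [207657080193024, - 14832648585216]],
    [[171674173440000], [- 171674173440000], [- 343348346880000], [- 171674173440000], [171674173440000], [343348346880000]],
    [[1513535569920000], [- 756767784960000], [0], [0], [756767784960000], [- 1513535569920000], [0]],
    [[1158800670720000], [0], [0], [1158800670720000], [- 1158800670720000], [0], [0], [- 1158800670720000]],
    [[1373393387520000], [0], [1373393387520000], [- 1373393387520000], [1373393387520000], [- 1373393387520000], [0], [- 1373393387520000], [0]],
    [[1483264858521600], [370816214630400], [- 370816214630400], [370816214630400], [- 370816214630400], [- 1483264858521600], [- 370816214630400], [370816214630400], [- 370816214630400], [370816214630400]],
    [[3371056496640000], [- 3371056496640000], [0], [0], [0], [0], [0], [0], [0], [0], [0]]]"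

definition tb12 :: "real list list list" where
  "tb12 = [[[- 26096916318766147, 0, 479731329466125, 0, - 1246317800310, 0, 1029069426, 0, - 321255, 0, 33]],
    [[0, 28464118105500000, 0, - 42150494232000, 0, 10373378400], [0, - 28464118105500000, 0, 42150494232000, 0, - 10373378400]],
    [[- 81512734392320000, - 42221249495040000, 116568883200000, 23313776640000], [- 81512734392320000, 42221249495040000, 116568883200000, - 23313776640000], [163025468784640000, 0, - 233137766400000, 0]],
    [[- 498121332065280000, 8365092341760000, 597506595840000], [498121332065280000, 8365092341760000, - 597506595840000], [498121332065280000, - 8365092341760000, - 597506595840000], [- 498121332065280000, - 8365092341760000, 597506595840000]],
    [[469898307179642880, 46989830717964288], [- 328928815025750016, - 23494915358982144], [- 328928815025750016, 23494915358982144], [469898307179642880, - 46989830717964288], [- 281938984307785728, 0]],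
    [[351245358858240000, 11330495447040000], [351245358858240000, - 11330495447040000], [0, - 22660990894080000], [- 351245358858240000, - 11330495447040000], [- 351245358858240000, 11330495447040000], [0, 22660990894080000]],
    [[2397440342753280000], [- 1198720171376640000], [0], [0], [0], [0], [- 1198720171376640000]],
    [[917770131210240000], [0], [0], [917770131210240000], [- 917770131210240000], [0], [0], [- 917770131210240000]],
    [[1450303417221120000], [- 725151708610560000], [1450303417221120000], [- 725151708610560000], [1450303417221120000], [- 725151708610560000], [- 725151708610560000], [- 725151708610560000], [- 725151708610560000]],
    [[1174745767949107200], [587372883974553600], [587372883974553600], [1174745767949107200], [0], [- 1174745767949107200], [- 587372883974553600], [- 587372883974553600], [- 1174745767949107200], [0]],
    [[4854321355161600000], [- 485432135516160000], [- 485432135516160000], [- 485432135516160000], [- 485432135516160000], [- 485432135516160000], [- 485432135516160000], [- 485432135516160000], [- 485432135516160000], [- 485432135516160000], [- 485432135516160000]],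
    [[1631591344373760000], [- 1631591344373760000], [815795672186880000], [- 815795672186880000], [- 815795672186880000], [815795672186880000], [- 1631591344373760000], [1631591344373760000], [- 815795672186880000], [815795672186880000], [815795672186880000], [- 815795672186880000]]]"

lemma quasi_2: "quasi 2 2 tb2"
proof (rule quasi_step[OF quasi_base, where m = 2 and zr = "[[], []]" and S = 2 and ks = "[0, 1]"])
  show "[[], []] = replicate 2 ([] :: real list)" by (simp add: eval_nat_numeral)
  show "rcs 2 2 tb2 ([[[]]] @ [[[], []]])" by (simp add: tb2_def rotate_drop_take numeral_2_eq_2[symmetric])
  show "sg 2 = 2" by (simp add: eval_nat_numeral)
  show "[0, 1] = [0..int 1]" by (simp add: upto.simps)
  show "list_all (\<lambda>i. qev tb2 (- i) (of_int (2 - 2 * i)) = (if i = 0 then 2 else 0)) [0, 1]"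
    by (simp add: tb2_def qev_def qrow_def)
qed simp_all

lemma quasi_3: "quasi 3 12 tb3"
proof (rule quasi_step[OF quasi_2, where m = 6 and zr = "[[], [], []]" and S = 5 and ks = "[0, 1, 2]"])
  show "[[], [], []] = replicate 3 ([] :: real list)" by (simp add: eval_nat_numeral)
  show "rcs 3 6 tb3 (tb2 @ [[[], [], []]])" by (simp add: tb2_def tb3_def rotate_drop_take numeral_2_eq_2[symmetric])
  show "sg 3 = 5" by (simp add: eval_nat_numeral)
  show "[0, 1, 2] = [0..int 2]" by (simp add: upto.simps)
  show "list_all (\<lambda>i. qev tb3 (- i) (of_int (5 - 2 * i)) = (if i = 0 then 12 else 0)) [0, 1, 2]"
    by (simp add: tb3_def qev_def qrow_def)
qed simp_all

lemma quasi_4: "quasi 4 576 tb4"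
proof (rule quasi_step[OF quasi_3, where m = 48 and zr = "[[], [], [], []]" and S = 9 and ks = "[0, 1, 2, 3]"])
  show "[[], [], [], []] = replicate 4 ([] :: real list)" by (simp add: eval_nat_numeral)
  show "rcs 4 48 tb4 (tb3 @ [[[], [], [], []]])" by (simp add: tb3_def tb4_def rotate_drop_take numeral_2_eq_2[symmetric])
  show "sg 4 = 9" by (simp add: eval_nat_numeral)
  show "[0, 1, 2, 3] = [0..int 3]" by (simp add: upto.simps)
  show "list_all (\<lambda>i. qev tb4 (- i) (of_int (9 - 2 * i)) = (if i = 0 then 576 else 0)) [0, 1, 2, 3]"
    by (simp add: tb4_def qev_def qrow_def)
qed simp_all

lemma quasi_5: "quasi 5 5760 tb5"
proof (rule quasi_step[OF quasi_4, where m = 10 and zr = "[[], [], [], [], []]" and S = 14 and ks = "[0, 1, 2, 3, 4]"])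
  show "[[], [], [], [], []] = replicate 5 ([] :: real list)" by (simp add: eval_nat_numeral)
  show "rcs 5 10 tb5 (tb4 @ [[[], [], [], [], []]])" by (simp add: tb4_def tb5_def rotate_drop_take numeral_2_eq_2[symmetric])
  show "sg 5 = 14" by (simp add: eval_nat_numeral)
  show "[0, 1, 2, 3, 4] = [0..int 4]" by (simp add: upto.simps)
  show "list_all (\<lambda>i. qev tb5 (- i) (of_int (14 - 2 * i)) = (if i = 0 then 5760 else 0)) [0, 1, 2, 3, 4]"
    by (simp add: tb5_def qev_def qrow_def)
qed simp_all

lemma quasi_6: "quasi 6 1382400 tb6"
proof (rule quasi_step[OF quasi_5, where m = 240 and zr = "[[], [], [], [], [], []]" and S = 20 and ks = "[0, 1, 2, 3, 4, 5]"])
  show "[[], [], [], [], [], []] = replicate 6 ([] :: real list)" by (simp add: eval_nat_numeral)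
  show "rcs 6 240 tb6 (tb5 @ [[[], [], [], [], [], []]])" by (simp add: tb5_def tb6_def rotate_drop_take numeral_2_eq_2[symmetric])
  show "sg 6 = 20" by (simp add: eval_nat_numeral)
  show "[0, 1, 2, 3, 4, 5] = [0..int 5]" by (simp add: upto.simps)
  show "list_all (\<lambda>i. qev tb6 (- i) (of_int (20 - 2 * i)) = (if i = 0 then 1382400 else 0)) [0, 1, 2, 3, 4, 5]"
    by (simp add: tb6_def qev_def qrow_def)
qed simp_all

lemma quasi_7: "quasi 7 58060800 tb7"
proof (rule quasi_step[OF quasi_6, where m = 42 and zr = "[[], [], [], [], [], [], []]" and S = 27 and ks = "[0, 1, 2, 3, 4, 5, 6]"])
  show "[[], [], [], [], [], [], []] = replicate 7 ([] :: real list)" by (simp add: eval_nat_numeral)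
  show "rcs 7 42 tb7 (tb6 @ [[[], [], [], [], [], [], []]])" by (simp add: tb6_def tb7_def rotate_drop_take numeral_2_eq_2[symmetric])
  show "sg 7 = 27" by (simp add: eval_nat_numeral)
  show "[0, 1, 2, 3, 4, 5, 6] = [0..int 6]" by (simp add: upto.simps)
  show "list_all (\<lambda>i. qev tb7 (- i) (of_int (27 - 2 * i)) = (if i = 0 then 58060800 else 0)) [0, 1, 2, 3, 4, 5, 6]"
    by (simp add: tb7_def qev_def qrow_def)
qed simp_all

lemma quasi_8: "quasi 8 39016857600 tb8"
proof (rule quasi_step[OF quasi_7, where m = 672 and zr = "[[], [], [], [], [], [], [], []]" and S = 35 and ks = "[0, 1, 2, 3, 4, 5, 6, 7]"])
  show "[[], [], [], [], [], [], [], []] = replicate 8 ([] :: real list)" by (simp add: eval_nat_numeral)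
  show "rcs 8 672 tb8 (tb7 @ [[[], [], [], [], [], [], [], []]])" by (simp add: tb7_def tb8_def rotate_drop_take numeral_2_eq_2[symmetric])
  show "sg 8 = 35" by (simp add: eval_nat_numeral)
  show "[0, 1, 2, 3, 4, 5, 6, 7] = [0..int 7]" by (simp add: upto.simps)
  show "list_all (\<lambda>i. qev tb8 (- i) (of_int (35 - 2 * i)) = (if i = 0 then 39016857600 else 0)) [0, 1, 2, 3, 4, 5, 6, 7]"
    by (simp add: tb8_def qev_def qrow_def)
qed simp_all

lemma quasi_9: "quasi 9 702303436800 tb9"
proof (rule quasi_step[OF quasi_8, where m = 18 and zr = "[[], [], [], [], [], [], [], [], []]" and S = 44 and ks = "[0, 1, 2, 3, 4, 5, 6, 7, 8]"])
  show "[[], [], [], [], [], [], [], [], []] = replicate 9 ([] :: real list)" by (simp add: eval_nat_numeral)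
  show "rcs 9 18 tb9 (tb8 @ [[[], [], [], [], [], [], [], [], []]])" by (simp add: tb8_def tb9_def rotate_drop_take numeral_2_eq_2[symmetric])
  show "sg 9 = 44" by (simp add: eval_nat_numeral)
  show "[0, 1, 2, 3, 4, 5, 6, 7, 8] = [0..int 8]" by (simp add: upto.simps)
  show "list_all (\<lambda>i. qev tb9 (- i) (of_int (44 - 2 * i)) = (if i = 0 then 702303436800 else 0)) [0, 1, 2, 3, 4, 5, 6, 7, 8]"
    by (simp add: tb9_def qev_def qrow_def)
qed simp_all

lemma quasi_10: "quasi 10 561842749440000 tb10"
proof (rule quasi_step[OF quasi_9, where m = 800 and zr = "[[], [], [], [], [], [], [], [], [], []]" and S = 54 and ks = "[0, 1, 2, 3, 4, 5, 6, 7, 8, 9]"])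
  show "[[], [], [], [], [], [], [], [], [], []] = replicate 10 ([] :: real list)" by (simp add: eval_nat_numeral)
  show "rcs 10 800 tb10 (tb9 @ [[[], [], [], [], [], [], [], [], [], []]])" by (simp add: tb9_def tb10_def rotate_drop_take numeral_2_eq_2[symmetric])
  show "sg 10 = 54" by (simp add: eval_nat_numeral)
  show "[0, 1, 2, 3, 4, 5, 6, 7, 8, 9] = [0..int 9]" by (simp add: upto.simps)
  show "list_all (\<lambda>i. qev tb10 (- i) (of_int (54 - 2 * i)) = (if i = 0 then 561842749440000 else 0)) [0, 1, 2, 3, 4, 5, 6, 7, 8, 9]"
    by (simp add: tb10_def qev_def qrow_def)
qed simp_all

lemma quasi_11: "quasi 11 37081621463040000 tb11"
proof (rule quasi_step[OF quasi_10, where m = 66 and zr = "[[], [], [], [], [], [], [], [], [], [], []]" and S = 65 and ks = "[0, 1, 2, 3, 4, 5, 6, 7, 8, 9, 10]"])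
  show "[[], [], [], [], [], [], [], [], [], [], []] = replicate 11 ([] :: real list)" by (simp add: eval_nat_numeral)
  show "rcs 11 66 tb11 (tb10 @ [[[], [], [], [], [], [], [], [], [], [], []]])" by (simp add: tb10_def tb11_def rotate_drop_take numeral_2_eq_2[symmetric])
  show "sg 11 = 65" by (simp add: eval_nat_numeral)
  show "[0, 1, 2, 3, 4, 5, 6, 7, 8, 9, 10] = [0..int 10]" by (simp add: upto.simps)
  show "list_all (\<lambda>i. qev tb11 (- i) (of_int (65 - 2 * i)) = (if i = 0 then 37081621463040000 else 0)) [0, 1, 2, 3, 4, 5, 6, 7, 8, 9, 10]"
    by (simp add: tb11_def qev_def qrow_def)
qed simp_all

lemma quasi_12: "quasi 12 58737288397455360000 tb12"
proof (rule quasi_step[OF quasi_11, where m = 1584 and zr = "[[], [], [], [], [], [], [], [], [], [], [], []]" and S = 77 and ks = "[0, 1, 2, 3, 4, 5, 6, 7, 8, 9, 10, 11]"])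
  show "[[], [], [], [], [], [], [], [], [], [], [], []] = replicate 12 ([] :: real list)" by (simp add: eval_nat_numeral)
  show "rcs 12 1584 tb12 (tb11 @ [[[], [], [], [], [], [], [], [], [], [], [], []]])" by (simp add: tb11_def tb12_def rotate_drop_take numeral_2_eq_2[symmetric])
  show "sg 12 = 77" by (simp add: eval_nat_numeral)
  show "[0, 1, 2, 3, 4, 5, 6, 7, 8, 9, 10, 11] = [0..int 11]" by (simp add: upto.simps)
  show "list_all (\<lambda>i. qev tb12 (- i) (of_int (77 - 2 * i)) = (if i = 0 then 58737288397455360000 else 0)) [0, 1, 2, 3, 4, 5, 6, 7, 8, 9, 10, 11]"
    by (simp add: tb12_def qev_def qrow_def)
qed simp_all

lemma est_4: "est 4 576 [- 29, 0, 3] [0, 18] [200]"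
proof -
  have "quasi 4 576 ([[- 29, 0, 3]] # [[0, 18], smul (- 1) [0, 18]] # [[[128], [- 64], [- 64]],
    [[72], [- 72], [- 72], [72]]])"
    using quasi_4 by (simp add: tb4_def)
  then have "est 4 576 [- 29, 0, 3] [0, 18] (foldr padd [[128], [72]] [])"
    by (rule est_of_quasi) simp_all
  then show ?thesis by simp
qed

lemma est_5: "est 5 5760 [0, - 54, 0, 1] [0, 90] [2512]"
proof -
  have "quasi 5 5760 ([[0, - 54, 0, 1]] # [[0, 90], smul (- 1) [0, 90]] # [[[640], [- 640], [0]],
    [[720], [0], [- 720], [0]],
    [[1152], [- 1152], [0], [0], [0]]])"
    using quasi_5 by (simp add: tb5_def)
  then have "est 5 5760 [0, - 54, 0, 1] [0, 90] (foldr padd [[640], [720], [1152]] [])"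
    by (rule est_of_quasi) simp_all
  then show ?thesis by simp
qed

lemma lump_5: "est 5 5760 [0, - 54, 0, 1] [] [2512, 90]"
  using est_lump[OF est_5] by simp

lemma est_6: "est 6 1382400 [15016, 0, - 900, 0, 5] [- 47400, 0, 900] [409984, 12800]"
proof -
  have "quasi 6 1382400 ([[15016, 0, - 900, 0, 5]] # [[- 47400, 0, 900], smul (- 1) [- 47400, 0, 900]] # [[[12800, 12800], [12800, - 12800], [- 25600, 0]],
    [[86400], [0], [- 86400], [0]],
    [[221184], [- 55296], [- 55296], [- 55296], [- 55296]],
    [[38400], [- 38400], [- 76800], [- 38400], [38400], [76800]]])"
    using quasi_6 by (simp add: tb6_def)
  then have "est 6 1382400 [15016, 0, - 900, 0, 5] [- 47400, 0, 900] (foldr padd [[25600, 12800], [86400], [221184], [76800]] [])"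
    by (rule est_of_quasi) simp_all
  then show ?thesis by simp
qed

lemma lump_6: "est 6 1382400 [15016, 0, - 900, 0, 5] [] [457384, 12800, 900]"
  using est_lump[OF est_6] by simp

lemma est_7: "est 7 58060800 [0, 105955, 0, - 1390, 0, 3] [- 1921500, 0, 18900] [18696064, 358400]"
proof -
  have "quasi 7 58060800 ([[0, 105955, 0, - 1390, 0, 3]] # [[- 1921500, 0, 18900], smul (- 1) [- 1921500, 0, 18900]] # [[[0, 358400], [- 716800, - 179200], [716800, - 179200]],
    [[1814400], [- 1814400], [- 1814400], [1814400]],
    [[4644864], [- 2322432], [2322432], [- 4644864], [0]],
    [[3225600], [1612800], [- 1612800], [- 3225600], [- 1612800], [1612800]],
    [[8294400], [- 8294400], [0], [0], [0], [0], [0]]])"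
    using quasi_7 by (simp add: tb7_def)
  then have "est 7 58060800 [0, 105955, 0, - 1390, 0, 3] [- 1921500, 0, 18900] (foldr padd [[716800, 358400], [1814400], [4644864], [3225600], [8294400]] [])"
    by (rule est_of_quasi) simp_all
  then show ?thesis by simp
qed

lemma lump_7: "est 7 58060800 [0, 105955, 0, - 1390, 0, 3] [] [20617564, 358400, 18900]"
  using est_lump[OF est_7] by simp

lemma est_8: "est 8 39016857600 [- 124907633, 0, 4695327, 0, - 21315, 0, 21] [0, - 97637400, 0, 264600] [12123428608, 196627200]"
proof -
  have "quasi 8 39016857600 ([[- 124907633, 0, 4695327, 0, - 21315, 0, 21]] # [[0, - 97637400, 0, 264600], smul (- 1) [0, - 97637400, 0, 264600]] # [[[160563200, 120422400], [160563200, - 120422400], [- 321126400, 0]],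
    [[381024000, 76204800], [381024000, - 76204800], [- 381024000, - 76204800], [- 381024000, 76204800]],
    [[3121348608], [- 1560674304], [0], [0], [- 1560674304]],
    [[1083801600], [1083801600], [0], [- 1083801600], [- 1083801600], [0]],
    [[4777574400], [- 796262400], [- 796262400], [- 796262400], [- 796262400], [- 796262400], [- 796262400]],
    [[2438553600], [- 2438553600], [0], [0], [- 2438553600], [2438553600], [0], [0]]])"
    using quasi_8 by (simp add: tb8_def)
  then have "est 8 39016857600 [- 124907633, 0, 4695327, 0, - 21315, 0, 21] [0, - 97637400, 0, 264600] (foldr padd [[321126400, 120422400], [381024000, 76204800], [3121348608], [1083801600], [4777574400], [2438553600]] [])"
    by (rule est_of_quasi) simp_all
  then show ?thesis by simp
qed

lemma lump_8: "est 8 39016857600 [- 124907633, 0, 4695327, 0, - 21315, 0, 21] [] [12123428608, 294264600, 0, 264600]"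
  using est_lump[OF est_8] by simp

lemma est_9: "est 9 702303436800 [0, - 333418400, 0, 3037608, 0, - 5964, 0, 3] [0, - 1457416800, 0, 2381400] [197782198272, 1692812800, 60211200]"
proof -
  have "quasi 9 702303436800 ([[0, - 333418400, 0, 3037608, 0, - 5964, 0, 3]] # [[0, - 1457416800, 0, 2381400], smul (- 1) [0, - 1457416800, 0, 2381400]] # [[[- 15534489600, 160563200, 60211200], [15534489600, 160563200, - 60211200], [0, - 321126400, 0]],
    [[0, 1371686400], [- 5486745600, 0], [0, - 1371686400], [5486745600, 0]],
    [[28092137472], [- 28092137472], [0], [0], [0]],
    [[9754214400], [9754214400], [0], [- 9754214400], [- 9754214400], [0]],
    [[42998169600], [- 14332723200], [28665446400], [- 28665446400], [14332723200], [- 42998169600], [0]],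
    [[43893964800], [0], [0], [0], [- 43893964800], [0], [0], [0]],
    [[52022476800], [- 52022476800], [0], [- 26011238400], [26011238400], [0], [- 26011238400], [26011238400], [0]]])"
    using quasi_9 by (simp add: tb9_def)
  then have "est 9 702303436800 [0, - 333418400, 0, 3037608, 0, - 5964, 0, 3] [0, - 1457416800, 0, 2381400] (foldr padd [[15534489600, 321126400, 60211200], [5486745600, 1371686400], [28092137472], [9754214400], [42998169600], [43893964800], [52022476800]] [])"
    by (rule est_of_quasi) simp_all
  then show ?thesis by simp
qed

lemma lump_9: "est 9 702303436800 [0, - 333418400, 0, 3037608, 0, - 5964, 0, 3] [] [197782198272, 3150229600, 60211200, 2381400]"
  using est_lump[OF est_9] by simp

lemma est_10: "est 10 561842749440000 [632787234176, 0, - 16146784000, 0, 55156080, 0, - 53760, 0, 15] [4534325308800, 0, - 33911136000, 0, 23814000] [124984148197376, 1865035898880, 32112640000]"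
proof -
  have "quasi 10 561842749440000 ([[632787234176, 0, - 16146784000, 0, 55156080, 0, - 53760, 0, 15]] # [[4534325308800, 0, - 33911136000, 0, 23814000], smul (- 1) [4534325308800, 0, - 33911136000, 0, 23814000]] # [[[- 12780830720000, 0, 32112640000], [6390415360000, - 192675840000, - 16056320000], [6390415360000, 192675840000, - 16056320000]],
    [[0, 548674560000], [- 2194698240000, 0], [0, - 548674560000], [2194698240000, 0]],
    [[4270004895744, 1123685498880], [4270004895744, - 1123685498880], [- 1348422598656, 0], [- 5843164594176, 0], [- 1348422598656, 0]],
    [[5202247680000], [2601123840000], [- 2601123840000], [- 5202247680000], [- 2601123840000], [2601123840000]],
    [[22932357120000], [- 22932357120000], [22932357120000], [0], [- 11466178560000], [- 11466178560000], [0]],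
    [[17557585920000], [0], [17557585920000], [0], [- 17557585920000], [0], [- 17557585920000], [0]],
    [[41617981440000], [0], [0], [- 20808990720000], [0], [0], [- 20808990720000], [0], [0]],
    [[16855282483200], [- 16855282483200], [- 11236854988800], [11236854988800], [- 11236854988800], [- 16855282483200], [16855282483200], [11236854988800], [- 11236854988800], [11236854988800]]])"
    using quasi_10 by (simp add: tb10_def)
  then have "est 10 561842749440000 [632787234176, 0, - 16146784000, 0, 55156080, 0, - 53760, 0, 15] [4534325308800, 0, - 33911136000, 0, 23814000] (foldr padd [[12780830720000, 192675840000, 32112640000], [2194698240000, 548674560000], [5843164594176, 1123685498880], [5202247680000], [22932357120000], [17557585920000], [41617981440000], [16855282483200]] [])"
    by (rule est_of_quasi) simp_all
  then show ?thesis by simp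
qed

lemma lump_10: "est 10 561842749440000 [632787234176, 0, - 16146784000, 0, 55156080, 0, - 53760, 0, 15] [] [129518473506176, 1865035898880, 66023776000, 0, 23814000]"
  using est_lump[OF est_10] by simp

lemma est_11: "est 11 37081621463040000 [0, 5486122777261, 0, - 36102624300, 0, 56912982, 0, - 30300, 0, 5] [342568928948400, 0, - 1689603300000, 0, 785862000] [10166649713434624, 84501635620864, 1059717120000]"
proof -
  have "quasi 11 37081621463040000 ([[0, 5486122777261, 0, - 36102624300, 0, 56912982, 0, - 30300, 0, 5]] # [[342568928948400, 0, - 1689603300000, 0, 785862000], smul (- 1) [342568928948400, 0, - 1689603300000, 0, 785862000]] # [[[- 588849479680000, 3532390400000, 1059717120000], [588849479680000, 3532390400000, - 1059717120000], [0, - 7064780800000, 0]],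
    [[126743823360000, 18106260480000], [126743823360000, - 18106260480000], [- 126743823360000, - 18106260480000], [- 126743823360000, 18106260480000]],
    [[0, 59330594340864], [- 207657080193024, - 14832648585216], [29665297170432, - 14832648585216], [- 29665297170432, - 14832648585216], [207657080193024, - 14832648585216]],
    [[171674173440000], [- 171674173440000], [- 343348346880000], [- 171674173440000], [171674173440000], [343348346880000]],
    [[1513535569920000], [- 756767784960000], [0], [0], [756767784960000], [- 1513535569920000], [0]],
    [[1158800670720000], [0], [0], [1158800670720000], [- 1158800670720000], [0], [0], [- 1158800670720000]],
    [[1373393387520000], [0], [1373393387520000], [- 1373393387520000], [1373393387520000], [- 1373393387520000], [0], [- 1373393387520000], [0]],
    [[1483264858521600], [370816214630400], [- 370816214630400], [370816214630400], [- 370816214630400], [- 1483264858521600], [- 370816214630400], [370816214630400], [- 370816214630400], [370816214630400]],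
    [[3371056496640000], [- 3371056496640000], [0], [0], [0], [0], [0], [0], [0], [0], [0]]])"
    using quasi_11 by (simp add: tb11_def)
  then have "est 11 37081621463040000 [0, 5486122777261, 0, - 36102624300, 0, 56912982, 0, - 30300, 0, 5] [342568928948400, 0, - 1689603300000, 0, 785862000] (foldr padd [[588849479680000, 7064780800000, 1059717120000], [126743823360000, 18106260480000], [207657080193024, 59330594340864], [343348346880000], [1513535569920000], [1158800670720000], [1373393387520000], [1483264858521600], [3371056496640000]] [])"
    by (rule est_of_quasi) simp_all
  then show ?thesis by simp
qed

lemma lump_11: "est 11 37081621463040000 [0, 5486122777261, 0, - 36102624300, 0, 56912982, 0, - 30300, 0, 5] [] [10509218642383024, 84501635620864, 2749320420000, 0, 785862000]"
  using est_lump[OF est_11] by simp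

lemma est_12: "est 12 58737288397455360000 [- 26096916318766147, 0, 479731329466125, 0, - 1246317800310, 0, 1029069426, 0, - 321255, 0, 33] [0, 28464118105500000, 0, - 42150494232000, 0, 10373378400] [13908462825556910080, 120237163448844288, 830644362240000, 23313776640000]"
proof -
  have "quasi 12 58737288397455360000 ([[- 26096916318766147, 0, 479731329466125, 0, - 1246317800310, 0, 1029069426, 0, - 321255, 0, 33]] # [[0, 28464118105500000, 0, - 42150494232000, 0, 10373378400], smul (- 1) [0, 28464118105500000, 0, - 42150494232000, 0, 10373378400]] # [[[- 81512734392320000, - 42221249495040000, 116568883200000, 23313776640000], [- 81512734392320000, 42221249495040000, 116568883200000, - 23313776640000], [163025468784640000, 0, - 233137766400000, 0]],
    [[- 498121332065280000, 8365092341760000, 597506595840000], [498121332065280000, 8365092341760000, - 597506595840000], [498121332065280000, - 8365092341760000, - 597506595840000], [- 498121332065280000, - 8365092341760000, 597506595840000]],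
    [[469898307179642880, 46989830717964288], [- 328928815025750016, - 23494915358982144], [- 328928815025750016, 23494915358982144], [469898307179642880, - 46989830717964288], [- 281938984307785728, 0]],
    [[351245358858240000, 11330495447040000], [351245358858240000, - 11330495447040000], [0, - 22660990894080000], [- 351245358858240000, - 11330495447040000], [- 351245358858240000, 11330495447040000], [0, 22660990894080000]],
    [[2397440342753280000], [- 1198720171376640000], [0], [0], [0], [0], [- 1198720171376640000]],
    [[917770131210240000], [0], [0], [917770131210240000], [- 917770131210240000], [0], [0], [- 917770131210240000]],
    [[1450303417221120000], [- 725151708610560000], [1450303417221120000], [- 725151708610560000], [1450303417221120000], [- 725151708610560000], [- 725151708610560000], [- 725151708610560000], [- 725151708610560000]],
    [[1174745767949107200], [587372883974553600], [587372883974553600], [1174745767949107200], [0], [- 1174745767949107200], [- 587372883974553600], [- 587372883974553600], [- 1174745767949107200], [0]],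
    [[4854321355161600000], [- 485432135516160000], [- 485432135516160000], [- 485432135516160000], [- 485432135516160000], [- 485432135516160000], [- 485432135516160000], [- 485432135516160000], [- 485432135516160000], [- 485432135516160000], [- 485432135516160000]],
    [[1631591344373760000], [- 1631591344373760000], [815795672186880000], [- 815795672186880000], [- 815795672186880000], [815795672186880000], [- 1631591344373760000], [1631591344373760000], [- 815795672186880000], [815795672186880000], [815795672186880000], [- 815795672186880000]]])"
    using quasi_12 by (simp add: tb12_def)
  then have "est 12 58737288397455360000 [- 26096916318766147, 0, 479731329466125, 0, - 1246317800310, 0, 1029069426, 0, - 321255, 0, 33] [0, 28464118105500000, 0, - 42150494232000, 0, 10373378400] (foldr padd [[163025468784640000, 42221249495040000, 233137766400000, 23313776640000], [498121332065280000, 8365092341760000, 597506595840000], [469898307179642880, 46989830717964288], [351245358858240000, 22660990894080000], [2397440342753280000], [917770131210240000], [1450303417221120000], [1174745767949107200], [4854321355161600000], [1631591344373760000]] [])"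
    by (rule est_of_quasi) simp_all
  then show ?thesis by simp
qed

lemma lump_12: "est 12 58737288397455360000 [- 26096916318766147, 0, 479731329466125, 0, - 1246317800310, 0, 1029069426, 0, - 321255, 0, 33] [] [13908462825556910080, 148701281554344288, 830644362240000, 65464270872000, 0, 10373378400]"
  using est_lump[OF est_12] by simp

lemma ec_step: "k = Suc n \<Longrightarrow> ec k = padd (ec n) (replicate k 0 @ smul (- 1) (ec n))" by simp

lemma ec_0: "ec 0 = [1]" by simp

lemma ec_1: "ec 1 = [1, - 1]"
proof -
  have "ec 1 = padd (ec 0) (replicate 1 0 @ smul (- 1) (ec 0))" by (rule ec_step) simp
  then show ?thesis unfolding ec_0 by (simp add: eval_nat_numeral del: ec.simps)
qed

lemma ec_2: "ec 2 = [1, - 1, - 1, 1]"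
proof -
  have "ec 2 = padd (ec 1) (replicate 2 0 @ smul (- 1) (ec 1))" by (rule ec_step) simp
  then show ?thesis unfolding ec_1 by (simp add: eval_nat_numeral del: ec.simps)
qed

lemma ec_3: "ec 3 = [1, - 1, - 1, 0, 1, 1, - 1]"
proof -
  have "ec 3 = padd (ec 2) (replicate 3 0 @ smul (- 1) (ec 2))" by (rule ec_step) simp
  then show ?thesis unfolding ec_2 by (simp add: eval_nat_numeral del: ec.simps)
qed

lemma ec_4: "ec 4 = [1, - 1, - 1, 0, 0, 2, 0, 0, - 1, - 1, 1]"
proof -
  have "ec 4 = padd (ec 3) (replicate 4 0 @ smul (- 1) (ec 3))" by (rule ec_step) simp
  then show ?thesis unfolding ec_3 by (simp add: eval_nat_numeral del: ec.simps)
qed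

lemma ec_5: "ec 5 = [1, - 1, - 1, 0, 0, 1, 1, 1, - 1, - 1, - 1, 0, 0, 1, 1, - 1]"
proof -
  have "ec 5 = padd (ec 4) (replicate 5 0 @ smul (- 1) (ec 4))" by (rule ec_step) simp
  then show ?thesis unfolding ec_4 by (simp add: eval_nat_numeral del: ec.simps)
qed

lemma ec_6: "ec 6 = [1, - 1, - 1, 0, 0, 1, 0, 2, 0, - 1, - 1, - 1, - 1, 0, 2, 0, 1, 0, 0, - 1, - 1, 1]"
proof -
  have "ec 6 = padd (ec 5) (replicate 6 0 @ smul (- 1) (ec 5))" by (rule ec_step) simp
  then show ?thesis unfolding ec_5 by (simp add: eval_nat_numeral del: ec.simps)
qed

lemma ec_7: "ec 7 = [1, - 1, - 1, 0, 0, 1, 0, 1, 1, 0, - 1, - 1, - 2, 0, 0, 0, 2, 1, 1, 0, - 1, - 1, 0, - 1, 0, 0, 1, 1, - 1]"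
proof -
  have "ec 7 = padd (ec 6) (replicate 7 0 @ smul (- 1) (ec 6))" by (rule ec_step) simp
  then show ?thesis unfolding ec_6 by (simp add: eval_nat_numeral del: ec.simps)
qed

lemma ec_8: "ec 8 = [1, - 1, - 1, 0, 0, 1, 0, 1, 0, 1, 0, - 1, - 2, - 1, 0, - 1, 1, 1, 2, 1, 1, - 1, 0, - 1, - 2, - 1, 0, 1, 0, 1, 0, 1, 0, 0, - 1, - 1, 1]"
proof -
  have "ec 8 = padd (ec 7) (replicate 8 0 @ smul (- 1) (ec 7))" by (rule ec_step) simp
  then show ?thesis unfolding ec_7 by (simp add: eval_nat_numeral del: ec.simps)
qed

lemma ec_9: "ec 9 = [1, - 1, - 1, 0, 0, 1, 0, 1, 0, 0, 1, 0, - 2, - 1, - 1, - 1, 0, 1, 1, 1, 2, 1, 1, - 1, - 1, - 2, - 1, - 1, - 1, 0, 1, 1, 1, 2, 0, - 1, 0, 0, - 1, 0, - 1, 0, 0, 1, 1, - 1]"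
proof -
  have "ec 9 = padd (ec 8) (replicate 9 0 @ smul (- 1) (ec 8))" by (rule ec_step) simp
  then show ?thesis unfolding ec_8 by (simp add: eval_nat_numeral del: ec.simps)
qed

lemma ec_10: "ec 10 = [1, - 1, - 1, 0, 0, 1, 0, 1, 0, 0, 0, 1, - 1, - 1, - 1, - 2, 0, 0, 1, 1, 1, 1, 3, 0, 0, - 1, - 1, - 2, - 2, - 1, - 1, 0, 0, 3, 1, 1, 1, 1, 0, 0, - 2, - 1, - 1, - 1, 1, 0, 0, 0, 1, 0, 1, 0, 0, - 1, - 1, 1]"
proof -
  have "ec 10 = padd (ec 9) (replicate 10 0 @ smul (- 1) (ec 9))" by (rule ec_step) simp
  then show ?thesis unfolding ec_9 by (simp add: eval_nat_numeral del: ec.simps)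
qed

lemma ec_11: "ec 11 = [1, - 1, - 1, 0, 0, 1, 0, 1, 0, 0, 0, 0, 0, 0, - 1, - 2, - 1, 0, 0, 1, 1, 1, 2, 1, 1, 0, 1, - 2, - 2, - 2, - 2, - 1, - 1, 0, 1, 1, 2, 2, 2, 2, - 1, 0, - 1, - 1, - 2, - 1, - 1, - 1, 0, 0, 1, 2, 1, 0, 0, 0, 0, 0, 0, - 1, 0, - 1, 0, 0, 1, 1, - 1]"
proof -
  have "ec 11 = padd (ec 10) (replicate 11 0 @ smul (- 1) (ec 10))" by (rule ec_step) simp
  then show ?thesis unfolding ec_10 by (simp add: eval_nat_numeral del: ec.simps)
qed

lemma ec_12: "ec 12 = [1, - 1, - 1, 0, 0, 1, 0, 1, 0, 0, 0, 0, - 1, 1, 0, - 2, - 1, - 1, 0, 0, 1, 1, 2, 1, 1, 0, 2, 0, - 1, - 2, - 2, - 2, - 2, - 1, - 1, 0, 1, 2, 1, 4, 1, 2, 1, 0, - 1, - 1, - 2, - 2, - 2, - 2, - 1, 0, 2, 0, 1, 1, 2, 1, 1, 0, 0, - 1, - 1, - 2, 0, 1, - 1, 0, 0, 0, 0, 1, 0, 1, 0, 0, - 1, - 1, 1]"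
proof -
  have "ec 12 = padd (ec 11) (replicate 12 0 @ smul (- 1) (ec 11))" by (rule ec_step) simp
  then show ?thesis unfolding ec_11 by (simp add: eval_nat_numeral del: ec.simps)
qed

section \<open>Positivity for five to twelve factors\<close>

primrec dl :: "real \<Rightarrow> nat \<Rightarrow> real list" where
  "dl u 0 = [0]" | "dl u (Suc j) = u * real (Suc j) # dl u j"

lemma length_dl [simp]: "length (dl u j) = Suc j" by (induction j) auto

lemma nth_dl: "i \<le> j \<Longrightarrow> dl u j ! i = u * (real j - real i)"
proof (induction j arbitrary: i)
  case (Suc j)
  then show ?case by (cases i) auto
qed simp

text \<open>Here \<open>v\<close> is the distance from the left end of the range and \<open>w\<close> the distance to the right end. For \<open>u = 2\<close> the range is cut at its midpoint, which is the middle degree when \<open>n (n + 1) / 2\<close> is odd; \<open>xl\<close> is a lower bound for \<open>w\<close> that matters because the sum vanishes at the middle.\<close>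

lemma chamber_gen:
  fixes u xl h :: real
  assumes est: "est n D Q R E" and D: "D > 0" "n \<ge> 1" and r: "r \<ge> 1" and u: "u > 0" and S: "sg n = S"
    and m: "2 * real j * real r \<le> 2 * of_int m + of_int S" "2 * of_int m + of_int S < 2 * (real j + 1) * real r"
      "xl \<le> 2 * real r / u - (2 * of_int m + of_int S - 2 * real j * real r)"
    and cs: "cs = take (j + 1) (ec n)" "j < length (ec n)" and bs: "bs = dl u j" and B: "B = replicate L 1" "length Q \<le> L" "length R \<le> L" "length E \<le> L"
    and h: "0 \<le> h" "h \<le> real r / u" "0 \<le> xl"
    and chk: "poschk h xl h (chamber_rows Q R E cs bs (sgn_par m) (sgn_par (int r)) B)"
  shows "0 \<le> dif r n m"
proof -
  define v where "v = 2 * of_int m + of_int S - 2 * real j * real r"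
  define w where "w = 2 * real r / u - v"
  have v: "0 \<le> v" and w: "xl \<le> w" using m by (auto simp: v_def w_def)
  have vw: "v + w = 2 * real r / u" by (simp add: w_def)
  have "h \<le> v \<or> h \<le> w"
  proof (rule ccontr)
    assume "\<not> (h \<le> v \<or> h \<le> w)"
    then have "v + w < 2 * h" by linarith
    then show False using vw h(2) by simp
  qed
  then have pos: "0 \<le> ev2 (chamber_rows Q R E cs bs (sgn_par m) (sgn_par (int r)) B) v w"
    using v w h by (intro poschk_ev2[OF chk]) auto
  have bsi: "bs ! i = u * (real j - real i)" if "i \<le> j" for i using that by (simp add: bs nth_dl)
  show ?thesis
  proof (rule chamber_nonneg[OF est D(1) r D(2) _ cs _ _ _ B pos])
    have "real_of_int (2 * m + sg n) < real_of_int (2 * int ((j + 1) * r))" using m(2) S by (simp add: algebra_simps)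
    then show "2 * m + sg n < 2 * int ((j + 1) * r)" by (simp only: of_int_less_iff)
    show "length bs = j + 1" by (simp add: bs)
    fix i assume i: "i \<le> j"
    have "(bs ! i + 1) * v + bs ! i * w = v + bs ! i * (v + w)" by (simp add: algebra_simps)
    also have "\<dots> = v + (real j - real i) * (2 * real r)" using u by (simp add: vw bsi[OF i])
    finally have z: "(bs ! i + 1) * v + bs ! i * w = v + (real j - real i) * (2 * real r)" .
    show "of_int (2 * m + sg n) - 2 * real i * real r = (bs ! i + 1) * v + bs ! i * w"
      unfolding z using S by (simp add: v_def algebra_simps)
    show "0 \<le> (bs ! i + 1) * v + bs ! i * w" unfolding z using v i by simp
  qed
qed

definition mulz where "mulz p q = map2 (*) p (q :: real list)"
definition addz where "addz p q = map2 (+) p (q :: real list)"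
definition sl where "sl a xs = a + sum_list (xs :: real list)"
definition nabs where "nabs cs = map (\<lambda>c :: real. - \<bar>c\<bar>) cs"
definition mtsh where "mtsh x A = map (tsh x) A"
definition rva where "rva xs ys = rev xs @ ys"
primrec hsc :: "real \<Rightarrow> real \<Rightarrow> real list \<Rightarrow> bool" where
  "hsc h a [] = True" | "hsc h a (b # p) = (let c = b + h * a in 0 \<le> c \<and> hsc h c p)"

lemma hchk_single: "hchk h [a] (map (\<lambda>a. [a]) p) = hsc h a p"
  by (induction p arbitrary: a) (auto simp: Let_def)

text \<open>Together with the rules below this is a call-by-value program for the positivity test. Arguments are normalised only inside \<open>Let\<close>, and the congruence rules keep the simplifier from traversing lists that are already in normal form.\<close>

lemma rowchk_eval: "rowchk h (r # A) = (if hsc h 0 (rva r []) then rowchk h A else False)"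
proof -
  have "hchk h [] (map (\<lambda>a. [a]) p) = hsc h 0 p" for p
    using hchk_single[of h _ "tl p"] by (cases p) (auto simp: Let_def)
  then show ?thesis by (simp add: rowchk_def rva_def rev_map)
qed

lemma padd_Nil2: "padd p [] = p" by (cases p) auto

lemma madd_Nil2: "madd A1 [] = A1" by (cases A1) auto

lemma pos_rules:
  "mulz [] q = []" "mulz p [] = []" "mulz (a # p) (b # q) = a * b # mulz p q"
  "addz [] q' = []" "addz p' [] = []" "addz (c # p') (d # q') = (c + d) # addz p' q'"
  "sl x [] = x" "sl x (y # ys) = Let (x + y) (\<lambda>z. sl z ys)"
  "mom [] ws bs = []" "mom (a # p) ws bs = Let (mulz ws bs) (\<lambda>w. Let (sl 0 ws) (\<lambda>s. s # mom p w bs))"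
  "psums x [] = []" "psums x (b # B) = Let (x + b) (\<lambda>z. z # psums z B)"
  "tri [] S B = []"
  "tri (a # p) (s # S) B = Let (mulz (s # S) B) (\<lambda>t. Let (mulz (a # p) t) (\<lambda>v. Let (addz (s # S) S) (\<lambda>S'. Let (psums 0 B) (\<lambda>B'. v # tri p S' B'))))"
  "madd [] A2 = A2" "madd A1 [] = A1" "madd (r1 # A1) (r2 # A2) = Let (padd r1 r2) (\<lambda>t. t # madd A1 A2)"
  "padd [] q = q" "padd p [] = p" "padd (a # p) (b # q) = (a + b) # padd p q"
  "smul x [] = []" "smul x (a # p) = x * a # smul x p"
  "nonneg [] = True" "nonneg (a # p) = (if 0 \<le> a then nonneg p else False)"
  "hchk h acc [] = True"
  "hchk h acc (r1 # A1) = Let (smul h acc) (\<lambda>t. Let (padd r1 t) (\<lambda>b. if nonneg b then hchk h b A1 else False))"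
  "hsc h x [] = True" "hsc h x (b # p) = Let (b + h * x) (\<lambda>c. if 0 \<le> c then hsc h c p else False)"
  "rowchk h [] = True" "rowchk h (r1 # A1) = Let (rva r1 []) (\<lambda>t. if hsc h 0 t then rowchk h A1 else False)"
  "tsh x [] = []" "tsh x (a # p) = Let (tsh x p) (\<lambda>t. Let (smul x t) (\<lambda>u. padd (a # t) u))"
  "mtsh x [] = []" "mtsh x (r1 # A1) = Let (tsh x r1) (\<lambda>t. t # mtsh x A1)"
  "rva [] zr = zr" "rva (z # zz) zr = rva zz (z # zr)"
  "nabs [] = []" "nabs (a # p) = (if 0 \<le> a then - a else a) # nabs p"
  "alt e \<rho> [] = []" "alt e \<rho> (a # p) = Let (e * a) (\<lambda>x. Let (e * \<rho>) (\<lambda>y. x # alt y \<rho> p))"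
  "poschk h x h' A = Let A (\<lambda>A. Let (mtsh x A) (\<lambda>t. Let (rva t []) (\<lambda>u. if hchk h [] u then rowchk h' A else False)))"
  "chamber_rows Q [] E cs bs s \<rho> B = Let (nabs cs) (\<lambda>c2. Let (mom Q cs bs) (\<lambda>m0. Let (mom E c2 bs) (\<lambda>m2.
     Let (tri Q m0 B) (\<lambda>t0. Let (tri E m2 B) (\<lambda>t2. madd t0 t2)))))"
  "chamber_rows Q (a # p) E cs bs s \<rho> B = Let (alt s \<rho> cs) (\<lambda>c1. Let (nabs cs) (\<lambda>c2. Let (mom Q cs bs) (\<lambda>m0. Let (mom (a # p) c1 bs) (\<lambda>m1. Let (mom E c2 bs) (\<lambda>m2.
     Let (tri Q m0 B) (\<lambda>t0. Let (tri (a # p) m1 B) (\<lambda>t1. Let (tri E m2 B) (\<lambda>t2. Let (madd t1 t2) (\<lambda>t3. madd t0 t3)))))))))"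
  by (simp_all add: padd_Nil2 madd_Nil2 mulz_def addz_def sl_def Let_def rva_def nabs_def mtsh_def poschk_def chamber_rows_def rowchk_eval rowchk_def[of _ "[]"] split: list.splits)

lemma pos_congs:
  "mulz p q = mulz p q" "addz p q = addz p q" "sl x p = sl x p" "mom q ws bs = mom q ws bs" "psums x p = psums x p"
  "tri q S B = tri q S B" "madd A1 A2 = madd A1 A2" "padd p q = padd p q" "smul x p = smul x p" "nonneg p = nonneg p"
  "hchk h p A1 = hchk h p A1" "hsc h x p = hsc h x p" "rowchk h A1 = rowchk h A1" "tsh x p = tsh x p" "mtsh x A1 = mtsh x A1"
  "rva zz zr = rva zz zr" "nabs p = nabs p" "alt e \<rho> p = alt e \<rho> p" "poschk h x h' A1 = poschk h x h' A1"
  "chamber_rows Q R E cs bs s \<rho> B = chamber_rows Q R E cs bs s \<rho> B"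
  "u1 = u2 \<Longrightarrow> Let u1 ff = Let u2 ff"
  by simp_all

lemma neg1_le: "(0 \<le> (- 1 :: real)) = False" "(0 \<le> (- numeral v :: real)) = False" by simp_all

lemmas pos_num = arith_simps rel_simps arith_special numeral_One Num.BitM.simps Num.inc.simps
  sub_num_simps dbl_simps dbl_inc_simps dbl_dec_simps mult_neg_numeral_simps mult_minus1 mult_minus1_right neg1_le
  add_0_left add_0_right diff_zero diff_0 minus_minus minus_zero diff_self mult_1_left mult_1_right mult_zero_left mult_zero_right
  zero_le_numeral zero_le_one order_refl if_True if_False simp_thms Let_def

text \<open>The lemmas are indexed by \<open>n\<close> and by the number \<open>j\<close> of the range. In most ranges the alternating part counts as error; in the ranges next to the middle degree for small \<open>n\<close> this would be too wasteful, and the signs of \<open>m\<close> and \<open>r\<close> are distinguished.\<close>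

lemma chamber_5_2_pos0:
  "poschk 18 0 18 (chamber_rows [0, - 54, 0, 1] [] [2512, 90] [1, - 1, - 1] [2, 1, 0] s \<rho> [1, 1, 1, 1])"
  by (simp only: pos_rules pos_num cong: pos_congs)

lemma chamber_5_2:
  assumes "r \<ge> 18" "4 * real r \<le> 2 * of_int m + 14" "2 * of_int m + 14 < 6 * real r"
  shows "0 \<le> dif r 5 m"
proof (rule chamber_gen[OF lump_5, where j = 2 and u = 1 and S = 14 and xl = 0 and h = 18 and L = 4
    and cs = "[1, - 1, - 1]" and bs = "[2, 1, 0]" and B = "[1, 1, 1, 1]"])
  show "sg 5 = 14" by (simp add: eval_nat_numeral)
  show "[1, - 1, - 1] = take (2 + 1) (ec 5)" by (simp add: ec_5)
  show "2 < length (ec 5)" by (simp add: ec_5)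
  show "[2, 1, 0] = dl 1 2" by (simp add: eval_nat_numeral)
  show "[1, 1, 1, 1] = replicate 4 1" by (simp add: eval_nat_numeral)
  show "poschk 18 0 18 (chamber_rows [0, - 54, 0, 1] [] [2512, 90] [1, - 1, - 1] [2, 1, 0] (sgn_par m) (sgn_par (int r)) [1, 1, 1, 1])"
    by (rule chamber_5_2_pos0)
qed (use assms in auto)

lemma chamber_5_3_pos0:
  "poschk 18 0 18 (chamber_rows [0, - 54, 0, 1] [] [2512, 90] [1, - 1, - 1, 0] [3, 2, 1, 0] s \<rho> [1, 1, 1, 1])"
  by (simp only: pos_rules pos_num cong: pos_congs)

lemma chamber_5_3:
  assumes "r \<ge> 18" "6 * real r \<le> 2 * of_int m + 14" "2 * of_int m + 14 < 8 * real r"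
  shows "0 \<le> dif r 5 m"
proof (rule chamber_gen[OF lump_5, where j = 3 and u = 1 and S = 14 and xl = 0 and h = 18 and L = 4
    and cs = "[1, - 1, - 1, 0]" and bs = "[3, 2, 1, 0]" and B = "[1, 1, 1, 1]"])
  show "sg 5 = 14" by (simp add: eval_nat_numeral)
  show "[1, - 1, - 1, 0] = take (3 + 1) (ec 5)" by (simp add: ec_5)
  show "3 < length (ec 5)" by (simp add: ec_5)
  show "[3, 2, 1, 0] = dl 1 3" by (simp add: eval_nat_numeral)
  show "[1, 1, 1, 1] = replicate 4 1" by (simp add: eval_nat_numeral)
  show "poschk 18 0 18 (chamber_rows [0, - 54, 0, 1] [] [2512, 90] [1, - 1, - 1, 0] [3, 2, 1, 0] (sgn_par m) (sgn_par (int r)) [1, 1, 1, 1])"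
    by (rule chamber_5_3_pos0)
qed (use assms in auto)

lemma chamber_5_4_pos0:
  "poschk 18 0 18 (chamber_rows [0, - 54, 0, 1] [] [2512, 90] [1, - 1, - 1, 0, 0] [4, 3, 2, 1, 0] s \<rho> [1, 1, 1, 1])"
  by (simp only: pos_rules pos_num cong: pos_congs)

lemma chamber_5_4:
  assumes "r \<ge> 18" "8 * real r \<le> 2 * of_int m + 14" "2 * of_int m + 14 < 10 * real r"
  shows "0 \<le> dif r 5 m"
proof (rule chamber_gen[OF lump_5, where j = 4 and u = 1 and S = 14 and xl = 0 and h = 18 and L = 4
    and cs = "[1, - 1, - 1, 0, 0]" and bs = "[4, 3, 2, 1, 0]" and B = "[1, 1, 1, 1]"])
  show "sg 5 = 14" by (simp add: eval_nat_numeral)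
  show "[1, - 1, - 1, 0, 0] = take (4 + 1) (ec 5)" by (simp add: ec_5)
  show "4 < length (ec 5)" by (simp add: ec_5)
  show "[4, 3, 2, 1, 0] = dl 1 4" by (simp add: eval_nat_numeral)
  show "[1, 1, 1, 1] = replicate 4 1" by (simp add: eval_nat_numeral)
  show "poschk 18 0 18 (chamber_rows [0, - 54, 0, 1] [] [2512, 90] [1, - 1, - 1, 0, 0] [4, 3, 2, 1, 0] (sgn_par m) (sgn_par (int r)) [1, 1, 1, 1])"
    by (rule chamber_5_4_pos0)
qed (use assms in auto)

lemma chamber_5_5_pos0:
  "poschk 18 0 18 (chamber_rows [0, - 54, 0, 1] [] [2512, 90] [1, - 1, - 1, 0, 0, 1] [5, 4, 3, 2, 1, 0] s \<rho> [1, 1, 1, 1])"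
  by (simp only: pos_rules pos_num cong: pos_congs)

lemma chamber_5_5:
  assumes "r \<ge> 18" "10 * real r \<le> 2 * of_int m + 14" "2 * of_int m + 14 < 12 * real r"
  shows "0 \<le> dif r 5 m"
proof (rule chamber_gen[OF lump_5, where j = 5 and u = 1 and S = 14 and xl = 0 and h = 18 and L = 4
    and cs = "[1, - 1, - 1, 0, 0, 1]" and bs = "[5, 4, 3, 2, 1, 0]" and B = "[1, 1, 1, 1]"])
  show "sg 5 = 14" by (simp add: eval_nat_numeral)
  show "[1, - 1, - 1, 0, 0, 1] = take (5 + 1) (ec 5)" by (simp add: ec_5)
  show "5 < length (ec 5)" by (simp add: ec_5)
  show "[5, 4, 3, 2, 1, 0] = dl 1 5" by (simp add: eval_nat_numeral)
  show "[1, 1, 1, 1] = replicate 4 1" by (simp add: eval_nat_numeral)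
  show "poschk 18 0 18 (chamber_rows [0, - 54, 0, 1] [] [2512, 90] [1, - 1, - 1, 0, 0, 1] [5, 4, 3, 2, 1, 0] (sgn_par m) (sgn_par (int r)) [1, 1, 1, 1])"
    by (rule chamber_5_5_pos0)
qed (use assms in auto)

lemma chamber_5_6_pos0:
  "poschk 18 0 18 (chamber_rows [0, - 54, 0, 1] [] [2512, 90] [1, - 1, - 1, 0, 0, 1, 1] [6, 5, 4, 3, 2, 1, 0] s \<rho> [1, 1, 1, 1])"
  by (simp only: pos_rules pos_num cong: pos_congs)

lemma chamber_5_6:
  assumes "r \<ge> 18" "12 * real r \<le> 2 * of_int m + 14" "2 * of_int m + 14 < 14 * real r"
  shows "0 \<le> dif r 5 m"
proof (rule chamber_gen[OF lump_5, where j = 6 and u = 1 and S = 14 and xl = 0 and h = 18 and L = 4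
    and cs = "[1, - 1, - 1, 0, 0, 1, 1]" and bs = "[6, 5, 4, 3, 2, 1, 0]" and B = "[1, 1, 1, 1]"])
  show "sg 5 = 14" by (simp add: eval_nat_numeral)
  show "[1, - 1, - 1, 0, 0, 1, 1] = take (6 + 1) (ec 5)" by (simp add: ec_5)
  show "6 < length (ec 5)" by (simp add: ec_5)
  show "[6, 5, 4, 3, 2, 1, 0] = dl 1 6" by (simp add: eval_nat_numeral)
  show "[1, 1, 1, 1] = replicate 4 1" by (simp add: eval_nat_numeral)
  show "poschk 18 0 18 (chamber_rows [0, - 54, 0, 1] [] [2512, 90] [1, - 1, - 1, 0, 0, 1, 1] [6, 5, 4, 3, 2, 1, 0] (sgn_par m) (sgn_par (int r)) [1, 1, 1, 1])"
    by (rule chamber_5_6_pos0)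
qed (use assms in auto)

lemma chamber_5_7_pos0:
  "poschk 9 2 9 (chamber_rows [0, - 54, 0, 1] [0, 90] [2512] [1, - 1, - 1, 0, 0, 1, 1, 1] [14, 12, 10, 8, 6, 4, 2, 0] 1 1 [1, 1, 1, 1])"
  by (simp only: pos_rules pos_num cong: pos_congs)

lemma chamber_5_7_pos1:
  "poschk 9 2 9 (chamber_rows [0, - 54, 0, 1] [0, 90] [2512] [1, - 1, - 1, 0, 0, 1, 1, 1] [14, 12, 10, 8, 6, 4, 2, 0] (- 1) 1 [1, 1, 1, 1])"
  by (simp only: pos_rules pos_num cong: pos_congs)

lemma chamber_5_7:
  assumes "r \<ge> 18" "even r" "14 * real r \<le> 2 * of_int m + 14" "2 * of_int m + 16 \<le> 15 * real r"
  shows "0 \<le> dif r 5 m"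
proof (rule chamber_gen[OF est_5, where j = 7 and u = 2 and S = 14 and xl = 2 and h = 9 and L = 4
    and cs = "[1, - 1, - 1, 0, 0, 1, 1, 1]" and bs = "[14, 12, 10, 8, 6, 4, 2, 0]" and B = "[1, 1, 1, 1]"])
  show "sg 5 = 14" by (simp add: eval_nat_numeral)
  show "[1, - 1, - 1, 0, 0, 1, 1, 1] = take (7 + 1) (ec 5)" by (simp add: ec_5)
  show "7 < length (ec 5)" by (simp add: ec_5)
  show "[14, 12, 10, 8, 6, 4, 2, 0] = dl 2 7" by (simp add: eval_nat_numeral)
  show "[1, 1, 1, 1] = replicate 4 1" by (simp add: eval_nat_numeral)
  show "poschk 9 2 9 (chamber_rows [0, - 54, 0, 1] [0, 90] [2512] [1, - 1, - 1, 0, 0, 1, 1, 1] [14, 12, 10, 8, 6, 4, 2, 0] (sgn_par m) (sgn_par (int r)) [1, 1, 1, 1])"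
    using chamber_5_7_pos0 chamber_5_7_pos1 \<open>even r\<close> by (simp add: sgn_par_def)
qed (use assms in auto)

lemma chamber_6_7_pos0:
  "poschk 18 0 18 (chamber_rows [15016, 0, - 900, 0, 5] [] [457384, 12800, 900] [1, - 1, - 1, 0, 0, 1, 0, 2] [7, 6, 5, 4, 3, 2, 1, 0] s \<rho> [1, 1, 1, 1, 1])"
  by (simp only: pos_rules pos_num cong: pos_congs)

lemma chamber_6_7:
  assumes "r \<ge> 18" "14 * real r \<le> 2 * of_int m + 20" "2 * of_int m + 20 < 16 * real r"
  shows "0 \<le> dif r 6 m"
proof (rule chamber_gen[OF lump_6, where j = 7 and u = 1 and S = 20 and xl = 0 and h = 18 and L = 5
    and cs = "[1, - 1, - 1, 0, 0, 1, 0, 2]" and bs = "[7, 6, 5, 4, 3, 2, 1, 0]" and B = "[1, 1, 1, 1, 1]"])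
  show "sg 6 = 20" by (simp add: eval_nat_numeral)
  show "[1, - 1, - 1, 0, 0, 1, 0, 2] = take (7 + 1) (ec 6)" by (simp add: ec_6)
  show "7 < length (ec 6)" by (simp add: ec_6)
  show "[7, 6, 5, 4, 3, 2, 1, 0] = dl 1 7" by (simp add: eval_nat_numeral)
  show "[1, 1, 1, 1, 1] = replicate 5 1" by (simp add: eval_nat_numeral)
  show "poschk 18 0 18 (chamber_rows [15016, 0, - 900, 0, 5] [] [457384, 12800, 900] [1, - 1, - 1, 0, 0, 1, 0, 2] [7, 6, 5, 4, 3, 2, 1, 0] (sgn_par m) (sgn_par (int r)) [1, 1, 1, 1, 1])"
    by (rule chamber_6_7_pos0)
qed (use assms in auto)

lemma chamber_6_8_pos0:
  "poschk 18 0 18 (chamber_rows [15016, 0, - 900, 0, 5] [] [457384, 12800, 900] [1, - 1, - 1, 0, 0, 1, 0, 2, 0] [8, 7, 6, 5, 4, 3, 2, 1, 0] s \<rho> [1, 1, 1, 1, 1])"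
  by (simp only: pos_rules pos_num cong: pos_congs)

lemma chamber_6_8:
  assumes "r \<ge> 18" "16 * real r \<le> 2 * of_int m + 20" "2 * of_int m + 20 < 18 * real r"
  shows "0 \<le> dif r 6 m"
proof (rule chamber_gen[OF lump_6, where j = 8 and u = 1 and S = 20 and xl = 0 and h = 18 and L = 5
    and cs = "[1, - 1, - 1, 0, 0, 1, 0, 2, 0]" and bs = "[8, 7, 6, 5, 4, 3, 2, 1, 0]" and B = "[1, 1, 1, 1, 1]"])
  show "sg 6 = 20" by (simp add: eval_nat_numeral)
  show "[1, - 1, - 1, 0, 0, 1, 0, 2, 0] = take (8 + 1) (ec 6)" by (simp add: ec_6)
  show "8 < length (ec 6)" by (simp add: ec_6)
  show "[8, 7, 6, 5, 4, 3, 2, 1, 0] = dl 1 8" by (simp add: eval_nat_numeral)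
  show "[1, 1, 1, 1, 1] = replicate 5 1" by (simp add: eval_nat_numeral)
  show "poschk 18 0 18 (chamber_rows [15016, 0, - 900, 0, 5] [] [457384, 12800, 900] [1, - 1, - 1, 0, 0, 1, 0, 2, 0] [8, 7, 6, 5, 4, 3, 2, 1, 0] (sgn_par m) (sgn_par (int r)) [1, 1, 1, 1, 1])"
    by (rule chamber_6_8_pos0)
qed (use assms in auto)

lemma chamber_6_9_pos0:
  "poschk 18 0 18 (chamber_rows [15016, 0, - 900, 0, 5] [- 47400, 0, 900] [409984, 12800] [1, - 1, - 1, 0, 0, 1, 0, 2, 0, - 1] [9, 8, 7, 6, 5, 4, 3, 2, 1, 0] 1 1 [1, 1, 1, 1, 1])"
  by (simp only: pos_rules pos_num cong: pos_congs)

lemma chamber_6_9_pos1: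
  "poschk 18 0 18 (chamber_rows [15016, 0, - 900, 0, 5] [- 47400, 0, 900] [409984, 12800] [1, - 1, - 1, 0, 0, 1, 0, 2, 0, - 1] [9, 8, 7, 6, 5, 4, 3, 2, 1, 0] (- 1) 1 [1, 1, 1, 1, 1])"
  by (simp only: pos_rules pos_num cong: pos_congs)

lemma chamber_6_9:
  assumes "r \<ge> 18" "even r" "18 * real r \<le> 2 * of_int m + 20" "2 * of_int m + 20 < 20 * real r"
  shows "0 \<le> dif r 6 m"
proof (rule chamber_gen[OF est_6, where j = 9 and u = 1 and S = 20 and xl = 0 and h = 18 and L = 5
    and cs = "[1, - 1, - 1, 0, 0, 1, 0, 2, 0, - 1]" and bs = "[9, 8, 7, 6, 5, 4, 3, 2, 1, 0]" and B = "[1, 1, 1, 1, 1]"])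
  show "sg 6 = 20" by (simp add: eval_nat_numeral)
  show "[1, - 1, - 1, 0, 0, 1, 0, 2, 0, - 1] = take (9 + 1) (ec 6)" by (simp add: ec_6)
  show "9 < length (ec 6)" by (simp add: ec_6)
  show "[9, 8, 7, 6, 5, 4, 3, 2, 1, 0] = dl 1 9" by (simp add: eval_nat_numeral)
  show "[1, 1, 1, 1, 1] = replicate 5 1" by (simp add: eval_nat_numeral)
  show "poschk 18 0 18 (chamber_rows [15016, 0, - 900, 0, 5] [- 47400, 0, 900] [409984, 12800] [1, - 1, - 1, 0, 0, 1, 0, 2, 0, - 1] [9, 8, 7, 6, 5, 4, 3, 2, 1, 0] (sgn_par m) (sgn_par (int r)) [1, 1, 1, 1, 1])"
    using chamber_6_9_pos0 chamber_6_9_pos1 \<open>even r\<close> by (simp add: sgn_par_def)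
qed (use assms in auto)

lemma chamber_6_10_pos0:
  "poschk 9 2 9 (chamber_rows [15016, 0, - 900, 0, 5] [- 47400, 0, 900] [409984, 12800] [1, - 1, - 1, 0, 0, 1, 0, 2, 0, - 1, - 1] [20, 18, 16, 14, 12, 10, 8, 6, 4, 2, 0] 1 1 [1, 1, 1, 1, 1])"
  by (simp only: pos_rules pos_num cong: pos_congs)

lemma chamber_6_10_pos1:
  "poschk 9 2 9 (chamber_rows [15016, 0, - 900, 0, 5] [- 47400, 0, 900] [409984, 12800] [1, - 1, - 1, 0, 0, 1, 0, 2, 0, - 1, - 1] [20, 18, 16, 14, 12, 10, 8, 6, 4, 2, 0] (- 1) 1 [1, 1, 1, 1, 1])"
  by (simp only: pos_rules pos_num cong: pos_congs)

lemma chamber_6_10: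
  assumes "r \<ge> 18" "even r" "20 * real r \<le> 2 * of_int m + 20" "2 * of_int m + 22 \<le> 21 * real r"
  shows "0 \<le> dif r 6 m"
proof (rule chamber_gen[OF est_6, where j = 10 and u = 2 and S = 20 and xl = 2 and h = 9 and L = 5
    and cs = "[1, - 1, - 1, 0, 0, 1, 0, 2, 0, - 1, - 1]" and bs = "[20, 18, 16, 14, 12, 10, 8, 6, 4, 2, 0]" and B = "[1, 1, 1, 1, 1]"])
  show "sg 6 = 20" by (simp add: eval_nat_numeral)
  show "[1, - 1, - 1, 0, 0, 1, 0, 2, 0, - 1, - 1] = take (10 + 1) (ec 6)" by (simp add: ec_6)
  show "10 < length (ec 6)" by (simp add: ec_6)
  show "[20, 18, 16, 14, 12, 10, 8, 6, 4, 2, 0] = dl 2 10" by (simp add: eval_nat_numeral)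
  show "[1, 1, 1, 1, 1] = replicate 5 1" by (simp add: eval_nat_numeral)
  show "poschk 9 2 9 (chamber_rows [15016, 0, - 900, 0, 5] [- 47400, 0, 900] [409984, 12800] [1, - 1, - 1, 0, 0, 1, 0, 2, 0, - 1, - 1] [20, 18, 16, 14, 12, 10, 8, 6, 4, 2, 0] (sgn_par m) (sgn_par (int r)) [1, 1, 1, 1, 1])"
    using chamber_6_10_pos0 chamber_6_10_pos1 \<open>even r\<close> by (simp add: sgn_par_def)
qed (use assms in auto)

lemma chamber_7_2_pos0:
  "poschk 18 0 18 (chamber_rows [0, 105955, 0, - 1390, 0, 3] [] [20617564, 358400, 18900] [1, - 1, - 1] [2, 1, 0] s \<rho> [1, 1, 1, 1, 1, 1])"
  by (simp only: pos_rules pos_num cong: pos_congs)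

lemma chamber_7_2:
  assumes "r \<ge> 18" "4 * real r \<le> 2 * of_int m + 27" "2 * of_int m + 27 < 6 * real r"
  shows "0 \<le> dif r 7 m"
proof (rule chamber_gen[OF lump_7, where j = 2 and u = 1 and S = 27 and xl = 0 and h = 18 and L = 6
    and cs = "[1, - 1, - 1]" and bs = "[2, 1, 0]" and B = "[1, 1, 1, 1, 1, 1]"])
  show "sg 7 = 27" by (simp add: eval_nat_numeral)
  show "[1, - 1, - 1] = take (2 + 1) (ec 7)" by (simp add: ec_7)
  show "2 < length (ec 7)" by (simp add: ec_7)
  show "[2, 1, 0] = dl 1 2" by (simp add: eval_nat_numeral)
  show "[1, 1, 1, 1, 1, 1] = replicate 6 1" by (simp add: eval_nat_numeral)
  show "poschk 18 0 18 (chamber_rows [0, 105955, 0, - 1390, 0, 3] [] [20617564, 358400, 18900] [1, - 1, - 1] [2, 1, 0] (sgn_par m) (sgn_par (int r)) [1, 1, 1, 1, 1, 1])"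
    by (rule chamber_7_2_pos0)
qed (use assms in auto)

lemma chamber_7_3_pos0:
  "poschk 18 0 18 (chamber_rows [0, 105955, 0, - 1390, 0, 3] [] [20617564, 358400, 18900] [1, - 1, - 1, 0] [3, 2, 1, 0] s \<rho> [1, 1, 1, 1, 1, 1])"
  by (simp only: pos_rules pos_num cong: pos_congs)

lemma chamber_7_3:
  assumes "r \<ge> 18" "6 * real r \<le> 2 * of_int m + 27" "2 * of_int m + 27 < 8 * real r"
  shows "0 \<le> dif r 7 m"
proof (rule chamber_gen[OF lump_7, where j = 3 and u = 1 and S = 27 and xl = 0 and h = 18 and L = 6
    and cs = "[1, - 1, - 1, 0]" and bs = "[3, 2, 1, 0]" and B = "[1, 1, 1, 1, 1, 1]"])
  show "sg 7 = 27" by (simp add: eval_nat_numeral)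
  show "[1, - 1, - 1, 0] = take (3 + 1) (ec 7)" by (simp add: ec_7)
  show "3 < length (ec 7)" by (simp add: ec_7)
  show "[3, 2, 1, 0] = dl 1 3" by (simp add: eval_nat_numeral)
  show "[1, 1, 1, 1, 1, 1] = replicate 6 1" by (simp add: eval_nat_numeral)
  show "poschk 18 0 18 (chamber_rows [0, 105955, 0, - 1390, 0, 3] [] [20617564, 358400, 18900] [1, - 1, - 1, 0] [3, 2, 1, 0] (sgn_par m) (sgn_par (int r)) [1, 1, 1, 1, 1, 1])"
    by (rule chamber_7_3_pos0)
qed (use assms in auto)

lemma chamber_7_4_pos0:
  "poschk 18 0 18 (chamber_rows [0, 105955, 0, - 1390, 0, 3] [] [20617564, 358400, 18900] [1, - 1, - 1, 0, 0] [4, 3, 2, 1, 0] s \<rho> [1, 1, 1, 1, 1, 1])"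
  by (simp only: pos_rules pos_num cong: pos_congs)

lemma chamber_7_4:
  assumes "r \<ge> 18" "8 * real r \<le> 2 * of_int m + 27" "2 * of_int m + 27 < 10 * real r"
  shows "0 \<le> dif r 7 m"
proof (rule chamber_gen[OF lump_7, where j = 4 and u = 1 and S = 27 and xl = 0 and h = 18 and L = 6
    and cs = "[1, - 1, - 1, 0, 0]" and bs = "[4, 3, 2, 1, 0]" and B = "[1, 1, 1, 1, 1, 1]"])
  show "sg 7 = 27" by (simp add: eval_nat_numeral)
  show "[1, - 1, - 1, 0, 0] = take (4 + 1) (ec 7)" by (simp add: ec_7)
  show "4 < length (ec 7)" by (simp add: ec_7)
  show "[4, 3, 2, 1, 0] = dl 1 4" by (simp add: eval_nat_numeral)
  show "[1, 1, 1, 1, 1, 1] = replicate 6 1" by (simp add: eval_nat_numeral)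
  show "poschk 18 0 18 (chamber_rows [0, 105955, 0, - 1390, 0, 3] [] [20617564, 358400, 18900] [1, - 1, - 1, 0, 0] [4, 3, 2, 1, 0] (sgn_par m) (sgn_par (int r)) [1, 1, 1, 1, 1, 1])"
    by (rule chamber_7_4_pos0)
qed (use assms in auto)

lemma chamber_7_5_pos0:
  "poschk 18 0 18 (chamber_rows [0, 105955, 0, - 1390, 0, 3] [] [20617564, 358400, 18900] [1, - 1, - 1, 0, 0, 1] [5, 4, 3, 2, 1, 0] s \<rho> [1, 1, 1, 1, 1, 1])"
  by (simp only: pos_rules pos_num cong: pos_congs)

lemma chamber_7_5:
  assumes "r \<ge> 18" "10 * real r \<le> 2 * of_int m + 27" "2 * of_int m + 27 < 12 * real r"
  shows "0 \<le> dif r 7 m"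
proof (rule chamber_gen[OF lump_7, where j = 5 and u = 1 and S = 27 and xl = 0 and h = 18 and L = 6
    and cs = "[1, - 1, - 1, 0, 0, 1]" and bs = "[5, 4, 3, 2, 1, 0]" and B = "[1, 1, 1, 1, 1, 1]"])
  show "sg 7 = 27" by (simp add: eval_nat_numeral)
  show "[1, - 1, - 1, 0, 0, 1] = take (5 + 1) (ec 7)" by (simp add: ec_7)
  show "5 < length (ec 7)" by (simp add: ec_7)
  show "[5, 4, 3, 2, 1, 0] = dl 1 5" by (simp add: eval_nat_numeral)
  show "[1, 1, 1, 1, 1, 1] = replicate 6 1" by (simp add: eval_nat_numeral)
  show "poschk 18 0 18 (chamber_rows [0, 105955, 0, - 1390, 0, 3] [] [20617564, 358400, 18900] [1, - 1, - 1, 0, 0, 1] [5, 4, 3, 2, 1, 0] (sgn_par m) (sgn_par (int r)) [1, 1, 1, 1, 1, 1])"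
    by (rule chamber_7_5_pos0)
qed (use assms in auto)

lemma chamber_7_6_pos0:
  "poschk 18 0 18 (chamber_rows [0, 105955, 0, - 1390, 0, 3] [] [20617564, 358400, 18900] [1, - 1, - 1, 0, 0, 1, 0] [6, 5, 4, 3, 2, 1, 0] s \<rho> [1, 1, 1, 1, 1, 1])"
  by (simp only: pos_rules pos_num cong: pos_congs)

lemma chamber_7_6:
  assumes "r \<ge> 18" "12 * real r \<le> 2 * of_int m + 27" "2 * of_int m + 27 < 14 * real r"
  shows "0 \<le> dif r 7 m"
proof (rule chamber_gen[OF lump_7, where j = 6 and u = 1 and S = 27 and xl = 0 and h = 18 and L = 6
    and cs = "[1, - 1, - 1, 0, 0, 1, 0]" and bs = "[6, 5, 4, 3, 2, 1, 0]" and B = "[1, 1, 1, 1, 1, 1]"])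
  show "sg 7 = 27" by (simp add: eval_nat_numeral)
  show "[1, - 1, - 1, 0, 0, 1, 0] = take (6 + 1) (ec 7)" by (simp add: ec_7)
  show "6 < length (ec 7)" by (simp add: ec_7)
  show "[6, 5, 4, 3, 2, 1, 0] = dl 1 6" by (simp add: eval_nat_numeral)
  show "[1, 1, 1, 1, 1, 1] = replicate 6 1" by (simp add: eval_nat_numeral)
  show "poschk 18 0 18 (chamber_rows [0, 105955, 0, - 1390, 0, 3] [] [20617564, 358400, 18900] [1, - 1, - 1, 0, 0, 1, 0] [6, 5, 4, 3, 2, 1, 0] (sgn_par m) (sgn_par (int r)) [1, 1, 1, 1, 1, 1])"
    by (rule chamber_7_6_pos0)
qed (use assms in auto)

lemma chamber_7_7_pos0:
  "poschk 18 0 18 (chamber_rows [0, 105955, 0, - 1390, 0, 3] [] [20617564, 358400, 18900] [1, - 1, - 1, 0, 0, 1, 0, 1] [7, 6, 5, 4, 3, 2, 1, 0] s \<rho> [1, 1, 1, 1, 1, 1])"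
  by (simp only: pos_rules pos_num cong: pos_congs)

lemma chamber_7_7:
  assumes "r \<ge> 18" "14 * real r \<le> 2 * of_int m + 27" "2 * of_int m + 27 < 16 * real r"
  shows "0 \<le> dif r 7 m"
proof (rule chamber_gen[OF lump_7, where j = 7 and u = 1 and S = 27 and xl = 0 and h = 18 and L = 6
    and cs = "[1, - 1, - 1, 0, 0, 1, 0, 1]" and bs = "[7, 6, 5, 4, 3, 2, 1, 0]" and B = "[1, 1, 1, 1, 1, 1]"])
  show "sg 7 = 27" by (simp add: eval_nat_numeral)
  show "[1, - 1, - 1, 0, 0, 1, 0, 1] = take (7 + 1) (ec 7)" by (simp add: ec_7)
  show "7 < length (ec 7)" by (simp add: ec_7)
  show "[7, 6, 5, 4, 3, 2, 1, 0] = dl 1 7" by (simp add: eval_nat_numeral)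
  show "[1, 1, 1, 1, 1, 1] = replicate 6 1" by (simp add: eval_nat_numeral)
  show "poschk 18 0 18 (chamber_rows [0, 105955, 0, - 1390, 0, 3] [] [20617564, 358400, 18900] [1, - 1, - 1, 0, 0, 1, 0, 1] [7, 6, 5, 4, 3, 2, 1, 0] (sgn_par m) (sgn_par (int r)) [1, 1, 1, 1, 1, 1])"
    by (rule chamber_7_7_pos0)
qed (use assms in auto)

lemma chamber_7_8_pos0:
  "poschk 18 0 18 (chamber_rows [0, 105955, 0, - 1390, 0, 3] [] [20617564, 358400, 18900] [1, - 1, - 1, 0, 0, 1, 0, 1, 1] [8, 7, 6, 5, 4, 3, 2, 1, 0] s \<rho> [1, 1, 1, 1, 1, 1])"
  by (simp only: pos_rules pos_num cong: pos_congs)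

lemma chamber_7_8:
  assumes "r \<ge> 18" "16 * real r \<le> 2 * of_int m + 27" "2 * of_int m + 27 < 18 * real r"
  shows "0 \<le> dif r 7 m"
proof (rule chamber_gen[OF lump_7, where j = 8 and u = 1 and S = 27 and xl = 0 and h = 18 and L = 6
    and cs = "[1, - 1, - 1, 0, 0, 1, 0, 1, 1]" and bs = "[8, 7, 6, 5, 4, 3, 2, 1, 0]" and B = "[1, 1, 1, 1, 1, 1]"])
  show "sg 7 = 27" by (simp add: eval_nat_numeral)
  show "[1, - 1, - 1, 0, 0, 1, 0, 1, 1] = take (8 + 1) (ec 7)" by (simp add: ec_7)
  show "8 < length (ec 7)" by (simp add: ec_7)
  show "[8, 7, 6, 5, 4, 3, 2, 1, 0] = dl 1 8" by (simp add: eval_nat_numeral)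
  show "[1, 1, 1, 1, 1, 1] = replicate 6 1" by (simp add: eval_nat_numeral)
  show "poschk 18 0 18 (chamber_rows [0, 105955, 0, - 1390, 0, 3] [] [20617564, 358400, 18900] [1, - 1, - 1, 0, 0, 1, 0, 1, 1] [8, 7, 6, 5, 4, 3, 2, 1, 0] (sgn_par m) (sgn_par (int r)) [1, 1, 1, 1, 1, 1])"
    by (rule chamber_7_8_pos0)
qed (use assms in auto)

lemma chamber_7_9_pos0:
  "poschk 18 0 18 (chamber_rows [0, 105955, 0, - 1390, 0, 3] [] [20617564, 358400, 18900] [1, - 1, - 1, 0, 0, 1, 0, 1, 1, 0] [9, 8, 7, 6, 5, 4, 3, 2, 1, 0] s \<rho> [1, 1, 1, 1, 1, 1])"
  by (simp only: pos_rules pos_num cong: pos_congs)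

lemma chamber_7_9:
  assumes "r \<ge> 18" "18 * real r \<le> 2 * of_int m + 27" "2 * of_int m + 27 < 20 * real r"
  shows "0 \<le> dif r 7 m"
proof (rule chamber_gen[OF lump_7, where j = 9 and u = 1 and S = 27 and xl = 0 and h = 18 and L = 6
    and cs = "[1, - 1, - 1, 0, 0, 1, 0, 1, 1, 0]" and bs = "[9, 8, 7, 6, 5, 4, 3, 2, 1, 0]" and B = "[1, 1, 1, 1, 1, 1]"])
  show "sg 7 = 27" by (simp add: eval_nat_numeral)
  show "[1, - 1, - 1, 0, 0, 1, 0, 1, 1, 0] = take (9 + 1) (ec 7)" by (simp add: ec_7)
  show "9 < length (ec 7)" by (simp add: ec_7)
  show "[9, 8, 7, 6, 5, 4, 3, 2, 1, 0] = dl 1 9" by (simp add: eval_nat_numeral)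
  show "[1, 1, 1, 1, 1, 1] = replicate 6 1" by (simp add: eval_nat_numeral)
  show "poschk 18 0 18 (chamber_rows [0, 105955, 0, - 1390, 0, 3] [] [20617564, 358400, 18900] [1, - 1, - 1, 0, 0, 1, 0, 1, 1, 0] [9, 8, 7, 6, 5, 4, 3, 2, 1, 0] (sgn_par m) (sgn_par (int r)) [1, 1, 1, 1, 1, 1])"
    by (rule chamber_7_9_pos0)
qed (use assms in auto)

lemma chamber_7_10_pos0:
  "poschk 18 0 18 (chamber_rows [0, 105955, 0, - 1390, 0, 3] [] [20617564, 358400, 18900] [1, - 1, - 1, 0, 0, 1, 0, 1, 1, 0, - 1] [10, 9, 8, 7, 6, 5, 4, 3, 2, 1, 0] s \<rho> [1, 1, 1, 1, 1, 1])"
  by (simp only: pos_rules pos_num cong: pos_congs)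

lemma chamber_7_10:
  assumes "r \<ge> 18" "20 * real r \<le> 2 * of_int m + 27" "2 * of_int m + 27 < 22 * real r"
  shows "0 \<le> dif r 7 m"
proof (rule chamber_gen[OF lump_7, where j = 10 and u = 1 and S = 27 and xl = 0 and h = 18 and L = 6
    and cs = "[1, - 1, - 1, 0, 0, 1, 0, 1, 1, 0, - 1]" and bs = "[10, 9, 8, 7, 6, 5, 4, 3, 2, 1, 0]" and B = "[1, 1, 1, 1, 1, 1]"])
  show "sg 7 = 27" by (simp add: eval_nat_numeral)
  show "[1, - 1, - 1, 0, 0, 1, 0, 1, 1, 0, - 1] = take (10 + 1) (ec 7)" by (simp add: ec_7)
  show "10 < length (ec 7)" by (simp add: ec_7)
  show "[10, 9, 8, 7, 6, 5, 4, 3, 2, 1, 0] = dl 1 10" by (simp add: eval_nat_numeral)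
  show "[1, 1, 1, 1, 1, 1] = replicate 6 1" by (simp add: eval_nat_numeral)
  show "poschk 18 0 18 (chamber_rows [0, 105955, 0, - 1390, 0, 3] [] [20617564, 358400, 18900] [1, - 1, - 1, 0, 0, 1, 0, 1, 1, 0, - 1] [10, 9, 8, 7, 6, 5, 4, 3, 2, 1, 0] (sgn_par m) (sgn_par (int r)) [1, 1, 1, 1, 1, 1])"
    by (rule chamber_7_10_pos0)
qed (use assms in auto)

lemma chamber_7_11_pos0:
  "poschk 18 0 18 (chamber_rows [0, 105955, 0, - 1390, 0, 3] [] [20617564, 358400, 18900] [1, - 1, - 1, 0, 0, 1, 0, 1, 1, 0, - 1, - 1] [11, 10, 9, 8, 7, 6, 5, 4, 3, 2, 1, 0] s \<rho> [1, 1, 1, 1, 1, 1])"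
  by (simp only: pos_rules pos_num cong: pos_congs)

lemma chamber_7_11:
  assumes "r \<ge> 18" "22 * real r \<le> 2 * of_int m + 27" "2 * of_int m + 27 < 24 * real r"
  shows "0 \<le> dif r 7 m"
proof (rule chamber_gen[OF lump_7, where j = 11 and u = 1 and S = 27 and xl = 0 and h = 18 and L = 6
    and cs = "[1, - 1, - 1, 0, 0, 1, 0, 1, 1, 0, - 1, - 1]" and bs = "[11, 10, 9, 8, 7, 6, 5, 4, 3, 2, 1, 0]" and B = "[1, 1, 1, 1, 1, 1]"])
  show "sg 7 = 27" by (simp add: eval_nat_numeral)
  show "[1, - 1, - 1, 0, 0, 1, 0, 1, 1, 0, - 1, - 1] = take (11 + 1) (ec 7)" by (simp add: ec_7)
  show "11 < length (ec 7)" by (simp add: ec_7)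
  show "[11, 10, 9, 8, 7, 6, 5, 4, 3, 2, 1, 0] = dl 1 11" by (simp add: eval_nat_numeral)
  show "[1, 1, 1, 1, 1, 1] = replicate 6 1" by (simp add: eval_nat_numeral)
  show "poschk 18 0 18 (chamber_rows [0, 105955, 0, - 1390, 0, 3] [] [20617564, 358400, 18900] [1, - 1, - 1, 0, 0, 1, 0, 1, 1, 0, - 1, - 1] [11, 10, 9, 8, 7, 6, 5, 4, 3, 2, 1, 0] (sgn_par m) (sgn_par (int r)) [1, 1, 1, 1, 1, 1])"
    by (rule chamber_7_11_pos0)
qed (use assms in auto)

lemma chamber_7_12_pos0:
  "poschk 18 0 18 (chamber_rows [0, 105955, 0, - 1390, 0, 3] [] [20617564, 358400, 18900] [1, - 1, - 1, 0, 0, 1, 0, 1, 1, 0, - 1, - 1, - 2] [12, 11, 10, 9, 8, 7, 6, 5, 4, 3, 2, 1, 0] s \<rho> [1, 1, 1, 1, 1, 1])"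
  by (simp only: pos_rules pos_num cong: pos_congs)

lemma chamber_7_12:
  assumes "r \<ge> 18" "24 * real r \<le> 2 * of_int m + 27" "2 * of_int m + 27 < 26 * real r"
  shows "0 \<le> dif r 7 m"
proof (rule chamber_gen[OF lump_7, where j = 12 and u = 1 and S = 27 and xl = 0 and h = 18 and L = 6
    and cs = "[1, - 1, - 1, 0, 0, 1, 0, 1, 1, 0, - 1, - 1, - 2]" and bs = "[12, 11, 10, 9, 8, 7, 6, 5, 4, 3, 2, 1, 0]" and B = "[1, 1, 1, 1, 1, 1]"])
  show "sg 7 = 27" by (simp add: eval_nat_numeral)
  show "[1, - 1, - 1, 0, 0, 1, 0, 1, 1, 0, - 1, - 1, - 2] = take (12 + 1) (ec 7)" by (simp add: ec_7)
  show "12 < length (ec 7)" by (simp add: ec_7)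
  show "[12, 11, 10, 9, 8, 7, 6, 5, 4, 3, 2, 1, 0] = dl 1 12" by (simp add: eval_nat_numeral)
  show "[1, 1, 1, 1, 1, 1] = replicate 6 1" by (simp add: eval_nat_numeral)
  show "poschk 18 0 18 (chamber_rows [0, 105955, 0, - 1390, 0, 3] [] [20617564, 358400, 18900] [1, - 1, - 1, 0, 0, 1, 0, 1, 1, 0, - 1, - 1, - 2] [12, 11, 10, 9, 8, 7, 6, 5, 4, 3, 2, 1, 0] (sgn_par m) (sgn_par (int r)) [1, 1, 1, 1, 1, 1])"
    by (rule chamber_7_12_pos0)
qed (use assms in auto)

lemma chamber_7_13_pos0:
  "poschk 18 1 18 (chamber_rows [0, 105955, 0, - 1390, 0, 3] [- 1921500, 0, 18900] [18696064, 358400] [1, - 1, - 1, 0, 0, 1, 0, 1, 1, 0, - 1, - 1, - 2, 0] [13, 12, 11, 10, 9, 8, 7, 6, 5, 4, 3, 2, 1, 0] 1 1 [1, 1, 1, 1, 1, 1])"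
  by (simp only: pos_rules pos_num cong: pos_congs)

lemma chamber_7_13_pos1:
  "poschk 18 1 18 (chamber_rows [0, 105955, 0, - 1390, 0, 3] [- 1921500, 0, 18900] [18696064, 358400] [1, - 1, - 1, 0, 0, 1, 0, 1, 1, 0, - 1, - 1, - 2, 0] [13, 12, 11, 10, 9, 8, 7, 6, 5, 4, 3, 2, 1, 0] 1 (- 1) [1, 1, 1, 1, 1, 1])"
  by (simp only: pos_rules pos_num cong: pos_congs)

lemma chamber_7_13_pos2:
  "poschk 18 1 18 (chamber_rows [0, 105955, 0, - 1390, 0, 3] [- 1921500, 0, 18900] [18696064, 358400] [1, - 1, - 1, 0, 0, 1, 0, 1, 1, 0, - 1, - 1, - 2, 0] [13, 12, 11, 10, 9, 8, 7, 6, 5, 4, 3, 2, 1, 0] (- 1) 1 [1, 1, 1, 1, 1, 1])"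
  by (simp only: pos_rules pos_num cong: pos_congs)

lemma chamber_7_13_pos3:
  "poschk 18 1 18 (chamber_rows [0, 105955, 0, - 1390, 0, 3] [- 1921500, 0, 18900] [18696064, 358400] [1, - 1, - 1, 0, 0, 1, 0, 1, 1, 0, - 1, - 1, - 2, 0] [13, 12, 11, 10, 9, 8, 7, 6, 5, 4, 3, 2, 1, 0] (- 1) (- 1) [1, 1, 1, 1, 1, 1])"
  by (simp only: pos_rules pos_num cong: pos_congs)

lemma chamber_7_13:
  assumes "r \<ge> 18" "26 * real r \<le> 2 * of_int m + 27" "2 * of_int m + 28 \<le> 28 * real r"
  shows "0 \<le> dif r 7 m"
proof (rule chamber_gen[OF est_7, where j = 13 and u = 1 and S = 27 and xl = 1 and h = 18 and L = 6
    and cs = "[1, - 1, - 1, 0, 0, 1, 0, 1, 1, 0, - 1, - 1, - 2, 0]" and bs = "[13, 12, 11, 10, 9, 8, 7, 6, 5, 4, 3, 2, 1, 0]" and B = "[1, 1, 1, 1, 1, 1]"])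
  show "sg 7 = 27" by (simp add: eval_nat_numeral)
  show "[1, - 1, - 1, 0, 0, 1, 0, 1, 1, 0, - 1, - 1, - 2, 0] = take (13 + 1) (ec 7)" by (simp add: ec_7)
  show "13 < length (ec 7)" by (simp add: ec_7)
  show "[13, 12, 11, 10, 9, 8, 7, 6, 5, 4, 3, 2, 1, 0] = dl 1 13" by (simp add: eval_nat_numeral)
  show "[1, 1, 1, 1, 1, 1] = replicate 6 1" by (simp add: eval_nat_numeral)
  show "poschk 18 1 18 (chamber_rows [0, 105955, 0, - 1390, 0, 3] [- 1921500, 0, 18900] [18696064, 358400] [1, - 1, - 1, 0, 0, 1, 0, 1, 1, 0, - 1, - 1, - 2, 0] [13, 12, 11, 10, 9, 8, 7, 6, 5, 4, 3, 2, 1, 0] (sgn_par m) (sgn_par (int r)) [1, 1, 1, 1, 1, 1])"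
    using chamber_7_13_pos0 chamber_7_13_pos1 chamber_7_13_pos2 chamber_7_13_pos3 by (simp add: sgn_par_def)
qed (use assms in auto)

lemma chamber_8_13_pos0:
  "poschk 18 0 18 (chamber_rows [- 124907633, 0, 4695327, 0, - 21315, 0, 21] [] [12123428608, 294264600, 0, 264600] [1, - 1, - 1, 0, 0, 1, 0, 1, 0, 1, 0, - 1, - 2, - 1] [13, 12, 11, 10, 9, 8, 7, 6, 5, 4, 3, 2, 1, 0] s \<rho> [1, 1, 1, 1, 1, 1, 1])"
  by (simp only: pos_rules pos_num cong: pos_congs)

lemma chamber_8_13:
  assumes "r \<ge> 18" "26 * real r \<le> 2 * of_int m + 35" "2 * of_int m + 35 < 28 * real r"
  shows "0 \<le> dif r 8 m"
proof (rule chamber_gen[OF lump_8, where j = 13 and u = 1 and S = 35 and xl = 0 and h = 18 and L = 7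
    and cs = "[1, - 1, - 1, 0, 0, 1, 0, 1, 0, 1, 0, - 1, - 2, - 1]" and bs = "[13, 12, 11, 10, 9, 8, 7, 6, 5, 4, 3, 2, 1, 0]" and B = "[1, 1, 1, 1, 1, 1, 1]"])
  show "sg 8 = 35" by (simp add: eval_nat_numeral)
  show "[1, - 1, - 1, 0, 0, 1, 0, 1, 0, 1, 0, - 1, - 2, - 1] = take (13 + 1) (ec 8)" by (simp add: ec_8)
  show "13 < length (ec 8)" by (simp add: ec_8)
  show "[13, 12, 11, 10, 9, 8, 7, 6, 5, 4, 3, 2, 1, 0] = dl 1 13" by (simp add: eval_nat_numeral)
  show "[1, 1, 1, 1, 1, 1, 1] = replicate 7 1" by (simp add: eval_nat_numeral)
  show "poschk 18 0 18 (chamber_rows [- 124907633, 0, 4695327, 0, - 21315, 0, 21] [] [12123428608, 294264600, 0, 264600] [1, - 1, - 1, 0, 0, 1, 0, 1, 0, 1, 0, - 1, - 2, - 1] [13, 12, 11, 10, 9, 8, 7, 6, 5, 4, 3, 2, 1, 0] (sgn_par m) (sgn_par (int r)) [1, 1, 1, 1, 1, 1, 1])"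
    by (rule chamber_8_13_pos0)
qed (use assms in auto)

lemma chamber_8_14_pos0:
  "poschk 18 0 18 (chamber_rows [- 124907633, 0, 4695327, 0, - 21315, 0, 21] [] [12123428608, 294264600, 0, 264600] [1, - 1, - 1, 0, 0, 1, 0, 1, 0, 1, 0, - 1, - 2, - 1, 0] [14, 13, 12, 11, 10, 9, 8, 7, 6, 5, 4, 3, 2, 1, 0] s \<rho> [1, 1, 1, 1, 1, 1, 1])"
  by (simp only: pos_rules pos_num cong: pos_congs)

lemma chamber_8_14:
  assumes "r \<ge> 18" "28 * real r \<le> 2 * of_int m + 35" "2 * of_int m + 35 < 30 * real r"
  shows "0 \<le> dif r 8 m"
proof (rule chamber_gen[OF lump_8, where j = 14 and u = 1 and S = 35 and xl = 0 and h = 18 and L = 7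
    and cs = "[1, - 1, - 1, 0, 0, 1, 0, 1, 0, 1, 0, - 1, - 2, - 1, 0]" and bs = "[14, 13, 12, 11, 10, 9, 8, 7, 6, 5, 4, 3, 2, 1, 0]" and B = "[1, 1, 1, 1, 1, 1, 1]"])
  show "sg 8 = 35" by (simp add: eval_nat_numeral)
  show "[1, - 1, - 1, 0, 0, 1, 0, 1, 0, 1, 0, - 1, - 2, - 1, 0] = take (14 + 1) (ec 8)" by (simp add: ec_8)
  show "14 < length (ec 8)" by (simp add: ec_8)
  show "[14, 13, 12, 11, 10, 9, 8, 7, 6, 5, 4, 3, 2, 1, 0] = dl 1 14" by (simp add: eval_nat_numeral)
  show "[1, 1, 1, 1, 1, 1, 1] = replicate 7 1" by (simp add: eval_nat_numeral)
  show "poschk 18 0 18 (chamber_rows [- 124907633, 0, 4695327, 0, - 21315, 0, 21] [] [12123428608, 294264600, 0, 264600] [1, - 1, - 1, 0, 0, 1, 0, 1, 0, 1, 0, - 1, - 2, - 1, 0] [14, 13, 12, 11, 10, 9, 8, 7, 6, 5, 4, 3, 2, 1, 0] (sgn_par m) (sgn_par (int r)) [1, 1, 1, 1, 1, 1, 1])"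
    by (rule chamber_8_14_pos0)
qed (use assms in auto)

lemma chamber_8_15_pos0:
  "poschk 18 0 18 (chamber_rows [- 124907633, 0, 4695327, 0, - 21315, 0, 21] [] [12123428608, 294264600, 0, 264600] [1, - 1, - 1, 0, 0, 1, 0, 1, 0, 1, 0, - 1, - 2, - 1, 0, - 1] [15, 14, 13, 12, 11, 10, 9, 8, 7, 6, 5, 4, 3, 2, 1, 0] s \<rho> [1, 1, 1, 1, 1, 1, 1])"
  by (simp only: pos_rules pos_num cong: pos_congs)

lemma chamber_8_15:
  assumes "r \<ge> 18" "30 * real r \<le> 2 * of_int m + 35" "2 * of_int m + 35 < 32 * real r"
  shows "0 \<le> dif r 8 m"
proof (rule chamber_gen[OF lump_8, where j = 15 and u = 1 and S = 35 and xl = 0 and h = 18 and L = 7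
    and cs = "[1, - 1, - 1, 0, 0, 1, 0, 1, 0, 1, 0, - 1, - 2, - 1, 0, - 1]" and bs = "[15, 14, 13, 12, 11, 10, 9, 8, 7, 6, 5, 4, 3, 2, 1, 0]" and B = "[1, 1, 1, 1, 1, 1, 1]"])
  show "sg 8 = 35" by (simp add: eval_nat_numeral)
  show "[1, - 1, - 1, 0, 0, 1, 0, 1, 0, 1, 0, - 1, - 2, - 1, 0, - 1] = take (15 + 1) (ec 8)" by (simp add: ec_8)
  show "15 < length (ec 8)" by (simp add: ec_8)
  show "[15, 14, 13, 12, 11, 10, 9, 8, 7, 6, 5, 4, 3, 2, 1, 0] = dl 1 15" by (simp add: eval_nat_numeral)
  show "[1, 1, 1, 1, 1, 1, 1] = replicate 7 1" by (simp add: eval_nat_numeral)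
  show "poschk 18 0 18 (chamber_rows [- 124907633, 0, 4695327, 0, - 21315, 0, 21] [] [12123428608, 294264600, 0, 264600] [1, - 1, - 1, 0, 0, 1, 0, 1, 0, 1, 0, - 1, - 2, - 1, 0, - 1] [15, 14, 13, 12, 11, 10, 9, 8, 7, 6, 5, 4, 3, 2, 1, 0] (sgn_par m) (sgn_par (int r)) [1, 1, 1, 1, 1, 1, 1])"
    by (rule chamber_8_15_pos0)
qed (use assms in auto)

lemma chamber_8_16_pos0:
  "poschk 18 0 18 (chamber_rows [- 124907633, 0, 4695327, 0, - 21315, 0, 21] [] [12123428608, 294264600, 0, 264600] [1, - 1, - 1, 0, 0, 1, 0, 1, 0, 1, 0, - 1, - 2, - 1, 0, - 1, 1] [16, 15, 14, 13, 12, 11, 10, 9, 8, 7, 6, 5, 4, 3, 2, 1, 0] s \<rho> [1, 1, 1, 1, 1, 1, 1])"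
  by (simp only: pos_rules pos_num cong: pos_congs)

lemma chamber_8_16:
  assumes "r \<ge> 18" "32 * real r \<le> 2 * of_int m + 35" "2 * of_int m + 35 < 34 * real r"
  shows "0 \<le> dif r 8 m"
proof (rule chamber_gen[OF lump_8, where j = 16 and u = 1 and S = 35 and xl = 0 and h = 18 and L = 7
    and cs = "[1, - 1, - 1, 0, 0, 1, 0, 1, 0, 1, 0, - 1, - 2, - 1, 0, - 1, 1]" and bs = "[16, 15, 14, 13, 12, 11, 10, 9, 8, 7, 6, 5, 4, 3, 2, 1, 0]" and B = "[1, 1, 1, 1, 1, 1, 1]"])
  show "sg 8 = 35" by (simp add: eval_nat_numeral)
  show "[1, - 1, - 1, 0, 0, 1, 0, 1, 0, 1, 0, - 1, - 2, - 1, 0, - 1, 1] = take (16 + 1) (ec 8)" by (simp add: ec_8)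
  show "16 < length (ec 8)" by (simp add: ec_8)
  show "[16, 15, 14, 13, 12, 11, 10, 9, 8, 7, 6, 5, 4, 3, 2, 1, 0] = dl 1 16" by (simp add: eval_nat_numeral)
  show "[1, 1, 1, 1, 1, 1, 1] = replicate 7 1" by (simp add: eval_nat_numeral)
  show "poschk 18 0 18 (chamber_rows [- 124907633, 0, 4695327, 0, - 21315, 0, 21] [] [12123428608, 294264600, 0, 264600] [1, - 1, - 1, 0, 0, 1, 0, 1, 0, 1, 0, - 1, - 2, - 1, 0, - 1, 1] [16, 15, 14, 13, 12, 11, 10, 9, 8, 7, 6, 5, 4, 3, 2, 1, 0] (sgn_par m) (sgn_par (int r)) [1, 1, 1, 1, 1, 1, 1])"
    by (rule chamber_8_16_pos0)
qed (use assms in auto)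

lemma chamber_8_17_pos0:
  "poschk 18 1 18 (chamber_rows [- 124907633, 0, 4695327, 0, - 21315, 0, 21] [0, - 97637400, 0, 264600] [12123428608, 196627200] [1, - 1, - 1, 0, 0, 1, 0, 1, 0, 1, 0, - 1, - 2, - 1, 0, - 1, 1, 1] [17, 16, 15, 14, 13, 12, 11, 10, 9, 8, 7, 6, 5, 4, 3, 2, 1, 0] 1 1 [1, 1, 1, 1, 1, 1, 1])"
  by (simp only: pos_rules pos_num cong: pos_congs)

lemma chamber_8_17_pos1:
  "poschk 18 1 18 (chamber_rows [- 124907633, 0, 4695327, 0, - 21315, 0, 21] [0, - 97637400, 0, 264600] [12123428608, 196627200] [1, - 1, - 1, 0, 0, 1, 0, 1, 0, 1, 0, - 1, - 2, - 1, 0, - 1, 1, 1] [17, 16, 15, 14, 13, 12, 11, 10, 9, 8, 7, 6, 5, 4, 3, 2, 1, 0] 1 (- 1) [1, 1, 1, 1, 1, 1, 1])"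
  by (simp only: pos_rules pos_num cong: pos_congs)

lemma chamber_8_17_pos2:
  "poschk 18 1 18 (chamber_rows [- 124907633, 0, 4695327, 0, - 21315, 0, 21] [0, - 97637400, 0, 264600] [12123428608, 196627200] [1, - 1, - 1, 0, 0, 1, 0, 1, 0, 1, 0, - 1, - 2, - 1, 0, - 1, 1, 1] [17, 16, 15, 14, 13, 12, 11, 10, 9, 8, 7, 6, 5, 4, 3, 2, 1, 0] (- 1) 1 [1, 1, 1, 1, 1, 1, 1])"
  by (simp only: pos_rules pos_num cong: pos_congs)

lemma chamber_8_17_pos3:
  "poschk 18 1 18 (chamber_rows [- 124907633, 0, 4695327, 0, - 21315, 0, 21] [0, - 97637400, 0, 264600] [12123428608, 196627200] [1, - 1, - 1, 0, 0, 1, 0, 1, 0, 1, 0, - 1, - 2, - 1, 0, - 1, 1, 1] [17, 16, 15, 14, 13, 12, 11, 10, 9, 8, 7, 6, 5, 4, 3, 2, 1, 0] (- 1) (- 1) [1, 1, 1, 1, 1, 1, 1])"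
  by (simp only: pos_rules pos_num cong: pos_congs)

lemma chamber_8_17:
  assumes "r \<ge> 18" "34 * real r \<le> 2 * of_int m + 35" "2 * of_int m + 36 \<le> 36 * real r"
  shows "0 \<le> dif r 8 m"
proof (rule chamber_gen[OF est_8, where j = 17 and u = 1 and S = 35 and xl = 1 and h = 18 and L = 7
    and cs = "[1, - 1, - 1, 0, 0, 1, 0, 1, 0, 1, 0, - 1, - 2, - 1, 0, - 1, 1, 1]" and bs = "[17, 16, 15, 14, 13, 12, 11, 10, 9, 8, 7, 6, 5, 4, 3, 2, 1, 0]" and B = "[1, 1, 1, 1, 1, 1, 1]"])
  show "sg 8 = 35" by (simp add: eval_nat_numeral)
  show "[1, - 1, - 1, 0, 0, 1, 0, 1, 0, 1, 0, - 1, - 2, - 1, 0, - 1, 1, 1] = take (17 + 1) (ec 8)" by (simp add: ec_8)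
  show "17 < length (ec 8)" by (simp add: ec_8)
  show "[17, 16, 15, 14, 13, 12, 11, 10, 9, 8, 7, 6, 5, 4, 3, 2, 1, 0] = dl 1 17" by (simp add: eval_nat_numeral)
  show "[1, 1, 1, 1, 1, 1, 1] = replicate 7 1" by (simp add: eval_nat_numeral)
  show "poschk 18 1 18 (chamber_rows [- 124907633, 0, 4695327, 0, - 21315, 0, 21] [0, - 97637400, 0, 264600] [12123428608, 196627200] [1, - 1, - 1, 0, 0, 1, 0, 1, 0, 1, 0, - 1, - 2, - 1, 0, - 1, 1, 1] [17, 16, 15, 14, 13, 12, 11, 10, 9, 8, 7, 6, 5, 4, 3, 2, 1, 0] (sgn_par m) (sgn_par (int r)) [1, 1, 1, 1, 1, 1, 1])"
    using chamber_8_17_pos0 chamber_8_17_pos1 chamber_8_17_pos2 chamber_8_17_pos3 by (simp add: sgn_par_def)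
qed (use assms in auto)

lemma chamber_9_17_pos0:
  "poschk 18 0 18 (chamber_rows [0, - 333418400, 0, 3037608, 0, - 5964, 0, 3] [] [197782198272, 3150229600, 60211200, 2381400] [1, - 1, - 1, 0, 0, 1, 0, 1, 0, 0, 1, 0, - 2, - 1, - 1, - 1, 0, 1] [17, 16, 15, 14, 13, 12, 11, 10, 9, 8, 7, 6, 5, 4, 3, 2, 1, 0] s \<rho> [1, 1, 1, 1, 1, 1, 1, 1])"
  by (simp only: pos_rules pos_num cong: pos_congs)

lemma chamber_9_17:
  assumes "r \<ge> 18" "34 * real r \<le> 2 * of_int m + 44" "2 * of_int m + 44 < 36 * real r"
  shows "0 \<le> dif r 9 m"
proof (rule chamber_gen[OF lump_9, where j = 17 and u = 1 and S = 44 and xl = 0 and h = 18 and L = 8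
    and cs = "[1, - 1, - 1, 0, 0, 1, 0, 1, 0, 0, 1, 0, - 2, - 1, - 1, - 1, 0, 1]" and bs = "[17, 16, 15, 14, 13, 12, 11, 10, 9, 8, 7, 6, 5, 4, 3, 2, 1, 0]" and B = "[1, 1, 1, 1, 1, 1, 1, 1]"])
  show "sg 9 = 44" by (simp add: eval_nat_numeral)
  show "[1, - 1, - 1, 0, 0, 1, 0, 1, 0, 0, 1, 0, - 2, - 1, - 1, - 1, 0, 1] = take (17 + 1) (ec 9)" by (simp add: ec_9)
  show "17 < length (ec 9)" by (simp add: ec_9)
  show "[17, 16, 15, 14, 13, 12, 11, 10, 9, 8, 7, 6, 5, 4, 3, 2, 1, 0] = dl 1 17" by (simp add: eval_nat_numeral)
  show "[1, 1, 1, 1, 1, 1, 1, 1] = replicate 8 1" by (simp add: eval_nat_numeral)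
  show "poschk 18 0 18 (chamber_rows [0, - 333418400, 0, 3037608, 0, - 5964, 0, 3] [] [197782198272, 3150229600, 60211200, 2381400] [1, - 1, - 1, 0, 0, 1, 0, 1, 0, 0, 1, 0, - 2, - 1, - 1, - 1, 0, 1] [17, 16, 15, 14, 13, 12, 11, 10, 9, 8, 7, 6, 5, 4, 3, 2, 1, 0] (sgn_par m) (sgn_par (int r)) [1, 1, 1, 1, 1, 1, 1, 1])"
    by (rule chamber_9_17_pos0)
qed (use assms in auto)

lemma chamber_9_18_pos0:
  "poschk 18 0 18 (chamber_rows [0, - 333418400, 0, 3037608, 0, - 5964, 0, 3] [] [197782198272, 3150229600, 60211200, 2381400] [1, - 1, - 1, 0, 0, 1, 0, 1, 0, 0, 1, 0, - 2, - 1, - 1, - 1, 0, 1, 1] [18, 17, 16, 15, 14, 13, 12, 11, 10, 9, 8, 7, 6, 5, 4, 3, 2, 1, 0] s \<rho> [1, 1, 1, 1, 1, 1, 1, 1])"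
  by (simp only: pos_rules pos_num cong: pos_congs)

lemma chamber_9_18:
  assumes "r \<ge> 18" "36 * real r \<le> 2 * of_int m + 44" "2 * of_int m + 44 < 38 * real r"
  shows "0 \<le> dif r 9 m"
proof (rule chamber_gen[OF lump_9, where j = 18 and u = 1 and S = 44 and xl = 0 and h = 18 and L = 8
    and cs = "[1, - 1, - 1, 0, 0, 1, 0, 1, 0, 0, 1, 0, - 2, - 1, - 1, - 1, 0, 1, 1]" and bs = "[18, 17, 16, 15, 14, 13, 12, 11, 10, 9, 8, 7, 6, 5, 4, 3, 2, 1, 0]" and B = "[1, 1, 1, 1, 1, 1, 1, 1]"])
  show "sg 9 = 44" by (simp add: eval_nat_numeral)
  show "[1, - 1, - 1, 0, 0, 1, 0, 1, 0, 0, 1, 0, - 2, - 1, - 1, - 1, 0, 1, 1] = take (18 + 1) (ec 9)" by (simp add: ec_9)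
  show "18 < length (ec 9)" by (simp add: ec_9)
  show "[18, 17, 16, 15, 14, 13, 12, 11, 10, 9, 8, 7, 6, 5, 4, 3, 2, 1, 0] = dl 1 18" by (simp add: eval_nat_numeral)
  show "[1, 1, 1, 1, 1, 1, 1, 1] = replicate 8 1" by (simp add: eval_nat_numeral)
  show "poschk 18 0 18 (chamber_rows [0, - 333418400, 0, 3037608, 0, - 5964, 0, 3] [] [197782198272, 3150229600, 60211200, 2381400] [1, - 1, - 1, 0, 0, 1, 0, 1, 0, 0, 1, 0, - 2, - 1, - 1, - 1, 0, 1, 1] [18, 17, 16, 15, 14, 13, 12, 11, 10, 9, 8, 7, 6, 5, 4, 3, 2, 1, 0] (sgn_par m) (sgn_par (int r)) [1, 1, 1, 1, 1, 1, 1, 1])"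
    by (rule chamber_9_18_pos0)
qed (use assms in auto)

lemma chamber_9_19_pos0:
  "poschk 18 0 18 (chamber_rows [0, - 333418400, 0, 3037608, 0, - 5964, 0, 3] [] [197782198272, 3150229600, 60211200, 2381400] [1, - 1, - 1, 0, 0, 1, 0, 1, 0, 0, 1, 0, - 2, - 1, - 1, - 1, 0, 1, 1, 1] [19, 18, 17, 16, 15, 14, 13, 12, 11, 10, 9, 8, 7, 6, 5, 4, 3, 2, 1, 0] s \<rho> [1, 1, 1, 1, 1, 1, 1, 1])"
  by (simp only: pos_rules pos_num cong: pos_congs)

lemma chamber_9_19:
  assumes "r \<ge> 18" "38 * real r \<le> 2 * of_int m + 44" "2 * of_int m + 44 < 40 * real r"
  shows "0 \<le> dif r 9 m"
proof (rule chamber_gen[OF lump_9, where j = 19 and u = 1 and S = 44 and xl = 0 and h = 18 and L = 8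
    and cs = "[1, - 1, - 1, 0, 0, 1, 0, 1, 0, 0, 1, 0, - 2, - 1, - 1, - 1, 0, 1, 1, 1]" and bs = "[19, 18, 17, 16, 15, 14, 13, 12, 11, 10, 9, 8, 7, 6, 5, 4, 3, 2, 1, 0]" and B = "[1, 1, 1, 1, 1, 1, 1, 1]"])
  show "sg 9 = 44" by (simp add: eval_nat_numeral)
  show "[1, - 1, - 1, 0, 0, 1, 0, 1, 0, 0, 1, 0, - 2, - 1, - 1, - 1, 0, 1, 1, 1] = take (19 + 1) (ec 9)" by (simp add: ec_9)
  show "19 < length (ec 9)" by (simp add: ec_9)
  show "[19, 18, 17, 16, 15, 14, 13, 12, 11, 10, 9, 8, 7, 6, 5, 4, 3, 2, 1, 0] = dl 1 19" by (simp add: eval_nat_numeral)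
  show "[1, 1, 1, 1, 1, 1, 1, 1] = replicate 8 1" by (simp add: eval_nat_numeral)
  show "poschk 18 0 18 (chamber_rows [0, - 333418400, 0, 3037608, 0, - 5964, 0, 3] [] [197782198272, 3150229600, 60211200, 2381400] [1, - 1, - 1, 0, 0, 1, 0, 1, 0, 0, 1, 0, - 2, - 1, - 1, - 1, 0, 1, 1, 1] [19, 18, 17, 16, 15, 14, 13, 12, 11, 10, 9, 8, 7, 6, 5, 4, 3, 2, 1, 0] (sgn_par m) (sgn_par (int r)) [1, 1, 1, 1, 1, 1, 1, 1])"
    by (rule chamber_9_19_pos0)
qed (use assms in auto)

lemma chamber_9_20_pos0:
  "poschk 18 0 18 (chamber_rows [0, - 333418400, 0, 3037608, 0, - 5964, 0, 3] [] [197782198272, 3150229600, 60211200, 2381400] [1, - 1, - 1, 0, 0, 1, 0, 1, 0, 0, 1, 0, - 2, - 1, - 1, - 1, 0, 1, 1, 1, 2] [20, 19, 18, 17, 16, 15, 14, 13, 12, 11, 10, 9, 8, 7, 6, 5, 4, 3, 2, 1, 0] s \<rho> [1, 1, 1, 1, 1, 1, 1, 1])"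
  by (simp only: pos_rules pos_num cong: pos_congs)

lemma chamber_9_20:
  assumes "r \<ge> 18" "40 * real r \<le> 2 * of_int m + 44" "2 * of_int m + 44 < 42 * real r"
  shows "0 \<le> dif r 9 m"
proof (rule chamber_gen[OF lump_9, where j = 20 and u = 1 and S = 44 and xl = 0 and h = 18 and L = 8
    and cs = "[1, - 1, - 1, 0, 0, 1, 0, 1, 0, 0, 1, 0, - 2, - 1, - 1, - 1, 0, 1, 1, 1, 2]" and bs = "[20, 19, 18, 17, 16, 15, 14, 13, 12, 11, 10, 9, 8, 7, 6, 5, 4, 3, 2, 1, 0]" and B = "[1, 1, 1, 1, 1, 1, 1, 1]"])
  show "sg 9 = 44" by (simp add: eval_nat_numeral)
  show "[1, - 1, - 1, 0, 0, 1, 0, 1, 0, 0, 1, 0, - 2, - 1, - 1, - 1, 0, 1, 1, 1, 2] = take (20 + 1) (ec 9)" by (simp add: ec_9)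
  show "20 < length (ec 9)" by (simp add: ec_9)
  show "[20, 19, 18, 17, 16, 15, 14, 13, 12, 11, 10, 9, 8, 7, 6, 5, 4, 3, 2, 1, 0] = dl 1 20" by (simp add: eval_nat_numeral)
  show "[1, 1, 1, 1, 1, 1, 1, 1] = replicate 8 1" by (simp add: eval_nat_numeral)
  show "poschk 18 0 18 (chamber_rows [0, - 333418400, 0, 3037608, 0, - 5964, 0, 3] [] [197782198272, 3150229600, 60211200, 2381400] [1, - 1, - 1, 0, 0, 1, 0, 1, 0, 0, 1, 0, - 2, - 1, - 1, - 1, 0, 1, 1, 1, 2] [20, 19, 18, 17, 16, 15, 14, 13, 12, 11, 10, 9, 8, 7, 6, 5, 4, 3, 2, 1, 0] (sgn_par m) (sgn_par (int r)) [1, 1, 1, 1, 1, 1, 1, 1])"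
    by (rule chamber_9_20_pos0)
qed (use assms in auto)

lemma chamber_9_21_pos0:
  "poschk 18 0 18 (chamber_rows [0, - 333418400, 0, 3037608, 0, - 5964, 0, 3] [] [197782198272, 3150229600, 60211200, 2381400] [1, - 1, - 1, 0, 0, 1, 0, 1, 0, 0, 1, 0, - 2, - 1, - 1, - 1, 0, 1, 1, 1, 2, 1] [21, 20, 19, 18, 17, 16, 15, 14, 13, 12, 11, 10, 9, 8, 7, 6, 5, 4, 3, 2, 1, 0] s \<rho> [1, 1, 1, 1, 1, 1, 1, 1])"
  by (simp only: pos_rules pos_num cong: pos_congs)

lemma chamber_9_21:
  assumes "r \<ge> 18" "42 * real r \<le> 2 * of_int m + 44" "2 * of_int m + 44 < 44 * real r"
  shows "0 \<le> dif r 9 m"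
proof (rule chamber_gen[OF lump_9, where j = 21 and u = 1 and S = 44 and xl = 0 and h = 18 and L = 8
    and cs = "[1, - 1, - 1, 0, 0, 1, 0, 1, 0, 0, 1, 0, - 2, - 1, - 1, - 1, 0, 1, 1, 1, 2, 1]" and bs = "[21, 20, 19, 18, 17, 16, 15, 14, 13, 12, 11, 10, 9, 8, 7, 6, 5, 4, 3, 2, 1, 0]" and B = "[1, 1, 1, 1, 1, 1, 1, 1]"])
  show "sg 9 = 44" by (simp add: eval_nat_numeral)
  show "[1, - 1, - 1, 0, 0, 1, 0, 1, 0, 0, 1, 0, - 2, - 1, - 1, - 1, 0, 1, 1, 1, 2, 1] = take (21 + 1) (ec 9)" by (simp add: ec_9)
  show "21 < length (ec 9)" by (simp add: ec_9)
  show "[21, 20, 19, 18, 17, 16, 15, 14, 13, 12, 11, 10, 9, 8, 7, 6, 5, 4, 3, 2, 1, 0] = dl 1 21" by (simp add: eval_nat_numeral)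
  show "[1, 1, 1, 1, 1, 1, 1, 1] = replicate 8 1" by (simp add: eval_nat_numeral)
  show "poschk 18 0 18 (chamber_rows [0, - 333418400, 0, 3037608, 0, - 5964, 0, 3] [] [197782198272, 3150229600, 60211200, 2381400] [1, - 1, - 1, 0, 0, 1, 0, 1, 0, 0, 1, 0, - 2, - 1, - 1, - 1, 0, 1, 1, 1, 2, 1] [21, 20, 19, 18, 17, 16, 15, 14, 13, 12, 11, 10, 9, 8, 7, 6, 5, 4, 3, 2, 1, 0] (sgn_par m) (sgn_par (int r)) [1, 1, 1, 1, 1, 1, 1, 1])"
    by (rule chamber_9_21_pos0)
qed (use assms in auto)

lemma chamber_9_22_pos0:
  "poschk 9 1 9 (chamber_rows [0, - 333418400, 0, 3037608, 0, - 5964, 0, 3] [] [197782198272, 3150229600, 60211200, 2381400] [1, - 1, - 1, 0, 0, 1, 0, 1, 0, 0, 1, 0, - 2, - 1, - 1, - 1, 0, 1, 1, 1, 2, 1, 1] [44, 42, 40, 38, 36, 34, 32, 30, 28, 26, 24, 22, 20, 18, 16, 14, 12, 10, 8, 6, 4, 2, 0] s \<rho> [1, 1, 1, 1, 1, 1, 1, 1])"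
  by (simp only: pos_rules pos_num cong: pos_congs)

lemma chamber_9_22:
  assumes "r \<ge> 18" "44 * real r \<le> 2 * of_int m + 44" "2 * of_int m + 45 \<le> 45 * real r"
  shows "0 \<le> dif r 9 m"
proof (rule chamber_gen[OF lump_9, where j = 22 and u = 2 and S = 44 and xl = 1 and h = 9 and L = 8
    and cs = "[1, - 1, - 1, 0, 0, 1, 0, 1, 0, 0, 1, 0, - 2, - 1, - 1, - 1, 0, 1, 1, 1, 2, 1, 1]" and bs = "[44, 42, 40, 38, 36, 34, 32, 30, 28, 26, 24, 22, 20, 18, 16, 14, 12, 10, 8, 6, 4, 2, 0]" and B = "[1, 1, 1, 1, 1, 1, 1, 1]"])
  show "sg 9 = 44" by (simp add: eval_nat_numeral)
  show "[1, - 1, - 1, 0, 0, 1, 0, 1, 0, 0, 1, 0, - 2, - 1, - 1, - 1, 0, 1, 1, 1, 2, 1, 1] = take (22 + 1) (ec 9)" by (simp add: ec_9)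
  show "22 < length (ec 9)" by (simp add: ec_9)
  show "[44, 42, 40, 38, 36, 34, 32, 30, 28, 26, 24, 22, 20, 18, 16, 14, 12, 10, 8, 6, 4, 2, 0] = dl 2 22" by (simp add: eval_nat_numeral)
  show "[1, 1, 1, 1, 1, 1, 1, 1] = replicate 8 1" by (simp add: eval_nat_numeral)
  show "poschk 9 1 9 (chamber_rows [0, - 333418400, 0, 3037608, 0, - 5964, 0, 3] [] [197782198272, 3150229600, 60211200, 2381400] [1, - 1, - 1, 0, 0, 1, 0, 1, 0, 0, 1, 0, - 2, - 1, - 1, - 1, 0, 1, 1, 1, 2, 1, 1] [44, 42, 40, 38, 36, 34, 32, 30, 28, 26, 24, 22, 20, 18, 16, 14, 12, 10, 8, 6, 4, 2, 0] (sgn_par m) (sgn_par (int r)) [1, 1, 1, 1, 1, 1, 1, 1])"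
    by (rule chamber_9_22_pos0)
qed (use assms in auto)

lemma chamber_10_22_pos0:
  "poschk 18 0 18 (chamber_rows [632787234176, 0, - 16146784000, 0, 55156080, 0, - 53760, 0, 15] [] [129518473506176, 1865035898880, 66023776000, 0, 23814000] [1, - 1, - 1, 0, 0, 1, 0, 1, 0, 0, 0, 1, - 1, - 1, - 1, - 2, 0, 0, 1, 1, 1, 1, 3] [22, 21, 20, 19, 18, 17, 16, 15, 14, 13, 12, 11, 10, 9, 8, 7, 6, 5, 4, 3, 2, 1, 0] s \<rho> [1, 1, 1, 1, 1, 1, 1, 1, 1])"
  by (simp only: pos_rules pos_num cong: pos_congs)

lemma chamber_10_22:
  assumes "r \<ge> 18" "44 * real r \<le> 2 * of_int m + 54" "2 * of_int m + 54 < 46 * real r"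
  shows "0 \<le> dif r 10 m"
proof (rule chamber_gen[OF lump_10, where j = 22 and u = 1 and S = 54 and xl = 0 and h = 18 and L = 9
    and cs = "[1, - 1, - 1, 0, 0, 1, 0, 1, 0, 0, 0, 1, - 1, - 1, - 1, - 2, 0, 0, 1, 1, 1, 1, 3]" and bs = "[22, 21, 20, 19, 18, 17, 16, 15, 14, 13, 12, 11, 10, 9, 8, 7, 6, 5, 4, 3, 2, 1, 0]" and B = "[1, 1, 1, 1, 1, 1, 1, 1, 1]"])
  show "sg 10 = 54" by (simp add: eval_nat_numeral)
  show "[1, - 1, - 1, 0, 0, 1, 0, 1, 0, 0, 0, 1, - 1, - 1, - 1, - 2, 0, 0, 1, 1, 1, 1, 3] = take (22 + 1) (ec 10)" by (simp add: ec_10)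
  show "22 < length (ec 10)" by (simp add: ec_10)
  show "[22, 21, 20, 19, 18, 17, 16, 15, 14, 13, 12, 11, 10, 9, 8, 7, 6, 5, 4, 3, 2, 1, 0] = dl 1 22" by (simp add: eval_nat_numeral)
  show "[1, 1, 1, 1, 1, 1, 1, 1, 1] = replicate 9 1" by (simp add: eval_nat_numeral)
  show "poschk 18 0 18 (chamber_rows [632787234176, 0, - 16146784000, 0, 55156080, 0, - 53760, 0, 15] [] [129518473506176, 1865035898880, 66023776000, 0, 23814000] [1, - 1, - 1, 0, 0, 1, 0, 1, 0, 0, 0, 1, - 1, - 1, - 1, - 2, 0, 0, 1, 1, 1, 1, 3] [22, 21, 20, 19, 18, 17, 16, 15, 14, 13, 12, 11, 10, 9, 8, 7, 6, 5, 4, 3, 2, 1, 0] (sgn_par m) (sgn_par (int r)) [1, 1, 1, 1, 1, 1, 1, 1, 1])"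
    by (rule chamber_10_22_pos0)
qed (use assms in auto)

lemma chamber_10_23_pos0:
  "poschk 18 0 18 (chamber_rows [632787234176, 0, - 16146784000, 0, 55156080, 0, - 53760, 0, 15] [] [129518473506176, 1865035898880, 66023776000, 0, 23814000] [1, - 1, - 1, 0, 0, 1, 0, 1, 0, 0, 0, 1, - 1, - 1, - 1, - 2, 0, 0, 1, 1, 1, 1, 3, 0] [23, 22, 21, 20, 19, 18, 17, 16, 15, 14, 13, 12, 11, 10, 9, 8, 7, 6, 5, 4, 3, 2, 1, 0] s \<rho> [1, 1, 1, 1, 1, 1, 1, 1, 1])"
  by (simp only: pos_rules pos_num cong: pos_congs)

lemma chamber_10_23:
  assumes "r \<ge> 18" "46 * real r \<le> 2 * of_int m + 54" "2 * of_int m + 54 < 48 * real r"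
  shows "0 \<le> dif r 10 m"
proof (rule chamber_gen[OF lump_10, where j = 23 and u = 1 and S = 54 and xl = 0 and h = 18 and L = 9
    and cs = "[1, - 1, - 1, 0, 0, 1, 0, 1, 0, 0, 0, 1, - 1, - 1, - 1, - 2, 0, 0, 1, 1, 1, 1, 3, 0]" and bs = "[23, 22, 21, 20, 19, 18, 17, 16, 15, 14, 13, 12, 11, 10, 9, 8, 7, 6, 5, 4, 3, 2, 1, 0]" and B = "[1, 1, 1, 1, 1, 1, 1, 1, 1]"])
  show "sg 10 = 54" by (simp add: eval_nat_numeral)
  show "[1, - 1, - 1, 0, 0, 1, 0, 1, 0, 0, 0, 1, - 1, - 1, - 1, - 2, 0, 0, 1, 1, 1, 1, 3, 0] = take (23 + 1) (ec 10)" by (simp add: ec_10)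
  show "23 < length (ec 10)" by (simp add: ec_10)
  show "[23, 22, 21, 20, 19, 18, 17, 16, 15, 14, 13, 12, 11, 10, 9, 8, 7, 6, 5, 4, 3, 2, 1, 0] = dl 1 23" by (simp add: eval_nat_numeral)
  show "[1, 1, 1, 1, 1, 1, 1, 1, 1] = replicate 9 1" by (simp add: eval_nat_numeral)
  show "poschk 18 0 18 (chamber_rows [632787234176, 0, - 16146784000, 0, 55156080, 0, - 53760, 0, 15] [] [129518473506176, 1865035898880, 66023776000, 0, 23814000] [1, - 1, - 1, 0, 0, 1, 0, 1, 0, 0, 0, 1, - 1, - 1, - 1, - 2, 0, 0, 1, 1, 1, 1, 3, 0] [23, 22, 21, 20, 19, 18, 17, 16, 15, 14, 13, 12, 11, 10, 9, 8, 7, 6, 5, 4, 3, 2, 1, 0] (sgn_par m) (sgn_par (int r)) [1, 1, 1, 1, 1, 1, 1, 1, 1])"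
    by (rule chamber_10_23_pos0)
qed (use assms in auto)

lemma chamber_10_24_pos0:
  "poschk 18 0 18 (chamber_rows [632787234176, 0, - 16146784000, 0, 55156080, 0, - 53760, 0, 15] [] [129518473506176, 1865035898880, 66023776000, 0, 23814000] [1, - 1, - 1, 0, 0, 1, 0, 1, 0, 0, 0, 1, - 1, - 1, - 1, - 2, 0, 0, 1, 1, 1, 1, 3, 0, 0] [24, 23, 22, 21, 20, 19, 18, 17, 16, 15, 14, 13, 12, 11, 10, 9, 8, 7, 6, 5, 4, 3, 2, 1, 0] s \<rho> [1, 1, 1, 1, 1, 1, 1, 1, 1])"
  by (simp only: pos_rules pos_num cong: pos_congs)

lemma chamber_10_24:
  assumes "r \<ge> 18" "48 * real r \<le> 2 * of_int m + 54" "2 * of_int m + 54 < 50 * real r"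
  shows "0 \<le> dif r 10 m"
proof (rule chamber_gen[OF lump_10, where j = 24 and u = 1 and S = 54 and xl = 0 and h = 18 and L = 9
    and cs = "[1, - 1, - 1, 0, 0, 1, 0, 1, 0, 0, 0, 1, - 1, - 1, - 1, - 2, 0, 0, 1, 1, 1, 1, 3, 0, 0]" and bs = "[24, 23, 22, 21, 20, 19, 18, 17, 16, 15, 14, 13, 12, 11, 10, 9, 8, 7, 6, 5, 4, 3, 2, 1, 0]" and B = "[1, 1, 1, 1, 1, 1, 1, 1, 1]"])
  show "sg 10 = 54" by (simp add: eval_nat_numeral)
  show "[1, - 1, - 1, 0, 0, 1, 0, 1, 0, 0, 0, 1, - 1, - 1, - 1, - 2, 0, 0, 1, 1, 1, 1, 3, 0, 0] = take (24 + 1) (ec 10)" by (simp add: ec_10)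
  show "24 < length (ec 10)" by (simp add: ec_10)
  show "[24, 23, 22, 21, 20, 19, 18, 17, 16, 15, 14, 13, 12, 11, 10, 9, 8, 7, 6, 5, 4, 3, 2, 1, 0] = dl 1 24" by (simp add: eval_nat_numeral)
  show "[1, 1, 1, 1, 1, 1, 1, 1, 1] = replicate 9 1" by (simp add: eval_nat_numeral)
  show "poschk 18 0 18 (chamber_rows [632787234176, 0, - 16146784000, 0, 55156080, 0, - 53760, 0, 15] [] [129518473506176, 1865035898880, 66023776000, 0, 23814000] [1, - 1, - 1, 0, 0, 1, 0, 1, 0, 0, 0, 1, - 1, - 1, - 1, - 2, 0, 0, 1, 1, 1, 1, 3, 0, 0] [24, 23, 22, 21, 20, 19, 18, 17, 16, 15, 14, 13, 12, 11, 10, 9, 8, 7, 6, 5, 4, 3, 2, 1, 0] (sgn_par m) (sgn_par (int r)) [1, 1, 1, 1, 1, 1, 1, 1, 1])"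
    by (rule chamber_10_24_pos0)
qed (use assms in auto)

lemma chamber_10_25_pos0:
  "poschk 18 0 18 (chamber_rows [632787234176, 0, - 16146784000, 0, 55156080, 0, - 53760, 0, 15] [] [129518473506176, 1865035898880, 66023776000, 0, 23814000] [1, - 1, - 1, 0, 0, 1, 0, 1, 0, 0, 0, 1, - 1, - 1, - 1, - 2, 0, 0, 1, 1, 1, 1, 3, 0, 0, - 1] [25, 24, 23, 22, 21, 20, 19, 18, 17, 16, 15, 14, 13, 12, 11, 10, 9, 8, 7, 6, 5, 4, 3, 2, 1, 0] s \<rho> [1, 1, 1, 1, 1, 1, 1, 1, 1])"
  by (simp only: pos_rules pos_num cong: pos_congs)

lemma chamber_10_25:
  assumes "r \<ge> 18" "50 * real r \<le> 2 * of_int m + 54" "2 * of_int m + 54 < 52 * real r"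
  shows "0 \<le> dif r 10 m"
proof (rule chamber_gen[OF lump_10, where j = 25 and u = 1 and S = 54 and xl = 0 and h = 18 and L = 9
    and cs = "[1, - 1, - 1, 0, 0, 1, 0, 1, 0, 0, 0, 1, - 1, - 1, - 1, - 2, 0, 0, 1, 1, 1, 1, 3, 0, 0, - 1]" and bs = "[25, 24, 23, 22, 21, 20, 19, 18, 17, 16, 15, 14, 13, 12, 11, 10, 9, 8, 7, 6, 5, 4, 3, 2, 1, 0]" and B = "[1, 1, 1, 1, 1, 1, 1, 1, 1]"])
  show "sg 10 = 54" by (simp add: eval_nat_numeral)
  show "[1, - 1, - 1, 0, 0, 1, 0, 1, 0, 0, 0, 1, - 1, - 1, - 1, - 2, 0, 0, 1, 1, 1, 1, 3, 0, 0, - 1] = take (25 + 1) (ec 10)" by (simp add: ec_10)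
  show "25 < length (ec 10)" by (simp add: ec_10)
  show "[25, 24, 23, 22, 21, 20, 19, 18, 17, 16, 15, 14, 13, 12, 11, 10, 9, 8, 7, 6, 5, 4, 3, 2, 1, 0] = dl 1 25" by (simp add: eval_nat_numeral)
  show "[1, 1, 1, 1, 1, 1, 1, 1, 1] = replicate 9 1" by (simp add: eval_nat_numeral)
  show "poschk 18 0 18 (chamber_rows [632787234176, 0, - 16146784000, 0, 55156080, 0, - 53760, 0, 15] [] [129518473506176, 1865035898880, 66023776000, 0, 23814000] [1, - 1, - 1, 0, 0, 1, 0, 1, 0, 0, 0, 1, - 1, - 1, - 1, - 2, 0, 0, 1, 1, 1, 1, 3, 0, 0, - 1] [25, 24, 23, 22, 21, 20, 19, 18, 17, 16, 15, 14, 13, 12, 11, 10, 9, 8, 7, 6, 5, 4, 3, 2, 1, 0] (sgn_par m) (sgn_par (int r)) [1, 1, 1, 1, 1, 1, 1, 1, 1])"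
    by (rule chamber_10_25_pos0)
qed (use assms in auto)

lemma chamber_10_26_pos0:
  "poschk 18 0 18 (chamber_rows [632787234176, 0, - 16146784000, 0, 55156080, 0, - 53760, 0, 15] [] [129518473506176, 1865035898880, 66023776000, 0, 23814000] [1, - 1, - 1, 0, 0, 1, 0, 1, 0, 0, 0, 1, - 1, - 1, - 1, - 2, 0, 0, 1, 1, 1, 1, 3, 0, 0, - 1, - 1] [26, 25, 24, 23, 22, 21, 20, 19, 18, 17, 16, 15, 14, 13, 12, 11, 10, 9, 8, 7, 6, 5, 4, 3, 2, 1, 0] s \<rho> [1, 1, 1, 1, 1, 1, 1, 1, 1])"
  by (simp only: pos_rules pos_num cong: pos_congs)

lemma chamber_10_26:
  assumes "r \<ge> 18" "52 * real r \<le> 2 * of_int m + 54" "2 * of_int m + 54 < 54 * real r"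
  shows "0 \<le> dif r 10 m"
proof (rule chamber_gen[OF lump_10, where j = 26 and u = 1 and S = 54 and xl = 0 and h = 18 and L = 9
    and cs = "[1, - 1, - 1, 0, 0, 1, 0, 1, 0, 0, 0, 1, - 1, - 1, - 1, - 2, 0, 0, 1, 1, 1, 1, 3, 0, 0, - 1, - 1]" and bs = "[26, 25, 24, 23, 22, 21, 20, 19, 18, 17, 16, 15, 14, 13, 12, 11, 10, 9, 8, 7, 6, 5, 4, 3, 2, 1, 0]" and B = "[1, 1, 1, 1, 1, 1, 1, 1, 1]"])
  show "sg 10 = 54" by (simp add: eval_nat_numeral)
  show "[1, - 1, - 1, 0, 0, 1, 0, 1, 0, 0, 0, 1, - 1, - 1, - 1, - 2, 0, 0, 1, 1, 1, 1, 3, 0, 0, - 1, - 1] = take (26 + 1) (ec 10)" by (simp add: ec_10)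
  show "26 < length (ec 10)" by (simp add: ec_10)
  show "[26, 25, 24, 23, 22, 21, 20, 19, 18, 17, 16, 15, 14, 13, 12, 11, 10, 9, 8, 7, 6, 5, 4, 3, 2, 1, 0] = dl 1 26" by (simp add: eval_nat_numeral)
  show "[1, 1, 1, 1, 1, 1, 1, 1, 1] = replicate 9 1" by (simp add: eval_nat_numeral)
  show "poschk 18 0 18 (chamber_rows [632787234176, 0, - 16146784000, 0, 55156080, 0, - 53760, 0, 15] [] [129518473506176, 1865035898880, 66023776000, 0, 23814000] [1, - 1, - 1, 0, 0, 1, 0, 1, 0, 0, 0, 1, - 1, - 1, - 1, - 2, 0, 0, 1, 1, 1, 1, 3, 0, 0, - 1, - 1] [26, 25, 24, 23, 22, 21, 20, 19, 18, 17, 16, 15, 14, 13, 12, 11, 10, 9, 8, 7, 6, 5, 4, 3, 2, 1, 0] (sgn_par m) (sgn_par (int r)) [1, 1, 1, 1, 1, 1, 1, 1, 1])"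
    by (rule chamber_10_26_pos0)
qed (use assms in auto)

lemma chamber_10_27_pos0:
  "poschk 9 1 9 (chamber_rows [632787234176, 0, - 16146784000, 0, 55156080, 0, - 53760, 0, 15] [4534325308800, 0, - 33911136000, 0, 23814000] [124984148197376, 1865035898880, 32112640000] [1, - 1, - 1, 0, 0, 1, 0, 1, 0, 0, 0, 1, - 1, - 1, - 1, - 2, 0, 0, 1, 1, 1, 1, 3, 0, 0, - 1, - 1, - 2] [54, 52, 50, 48, 46, 44, 42, 40, 38, 36, 34, 32, 30, 28, 26, 24, 22, 20, 18, 16, 14, 12, 10, 8, 6, 4, 2, 0] 1 1 [1, 1, 1, 1, 1, 1, 1, 1, 1])"
  by (simp only: pos_rules pos_num cong: pos_congs)

lemma chamber_10_27_pos1: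
  "poschk 9 1 9 (chamber_rows [632787234176, 0, - 16146784000, 0, 55156080, 0, - 53760, 0, 15] [4534325308800, 0, - 33911136000, 0, 23814000] [124984148197376, 1865035898880, 32112640000] [1, - 1, - 1, 0, 0, 1, 0, 1, 0, 0, 0, 1, - 1, - 1, - 1, - 2, 0, 0, 1, 1, 1, 1, 3, 0, 0, - 1, - 1, - 2] [54, 52, 50, 48, 46, 44, 42, 40, 38, 36, 34, 32, 30, 28, 26, 24, 22, 20, 18, 16, 14, 12, 10, 8, 6, 4, 2, 0] 1 (- 1) [1, 1, 1, 1, 1, 1, 1, 1, 1])"
  by (simp only: pos_rules pos_num cong: pos_congs)

lemma chamber_10_27_pos2:
  "poschk 9 1 9 (chamber_rows [632787234176, 0, - 16146784000, 0, 55156080, 0, - 53760, 0, 15] [4534325308800, 0, - 33911136000, 0, 23814000] [124984148197376, 1865035898880, 32112640000] [1, - 1, - 1, 0, 0, 1, 0, 1, 0, 0, 0, 1, - 1, - 1, - 1, - 2, 0, 0, 1, 1, 1, 1, 3, 0, 0, - 1, - 1, - 2] [54, 52, 50, 48, 46, 44, 42, 40, 38, 36, 34, 32, 30, 28, 26, 24, 22, 20, 18, 16, 14, 12, 10, 8, 6, 4, 2, 0] (- 1) 1 [1, 1, 1, 1, 1, 1, 1, 1, 1])"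
  by (simp only: pos_rules pos_num cong: pos_congs)

lemma chamber_10_27_pos3:
  "poschk 9 1 9 (chamber_rows [632787234176, 0, - 16146784000, 0, 55156080, 0, - 53760, 0, 15] [4534325308800, 0, - 33911136000, 0, 23814000] [124984148197376, 1865035898880, 32112640000] [1, - 1, - 1, 0, 0, 1, 0, 1, 0, 0, 0, 1, - 1, - 1, - 1, - 2, 0, 0, 1, 1, 1, 1, 3, 0, 0, - 1, - 1, - 2] [54, 52, 50, 48, 46, 44, 42, 40, 38, 36, 34, 32, 30, 28, 26, 24, 22, 20, 18, 16, 14, 12, 10, 8, 6, 4, 2, 0] (- 1) (- 1) [1, 1, 1, 1, 1, 1, 1, 1, 1])"
  by (simp only: pos_rules pos_num cong: pos_congs)

lemma chamber_10_27:
  assumes "r \<ge> 18" "54 * real r \<le> 2 * of_int m + 54" "2 * of_int m + 55 \<le> 55 * real r"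
  shows "0 \<le> dif r 10 m"
proof (rule chamber_gen[OF est_10, where j = 27 and u = 2 and S = 54 and xl = 1 and h = 9 and L = 9
    and cs = "[1, - 1, - 1, 0, 0, 1, 0, 1, 0, 0, 0, 1, - 1, - 1, - 1, - 2, 0, 0, 1, 1, 1, 1, 3, 0, 0, - 1, - 1, - 2]" and bs = "[54, 52, 50, 48, 46, 44, 42, 40, 38, 36, 34, 32, 30, 28, 26, 24, 22, 20, 18, 16, 14, 12, 10, 8, 6, 4, 2, 0]" and B = "[1, 1, 1, 1, 1, 1, 1, 1, 1]"])
  show "sg 10 = 54" by (simp add: eval_nat_numeral)
  show "[1, - 1, - 1, 0, 0, 1, 0, 1, 0, 0, 0, 1, - 1, - 1, - 1, - 2, 0, 0, 1, 1, 1, 1, 3, 0, 0, - 1, - 1, - 2] = take (27 + 1) (ec 10)" by (simp add: ec_10)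
  show "27 < length (ec 10)" by (simp add: ec_10)
  show "[54, 52, 50, 48, 46, 44, 42, 40, 38, 36, 34, 32, 30, 28, 26, 24, 22, 20, 18, 16, 14, 12, 10, 8, 6, 4, 2, 0] = dl 2 27" by (simp add: eval_nat_numeral)
  show "[1, 1, 1, 1, 1, 1, 1, 1, 1] = replicate 9 1" by (simp add: eval_nat_numeral)
  show "poschk 9 1 9 (chamber_rows [632787234176, 0, - 16146784000, 0, 55156080, 0, - 53760, 0, 15] [4534325308800, 0, - 33911136000, 0, 23814000] [124984148197376, 1865035898880, 32112640000] [1, - 1, - 1, 0, 0, 1, 0, 1, 0, 0, 0, 1, - 1, - 1, - 1, - 2, 0, 0, 1, 1, 1, 1, 3, 0, 0, - 1, - 1, - 2] [54, 52, 50, 48, 46, 44, 42, 40, 38, 36, 34, 32, 30, 28, 26, 24, 22, 20, 18, 16, 14, 12, 10, 8, 6, 4, 2, 0] (sgn_par m) (sgn_par (int r)) [1, 1, 1, 1, 1, 1, 1, 1, 1])"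
    using chamber_10_27_pos0 chamber_10_27_pos1 chamber_10_27_pos2 chamber_10_27_pos3 by (simp add: sgn_par_def)
qed (use assms in auto)

lemma chamber_11_27_pos0:
  "poschk 18 0 18 (chamber_rows [0, 5486122777261, 0, - 36102624300, 0, 56912982, 0, - 30300, 0, 5] [] [10509218642383024, 84501635620864, 2749320420000, 0, 785862000] [1, - 1, - 1, 0, 0, 1, 0, 1, 0, 0, 0, 0, 0, 0, - 1, - 2, - 1, 0, 0, 1, 1, 1, 2, 1, 1, 0, 1, - 2] [27, 26, 25, 24, 23, 22, 21, 20, 19, 18, 17, 16, 15, 14, 13, 12, 11, 10, 9, 8, 7, 6, 5, 4, 3, 2, 1, 0] s \<rho> [1, 1, 1, 1, 1, 1, 1, 1, 1, 1])"
  by (simp only: pos_rules pos_num cong: pos_congs)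

lemma chamber_11_27:
  assumes "r \<ge> 18" "54 * real r \<le> 2 * of_int m + 65" "2 * of_int m + 65 < 56 * real r"
  shows "0 \<le> dif r 11 m"
proof (rule chamber_gen[OF lump_11, where j = 27 and u = 1 and S = 65 and xl = 0 and h = 18 and L = 10
    and cs = "[1, - 1, - 1, 0, 0, 1, 0, 1, 0, 0, 0, 0, 0, 0, - 1, - 2, - 1, 0, 0, 1, 1, 1, 2, 1, 1, 0, 1, - 2]" and bs = "[27, 26, 25, 24, 23, 22, 21, 20, 19, 18, 17, 16, 15, 14, 13, 12, 11, 10, 9, 8, 7, 6, 5, 4, 3, 2, 1, 0]" and B = "[1, 1, 1, 1, 1, 1, 1, 1, 1, 1]"])
  show "sg 11 = 65" by (simp add: eval_nat_numeral)
  show "[1, - 1, - 1, 0, 0, 1, 0, 1, 0, 0, 0, 0, 0, 0, - 1, - 2, - 1, 0, 0, 1, 1, 1, 2, 1, 1, 0, 1, - 2] = take (27 + 1) (ec 11)" by (simp add: ec_11)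
  show "27 < length (ec 11)" by (simp add: ec_11)
  show "[27, 26, 25, 24, 23, 22, 21, 20, 19, 18, 17, 16, 15, 14, 13, 12, 11, 10, 9, 8, 7, 6, 5, 4, 3, 2, 1, 0] = dl 1 27" by (simp add: eval_nat_numeral)
  show "[1, 1, 1, 1, 1, 1, 1, 1, 1, 1] = replicate 10 1" by (simp add: eval_nat_numeral)
  show "poschk 18 0 18 (chamber_rows [0, 5486122777261, 0, - 36102624300, 0, 56912982, 0, - 30300, 0, 5] [] [10509218642383024, 84501635620864, 2749320420000, 0, 785862000] [1, - 1, - 1, 0, 0, 1, 0, 1, 0, 0, 0, 0, 0, 0, - 1, - 2, - 1, 0, 0, 1, 1, 1, 2, 1, 1, 0, 1, - 2] [27, 26, 25, 24, 23, 22, 21, 20, 19, 18, 17, 16, 15, 14, 13, 12, 11, 10, 9, 8, 7, 6, 5, 4, 3, 2, 1, 0] (sgn_par m) (sgn_par (int r)) [1, 1, 1, 1, 1, 1, 1, 1, 1, 1])"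
    by (rule chamber_11_27_pos0)
qed (use assms in auto)

lemma chamber_11_28_pos0:
  "poschk 18 0 18 (chamber_rows [0, 5486122777261, 0, - 36102624300, 0, 56912982, 0, - 30300, 0, 5] [] [10509218642383024, 84501635620864, 2749320420000, 0, 785862000] [1, - 1, - 1, 0, 0, 1, 0, 1, 0, 0, 0, 0, 0, 0, - 1, - 2, - 1, 0, 0, 1, 1, 1, 2, 1, 1, 0, 1, - 2, - 2] [28, 27, 26, 25, 24, 23, 22, 21, 20, 19, 18, 17, 16, 15, 14, 13, 12, 11, 10, 9, 8, 7, 6, 5, 4, 3, 2, 1, 0] s \<rho> [1, 1, 1, 1, 1, 1, 1, 1, 1, 1])"
  by (simp only: pos_rules pos_num cong: pos_congs)

lemma chamber_11_28:
  assumes "r \<ge> 18" "56 * real r \<le> 2 * of_int m + 65" "2 * of_int m + 65 < 58 * real r"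
  shows "0 \<le> dif r 11 m"
proof (rule chamber_gen[OF lump_11, where j = 28 and u = 1 and S = 65 and xl = 0 and h = 18 and L = 10
    and cs = "[1, - 1, - 1, 0, 0, 1, 0, 1, 0, 0, 0, 0, 0, 0, - 1, - 2, - 1, 0, 0, 1, 1, 1, 2, 1, 1, 0, 1, - 2, - 2]" and bs = "[28, 27, 26, 25, 24, 23, 22, 21, 20, 19, 18, 17, 16, 15, 14, 13, 12, 11, 10, 9, 8, 7, 6, 5, 4, 3, 2, 1, 0]" and B = "[1, 1, 1, 1, 1, 1, 1, 1, 1, 1]"])
  show "sg 11 = 65" by (simp add: eval_nat_numeral)
  show "[1, - 1, - 1, 0, 0, 1, 0, 1, 0, 0, 0, 0, 0, 0, - 1, - 2, - 1, 0, 0, 1, 1, 1, 2, 1, 1, 0, 1, - 2, - 2] = take (28 + 1) (ec 11)" by (simp add: ec_11)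
  show "28 < length (ec 11)" by (simp add: ec_11)
  show "[28, 27, 26, 25, 24, 23, 22, 21, 20, 19, 18, 17, 16, 15, 14, 13, 12, 11, 10, 9, 8, 7, 6, 5, 4, 3, 2, 1, 0] = dl 1 28" by (simp add: eval_nat_numeral)
  show "[1, 1, 1, 1, 1, 1, 1, 1, 1, 1] = replicate 10 1" by (simp add: eval_nat_numeral)
  show "poschk 18 0 18 (chamber_rows [0, 5486122777261, 0, - 36102624300, 0, 56912982, 0, - 30300, 0, 5] [] [10509218642383024, 84501635620864, 2749320420000, 0, 785862000] [1, - 1, - 1, 0, 0, 1, 0, 1, 0, 0, 0, 0, 0, 0, - 1, - 2, - 1, 0, 0, 1, 1, 1, 2, 1, 1, 0, 1, - 2, - 2] [28, 27, 26, 25, 24, 23, 22, 21, 20, 19, 18, 17, 16, 15, 14, 13, 12, 11, 10, 9, 8, 7, 6, 5, 4, 3, 2, 1, 0] (sgn_par m) (sgn_par (int r)) [1, 1, 1, 1, 1, 1, 1, 1, 1, 1])"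
    by (rule chamber_11_28_pos0)
qed (use assms in auto)

lemma chamber_11_29_pos0:
  "poschk 18 0 18 (chamber_rows [0, 5486122777261, 0, - 36102624300, 0, 56912982, 0, - 30300, 0, 5] [] [10509218642383024, 84501635620864, 2749320420000, 0, 785862000] [1, - 1, - 1, 0, 0, 1, 0, 1, 0, 0, 0, 0, 0, 0, - 1, - 2, - 1, 0, 0, 1, 1, 1, 2, 1, 1, 0, 1, - 2, - 2, - 2] [29, 28, 27, 26, 25, 24, 23, 22, 21, 20, 19, 18, 17, 16, 15, 14, 13, 12, 11, 10, 9, 8, 7, 6, 5, 4, 3, 2, 1, 0] s \<rho> [1, 1, 1, 1, 1, 1, 1, 1, 1, 1])"
  by (simp only: pos_rules pos_num cong: pos_congs)

lemma chamber_11_29: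
  assumes "r \<ge> 18" "58 * real r \<le> 2 * of_int m + 65" "2 * of_int m + 65 < 60 * real r"
  shows "0 \<le> dif r 11 m"
proof (rule chamber_gen[OF lump_11, where j = 29 and u = 1 and S = 65 and xl = 0 and h = 18 and L = 10
    and cs = "[1, - 1, - 1, 0, 0, 1, 0, 1, 0, 0, 0, 0, 0, 0, - 1, - 2, - 1, 0, 0, 1, 1, 1, 2, 1, 1, 0, 1, - 2, - 2, - 2]" and bs = "[29, 28, 27, 26, 25, 24, 23, 22, 21, 20, 19, 18, 17, 16, 15, 14, 13, 12, 11, 10, 9, 8, 7, 6, 5, 4, 3, 2, 1, 0]" and B = "[1, 1, 1, 1, 1, 1, 1, 1, 1, 1]"])
  show "sg 11 = 65" by (simp add: eval_nat_numeral)
  show "[1, - 1, - 1, 0, 0, 1, 0, 1, 0, 0, 0, 0, 0, 0, - 1, - 2, - 1, 0, 0, 1, 1, 1, 2, 1, 1, 0, 1, - 2, - 2, - 2] = take (29 + 1) (ec 11)" by (simp add: ec_11)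
  show "29 < length (ec 11)" by (simp add: ec_11)
  show "[29, 28, 27, 26, 25, 24, 23, 22, 21, 20, 19, 18, 17, 16, 15, 14, 13, 12, 11, 10, 9, 8, 7, 6, 5, 4, 3, 2, 1, 0] = dl 1 29" by (simp add: eval_nat_numeral)
  show "[1, 1, 1, 1, 1, 1, 1, 1, 1, 1] = replicate 10 1" by (simp add: eval_nat_numeral)
  show "poschk 18 0 18 (chamber_rows [0, 5486122777261, 0, - 36102624300, 0, 56912982, 0, - 30300, 0, 5] [] [10509218642383024, 84501635620864, 2749320420000, 0, 785862000] [1, - 1, - 1, 0, 0, 1, 0, 1, 0, 0, 0, 0, 0, 0, - 1, - 2, - 1, 0, 0, 1, 1, 1, 2, 1, 1, 0, 1, - 2, - 2, - 2] [29, 28, 27, 26, 25, 24, 23, 22, 21, 20, 19, 18, 17, 16, 15, 14, 13, 12, 11, 10, 9, 8, 7, 6, 5, 4, 3, 2, 1, 0] (sgn_par m) (sgn_par (int r)) [1, 1, 1, 1, 1, 1, 1, 1, 1, 1])"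
    by (rule chamber_11_29_pos0)
qed (use assms in auto)

lemma chamber_11_30_pos0:
  "poschk 18 0 18 (chamber_rows [0, 5486122777261, 0, - 36102624300, 0, 56912982, 0, - 30300, 0, 5] [] [10509218642383024, 84501635620864, 2749320420000, 0, 785862000] [1, - 1, - 1, 0, 0, 1, 0, 1, 0, 0, 0, 0, 0, 0, - 1, - 2, - 1, 0, 0, 1, 1, 1, 2, 1, 1, 0, 1, - 2, - 2, - 2, - 2] [30, 29, 28, 27, 26, 25, 24, 23, 22, 21, 20, 19, 18, 17, 16, 15, 14, 13, 12, 11, 10, 9, 8, 7, 6, 5, 4, 3, 2, 1, 0] s \<rho> [1, 1, 1, 1, 1, 1, 1, 1, 1, 1])"
  by (simp only: pos_rules pos_num cong: pos_congs)

lemma chamber_11_30: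
  assumes "r \<ge> 18" "60 * real r \<le> 2 * of_int m + 65" "2 * of_int m + 65 < 62 * real r"
  shows "0 \<le> dif r 11 m"
proof (rule chamber_gen[OF lump_11, where j = 30 and u = 1 and S = 65 and xl = 0 and h = 18 and L = 10
    and cs = "[1, - 1, - 1, 0, 0, 1, 0, 1, 0, 0, 0, 0, 0, 0, - 1, - 2, - 1, 0, 0, 1, 1, 1, 2, 1, 1, 0, 1, - 2, - 2, - 2, - 2]" and bs = "[30, 29, 28, 27, 26, 25, 24, 23, 22, 21, 20, 19, 18, 17, 16, 15, 14, 13, 12, 11, 10, 9, 8, 7, 6, 5, 4, 3, 2, 1, 0]" and B = "[1, 1, 1, 1, 1, 1, 1, 1, 1, 1]"])
  show "sg 11 = 65" by (simp add: eval_nat_numeral)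
  show "[1, - 1, - 1, 0, 0, 1, 0, 1, 0, 0, 0, 0, 0, 0, - 1, - 2, - 1, 0, 0, 1, 1, 1, 2, 1, 1, 0, 1, - 2, - 2, - 2, - 2] = take (30 + 1) (ec 11)" by (simp add: ec_11)
  show "30 < length (ec 11)" by (simp add: ec_11)
  show "[30, 29, 28, 27, 26, 25, 24, 23, 22, 21, 20, 19, 18, 17, 16, 15, 14, 13, 12, 11, 10, 9, 8, 7, 6, 5, 4, 3, 2, 1, 0] = dl 1 30" by (simp add: eval_nat_numeral)
  show "[1, 1, 1, 1, 1, 1, 1, 1, 1, 1] = replicate 10 1" by (simp add: eval_nat_numeral)
  show "poschk 18 0 18 (chamber_rows [0, 5486122777261, 0, - 36102624300, 0, 56912982, 0, - 30300, 0, 5] [] [10509218642383024, 84501635620864, 2749320420000, 0, 785862000] [1, - 1, - 1, 0, 0, 1, 0, 1, 0, 0, 0, 0, 0, 0, - 1, - 2, - 1, 0, 0, 1, 1, 1, 2, 1, 1, 0, 1, - 2, - 2, - 2, - 2] [30, 29, 28, 27, 26, 25, 24, 23, 22, 21, 20, 19, 18, 17, 16, 15, 14, 13, 12, 11, 10, 9, 8, 7, 6, 5, 4, 3, 2, 1, 0] (sgn_par m) (sgn_par (int r)) [1, 1, 1, 1, 1, 1, 1, 1, 1, 1])"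
    by (rule chamber_11_30_pos0)
qed (use assms in auto)

lemma chamber_11_31_pos0:
  "poschk 18 0 18 (chamber_rows [0, 5486122777261, 0, - 36102624300, 0, 56912982, 0, - 30300, 0, 5] [] [10509218642383024, 84501635620864, 2749320420000, 0, 785862000] [1, - 1, - 1, 0, 0, 1, 0, 1, 0, 0, 0, 0, 0, 0, - 1, - 2, - 1, 0, 0, 1, 1, 1, 2, 1, 1, 0, 1, - 2, - 2, - 2, - 2, - 1] [31, 30, 29, 28, 27, 26, 25, 24, 23, 22, 21, 20, 19, 18, 17, 16, 15, 14, 13, 12, 11, 10, 9, 8, 7, 6, 5, 4, 3, 2, 1, 0] s \<rho> [1, 1, 1, 1, 1, 1, 1, 1, 1, 1])"
  by (simp only: pos_rules pos_num cong: pos_congs)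

lemma chamber_11_31:
  assumes "r \<ge> 18" "62 * real r \<le> 2 * of_int m + 65" "2 * of_int m + 65 < 64 * real r"
  shows "0 \<le> dif r 11 m"
proof (rule chamber_gen[OF lump_11, where j = 31 and u = 1 and S = 65 and xl = 0 and h = 18 and L = 10
    and cs = "[1, - 1, - 1, 0, 0, 1, 0, 1, 0, 0, 0, 0, 0, 0, - 1, - 2, - 1, 0, 0, 1, 1, 1, 2, 1, 1, 0, 1, - 2, - 2, - 2, - 2, - 1]" and bs = "[31, 30, 29, 28, 27, 26, 25, 24, 23, 22, 21, 20, 19, 18, 17, 16, 15, 14, 13, 12, 11, 10, 9, 8, 7, 6, 5, 4, 3, 2, 1, 0]" and B = "[1, 1, 1, 1, 1, 1, 1, 1, 1, 1]"])
  show "sg 11 = 65" by (simp add: eval_nat_numeral)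
  show "[1, - 1, - 1, 0, 0, 1, 0, 1, 0, 0, 0, 0, 0, 0, - 1, - 2, - 1, 0, 0, 1, 1, 1, 2, 1, 1, 0, 1, - 2, - 2, - 2, - 2, - 1] = take (31 + 1) (ec 11)" by (simp add: ec_11)
  show "31 < length (ec 11)" by (simp add: ec_11)
  show "[31, 30, 29, 28, 27, 26, 25, 24, 23, 22, 21, 20, 19, 18, 17, 16, 15, 14, 13, 12, 11, 10, 9, 8, 7, 6, 5, 4, 3, 2, 1, 0] = dl 1 31" by (simp add: eval_nat_numeral)
  show "[1, 1, 1, 1, 1, 1, 1, 1, 1, 1] = replicate 10 1" by (simp add: eval_nat_numeral)
  show "poschk 18 0 18 (chamber_rows [0, 5486122777261, 0, - 36102624300, 0, 56912982, 0, - 30300, 0, 5] [] [10509218642383024, 84501635620864, 2749320420000, 0, 785862000] [1, - 1, - 1, 0, 0, 1, 0, 1, 0, 0, 0, 0, 0, 0, - 1, - 2, - 1, 0, 0, 1, 1, 1, 2, 1, 1, 0, 1, - 2, - 2, - 2, - 2, - 1] [31, 30, 29, 28, 27, 26, 25, 24, 23, 22, 21, 20, 19, 18, 17, 16, 15, 14, 13, 12, 11, 10, 9, 8, 7, 6, 5, 4, 3, 2, 1, 0] (sgn_par m) (sgn_par (int r)) [1, 1, 1, 1, 1, 1, 1, 1, 1, 1])"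
    by (rule chamber_11_31_pos0)
qed (use assms in auto)

lemma chamber_11_32_pos0:
  "poschk 18 1 18 (chamber_rows [0, 5486122777261, 0, - 36102624300, 0, 56912982, 0, - 30300, 0, 5] [] [10509218642383024, 84501635620864, 2749320420000, 0, 785862000] [1, - 1, - 1, 0, 0, 1, 0, 1, 0, 0, 0, 0, 0, 0, - 1, - 2, - 1, 0, 0, 1, 1, 1, 2, 1, 1, 0, 1, - 2, - 2, - 2, - 2, - 1, - 1] [32, 31, 30, 29, 28, 27, 26, 25, 24, 23, 22, 21, 20, 19, 18, 17, 16, 15, 14, 13, 12, 11, 10, 9, 8, 7, 6, 5, 4, 3, 2, 1, 0] s \<rho> [1, 1, 1, 1, 1, 1, 1, 1, 1, 1])"
  by (simp only: pos_rules pos_num cong: pos_congs)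

lemma chamber_11_32:
  assumes "r \<ge> 18" "64 * real r \<le> 2 * of_int m + 65" "2 * of_int m + 66 \<le> 66 * real r"
  shows "0 \<le> dif r 11 m"
proof (rule chamber_gen[OF lump_11, where j = 32 and u = 1 and S = 65 and xl = 1 and h = 18 and L = 10
    and cs = "[1, - 1, - 1, 0, 0, 1, 0, 1, 0, 0, 0, 0, 0, 0, - 1, - 2, - 1, 0, 0, 1, 1, 1, 2, 1, 1, 0, 1, - 2, - 2, - 2, - 2, - 1, - 1]" and bs = "[32, 31, 30, 29, 28, 27, 26, 25, 24, 23, 22, 21, 20, 19, 18, 17, 16, 15, 14, 13, 12, 11, 10, 9, 8, 7, 6, 5, 4, 3, 2, 1, 0]" and B = "[1, 1, 1, 1, 1, 1, 1, 1, 1, 1]"])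
  show "sg 11 = 65" by (simp add: eval_nat_numeral)
  show "[1, - 1, - 1, 0, 0, 1, 0, 1, 0, 0, 0, 0, 0, 0, - 1, - 2, - 1, 0, 0, 1, 1, 1, 2, 1, 1, 0, 1, - 2, - 2, - 2, - 2, - 1, - 1] = take (32 + 1) (ec 11)" by (simp add: ec_11)
  show "32 < length (ec 11)" by (simp add: ec_11)
  show "[32, 31, 30, 29, 28, 27, 26, 25, 24, 23, 22, 21, 20, 19, 18, 17, 16, 15, 14, 13, 12, 11, 10, 9, 8, 7, 6, 5, 4, 3, 2, 1, 0] = dl 1 32" by (simp add: eval_nat_numeral)
  show "[1, 1, 1, 1, 1, 1, 1, 1, 1, 1] = replicate 10 1" by (simp add: eval_nat_numeral)
  show "poschk 18 1 18 (chamber_rows [0, 5486122777261, 0, - 36102624300, 0, 56912982, 0, - 30300, 0, 5] [] [10509218642383024, 84501635620864, 2749320420000, 0, 785862000] [1, - 1, - 1, 0, 0, 1, 0, 1, 0, 0, 0, 0, 0, 0, - 1, - 2, - 1, 0, 0, 1, 1, 1, 2, 1, 1, 0, 1, - 2, - 2, - 2, - 2, - 1, - 1] [32, 31, 30, 29, 28, 27, 26, 25, 24, 23, 22, 21, 20, 19, 18, 17, 16, 15, 14, 13, 12, 11, 10, 9, 8, 7, 6, 5, 4, 3, 2, 1, 0] (sgn_par m) (sgn_par (int r)) [1, 1, 1, 1, 1, 1, 1, 1, 1, 1])"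
    by (rule chamber_11_32_pos0)
qed (use assms in auto)

lemma chamber_12_32_pos0:
  "poschk 18 0 18 (chamber_rows [- 26096916318766147, 0, 479731329466125, 0, - 1246317800310, 0, 1029069426, 0, - 321255, 0, 33] [] [13908462825556910080, 148701281554344288, 830644362240000, 65464270872000, 0, 10373378400] [1, - 1, - 1, 0, 0, 1, 0, 1, 0, 0, 0, 0, - 1, 1, 0, - 2, - 1, - 1, 0, 0, 1, 1, 2, 1, 1, 0, 2, 0, - 1, - 2, - 2, - 2, - 2] [32, 31, 30, 29, 28, 27, 26, 25, 24, 23, 22, 21, 20, 19, 18, 17, 16, 15, 14, 13, 12, 11, 10, 9, 8, 7, 6, 5, 4, 3, 2, 1, 0] s \<rho> [1, 1, 1, 1, 1, 1, 1, 1, 1, 1, 1])"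
  by (simp only: pos_rules pos_num cong: pos_congs)

lemma chamber_12_32:
  assumes "r \<ge> 18" "64 * real r \<le> 2 * of_int m + 77" "2 * of_int m + 77 < 66 * real r"
  shows "0 \<le> dif r 12 m"
proof (rule chamber_gen[OF lump_12, where j = 32 and u = 1 and S = 77 and xl = 0 and h = 18 and L = 11
    and cs = "[1, - 1, - 1, 0, 0, 1, 0, 1, 0, 0, 0, 0, - 1, 1, 0, - 2, - 1, - 1, 0, 0, 1, 1, 2, 1, 1, 0, 2, 0, - 1, - 2, - 2, - 2, - 2]" and bs = "[32, 31, 30, 29, 28, 27, 26, 25, 24, 23, 22, 21, 20, 19, 18, 17, 16, 15, 14, 13, 12, 11, 10, 9, 8, 7, 6, 5, 4, 3, 2, 1, 0]" and B = "[1, 1, 1, 1, 1, 1, 1, 1, 1, 1, 1]"])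
  show "sg 12 = 77" by (simp add: eval_nat_numeral)
  show "[1, - 1, - 1, 0, 0, 1, 0, 1, 0, 0, 0, 0, - 1, 1, 0, - 2, - 1, - 1, 0, 0, 1, 1, 2, 1, 1, 0, 2, 0, - 1, - 2, - 2, - 2, - 2] = take (32 + 1) (ec 12)" by (simp add: ec_12)
  show "32 < length (ec 12)" by (simp add: ec_12)
  show "[32, 31, 30, 29, 28, 27, 26, 25, 24, 23, 22, 21, 20, 19, 18, 17, 16, 15, 14, 13, 12, 11, 10, 9, 8, 7, 6, 5, 4, 3, 2, 1, 0] = dl 1 32" by (simp add: eval_nat_numeral)
  show "[1, 1, 1, 1, 1, 1, 1, 1, 1, 1, 1] = replicate 11 1" by (simp add: eval_nat_numeral)
  show "poschk 18 0 18 (chamber_rows [- 26096916318766147, 0, 479731329466125, 0, - 1246317800310, 0, 1029069426, 0, - 321255, 0, 33] [] [13908462825556910080, 148701281554344288, 830644362240000, 65464270872000, 0, 10373378400] [1, - 1, - 1, 0, 0, 1, 0, 1, 0, 0, 0, 0, - 1, 1, 0, - 2, - 1, - 1, 0, 0, 1, 1, 2, 1, 1, 0, 2, 0, - 1, - 2, - 2, - 2, - 2] [32, 31, 30, 29, 28, 27, 26, 25, 24, 23, 22, 21, 20, 19, 18, 17, 16, 15, 14, 13, 12, 11, 10, 9, 8, 7, 6, 5, 4, 3, 2, 1, 0] (sgn_par m) (sgn_par (int r)) [1, 1, 1, 1, 1, 1, 1, 1, 1, 1, 1])"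
    by (rule chamber_12_32_pos0)
qed (use assms in auto)

lemma chamber_12_33_pos0:
  "poschk 18 0 18 (chamber_rows [- 26096916318766147, 0, 479731329466125, 0, - 1246317800310, 0, 1029069426, 0, - 321255, 0, 33] [] [13908462825556910080, 148701281554344288, 830644362240000, 65464270872000, 0, 10373378400] [1, - 1, - 1, 0, 0, 1, 0, 1, 0, 0, 0, 0, - 1, 1, 0, - 2, - 1, - 1, 0, 0, 1, 1, 2, 1, 1, 0, 2, 0, - 1, - 2, - 2, - 2, - 2, - 1] [33, 32, 31, 30, 29, 28, 27, 26, 25, 24, 23, 22, 21, 20, 19, 18, 17, 16, 15, 14, 13, 12, 11, 10, 9, 8, 7, 6, 5, 4, 3, 2, 1, 0] s \<rho> [1, 1, 1, 1, 1, 1, 1, 1, 1, 1, 1])"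
  by (simp only: pos_rules pos_num cong: pos_congs)

lemma chamber_12_33:
  assumes "r \<ge> 18" "66 * real r \<le> 2 * of_int m + 77" "2 * of_int m + 77 < 68 * real r"
  shows "0 \<le> dif r 12 m"
proof (rule chamber_gen[OF lump_12, where j = 33 and u = 1 and S = 77 and xl = 0 and h = 18 and L = 11
    and cs = "[1, - 1, - 1, 0, 0, 1, 0, 1, 0, 0, 0, 0, - 1, 1, 0, - 2, - 1, - 1, 0, 0, 1, 1, 2, 1, 1, 0, 2, 0, - 1, - 2, - 2, - 2, - 2, - 1]" and bs = "[33, 32, 31, 30, 29, 28, 27, 26, 25, 24, 23, 22, 21, 20, 19, 18, 17, 16, 15, 14, 13, 12, 11, 10, 9, 8, 7, 6, 5, 4, 3, 2, 1, 0]" and B = "[1, 1, 1, 1, 1, 1, 1, 1, 1, 1, 1]"])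
  show "sg 12 = 77" by (simp add: eval_nat_numeral)
  show "[1, - 1, - 1, 0, 0, 1, 0, 1, 0, 0, 0, 0, - 1, 1, 0, - 2, - 1, - 1, 0, 0, 1, 1, 2, 1, 1, 0, 2, 0, - 1, - 2, - 2, - 2, - 2, - 1] = take (33 + 1) (ec 12)" by (simp add: ec_12)
  show "33 < length (ec 12)" by (simp add: ec_12)
  show "[33, 32, 31, 30, 29, 28, 27, 26, 25, 24, 23, 22, 21, 20, 19, 18, 17, 16, 15, 14, 13, 12, 11, 10, 9, 8, 7, 6, 5, 4, 3, 2, 1, 0] = dl 1 33" by (simp add: eval_nat_numeral)
  show "[1, 1, 1, 1, 1, 1, 1, 1, 1, 1, 1] = replicate 11 1" by (simp add: eval_nat_numeral)
  show "poschk 18 0 18 (chamber_rows [- 26096916318766147, 0, 479731329466125, 0, - 1246317800310, 0, 1029069426, 0, - 321255, 0, 33] [] [13908462825556910080, 148701281554344288, 830644362240000, 65464270872000, 0, 10373378400] [1, - 1, - 1, 0, 0, 1, 0, 1, 0, 0, 0, 0, - 1, 1, 0, - 2, - 1, - 1, 0, 0, 1, 1, 2, 1, 1, 0, 2, 0, - 1, - 2, - 2, - 2, - 2, - 1] [33, 32, 31, 30, 29, 28, 27, 26, 25, 24, 23, 22, 21, 20, 19, 18, 17, 16, 15, 14, 13, 12, 11, 10, 9, 8, 7, 6, 5, 4, 3, 2, 1, 0] (sgn_par m) (sgn_par (int r)) [1, 1, 1, 1, 1, 1, 1, 1, 1, 1, 1])"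
    by (rule chamber_12_33_pos0)
qed (use assms in auto)

lemma chamber_12_34_pos0:
  "poschk 18 0 18 (chamber_rows [- 26096916318766147, 0, 479731329466125, 0, - 1246317800310, 0, 1029069426, 0, - 321255, 0, 33] [] [13908462825556910080, 148701281554344288, 830644362240000, 65464270872000, 0, 10373378400] [1, - 1, - 1, 0, 0, 1, 0, 1, 0, 0, 0, 0, - 1, 1, 0, - 2, - 1, - 1, 0, 0, 1, 1, 2, 1, 1, 0, 2, 0, - 1, - 2, - 2, - 2, - 2, - 1, - 1] [34, 33, 32, 31, 30, 29, 28, 27, 26, 25, 24, 23, 22, 21, 20, 19, 18, 17, 16, 15, 14, 13, 12, 11, 10, 9, 8, 7, 6, 5, 4, 3, 2, 1, 0] s \<rho> [1, 1, 1, 1, 1, 1, 1, 1, 1, 1, 1])"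
  by (simp only: pos_rules pos_num cong: pos_congs)

lemma chamber_12_34:
  assumes "r \<ge> 18" "68 * real r \<le> 2 * of_int m + 77" "2 * of_int m + 77 < 70 * real r"
  shows "0 \<le> dif r 12 m"
proof (rule chamber_gen[OF lump_12, where j = 34 and u = 1 and S = 77 and xl = 0 and h = 18 and L = 11
    and cs = "[1, - 1, - 1, 0, 0, 1, 0, 1, 0, 0, 0, 0, - 1, 1, 0, - 2, - 1, - 1, 0, 0, 1, 1, 2, 1, 1, 0, 2, 0, - 1, - 2, - 2, - 2, - 2, - 1, - 1]" and bs = "[34, 33, 32, 31, 30, 29, 28, 27, 26, 25, 24, 23, 22, 21, 20, 19, 18, 17, 16, 15, 14, 13, 12, 11, 10, 9, 8, 7, 6, 5, 4, 3, 2, 1, 0]" and B = "[1, 1, 1, 1, 1, 1, 1, 1, 1, 1, 1]"])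
  show "sg 12 = 77" by (simp add: eval_nat_numeral)
  show "[1, - 1, - 1, 0, 0, 1, 0, 1, 0, 0, 0, 0, - 1, 1, 0, - 2, - 1, - 1, 0, 0, 1, 1, 2, 1, 1, 0, 2, 0, - 1, - 2, - 2, - 2, - 2, - 1, - 1] = take (34 + 1) (ec 12)" by (simp add: ec_12)
  show "34 < length (ec 12)" by (simp add: ec_12)
  show "[34, 33, 32, 31, 30, 29, 28, 27, 26, 25, 24, 23, 22, 21, 20, 19, 18, 17, 16, 15, 14, 13, 12, 11, 10, 9, 8, 7, 6, 5, 4, 3, 2, 1, 0] = dl 1 34" by (simp add: eval_nat_numeral)
  show "[1, 1, 1, 1, 1, 1, 1, 1, 1, 1, 1] = replicate 11 1" by (simp add: eval_nat_numeral)
  show "poschk 18 0 18 (chamber_rows [- 26096916318766147, 0, 479731329466125, 0, - 1246317800310, 0, 1029069426, 0, - 321255, 0, 33] [] [13908462825556910080, 148701281554344288, 830644362240000, 65464270872000, 0, 10373378400] [1, - 1, - 1, 0, 0, 1, 0, 1, 0, 0, 0, 0, - 1, 1, 0, - 2, - 1, - 1, 0, 0, 1, 1, 2, 1, 1, 0, 2, 0, - 1, - 2, - 2, - 2, - 2, - 1, - 1] [34, 33, 32, 31, 30, 29, 28, 27, 26, 25, 24, 23, 22, 21, 20, 19, 18, 17, 16, 15, 14, 13, 12, 11, 10, 9, 8, 7, 6, 5, 4, 3, 2, 1, 0] (sgn_par m) (sgn_par (int r)) [1, 1, 1, 1, 1, 1, 1, 1, 1, 1, 1])"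
    by (rule chamber_12_34_pos0)
qed (use assms in auto)

lemma chamber_12_35_pos0:
  "poschk 18 0 18 (chamber_rows [- 26096916318766147, 0, 479731329466125, 0, - 1246317800310, 0, 1029069426, 0, - 321255, 0, 33] [] [13908462825556910080, 148701281554344288, 830644362240000, 65464270872000, 0, 10373378400] [1, - 1, - 1, 0, 0, 1, 0, 1, 0, 0, 0, 0, - 1, 1, 0, - 2, - 1, - 1, 0, 0, 1, 1, 2, 1, 1, 0, 2, 0, - 1, - 2, - 2, - 2, - 2, - 1, - 1, 0] [35, 34, 33, 32, 31, 30, 29, 28, 27, 26, 25, 24, 23, 22, 21, 20, 19, 18, 17, 16, 15, 14, 13, 12, 11, 10, 9, 8, 7, 6, 5, 4, 3, 2, 1, 0] s \<rho> [1, 1, 1, 1, 1, 1, 1, 1, 1, 1, 1])"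
  by (simp only: pos_rules pos_num cong: pos_congs)

lemma chamber_12_35:
  assumes "r \<ge> 18" "70 * real r \<le> 2 * of_int m + 77" "2 * of_int m + 77 < 72 * real r"
  shows "0 \<le> dif r 12 m"
proof (rule chamber_gen[OF lump_12, where j = 35 and u = 1 and S = 77 and xl = 0 and h = 18 and L = 11
    and cs = "[1, - 1, - 1, 0, 0, 1, 0, 1, 0, 0, 0, 0, - 1, 1, 0, - 2, - 1, - 1, 0, 0, 1, 1, 2, 1, 1, 0, 2, 0, - 1, - 2, - 2, - 2, - 2, - 1, - 1, 0]" and bs = "[35, 34, 33, 32, 31, 30, 29, 28, 27, 26, 25, 24, 23, 22, 21, 20, 19, 18, 17, 16, 15, 14, 13, 12, 11, 10, 9, 8, 7, 6, 5, 4, 3, 2, 1, 0]" and B = "[1, 1, 1, 1, 1, 1, 1, 1, 1, 1, 1]"])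
  show "sg 12 = 77" by (simp add: eval_nat_numeral)
  show "[1, - 1, - 1, 0, 0, 1, 0, 1, 0, 0, 0, 0, - 1, 1, 0, - 2, - 1, - 1, 0, 0, 1, 1, 2, 1, 1, 0, 2, 0, - 1, - 2, - 2, - 2, - 2, - 1, - 1, 0] = take (35 + 1) (ec 12)" by (simp add: ec_12)
  show "35 < length (ec 12)" by (simp add: ec_12)
  show "[35, 34, 33, 32, 31, 30, 29, 28, 27, 26, 25, 24, 23, 22, 21, 20, 19, 18, 17, 16, 15, 14, 13, 12, 11, 10, 9, 8, 7, 6, 5, 4, 3, 2, 1, 0] = dl 1 35" by (simp add: eval_nat_numeral)
  show "[1, 1, 1, 1, 1, 1, 1, 1, 1, 1, 1] = replicate 11 1" by (simp add: eval_nat_numeral)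
  show "poschk 18 0 18 (chamber_rows [- 26096916318766147, 0, 479731329466125, 0, - 1246317800310, 0, 1029069426, 0, - 321255, 0, 33] [] [13908462825556910080, 148701281554344288, 830644362240000, 65464270872000, 0, 10373378400] [1, - 1, - 1, 0, 0, 1, 0, 1, 0, 0, 0, 0, - 1, 1, 0, - 2, - 1, - 1, 0, 0, 1, 1, 2, 1, 1, 0, 2, 0, - 1, - 2, - 2, - 2, - 2, - 1, - 1, 0] [35, 34, 33, 32, 31, 30, 29, 28, 27, 26, 25, 24, 23, 22, 21, 20, 19, 18, 17, 16, 15, 14, 13, 12, 11, 10, 9, 8, 7, 6, 5, 4, 3, 2, 1, 0] (sgn_par m) (sgn_par (int r)) [1, 1, 1, 1, 1, 1, 1, 1, 1, 1, 1])"
    by (rule chamber_12_35_pos0)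
qed (use assms in auto)

lemma chamber_12_36_pos0:
  "poschk 18 0 18 (chamber_rows [- 26096916318766147, 0, 479731329466125, 0, - 1246317800310, 0, 1029069426, 0, - 321255, 0, 33] [] [13908462825556910080, 148701281554344288, 830644362240000, 65464270872000, 0, 10373378400] [1, - 1, - 1, 0, 0, 1, 0, 1, 0, 0, 0, 0, - 1, 1, 0, - 2, - 1, - 1, 0, 0, 1, 1, 2, 1, 1, 0, 2, 0, - 1, - 2, - 2, - 2, - 2, - 1, - 1, 0, 1] [36, 35, 34, 33, 32, 31, 30, 29, 28, 27, 26, 25, 24, 23, 22, 21, 20, 19, 18, 17, 16, 15, 14, 13, 12, 11, 10, 9, 8, 7, 6, 5, 4, 3, 2, 1, 0] s \<rho> [1, 1, 1, 1, 1, 1, 1, 1, 1, 1, 1])"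
  by (simp only: pos_rules pos_num cong: pos_congs)

lemma chamber_12_36:
  assumes "r \<ge> 18" "72 * real r \<le> 2 * of_int m + 77" "2 * of_int m + 77 < 74 * real r"
  shows "0 \<le> dif r 12 m"
proof (rule chamber_gen[OF lump_12, where j = 36 and u = 1 and S = 77 and xl = 0 and h = 18 and L = 11
    and cs = "[1, - 1, - 1, 0, 0, 1, 0, 1, 0, 0, 0, 0, - 1, 1, 0, - 2, - 1, - 1, 0, 0, 1, 1, 2, 1, 1, 0, 2, 0, - 1, - 2, - 2, - 2, - 2, - 1, - 1, 0, 1]" and bs = "[36, 35, 34, 33, 32, 31, 30, 29, 28, 27, 26, 25, 24, 23, 22, 21, 20, 19, 18, 17, 16, 15, 14, 13, 12, 11, 10, 9, 8, 7, 6, 5, 4, 3, 2, 1, 0]" and B = "[1, 1, 1, 1, 1, 1, 1, 1, 1, 1, 1]"])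
  show "sg 12 = 77" by (simp add: eval_nat_numeral)
  show "[1, - 1, - 1, 0, 0, 1, 0, 1, 0, 0, 0, 0, - 1, 1, 0, - 2, - 1, - 1, 0, 0, 1, 1, 2, 1, 1, 0, 2, 0, - 1, - 2, - 2, - 2, - 2, - 1, - 1, 0, 1] = take (36 + 1) (ec 12)" by (simp add: ec_12)
  show "36 < length (ec 12)" by (simp add: ec_12)
  show "[36, 35, 34, 33, 32, 31, 30, 29, 28, 27, 26, 25, 24, 23, 22, 21, 20, 19, 18, 17, 16, 15, 14, 13, 12, 11, 10, 9, 8, 7, 6, 5, 4, 3, 2, 1, 0] = dl 1 36" by (simp add: eval_nat_numeral)
  show "[1, 1, 1, 1, 1, 1, 1, 1, 1, 1, 1] = replicate 11 1" by (simp add: eval_nat_numeral)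
  show "poschk 18 0 18 (chamber_rows [- 26096916318766147, 0, 479731329466125, 0, - 1246317800310, 0, 1029069426, 0, - 321255, 0, 33] [] [13908462825556910080, 148701281554344288, 830644362240000, 65464270872000, 0, 10373378400] [1, - 1, - 1, 0, 0, 1, 0, 1, 0, 0, 0, 0, - 1, 1, 0, - 2, - 1, - 1, 0, 0, 1, 1, 2, 1, 1, 0, 2, 0, - 1, - 2, - 2, - 2, - 2, - 1, - 1, 0, 1] [36, 35, 34, 33, 32, 31, 30, 29, 28, 27, 26, 25, 24, 23, 22, 21, 20, 19, 18, 17, 16, 15, 14, 13, 12, 11, 10, 9, 8, 7, 6, 5, 4, 3, 2, 1, 0] (sgn_par m) (sgn_par (int r)) [1, 1, 1, 1, 1, 1, 1, 1, 1, 1, 1])"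
    by (rule chamber_12_36_pos0)
qed (use assms in auto)

lemma chamber_12_37_pos0:
  "poschk 18 0 18 (chamber_rows [- 26096916318766147, 0, 479731329466125, 0, - 1246317800310, 0, 1029069426, 0, - 321255, 0, 33] [] [13908462825556910080, 148701281554344288, 830644362240000, 65464270872000, 0, 10373378400] [1, - 1, - 1, 0, 0, 1, 0, 1, 0, 0, 0, 0, - 1, 1, 0, - 2, - 1, - 1, 0, 0, 1, 1, 2, 1, 1, 0, 2, 0, - 1, - 2, - 2, - 2, - 2, - 1, - 1, 0, 1, 2] [37, 36, 35, 34, 33, 32, 31, 30, 29, 28, 27, 26, 25, 24, 23, 22, 21, 20, 19, 18, 17, 16, 15, 14, 13, 12, 11, 10, 9, 8, 7, 6, 5, 4, 3, 2, 1, 0] s \<rho> [1, 1, 1, 1, 1, 1, 1, 1, 1, 1, 1])"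
  by (simp only: pos_rules pos_num cong: pos_congs)

lemma chamber_12_37:
  assumes "r \<ge> 18" "74 * real r \<le> 2 * of_int m + 77" "2 * of_int m + 77 < 76 * real r"
  shows "0 \<le> dif r 12 m"
proof (rule chamber_gen[OF lump_12, where j = 37 and u = 1 and S = 77 and xl = 0 and h = 18 and L = 11
    and cs = "[1, - 1, - 1, 0, 0, 1, 0, 1, 0, 0, 0, 0, - 1, 1, 0, - 2, - 1, - 1, 0, 0, 1, 1, 2, 1, 1, 0, 2, 0, - 1, - 2, - 2, - 2, - 2, - 1, - 1, 0, 1, 2]" and bs = "[37, 36, 35, 34, 33, 32, 31, 30, 29, 28, 27, 26, 25, 24, 23, 22, 21, 20, 19, 18, 17, 16, 15, 14, 13, 12, 11, 10, 9, 8, 7, 6, 5, 4, 3, 2, 1, 0]" and B = "[1, 1, 1, 1, 1, 1, 1, 1, 1, 1, 1]"])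
  show "sg 12 = 77" by (simp add: eval_nat_numeral)
  show "[1, - 1, - 1, 0, 0, 1, 0, 1, 0, 0, 0, 0, - 1, 1, 0, - 2, - 1, - 1, 0, 0, 1, 1, 2, 1, 1, 0, 2, 0, - 1, - 2, - 2, - 2, - 2, - 1, - 1, 0, 1, 2] = take (37 + 1) (ec 12)" by (simp add: ec_12)
  show "37 < length (ec 12)" by (simp add: ec_12)
  show "[37, 36, 35, 34, 33, 32, 31, 30, 29, 28, 27, 26, 25, 24, 23, 22, 21, 20, 19, 18, 17, 16, 15, 14, 13, 12, 11, 10, 9, 8, 7, 6, 5, 4, 3, 2, 1, 0] = dl 1 37" by (simp add: eval_nat_numeral)
  show "[1, 1, 1, 1, 1, 1, 1, 1, 1, 1, 1] = replicate 11 1" by (simp add: eval_nat_numeral)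
  show "poschk 18 0 18 (chamber_rows [- 26096916318766147, 0, 479731329466125, 0, - 1246317800310, 0, 1029069426, 0, - 321255, 0, 33] [] [13908462825556910080, 148701281554344288, 830644362240000, 65464270872000, 0, 10373378400] [1, - 1, - 1, 0, 0, 1, 0, 1, 0, 0, 0, 0, - 1, 1, 0, - 2, - 1, - 1, 0, 0, 1, 1, 2, 1, 1, 0, 2, 0, - 1, - 2, - 2, - 2, - 2, - 1, - 1, 0, 1, 2] [37, 36, 35, 34, 33, 32, 31, 30, 29, 28, 27, 26, 25, 24, 23, 22, 21, 20, 19, 18, 17, 16, 15, 14, 13, 12, 11, 10, 9, 8, 7, 6, 5, 4, 3, 2, 1, 0] (sgn_par m) (sgn_par (int r)) [1, 1, 1, 1, 1, 1, 1, 1, 1, 1, 1])"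
    by (rule chamber_12_37_pos0)
qed (use assms in auto)

lemma chamber_12_38_pos0:
  "poschk 18 1 18 (chamber_rows [- 26096916318766147, 0, 479731329466125, 0, - 1246317800310, 0, 1029069426, 0, - 321255, 0, 33] [] [13908462825556910080, 148701281554344288, 830644362240000, 65464270872000, 0, 10373378400] [1, - 1, - 1, 0, 0, 1, 0, 1, 0, 0, 0, 0, - 1, 1, 0, - 2, - 1, - 1, 0, 0, 1, 1, 2, 1, 1, 0, 2, 0, - 1, - 2, - 2, - 2, - 2, - 1, - 1, 0, 1, 2, 1] [38, 37, 36, 35, 34, 33, 32, 31, 30, 29, 28, 27, 26, 25, 24, 23, 22, 21, 20, 19, 18, 17, 16, 15, 14, 13, 12, 11, 10, 9, 8, 7, 6, 5, 4, 3, 2, 1, 0] s \<rho> [1, 1, 1, 1, 1, 1, 1, 1, 1, 1, 1])"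
  by (simp only: pos_rules pos_num cong: pos_congs)

lemma chamber_12_38:
  assumes "r \<ge> 18" "76 * real r \<le> 2 * of_int m + 77" "2 * of_int m + 78 \<le> 78 * real r"
  shows "0 \<le> dif r 12 m"
proof (rule chamber_gen[OF lump_12, where j = 38 and u = 1 and S = 77 and xl = 1 and h = 18 and L = 11
    and cs = "[1, - 1, - 1, 0, 0, 1, 0, 1, 0, 0, 0, 0, - 1, 1, 0, - 2, - 1, - 1, 0, 0, 1, 1, 2, 1, 1, 0, 2, 0, - 1, - 2, - 2, - 2, - 2, - 1, - 1, 0, 1, 2, 1]" and bs = "[38, 37, 36, 35, 34, 33, 32, 31, 30, 29, 28, 27, 26, 25, 24, 23, 22, 21, 20, 19, 18, 17, 16, 15, 14, 13, 12, 11, 10, 9, 8, 7, 6, 5, 4, 3, 2, 1, 0]" and B = "[1, 1, 1, 1, 1, 1, 1, 1, 1, 1, 1]"])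
  show "sg 12 = 77" by (simp add: eval_nat_numeral)
  show "[1, - 1, - 1, 0, 0, 1, 0, 1, 0, 0, 0, 0, - 1, 1, 0, - 2, - 1, - 1, 0, 0, 1, 1, 2, 1, 1, 0, 2, 0, - 1, - 2, - 2, - 2, - 2, - 1, - 1, 0, 1, 2, 1] = take (38 + 1) (ec 12)" by (simp add: ec_12)
  show "38 < length (ec 12)" by (simp add: ec_12)
  show "[38, 37, 36, 35, 34, 33, 32, 31, 30, 29, 28, 27, 26, 25, 24, 23, 22, 21, 20, 19, 18, 17, 16, 15, 14, 13, 12, 11, 10, 9, 8, 7, 6, 5, 4, 3, 2, 1, 0] = dl 1 38" by (simp add: eval_nat_numeral)
  show "[1, 1, 1, 1, 1, 1, 1, 1, 1, 1, 1] = replicate 11 1" by (simp add: eval_nat_numeral)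
  show "poschk 18 1 18 (chamber_rows [- 26096916318766147, 0, 479731329466125, 0, - 1246317800310, 0, 1029069426, 0, - 321255, 0, 33] [] [13908462825556910080, 148701281554344288, 830644362240000, 65464270872000, 0, 10373378400] [1, - 1, - 1, 0, 0, 1, 0, 1, 0, 0, 0, 0, - 1, 1, 0, - 2, - 1, - 1, 0, 0, 1, 1, 2, 1, 1, 0, 2, 0, - 1, - 2, - 2, - 2, - 2, - 1, - 1, 0, 1, 2, 1] [38, 37, 36, 35, 34, 33, 32, 31, 30, 29, 28, 27, 26, 25, 24, 23, 22, 21, 20, 19, 18, 17, 16, 15, 14, 13, 12, 11, 10, 9, 8, 7, 6, 5, 4, 3, 2, 1, 0] (sgn_par m) (sgn_par (int r)) [1, 1, 1, 1, 1, 1, 1, 1, 1, 1, 1])"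
    by (rule chamber_12_38_pos0)
qed (use assms in auto)

lemma top_deg_real: "r \<ge> 1 \<Longrightarrow> real (top_deg r n) = (real r - 1) * (real n * (real n + 1) / 2)"
proof (induction n)
  case (Suc n)
  then show ?case by (simp add: top_deg_Suc of_nat_diff field_simps)
qed (simp add: top_deg_def)

lemma le_top_deg_real:
  assumes "r \<ge> 1" "2 * m \<le> int (top_deg r n)"
  shows "2 * real_of_int m \<le> (real r - 1) * (real n * (real n + 1) / 2)"
proof -
  have "real_of_int (2 * m) \<le> real_of_int (int (top_deg r n))" using assms(2) by (simp only: of_int_le_iff)
  then show ?thesis using top_deg_real[OF assms(1), of n] by simp
qed

lemma gt_top_deg_real:
  assumes "r \<ge> 1" "int (top_deg r n) < 2 * m"
  shows "(real r - 1) * (real n * (real n + 1) / 2) < 2 * real_of_int m"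
proof -
  have "real_of_int (int (top_deg r n)) < real_of_int (2 * m)" using assms(2) by (simp only: of_int_less_iff)
  then show ?thesis using top_deg_real[OF assms(1), of n] by simp
qed

lemma rising_5:
  assumes r: "r \<ge> 18" and ev: "even r"
  shows "rising r 5"
  unfolding rising_def
proof (intro allI impI)
  fix m assume k: "2 * m \<le> int (top_deg r 5)"
  show "0 \<le> dif r 5 m"
  proof (cases "m < 2 * int r")
    case True
    then show ?thesis using r by (intro dif_nonneg_below_2r) auto
  next
    case False
    then have "real_of_int (2 * int r) \<le> real_of_int m" by (simp only: of_int_le_iff not_less)
    then have l0: "2 * real r \<le> real_of_int m" by simp
    have "(\<Sum>{1..5::nat}) = 15" by (simp add: eval_nat_numeral)
    then have "top_deg r 5 = (r - 1) * 15" by (simp only: top_deg_def)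
    moreover have "odd (r - 1)" using r ev by simp
    ultimately have "odd (top_deg r 5)" by simp
    then have "2 * m + 1 \<le> int (top_deg r 5)" using k by presburger
    then have "real_of_int (2 * m + 1) \<le> real_of_int (int (top_deg r 5))" by (simp only: of_int_le_iff)
    then have u0: "2 * real_of_int m + 16 \<le> 15 * real r" using top_deg_real[of r 5] r by simp
    have rr: "real r \<ge> 18" using r by simp
    have a2: "0 \<le> dif r 5 m \<or> 4 * real r \<le> 2 * real_of_int m + 14" using l0 rr by (intro disjI2) linarith
    have a3: "0 \<le> dif r 5 m \<or> 6 * real r \<le> 2 * real_of_int m + 14"
      using a2 chamber_5_2[of r m] r ev by (cases "2 * real_of_int m + 14 < 6 * real r") auto
    have a4: "0 \<le> dif r 5 m \<or> 8 * real r \<le> 2 * real_of_int m + 14"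
      using a3 chamber_5_3[of r m] r ev by (cases "2 * real_of_int m + 14 < 8 * real r") auto
    have a5: "0 \<le> dif r 5 m \<or> 10 * real r \<le> 2 * real_of_int m + 14"
      using a4 chamber_5_4[of r m] r ev by (cases "2 * real_of_int m + 14 < 10 * real r") auto
    have a6: "0 \<le> dif r 5 m \<or> 12 * real r \<le> 2 * real_of_int m + 14"
      using a5 chamber_5_5[of r m] r ev by (cases "2 * real_of_int m + 14 < 12 * real r") auto
    have a7: "0 \<le> dif r 5 m \<or> 14 * real r \<le> 2 * real_of_int m + 14"
      using a6 chamber_5_6[of r m] r ev by (cases "2 * real_of_int m + 14 < 14 * real r") auto
    have "0 \<le> dif r 5 m" using a7 chamber_5_7[of r m] r ev u0 by auto
    then show ?thesis .
  qed
qed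

lemma rising_6:
  assumes r: "r \<ge> 18" and ev: "even r" and R: "rising r 5"
  shows "rising r 6"
proof -
  have "rising r (Suc 5)"
  proof (rule rising_Suc[OF R])
    fix m assume k0: "int (top_deg r 5) < 2 * m" "2 * m \<le> int (top_deg r (Suc 5))"
    then have k: "2 * m \<le> int (top_deg r 6)" by simp
    have l0: "15 * real r - 15 < 2 * real_of_int m" using gt_top_deg_real[of r 5 m] k0 r by (simp add: algebra_simps)
    have "(\<Sum>{1..6::nat}) = 21" by (simp add: eval_nat_numeral)
    then have "top_deg r 6 = (r - 1) * 21" by (simp only: top_deg_def)
    moreover have "odd (r - 1)" using r ev by simp
    ultimately have "odd (top_deg r 6)" by simp
    then have "2 * m + 1 \<le> int (top_deg r 6)" using k by presburger
    then have "real_of_int (2 * m + 1) \<le> real_of_int (int (top_deg r 6))" by (simp only: of_int_le_iff)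
    then have u0: "2 * real_of_int m + 22 \<le> 21 * real r" using top_deg_real[of r 6] r by simp
    have rr: "real r \<ge> 18" using r by simp
    have a7: "0 \<le> dif r 6 m \<or> 14 * real r \<le> 2 * real_of_int m + 20" using l0 rr by (intro disjI2) linarith
    have a8: "0 \<le> dif r 6 m \<or> 16 * real r \<le> 2 * real_of_int m + 20"
      using a7 chamber_6_7[of r m] r ev by (cases "2 * real_of_int m + 20 < 16 * real r") auto
    have a9: "0 \<le> dif r 6 m \<or> 18 * real r \<le> 2 * real_of_int m + 20"
      using a8 chamber_6_8[of r m] r ev by (cases "2 * real_of_int m + 20 < 18 * real r") auto
    have a10: "0 \<le> dif r 6 m \<or> 20 * real r \<le> 2 * real_of_int m + 20"
      using a9 chamber_6_9[of r m] r ev by (cases "2 * real_of_int m + 20 < 20 * real r") auto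
    have "0 \<le> dif r 6 m" using a10 chamber_6_10[of r m] r ev u0 by auto
    then show "0 \<le> dif r (Suc 5) m" by simp
  qed
  then show ?thesis by simp
qed

lemma rising_7:
  assumes r: "r \<ge> 18"
  shows "rising r 7"
  unfolding rising_def
proof (intro allI impI)
  fix m assume k: "2 * m \<le> int (top_deg r 7)"
  show "0 \<le> dif r 7 m"
  proof (cases "m < 2 * int r")
    case True
    then show ?thesis using r by (intro dif_nonneg_below_2r) auto
  next
    case False
    then have "real_of_int (2 * int r) \<le> real_of_int m" by (simp only: of_int_le_iff not_less)
    then have l0: "2 * real r \<le> real_of_int m" by simp
    have u0: "2 * real_of_int m + 28 \<le> 28 * real r" using le_top_deg_real[of r m 7] k r by simp
    have rr: "real r \<ge> 18" using r by simp
    have a2: "0 \<le> dif r 7 m \<or> 4 * real r \<le> 2 * real_of_int m + 27" using l0 rr by (intro disjI2) linarith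
    have a3: "0 \<le> dif r 7 m \<or> 6 * real r \<le> 2 * real_of_int m + 27"
      using a2 chamber_7_2[of r m] r by (cases "2 * real_of_int m + 27 < 6 * real r") auto
    have a4: "0 \<le> dif r 7 m \<or> 8 * real r \<le> 2 * real_of_int m + 27"
      using a3 chamber_7_3[of r m] r by (cases "2 * real_of_int m + 27 < 8 * real r") auto
    have a5: "0 \<le> dif r 7 m \<or> 10 * real r \<le> 2 * real_of_int m + 27"
      using a4 chamber_7_4[of r m] r by (cases "2 * real_of_int m + 27 < 10 * real r") auto
    have a6: "0 \<le> dif r 7 m \<or> 12 * real r \<le> 2 * real_of_int m + 27"
      using a5 chamber_7_5[of r m] r by (cases "2 * real_of_int m + 27 < 12 * real r") auto
    have a7: "0 \<le> dif r 7 m \<or> 14 * real r \<le> 2 * real_of_int m + 27"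
      using a6 chamber_7_6[of r m] r by (cases "2 * real_of_int m + 27 < 14 * real r") auto
    have a8: "0 \<le> dif r 7 m \<or> 16 * real r \<le> 2 * real_of_int m + 27"
      using a7 chamber_7_7[of r m] r by (cases "2 * real_of_int m + 27 < 16 * real r") auto
    have a9: "0 \<le> dif r 7 m \<or> 18 * real r \<le> 2 * real_of_int m + 27"
      using a8 chamber_7_8[of r m] r by (cases "2 * real_of_int m + 27 < 18 * real r") auto
    have a10: "0 \<le> dif r 7 m \<or> 20 * real r \<le> 2 * real_of_int m + 27"
      using a9 chamber_7_9[of r m] r by (cases "2 * real_of_int m + 27 < 20 * real r") auto
    have a11: "0 \<le> dif r 7 m \<or> 22 * real r \<le> 2 * real_of_int m + 27"
      using a10 chamber_7_10[of r m] r by (cases "2 * real_of_int m + 27 < 22 * real r") auto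
    have a12: "0 \<le> dif r 7 m \<or> 24 * real r \<le> 2 * real_of_int m + 27"
      using a11 chamber_7_11[of r m] r by (cases "2 * real_of_int m + 27 < 24 * real r") auto
    have a13: "0 \<le> dif r 7 m \<or> 26 * real r \<le> 2 * real_of_int m + 27"
      using a12 chamber_7_12[of r m] r by (cases "2 * real_of_int m + 27 < 26 * real r") auto
    have "0 \<le> dif r 7 m" using a13 chamber_7_13[of r m] r u0 by auto
    then show ?thesis .
  qed
qed

lemma rising_8:
  assumes r: "r \<ge> 18" and R: "rising r 7"
  shows "rising r 8"
proof -
  have "rising r (Suc 7)"
  proof (rule rising_Suc[OF R])
    fix m assume k0: "int (top_deg r 7) < 2 * m" "2 * m \<le> int (top_deg r (Suc 7))"
    then have k: "2 * m \<le> int (top_deg r 8)" by simp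
    have l0: "28 * real r - 28 < 2 * real_of_int m" using gt_top_deg_real[of r 7 m] k0 r by (simp add: algebra_simps)
    have u0: "2 * real_of_int m + 36 \<le> 36 * real r" using le_top_deg_real[of r m 8] k r by simp
    have rr: "real r \<ge> 18" using r by simp
    have a13: "0 \<le> dif r 8 m \<or> 26 * real r \<le> 2 * real_of_int m + 35" using l0 rr by (intro disjI2) linarith
    have a14: "0 \<le> dif r 8 m \<or> 28 * real r \<le> 2 * real_of_int m + 35"
      using a13 chamber_8_13[of r m] r by (cases "2 * real_of_int m + 35 < 28 * real r") auto
    have a15: "0 \<le> dif r 8 m \<or> 30 * real r \<le> 2 * real_of_int m + 35"
      using a14 chamber_8_14[of r m] r by (cases "2 * real_of_int m + 35 < 30 * real r") auto
    have a16: "0 \<le> dif r 8 m \<or> 32 * real r \<le> 2 * real_of_int m + 35"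
      using a15 chamber_8_15[of r m] r by (cases "2 * real_of_int m + 35 < 32 * real r") auto
    have a17: "0 \<le> dif r 8 m \<or> 34 * real r \<le> 2 * real_of_int m + 35"
      using a16 chamber_8_16[of r m] r by (cases "2 * real_of_int m + 35 < 34 * real r") auto
    have "0 \<le> dif r 8 m" using a17 chamber_8_17[of r m] r u0 by auto
    then show "0 \<le> dif r (Suc 7) m" by simp
  qed
  then show ?thesis by simp
qed

lemma rising_9:
  assumes r: "r \<ge> 18" and R: "rising r 8"
  shows "rising r 9"
proof -
  have "rising r (Suc 8)"
  proof (rule rising_Suc[OF R])
    fix m assume k0: "int (top_deg r 8) < 2 * m" "2 * m \<le> int (top_deg r (Suc 8))"
    then have k: "2 * m \<le> int (top_deg r 9)" by simp
    have l0: "36 * real r - 36 < 2 * real_of_int m" using gt_top_deg_real[of r 8 m] k0 r by (simp add: algebra_simps)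
    have u0: "2 * real_of_int m + 45 \<le> 45 * real r" using le_top_deg_real[of r m 9] k r by simp
    have rr: "real r \<ge> 18" using r by simp
    have a17: "0 \<le> dif r 9 m \<or> 34 * real r \<le> 2 * real_of_int m + 44" using l0 rr by (intro disjI2) linarith
    have a18: "0 \<le> dif r 9 m \<or> 36 * real r \<le> 2 * real_of_int m + 44"
      using a17 chamber_9_17[of r m] r by (cases "2 * real_of_int m + 44 < 36 * real r") auto
    have a19: "0 \<le> dif r 9 m \<or> 38 * real r \<le> 2 * real_of_int m + 44"
      using a18 chamber_9_18[of r m] r by (cases "2 * real_of_int m + 44 < 38 * real r") auto
    have a20: "0 \<le> dif r 9 m \<or> 40 * real r \<le> 2 * real_of_int m + 44"
      using a19 chamber_9_19[of r m] r by (cases "2 * real_of_int m + 44 < 40 * real r") auto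
    have a21: "0 \<le> dif r 9 m \<or> 42 * real r \<le> 2 * real_of_int m + 44"
      using a20 chamber_9_20[of r m] r by (cases "2 * real_of_int m + 44 < 42 * real r") auto
    have a22: "0 \<le> dif r 9 m \<or> 44 * real r \<le> 2 * real_of_int m + 44"
      using a21 chamber_9_21[of r m] r by (cases "2 * real_of_int m + 44 < 44 * real r") auto
    have "0 \<le> dif r 9 m" using a22 chamber_9_22[of r m] r u0 by auto
    then show "0 \<le> dif r (Suc 8) m" by simp
  qed
  then show ?thesis by simp
qed

lemma rising_10:
  assumes r: "r \<ge> 18" and R: "rising r 9"
  shows "rising r 10"
proof -
  have "rising r (Suc 9)"
  proof (rule rising_Suc[OF R])
    fix m assume k0: "int (top_deg r 9) < 2 * m" "2 * m \<le> int (top_deg r (Suc 9))"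
    then have k: "2 * m \<le> int (top_deg r 10)" by simp
    have l0: "45 * real r - 45 < 2 * real_of_int m" using gt_top_deg_real[of r 9 m] k0 r by (simp add: algebra_simps)
    have u0: "2 * real_of_int m + 55 \<le> 55 * real r" using le_top_deg_real[of r m 10] k r by simp
    have rr: "real r \<ge> 18" using r by simp
    have a22: "0 \<le> dif r 10 m \<or> 44 * real r \<le> 2 * real_of_int m + 54" using l0 rr by (intro disjI2) linarith
    have a23: "0 \<le> dif r 10 m \<or> 46 * real r \<le> 2 * real_of_int m + 54"
      using a22 chamber_10_22[of r m] r by (cases "2 * real_of_int m + 54 < 46 * real r") auto
    have a24: "0 \<le> dif r 10 m \<or> 48 * real r \<le> 2 * real_of_int m + 54"
      using a23 chamber_10_23[of r m] r by (cases "2 * real_of_int m + 54 < 48 * real r") auto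
    have a25: "0 \<le> dif r 10 m \<or> 50 * real r \<le> 2 * real_of_int m + 54"
      using a24 chamber_10_24[of r m] r by (cases "2 * real_of_int m + 54 < 50 * real r") auto
    have a26: "0 \<le> dif r 10 m \<or> 52 * real r \<le> 2 * real_of_int m + 54"
      using a25 chamber_10_25[of r m] r by (cases "2 * real_of_int m + 54 < 52 * real r") auto
    have a27: "0 \<le> dif r 10 m \<or> 54 * real r \<le> 2 * real_of_int m + 54"
      using a26 chamber_10_26[of r m] r by (cases "2 * real_of_int m + 54 < 54 * real r") auto
    have "0 \<le> dif r 10 m" using a27 chamber_10_27[of r m] r u0 by auto
    then show "0 \<le> dif r (Suc 9) m" by simp
  qed
  then show ?thesis by simp
qed

lemma rising_11:
  assumes r: "r \<ge> 18" and R: "rising r 10"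
  shows "rising r 11"
proof -
  have "rising r (Suc 10)"
  proof (rule rising_Suc[OF R])
    fix m assume k0: "int (top_deg r 10) < 2 * m" "2 * m \<le> int (top_deg r (Suc 10))"
    then have k: "2 * m \<le> int (top_deg r 11)" by simp
    have l0: "55 * real r - 55 < 2 * real_of_int m" using gt_top_deg_real[of r 10 m] k0 r by (simp add: algebra_simps)
    have u0: "2 * real_of_int m + 66 \<le> 66 * real r" using le_top_deg_real[of r m 11] k r by simp
    have rr: "real r \<ge> 18" using r by simp
    have a27: "0 \<le> dif r 11 m \<or> 54 * real r \<le> 2 * real_of_int m + 65" using l0 rr by (intro disjI2) linarith
    have a28: "0 \<le> dif r 11 m \<or> 56 * real r \<le> 2 * real_of_int m + 65"
      using a27 chamber_11_27[of r m] r by (cases "2 * real_of_int m + 65 < 56 * real r") auto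
    have a29: "0 \<le> dif r 11 m \<or> 58 * real r \<le> 2 * real_of_int m + 65"
      using a28 chamber_11_28[of r m] r by (cases "2 * real_of_int m + 65 < 58 * real r") auto
    have a30: "0 \<le> dif r 11 m \<or> 60 * real r \<le> 2 * real_of_int m + 65"
      using a29 chamber_11_29[of r m] r by (cases "2 * real_of_int m + 65 < 60 * real r") auto
    have a31: "0 \<le> dif r 11 m \<or> 62 * real r \<le> 2 * real_of_int m + 65"
      using a30 chamber_11_30[of r m] r by (cases "2 * real_of_int m + 65 < 62 * real r") auto
    have a32: "0 \<le> dif r 11 m \<or> 64 * real r \<le> 2 * real_of_int m + 65"
      using a31 chamber_11_31[of r m] r by (cases "2 * real_of_int m + 65 < 64 * real r") auto
    have "0 \<le> dif r 11 m" using a32 chamber_11_32[of r m] r u0 by auto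
    then show "0 \<le> dif r (Suc 10) m" by simp
  qed
  then show ?thesis by simp
qed

lemma rising_12:
  assumes r: "r \<ge> 18" and R: "rising r 11"
  shows "rising r 12"
proof -
  have "rising r (Suc 11)"
  proof (rule rising_Suc[OF R])
    fix m assume k0: "int (top_deg r 11) < 2 * m" "2 * m \<le> int (top_deg r (Suc 11))"
    then have k: "2 * m \<le> int (top_deg r 12)" by simp
    have l0: "66 * real r - 66 < 2 * real_of_int m" using gt_top_deg_real[of r 11 m] k0 r by (simp add: algebra_simps)
    have u0: "2 * real_of_int m + 78 \<le> 78 * real r" using le_top_deg_real[of r m 12] k r by simp
    have rr: "real r \<ge> 18" using r by simp
    have a32: "0 \<le> dif r 12 m \<or> 64 * real r \<le> 2 * real_of_int m + 77" using l0 rr by (intro disjI2) linarith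
    have a33: "0 \<le> dif r 12 m \<or> 66 * real r \<le> 2 * real_of_int m + 77"
      using a32 chamber_12_32[of r m] r by (cases "2 * real_of_int m + 77 < 66 * real r") auto
    have a34: "0 \<le> dif r 12 m \<or> 68 * real r \<le> 2 * real_of_int m + 77"
      using a33 chamber_12_33[of r m] r by (cases "2 * real_of_int m + 77 < 68 * real r") auto
    have a35: "0 \<le> dif r 12 m \<or> 70 * real r \<le> 2 * real_of_int m + 77"
      using a34 chamber_12_34[of r m] r by (cases "2 * real_of_int m + 77 < 70 * real r") auto
    have a36: "0 \<le> dif r 12 m \<or> 72 * real r \<le> 2 * real_of_int m + 77"
      using a35 chamber_12_35[of r m] r by (cases "2 * real_of_int m + 77 < 72 * real r") auto
    have a37: "0 \<le> dif r 12 m \<or> 74 * real r \<le> 2 * real_of_int m + 77"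
      using a36 chamber_12_36[of r m] r by (cases "2 * real_of_int m + 77 < 74 * real r") auto
    have a38: "0 \<le> dif r 12 m \<or> 76 * real r \<le> 2 * real_of_int m + 77"
      using a37 chamber_12_37[of r m] r by (cases "2 * real_of_int m + 77 < 76 * real r") auto
    have "0 \<le> dif r 12 m" using a38 chamber_12_38[of r m] r u0 by auto
    then show "0 \<le> dif r (Suc 11) m" by simp
  qed
  then show ?thesis by simp
qed

section \<open>At most four factors\<close>

lemma pp_Ints: "pp n y \<in> \<int>"
  by (induction n arbitrary: y) (auto intro!: Ints_sum)

lemma cf_Ints: "cf (ec n) i \<in> \<int>"
proof (induction n arbitrary: i)
  case 0
  show ?case by (cases i) (auto simp: cf_def)
next
  case (Suc n)
  then show ?case unfolding cf_ec_Suc by auto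
qed

lemma dif_Ints:
  assumes "r \<ge> 1" "n \<ge> 1"
  shows "dif r n m \<in> \<int>"
  using dif_eq_sum_pp_aux[OF assms, of m "nat m"] pp_Ints cf_Ints by (auto intro!: Ints_sum Ints_mult)

text \<open>The differences are integers, so a bound by \<open>-1\<close> is enough.\<close>

lemma dif_nonneg_if_gt:
  assumes "r \<ge> 1" "n \<ge> 1" "- 1 < dif r n m"
  shows "0 \<le> dif r n m"
proof -
  obtain k where k: "dif r n m = of_int k" using dif_Ints[OF assms(1,2)] by (auto elim: Ints_cases)
  then have "- 1 < k" using assms(3) by linarith
  then show ?thesis using k by simp
qed

lemma rising_1: assumes "r \<ge> 2" shows "rising r 1"
  unfolding rising_def
proof (intro allI impI)
  fix m assume k: "2 * m \<le> int (top_deg r 1)"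
  then have "m < int ((0 + 1) * r)" using assms by (simp add: top_deg_def)
  then have "dif r 1 m = (\<Sum>i\<le>0. cf (ec 1) i * pp 1 (m - int (i * r)))" using assms by (intro dif_eq_sum_pp) auto
  then show "0 \<le> dif r 1 m" using cf_ec_01[of 1] pp_nonneg[of 1 m] by simp
qed

lemma rising_2: assumes "r \<ge> 2" "even r" shows "rising r 2"
  unfolding rising_def
proof (intro allI impI)
  fix m assume k: "2 * m \<le> int (top_deg r 2)"
  have "2 * real_of_int m \<le> (real r - 1) * 3" using le_top_deg_real[of r m 2] k assms by simp
  then have "real_of_int m < real_of_int (2 * int r)" by simp
  then have "m < 2 * int r" by (simp only: of_int_less_iff)
  then show "0 \<le> dif r 2 m" using assms by (intro dif_nonneg_below_2r) auto
qed

text \<open>The exact quasi-polynomial. Crude bounds for its oscillation do not suffice here, the residues modulo \<open>3\<close> have to be correlated.\<close>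

lemma pp_3:
  assumes "- 5 < y"
  shows "12 * pp 3 y = 2 * of_int y + 5 + 3 * sgn_par y + (if y mod 3 = 0 then 4 else if y mod 3 = 1 then - 4 else 0)"
proof -
  have "12 * pp 3 y = qev tb3 y (of_int (2 * y + sg 3))"
    using quasi_3 assms unfolding quasi_def by (simp add: eval_nat_numeral)
  moreover have "sg 3 = 5" by (simp add: eval_nat_numeral)
  moreover have "y mod 3 = 0 \<or> y mod 3 = 1 \<or> y mod 3 = 2" by presburger
  moreover have "y mod 2 = (if even y then 0 else 1)" by presburger
  ultimately show ?thesis by (auto simp: tb3_def qev_def qrow_def sgn_par_def)
qed

lemma rising_3: assumes r: "r \<ge> 2" "even r" shows "rising r 3"
  unfolding rising_def
proof (intro allI impI)
  fix m assume k: "2 * m \<le> int (top_deg r 3)"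
  have u0: "2 * real_of_int m \<le> (real r - 1) * 6" using le_top_deg_real[of r m 3] k r by simp
  show "0 \<le> dif r 3 m"
  proof (cases "m < 2 * int r")
    case True
    then show ?thesis using r by (intro dif_nonneg_below_2r) auto
  next
    case False
    have "real_of_int m < real_of_int (int ((2 + 1) * r))" using u0 by simp
    then have "m < int ((2 + 1) * r)" by (simp only: of_int_less_iff)
    then have "dif r 3 m = (\<Sum>i\<le>2. cf (ec 3) i * pp 3 (m - int (i * r)))" using r by (intro dif_eq_sum_pp) auto
    then have d: "dif r 3 m = pp 3 m - pp 3 (m - int r) - pp 3 (m - 2 * int r)"
      by (simp add: ec_3 cf_def numeral_2_eq_2)
    have par: "sgn_par (m - int r) = sgn_par m" "sgn_par (m - 2 * int r) = sgn_par m" using r by (auto simp: sgn_par_def)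
    have s: "sgn_par m \<le> 1" by (simp add: sgn_par_def)
    have m3: "m mod 3 = 0 \<or> m mod 3 = 1 \<or> m mod 3 = 2" "int r mod 3 = 0 \<or> int r mod 3 = 1 \<or> int r mod 3 = 2" by presburger+
    have md0: "(m - x) mod 3 = (m mod 3 - x mod 3) mod 3" "(m - 2 * x) mod 3 = (m mod 3 - 2 * (x mod 3)) mod 3" for x :: int
      by presburger+
    have md: "(m - int r) mod 3 = (m mod 3 - int r mod 3) mod 3" "(m - 2 * int r) mod 3 = (m mod 3 - 2 * (int r mod 3)) mod 3"
      by (rule md0)+
    define N :: "int \<Rightarrow> real" where "N y = (if y mod 3 = 0 then 4 else if y mod 3 = 1 then - 4 else 0)" for y
    have N: "- 8 \<le> N m - N (m - int r) - N (m - 2 * int r)"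
      using m3 by (elim disjE; simp only: N_def md; simp)
    have p: "12 * pp 3 y = 2 * of_int y + 5 + 3 * sgn_par y + N y" if "- 5 < y" for y using pp_3[OF that] by (simp only: N_def)
    have "12 * dif r 3 m = 12 * pp 3 m - 12 * pp 3 (m - int r) - 12 * pp 3 (m - 2 * int r)" by (simp only: d right_diff_distrib)
    also have "\<dots> = 6 * real r - 2 * of_int m - 5 - 3 * sgn_par m + (N m - N (m - int r) - N (m - 2 * int r))"
      using False by (subst (1 2 3) p) (simp_all add: par)
    finally have e: "12 * dif r 3 m = 6 * real r - 2 * of_int m - 5 - 3 * sgn_par m + (N m - N (m - int r) - N (m - 2 * int r))" .
    have "2 * real_of_int m \<le> 6 * real r - 6" using u0 by (simp add: algebra_simps)
    then have "- 12 < 12 * dif r 3 m" using N s unfolding e by linarith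
    then show ?thesis using r by (intro dif_nonneg_if_gt) auto
  qed
qed

lemma rising_4: assumes r: "r \<ge> 2" "even r" shows "rising r 4"
  unfolding rising_def
proof (intro allI impI)
  fix m assume k: "2 * m \<le> int (top_deg r 4)"
  have u0: "2 * real_of_int m \<le> (real r - 1) * 10" using le_top_deg_real[of r m 4] k r by simp
  show "0 \<le> dif r 4 m"
  proof (cases "m < 2 * int r")
    case True
    then show ?thesis using r by (intro dif_nonneg_below_2r) auto
  next
    case False
    have "real_of_int m < real_of_int (int ((4 + 1) * r))" using u0 by simp
    then have "m < int ((4 + 1) * r)" by (simp only: of_int_less_iff)
    then have "dif r 4 m = (\<Sum>i\<le>4. cf (ec 4) i * pp 4 (m - int (i * r)))" using r by (intro dif_eq_sum_pp) auto
    then have d: "dif r 4 m = pp 4 m - pp 4 (m - int r) - pp 4 (m - 2 * int r)"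
    proof -
      have "{..4::nat} = {0, 1, 2, 3, 4}" by (rule set_eqI) (simp, presburger)
      then show ?thesis using \<open>dif r 4 m = _\<close> by (simp add: ec_4 cf_def)
    qed
    define s where "s = sgn_par m"
    have par: "sgn_par (m - int r) = s" "sgn_par (m - 2 * int r) = s" using r by (auto simp: sgn_par_def s_def)
    have s: "s = 1 \<or> s = - 1" by (simp add: sgn_par_def s_def)
    have sg4: "sg 4 = 9" by (simp add: eval_nat_numeral)
    define z where "z = 2 * real_of_int m + 9"
    have zr: "4 * real r \<le> z"
    proof -
      have "real_of_int (2 * int r) \<le> real_of_int m" using False by (simp only: of_int_le_iff not_less)
      then show ?thesis by (simp add: z_def)
    qed
    have e: "\<bar>576 * pp 4 y - pev [- 29, 0, 3] (of_int (2 * y + 9)) - sgn_par y * pev [0, 18] (of_int (2 * y + 9))\<bar> \<le> pev [200] (of_int (2 * y + 9))"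
      if "0 \<le> 2 * y + 9" for y
      using est_4 that unfolding est_def sg4 by blast
    have e0: "576 * pp 4 m \<ge> pev [- 29, 0, 3] z + s * pev [0, 18] z - pev [200] z"
      using e[of m] False unfolding s_def[symmetric] z_def by (simp add: abs_le_iff)
    have e1: "576 * pp 4 (m - int r) \<le> pev [- 29, 0, 3] (z - 2 * real r) + s * pev [0, 18] (z - 2 * real r) + pev [200] (z - 2 * real r)"
      using e[of "m - int r"] False unfolding par z_def by (simp add: abs_le_iff algebra_simps)
    have e2: "576 * pp 4 (m - 2 * int r) \<le> pev [- 29, 0, 3] (z - 4 * real r) + s * pev [0, 18] (z - 4 * real r) + pev [200] (z - 4 * real r)"
      using e[of "m - 2 * int r"] False unfolding par z_def by (simp add: abs_le_iff algebra_simps)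
    have zu: "z + 3 * s \<le> 10 * real r"
    proof (cases "even m")
      case True
      then have "m \<noteq> 5 * int r - 5" using r(2) by auto
      moreover have "real_of_int m \<le> real_of_int (5 * int r - 5)" using u0 by simp
      ultimately have "m \<le> 5 * int r - 6" by (simp only: of_int_le_iff)
      then have "real_of_int m \<le> real_of_int (5 * int r - 6)" by (simp only: of_int_le_iff)
      then show ?thesis using s by (auto simp: z_def)
    next
      case False
      then show ?thesis using u0 by (auto simp: z_def s_def sgn_par_def)
    qed
    have p: "0 \<le> (z + 3 * s - 2 * real r) * (10 * real r - (z + 3 * s))"
      using zr zu s r by (intro mult_nonneg_nonneg) auto
    have big: "- 576 < 576 * dif r 4 m"
      using e0 e1 e2 p s zr unfolding d
      by (elim disjE) (auto simp: algebra_simps power2_eq_square)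
    then have "- 1 < dif r 4 m" by simp
    then show ?thesis using r by (intro dif_nonneg_if_gt) auto
  qed
qed

section \<open>Evaluating the recurrence by rewriting\<close>

text \<open>The queue recurrence on one block of the list. Lists are kept as lists of blocks, since a rewriting step costs time proportional to the size of the term it acts on.\<close>

fun gob :: "real list \<Rightarrow> real list \<Rightarrow> real list \<Rightarrow> real list \<Rightarrow> real list \<Rightarrow> real list \<times> real list \<times> real list \<times> real list \<times> real list" where
  "gob [] S Q B O' = ([], S, Q, B, O')"
| "gob (a # A) [] Q B O' = (a # A, [], Q, B, O')"
| "gob (a # A) (s # S) (q # Q) B O' = (let x = a - s + q in gob A S Q (x # B) (x # O'))"
| "gob (a # A) (s # S) [] B O' = (case rev B of [] \<Rightarrow> (a # A, s # S, [], [], O')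
     | q # Q \<Rightarrow> let x = a - s + q in gob A S Q [x] (x # O'))"

definition gval where
  "gval X A' S' = (case X of (A, S, Q, B, O') \<Rightarrow> rev (outs (A @ A') (S @ S') (Q @ rev B)) @ O')"

text \<open>Processing a block does not change the value of the whole remaining computation.\<close>

lemma gval_gob: "gval (gob A S Q B O') A' S' = rev (outs (A @ A') (S @ S') (Q @ rev B)) @ O'"
  by (induction A S Q B O' rule: gob.induct) (auto simp: gval_def Let_def split: list.splits)

lemma gob_rot: "gob (a # A) (s # S) [] (b # B) O' = gob (a # A) (s # S) (rev (b # B)) [] O'"
  by (cases "rev (b # B)") (simp_all add: Let_def)

definition push1 where "push1 x1 A S Q B O' = gob A S Q (x1 # B) (x1 # O')"
definition push2 where "push2 x1 x2 A S Q B O' = gob A S Q (x2 # x1 # B) (x2 # x1 # O')"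
definition push4 where "push4 x1 x2 x3 x4 A S Q B O' = gob A S Q (x4 # x3 # x2 # x1 # B) (x4 # x3 # x2 # x1 # O')"
definition push8 where "push8 x1 x2 x3 x4 x5 x6 x7 x8 A S Q B O' = gob A S Q (x8 # x7 # x6 # x5 # x4 # x3 # x2 # x1 # B) (x8 # x7 # x6 # x5 # x4 # x3 # x2 # x1 # O')"
definition rot where "rot A S Q O' = gob A S Q [] O'"
definition ntl where "ntl Z c Rs = nt (length Z) (c @ concat Rs)"
definition zeros :: "nat \<Rightarrow> real list" where "zeros k = replicate k 0"
definition rvb :: "real list list \<Rightarrow> real list list \<Rightarrow> real list list" where "rvb Rs Z = rev (map rev Rs) @ Z"
definition nnb where "nnb Rs = nn (concat Rs)"
definition chkb where "chkb lo p n N Rs t = chk lo p n N (concat Rs) t"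
definition st4 where "st4 b lo p k N R' t \<longleftrightarrow> (b \<longrightarrow> nn R') \<and> chk lo p k N R' t"
definition st1 where "st1 b lo p k N u Rs t \<longleftrightarrow> st4 b lo p k (N + u) (go (ext N u (concat Rs)) (zs (k + u) (ext N u (concat Rs))) (zs k []) [] []) t"
definition st1a where "st1a b lo p k N u Rs Z t \<longleftrightarrow>
  (let A = rev (concat Rs) @ Z in st4 b lo p k N (go A (zs (k + u) A) (zs k []) [] []) t)"
definition st2 where "st2 b lo p k N As Z Q t \<longleftrightarrow> st4 b lo p k N (go (concat As) (Z @ concat As) Q [] []) t"
definition bl where "bl b lo p k N t X As Ss acc \<longleftrightarrow> st4 b lo p k N (gval X (concat As) (concat Ss) @ concat acc) t"
definition st5 where "st5 b lo p k N Rs t = st4 b lo p k N (concat Rs) t"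

lemma concat_rev_map_rev: "concat (rev (map rev Rs)) = rev (concat Rs)"
  by (induction Rs) auto

lemma nn_append: "nn (xs @ ys) = (nn xs \<and> nn ys)" by (auto simp: nn_def)
lemma nn_Cons: "nn (x # xs) = (0 \<le> x \<and> nn xs)" by (auto simp: nn_def)
lemma nn_Nil: "nn [] = True" by (auto simp: nn_def)

lemma st1_eval: "st1 b lo p k N u Rs t = st1a b lo p k (N + u) u Rs
     (if even N then ntl (zeros (u div 2)) [] Rs else 0 # ntl (zeros ((u - 1) div 2)) [] Rs) t"
  by (simp add: st1_def st1a_def ext_def Let_def zeros_def ntl_def rvapp_def)

lemma st1a_eval: "st1a b lo p k N u Rs Z t = st2 b lo p k N (rvb Rs [Z]) (zeros (k + u)) (zeros k) t"
  by (simp add: st1a_def st2_def rvb_def concat_rev_map_rev zs_def zeros_def Let_def)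

lemma st2_eval: "st2 b lo p k N (A # As) Z Q t = bl b lo p k N t (gob A Z Q [] []) As (A # As) []"
  by (simp add: st2_def bl_def gval_gob go_def)

lemma bl_eval:
  "bl b lo p k N t ([], S, Q, B, O') [] Ss acc = st5 b lo p k N (O' # acc) t"
  "bl b lo p k N t ([], S, Q, B, O') (A # As) Ss acc = bl b lo p k N t (gob A S Q B []) As Ss (O' # acc)"
  "bl b lo p k N t (a # A, [], Q, B, O') As (S # Ss) acc = bl b lo p k N t (gob (a # A) S Q B O') As Ss acc"
  unfolding bl_def gval_gob by (simp_all add: gval_def st5_def del: outs.simps(2))

lemma st5_eval:
  "st5 True lo p k N Rs t = (if nnb Rs then chkb lo p k N Rs t else False)"
  "st5 False lo p k N Rs t = chkb lo p k N Rs t"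
  by (simp_all add: st5_def st4_def nnb_def chkb_def)

lemma chkb_eval:
  "chkb lo p n N Rs 0 = True"
  "chkb lo p n N Rs 1 = st1 (lo \<le> n + 1) lo p (n + 1) N (p * (n + 1)) Rs 0"
  "chkb lo p n N Rs (numeral v) = st1 (lo \<le> n + 1) lo p (n + 1) N (p * (n + 1)) Rs (pred_numeral v)"
  by (simp_all add: chkb_def st1_def st4_def new_def Let_def numeral_eq_Suc)

lemma chk_blocks: "chk lo p n N [x] t = chkb lo p n N [[x]] t" by (simp add: chkb_def)

lemma gob_eval:
  "gob [] S Q B O' = ([], S, Q, B, O')"
  "gob (a # A) [] Q B O' = (a # A, [], Q, B, O')"
  "gob (a1 # A) (x1 # S) (q1 # Q) B O' = push1 (a1 - x1 + q1) A S Q B O'"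
  "gob (a1 # a2 # A) (x1 # x2 # S) (q1 # q2 # Q) B O' = push2 (a1 - x1 + q1) (a2 - x2 + q2) A S Q B O'"
  "gob (a1 # a2 # a3 # a4 # A) (x1 # x2 # x3 # x4 # S) (q1 # q2 # q3 # q4 # Q) B O' = push4 (a1 - x1 + q1) (a2 - x2 + q2) (a3 - x3 + q3) (a4 - x4 + q4) A S Q B O'"
  "gob (a1 # a2 # a3 # a4 # a5 # a6 # a7 # a8 # A) (x1 # x2 # x3 # x4 # x5 # x6 # x7 # x8 # S) (q1 # q2 # q3 # q4 # q5 # q6 # q7 # q8 # Q) B O' = push8 (a1 - x1 + q1) (a2 - x2 + q2) (a3 - x3 + q3) (a4 - x4 + q4) (a5 - x5 + q5) (a6 - x6 + q6) (a7 - x7 + q7) (a8 - x8 + q8) A S Q B O'"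
  "gob (a # A) (s # S) [] (b # B) O' = rot (a # A) (s # S) (rvapp (b # B) []) O'"
  "push1 x1 A S Q B O' = gob A S Q (x1 # B) (x1 # O')"
  "push2 x1 x2 A S Q B O' = gob A S Q (x2 # x1 # B) (x2 # x1 # O')"
  "push4 x1 x2 x3 x4 A S Q B O' = gob A S Q (x4 # x3 # x2 # x1 # B) (x4 # x3 # x2 # x1 # O')"
  "push8 x1 x2 x3 x4 x5 x6 x7 x8 A S Q B O' = gob A S Q (x8 # x7 # x6 # x5 # x4 # x3 # x2 # x1 # B) (x8 # x7 # x6 # x5 # x4 # x3 # x2 # x1 # O')"
  "rot A S Q O' = gob A S Q [] O'"
  by (simp_all add: push1_def push2_def push4_def push8_def rot_def rvapp_def Let_def gob_rot del: rev.simps gob.simps(4))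

lemma list_eval:
  "rvapp [] Z = Z"
  "rvapp (x1 # R) Z = rvapp R (x1 # Z)"
  "rvapp (x1 # x2 # R) Z = rvapp R (x2 # x1 # Z)"
  "rvapp (x1 # x2 # x3 # x4 # R) Z = rvapp R (x4 # x3 # x2 # x1 # Z)"
  "rvapp (x1 # x2 # x3 # x4 # x5 # x6 # x7 # x8 # R) Z = rvapp R (x8 # x7 # x6 # x5 # x4 # x3 # x2 # x1 # Z)"
  "rvb [] Zs = Zs"
  "rvb (c # Rs) Zs = Let (rvapp c []) (\<lambda>d. rvb Rs (d # Zs))"
  "zeros 0 = []"
  "zeros 1 = [0]"
  "zeros (numeral v) = 0 # zeros (pred_numeral v)"
  "ntl [] c Rs = []"
  "ntl (z # Z) [] (c # Rs) = ntl (z # Z) c Rs"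
  "ntl (z # Z) [] [] = 0 # ntl Z [] []"
  "ntl (z1 # Z) (x1 # R) Rs = - x1 # ntl Z R Rs"
  "ntl (z1 # z2 # Z) (x1 # x2 # R) Rs = - x1 # - x2 # ntl Z R Rs"
  "ntl (z1 # z2 # z3 # z4 # Z) (x1 # x2 # x3 # x4 # R) Rs = - x1 # - x2 # - x3 # - x4 # ntl Z R Rs"
  "ntl (z1 # z2 # z3 # z4 # z5 # z6 # z7 # z8 # Z) (x1 # x2 # x3 # x4 # x5 # x6 # x7 # x8 # R) Rs = - x1 # - x2 # - x3 # - x4 # - x5 # - x6 # - x7 # - x8 # ntl Z R Rs"
  "nn [] = True"
  "nn (x1 # R) = (if 0 \<le> x1 then nn R else False)"
  "nn (x1 # x2 # R) = (if 0 \<le> x1 \<and> 0 \<le> x2 then nn R else False)"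
  "nn (x1 # x2 # x3 # x4 # R) = (if 0 \<le> x1 \<and> 0 \<le> x2 \<and> 0 \<le> x3 \<and> 0 \<le> x4 then nn R else False)"
  "nn (x1 # x2 # x3 # x4 # x5 # x6 # x7 # x8 # R) = (if 0 \<le> x1 \<and> 0 \<le> x2 \<and> 0 \<le> x3 \<and> 0 \<le> x4 \<and> 0 \<le> x5 \<and> 0 \<le> x6 \<and> 0 \<le> x7 \<and> 0 \<le> x8 then nn R else False)"
  "nnb [] = True"
  "nnb (c # Rs) = (if nn c then nnb Rs else False)"
  by (simp_all add: rvapp_def rvb_def zeros_def ntl_def numeral_eq_Suc nnb_def nn_append nn_Cons nn_Nil Let_def)
    blast+

lemma halves:
  "(0::nat) div 2 = 0" "(1::nat) div 2 = 0"
  "numeral (num.Bit0 v) div 2 = (numeral v :: nat)" "numeral (num.Bit1 v) div 2 = (numeral v :: nat)"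
  "(1::nat) - 1 = 0" "numeral v - (1::nat) = pred_numeral v"
  by simp_all

text \<open>These rules restrict rewriting to the arguments that are not yet in normal form.\<close>

lemma weak_congs:
  "gob A S Q B O' = gob A S Q B O'"
  "rvapp R Z = rvapp R Z"
  "x1 = x1' \<Longrightarrow> push1 x1 A S Q B O' = push1 x1' A S Q B O'"
  "x1 = x1' \<Longrightarrow> x2 = x2' \<Longrightarrow> push2 x1 x2 A S Q B O' = push2 x1' x2' A S Q B O'"
  "x1 = x1' \<Longrightarrow> x2 = x2' \<Longrightarrow> x3 = x3' \<Longrightarrow> x4 = x4' \<Longrightarrow> push4 x1 x2 x3 x4 A S Q B O' = push4 x1' x2' x3' x4' A S Q B O'"
  "x1 = x1' \<Longrightarrow> x2 = x2' \<Longrightarrow> x3 = x3' \<Longrightarrow> x4 = x4' \<Longrightarrow> x5 = x5' \<Longrightarrow> x6 = x6' \<Longrightarrow> x7 = x7' \<Longrightarrow> x8 = x8' \<Longrightarrow> push8 x1 x2 x3 x4 x5 x6 x7 x8 A S Q B O' = push8 x1' x2' x3' x4' x5' x6' x7' x8' A S Q B O'"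
  "Q = Q' \<Longrightarrow> rot A S Q O' = rot A S Q' O'"
  "rvb Rs Zs = rvb Rs Zs"
  "Z = Z' \<Longrightarrow> ntl Z c Rs = ntl Z' c Rs"
  "nn R = nn R"
  "nnb Rs = nnb Rs"
  "chkb lo p n N Rs t = chkb lo p n N Rs t"
  "b = b' \<Longrightarrow> k = k' \<Longrightarrow> u = u' \<Longrightarrow> t = t' \<Longrightarrow> st1 b lo p k N u Rs t = st1 b' lo p k' N u' Rs t'"
  "N = N' \<Longrightarrow> Z = Z' \<Longrightarrow> st1a b lo p k N u Rs Z t = st1a b lo p k N' u Rs Z' t"
  "As = As' \<Longrightarrow> Z = Z' \<Longrightarrow> Q = Q' \<Longrightarrow> st2 b lo p k N As Z Q t = st2 b lo p k N As' Z' Q' t"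
  "X = X' \<Longrightarrow> bl b lo p k N t X As Ss acc = bl b lo p k N t X' As Ss acc"
  "st5 b lo p k N Rs t = st5 b lo p k N Rs t"
  "u1 = u2 \<Longrightarrow> Let u1 ff = Let u2 ff"
  by simp_all

lemmas num_rules = arith_simps rel_simps arith_special numeral_One pred_numeral_simps Num.BitM.simps Num.inc.simps
  sub_num_simps dbl_simps dbl_inc_simps dbl_dec_simps
  add_0_left add_0_right diff_zero diff_0 minus_minus minus_zero diff_self mult_1_left mult_1_right mult_zero_left mult_zero_right
  zero_le_numeral zero_le_one order_refl even_numeral odd_numeral even_zero odd_one if_True if_False simp_thms
  halves Let_def

lemmas chk_eval = chk_blocks chkb_eval st1_eval st1a_eval st2_eval bl_eval st5_eval gob_eval list_eval num_rules

section \<open>Small r\<close>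

lemma small_2: "1 \<le> n \<Longrightarrow> n \<le> 74 \<Longrightarrow> rising 2 n"
proof -
  have "chk 1 1 0 0 [1] 74" by (simp only: chk_eval cong: weak_congs)
  then show "1 \<le> n \<Longrightarrow> n \<le> 74 \<Longrightarrow> rising 2 n" using chk_sound[of 1 1 74 n] by (simp add: numeral_2_eq_2)
qed

lemma small_3: "11 \<le> n \<Longrightarrow> n \<le> 39 \<Longrightarrow> rising 3 n"
proof -
  have "chk 11 2 0 0 [1] 39" by (simp only: chk_eval cong: weak_congs)
  then show "11 \<le> n \<Longrightarrow> n \<le> 39 \<Longrightarrow> rising 3 n" using chk_sound[of 11 2 39 n] by (simp)
qed

lemma small_4: "1 \<le> n \<Longrightarrow> n \<le> 29 \<Longrightarrow> rising 4 n"
proof -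
  have "chk 1 3 0 0 [1] 29" by (simp only: chk_eval cong: weak_congs)
  then show "1 \<le> n \<Longrightarrow> n \<le> 29 \<Longrightarrow> rising 4 n" using chk_sound[of 1 3 29 n] by (simp)
qed

lemma small_5: "11 \<le> n \<Longrightarrow> n \<le> 27 \<Longrightarrow> rising 5 n"
proof -
  have "chk 11 4 0 0 [1] 27" by (simp only: chk_eval cong: weak_congs)
  then show "11 \<le> n \<Longrightarrow> n \<le> 27 \<Longrightarrow> rising 5 n" using chk_sound[of 11 4 27 n] by (simp)
qed

lemma small_6: "1 \<le> n \<Longrightarrow> n \<le> 27 \<Longrightarrow> rising 6 n"
proof -
  have "chk 1 5 0 0 [1] 27" by (simp only: chk_eval cong: weak_congs)
  then show "1 \<le> n \<Longrightarrow> n \<le> 27 \<Longrightarrow> rising 6 n" using chk_sound[of 1 5 27 n] by (simp)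
qed

lemma small_7: "11 \<le> n \<Longrightarrow> n \<le> 27 \<Longrightarrow> rising 7 n"
proof -
  have "chk 11 6 0 0 [1] 27" by (simp only: chk_eval cong: weak_congs)
  then show "11 \<le> n \<Longrightarrow> n \<le> 27 \<Longrightarrow> rising 7 n" using chk_sound[of 11 6 27 n] by (simp)
qed

lemma small_8: "1 \<le> n \<Longrightarrow> n \<le> 27 \<Longrightarrow> rising 8 n"
proof -
  have "chk 1 7 0 0 [1] 27" by (simp only: chk_eval cong: weak_congs)
  then show "1 \<le> n \<Longrightarrow> n \<le> 27 \<Longrightarrow> rising 8 n" using chk_sound[of 1 7 27 n] by (simp)
qed

lemma small_9: "11 \<le> n \<Longrightarrow> n \<le> 16 \<Longrightarrow> rising 9 n"
proof -
  have "chk 11 8 0 0 [1] 16" by (simp only: chk_eval cong: weak_congs)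
  then show "11 \<le> n \<Longrightarrow> n \<le> 16 \<Longrightarrow> rising 9 n" using chk_sound[of 11 8 16 n] by (simp)
qed

lemma small_10: "1 \<le> n \<Longrightarrow> n \<le> 16 \<Longrightarrow> rising 10 n"
proof -
  have "chk 1 9 0 0 [1] 16" by (simp only: chk_eval cong: weak_congs)
  then show "1 \<le> n \<Longrightarrow> n \<le> 16 \<Longrightarrow> rising 10 n" using chk_sound[of 1 9 16 n] by (simp)
qed

lemma small_11: "11 \<le> n \<Longrightarrow> n \<le> 16 \<Longrightarrow> rising 11 n"
proof -
  have "chk 11 10 0 0 [1] 16" by (simp only: chk_eval cong: weak_congs)
  then show "11 \<le> n \<Longrightarrow> n \<le> 16 \<Longrightarrow> rising 11 n" using chk_sound[of 11 10 16 n] by (simp)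
qed

lemma small_12: "1 \<le> n \<Longrightarrow> n \<le> 14 \<Longrightarrow> rising 12 n"
proof -
  have "chk 1 11 0 0 [1] 14" by (simp only: chk_eval cong: weak_congs)
  then show "1 \<le> n \<Longrightarrow> n \<le> 14 \<Longrightarrow> rising 12 n" using chk_sound[of 1 11 14 n] by (simp)
qed

lemma small_13: "11 \<le> n \<Longrightarrow> n \<le> 14 \<Longrightarrow> rising 13 n"
proof -
  have "chk 11 12 0 0 [1] 14" by (simp only: chk_eval cong: weak_congs)
  then show "11 \<le> n \<Longrightarrow> n \<le> 14 \<Longrightarrow> rising 13 n" using chk_sound[of 11 12 14 n] by (simp)
qed

lemma small_14: "1 \<le> n \<Longrightarrow> n \<le> 14 \<Longrightarrow> rising 14 n"
proof -
  have "chk 1 13 0 0 [1] 14" by (simp only: chk_eval cong: weak_congs)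
  then show "1 \<le> n \<Longrightarrow> n \<le> 14 \<Longrightarrow> rising 14 n" using chk_sound[of 1 13 14 n] by (simp)
qed

lemma small_15: "11 \<le> n \<Longrightarrow> n \<le> 14 \<Longrightarrow> rising 15 n"
proof -
  have "chk 11 14 0 0 [1] 14" by (simp only: chk_eval cong: weak_congs)
  then show "11 \<le> n \<Longrightarrow> n \<le> 14 \<Longrightarrow> rising 15 n" using chk_sound[of 11 14 14 n] by (simp)
qed

lemma small_16: "1 \<le> n \<Longrightarrow> n \<le> 14 \<Longrightarrow> rising 16 n"
proof -
  have "chk 1 15 0 0 [1] 14" by (simp only: chk_eval cong: weak_congs)
  then show "1 \<le> n \<Longrightarrow> n \<le> 14 \<Longrightarrow> rising 16 n" using chk_sound[of 1 15 14 n] by (simp)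
qed

lemma small_17: "11 \<le> n \<Longrightarrow> n \<le> 14 \<Longrightarrow> rising 17 n"
proof -
  have "chk 11 16 0 0 [1] 14" by (simp only: chk_eval cong: weak_congs)
  then show "11 \<le> n \<Longrightarrow> n \<le> 14 \<Longrightarrow> rising 17 n" using chk_sound[of 11 16 14 n] by (simp)
qed

section \<open>All r\<close>

lemma rising_upward:
  assumes "\<And>n. N \<le> n \<Longrightarrow> rising r n \<Longrightarrow> rising r (Suc n)" "rising r N" "N \<le> n"
  shows "rising r n"
  using assms(3) by (induction n rule: dec_induct) (use assms in auto)

lemma rising_large_r:
  assumes r: "r \<ge> 18" and n: "n \<ge> 1" "even r \<or> n \<ge> 11"
  shows "rising r n"
proof -
  have r2: "r \<ge> 2" using r by simp
  have 7: "rising r 7" using r by (rule rising_7)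
  have 8: "rising r 8" using rising_8[OF r 7] .
  have 9: "rising r 9" using rising_9[OF r 8] .
  have 10: "rising r 10" using rising_10[OF r 9] .
  have 11: "rising r 11" using rising_11[OF r 10] .
  have 12: "rising r 12" using rising_12[OF r 11] .
  have up: "rising r n" if "12 \<le> n"
    by (rule rising_upward[OF _ 12 that], rule fourier_step_9_up) (use r in auto)
  have low: "rising r n" if "even r" "n \<le> 6"
  proof -
    have 5: "rising r 5" using rising_5[OF r that(1)] .
    have 6: "rising r 6" using rising_6[OF r that(1) 5] .
    have "n = 1 \<or> n = 2 \<or> n = 3 \<or> n = 4 \<or> n = 5 \<or> n = 6" using n that by linarith
    then show ?thesis using rising_1[OF r2] rising_2[OF r2 that(1)] rising_3[OF r2 that(1)] rising_4[OF r2 that(1)] 5 6 by auto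
  qed
  have "n \<le> 6 \<or> n = 7 \<or> n = 8 \<or> n = 9 \<or> n = 10 \<or> n = 11 \<or> 12 \<le> n" by linarith
  then show ?thesis using n(2) low up 7 8 9 10 11 by auto
qed

lemma rising_small_r:
  assumes r: "2 \<le> r" "r < 18" and n: "n \<ge> 1" "even r \<or> n \<ge> 11"
  shows "rising r n"
proof -
  have *: "rising r n" if "\<And>n. lo \<le> n \<Longrightarrow> n \<le> N \<Longrightarrow> rising r n" "\<And>n. N \<le> n \<Longrightarrow> rising r n \<Longrightarrow> rising r (Suc n)" "lo \<le> n" "lo \<le> N" for lo N
    using that rising_upward[of N r n] by (cases "n \<le> N") auto
  have "r = 2 \<or> r = 3 \<or> r = 4 \<or> r = 5 \<or> r = 6 \<or> r = 7 \<or> r = 8 \<or> r = 9 \<or> r = 10 \<or> r = 11 \<or> r = 12 \<or> r = 13 \<or> r = 14 \<or> r = 15 \<or> r = 16 \<or> r = 17"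
    using r by (auto simp: eval_nat_numeral less_Suc_eq)
  then show ?thesis
  proof (elim disjE)
    assume R: "r = 2"
    have st: "rising r (Suc n)" if "74 \<le> n" "rising r n" for n using fourier_step_2[of n] that R by auto
    show ?thesis by (rule *[of 1 74]) (use small_2 st n R in auto)
  next
    assume R: "r = 3"
    have st: "rising r (Suc n)" if "39 \<le> n" "rising r n" for n using fourier_step_3_to_8[of r n] that R by auto
    show ?thesis by (rule *[of 11 39]) (use small_3 st n R in auto)
  next
    assume R: "r = 4"
    have st: "rising r (Suc n)" if "29 \<le> n" "rising r n" for n using fourier_step_3_to_8[of r n] that R by auto
    show ?thesis by (rule *[of 1 29]) (use small_4 st n R in auto)
  next
    assume R: "r = 5"
    have st: "rising r (Suc n)" if "27 \<le> n" "rising r n" for n using fourier_step_3_to_8[of r n] that R by auto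
    show ?thesis by (rule *[of 11 27]) (use small_5 st n R in auto)
  next
    assume R: "r = 6"
    have st: "rising r (Suc n)" if "27 \<le> n" "rising r n" for n using fourier_step_3_to_8[of r n] that R by auto
    show ?thesis by (rule *[of 1 27]) (use small_6 st n R in auto)
  next
    assume R: "r = 7"
    have st: "rising r (Suc n)" if "27 \<le> n" "rising r n" for n using fourier_step_3_to_8[of r n] that R by auto
    show ?thesis by (rule *[of 11 27]) (use small_7 st n R in auto)
  next
    assume R: "r = 8"
    have st: "rising r (Suc n)" if "27 \<le> n" "rising r n" for n using fourier_step_3_to_8[of r n] that R by auto
    show ?thesis by (rule *[of 1 27]) (use small_8 st n R in auto)
  next
    assume R: "r = 9"
    have st: "rising r (Suc n)" if "16 \<le> n" "rising r n" for n using fourier_step_9_up[of r n] that R by auto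
    show ?thesis by (rule *[of 11 16]) (use small_9 st n R in auto)
  next
    assume R: "r = 10"
    have st: "rising r (Suc n)" if "16 \<le> n" "rising r n" for n using fourier_step_9_up[of r n] that R by auto
    show ?thesis by (rule *[of 1 16]) (use small_10 st n R in auto)
  next
    assume R: "r = 11"
    have st: "rising r (Suc n)" if "16 \<le> n" "rising r n" for n using fourier_step_9_up[of r n] that R by auto
    show ?thesis by (rule *[of 11 16]) (use small_11 st n R in auto)
  next
    assume R: "r = 12"
    have st: "rising r (Suc n)" if "14 \<le> n" "rising r n" for n using fourier_step_9_up[of r n] that R by auto
    show ?thesis by (rule *[of 1 14]) (use small_12 st n R in auto)
  next
    assume R: "r = 13"
    have st: "rising r (Suc n)" if "14 \<le> n" "rising r n" for n using fourier_step_9_up[of r n] that R by auto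
    show ?thesis by (rule *[of 11 14]) (use small_13 st n R in auto)
  next
    assume R: "r = 14"
    have st: "rising r (Suc n)" if "14 \<le> n" "rising r n" for n using fourier_step_9_up[of r n] that R by auto
    show ?thesis by (rule *[of 1 14]) (use small_14 st n R in auto)
  next
    assume R: "r = 15"
    have st: "rising r (Suc n)" if "14 \<le> n" "rising r n" for n using fourier_step_9_up[of r n] that R by auto
    show ?thesis by (rule *[of 11 14]) (use small_15 st n R in auto)
  next
    assume R: "r = 16"
    have st: "rising r (Suc n)" if "14 \<le> n" "rising r n" for n using fourier_step_9_up[of r n] that R by auto
    show ?thesis by (rule *[of 1 14]) (use small_16 st n R in auto)
  next
    assume R: "r = 17"
    have st: "rising r (Suc n)" if "14 \<le> n" "rising r n" for n using fourier_step_9_up[of r n] that R by auto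
    show ?thesis by (rule *[of 11 14]) (use small_17 st n R in auto)
  qed
qed

theorem theorem1p3:
  fixes r n :: nat
  assumes "r \<ge> 2" and "n \<ge> 1" and "even r \<or> n \<ge> 11"
  shows "unimodal_poly (F r n)"
proof (rule rising_imp_unimodal)
  show "r > 0" using assms by simp
  show "rising r n" using assms rising_large_r[of r n] rising_small_r[of r n] by (cases "r < 18") auto
qed

end
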